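(* Let $A=\mathbb{K}[x_1][x_2;\sigma_2,\delta_2]\cdots[x_N;\sigma_N,\delta_N]$ be a CGL extension with torus $\mathcal{H}$, and let $\pi:\mathbb{Z}^N\to X(\mathcal{H})$ be the homomorphism with $\pi(e_i)=\deg x_i$ for all $i\in[1,N]$. Let $V(A)=\{k\in[1,N]\mid\delta_k=0\}$ (with $1\in V(A)$) and $N(A)=[1,N]\setminus V(A)$. Assume that the elements $\pi(e_j)$, $j\in V(A)$, are $\mathbb{Z}$-linearly independent in $X(\mathcal{H})$. Let $\chi'$ be the alternating bicharacter on $\mathbb{Z}^N$ such that $\chi'(e_i,e_j)=\lambda_{ij}$ for $i,j\in[1,N]$. (a) For each $k\in N(A)$ choose $b_k\in\ker\pi$ such that $b_k-e_k\in\sum_{j=1}^{k-1}\mathbb{Z}e_j$ (such elements exist). Then $$\mathrm{tw}_{X(\mathcal{H})}(A)=\langle\lambda_k,\ \chi'(b_k,e_i)\mid k\in N(A),\ i\in V(A),\ i<k\rangle.$$ (b) If $A$ is a symmetric CGL extension, then $$\mathrm{tw}_{X(\mathcal{H})}(A)=\langle\lambda_k\mid k\in N(A)\rangle.$$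
   Context: $\mathbb{K}$ is a field; algebras are unital associative $\mathbb{K}$-algebras; $[j,k]=\{j,j+1,\dots,k\}$; $e_1,\dots,e_N$ is the standard basis of $\mathbb{Z}^N$; $\langle\cdots\rangle$ denotes the subgroup of $\mathbb{K}^*$ generated by the listed elements. CGL extension: an iterated skew polynomial algebra $A=\mathbb{K}[x_1][x_2;\sigma_2,\delta_2]\cdots[x_N;\sigma_N,\delta_N]$, where each $\sigma_k$ is a $\mathbb{K}$-algebra automorphism and $\delta_k$ a $\mathbb{K}$-linear $\sigma_k$-derivation of $A_{k-1}=\mathbb{K}[x_1]\cdots[x_{k-1};\sigma_{k-1},\delta_{k-1}]$ (so $x_ka=\sigma_k(a)x_k+\delta_k(a)$; $A_0=\mathbb{K}$), equipped with a rational action of a $\mathbb{K}$-torus $\mathcal{H}\cong(\mathbb{K}^* )^r$ by $\mathbb{K}$-algebra automorphisms such that: (i) $x_1,\dots,x_N$ are $\mathcal{H}$-eigenvectors; (ii) for every $k\in[2,N]$, $\delta_k$ is locally nilpotent on $A_{k-1}$; (iii) for every $k\in[1,N]$ there is $h_k\in\mathcal{H}$ such that $\sigma_k=(h_k\cdot)|_{A_{k-1}}$ and the $h_k$-eigenvalue of $x_k$, denoted $\lambda_k$, is not a root of unity. Then $\sigma_k(x_j)=\lambda_{kj}x_j$ with $\lambda_{kj}\in\mathbb{K}^*$ for $j<k$; put $\lambda_{kk}=1$ and $\lambda_{jk}=\lambda_{kj}^{-1}$ for $j<k$. $X(\mathcal{H})$ is the (additively written) group of rational characters of $\mathcal{H}$;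 the $\mathcal{H}$-action gives an $X(\mathcal{H})$-grading of $A$ whose homogeneous components are the $\mathcal{H}$-eigenspaces. $A$ is symmetric if moreover: (i) $\delta_k(x_j)\in A_{[j+1,k-1]}$ for all $1\le j<k\le N$, where $A_{[j,k]}$ is the unital subalgebra generated by the $x_i$ with $j\le i\le k$ (equal to $\mathbb{K}$ if $j>k$); (ii) for all $j\in[1,N]$ there is $h_j^*\in\mathcal{H}$ with $h_j^*\cdot x_k=\lambda_{kj}^{-1}x_k$ for all $k\in[j+1,N]$ and $h_j^*\cdot x_j=\lambda_j^*x_j$ for some $\lambda_j^*\in\mathbb{K}^*$ that is not a root of unity. An alternating bicharacter on an abelian group is a map to $\mathbb{K}^*$ in two variables that is a homomorphism in each variable and equals $1$ on the diagonal. For a semiprime right Goldie $\mathbb{K}$-algebra $B$ with classical right quotient ring $\mathrm{Fract}\,B$, $\mathrm{AD}(B)$ is the intersection of $\mathbb{K}^*$ with the commutator subgroup of the group of units of $\mathrm{Fract}\,B$. For an abelian group $\Gamma$, $Z^2(\Gamma,\mathbb{K}^* )$ is the set of maps $\mathbf c:\Gamma\times\Gamma\to\mathbb{K}^*$ with $\mathbf c(s,t+u)\mathbf c(t,u)=\mathbf c(s+t,u)\mathbf c(s,t)$. For $\Gamma$-graded $B$, the twist $B^{\mathbf c}$ is the graded space $B$ with multiplication $x*_{\mathbf c}y=\mathbf c(s,t)xy$ for $x\in B_s$, $y\in B_t$ (identity $\mathbf c(0,0)^{-1}1$). For a $\Gamma$-graded semiprime right Goldie $B$, $\mathrm{tw}_\Gamma(B)=\bigcap_{\mathbf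 c\in Z^2(\Gamma,\mathbb{K}^* )}\mathrm{AD}(B^{\mathbf c})$. *)

theory Defs
  imports "HOL-Algebra.Algebra"
begin

section \<open>Algebras over a field\<close>

text \<open>The group \<open>K\<^sup>*\<close> of a field \<open>K\<close> is \<^term>\<open>units_of K\<close>. The library locale
  \<^locale>\<open>algebra\<close> is for commutative algebras only.\<close>

locale assoc_algebra = module K A + ring A
  for K :: "('k, 'm) ring_scheme" (structure) and A :: "('k, 'a, 'n) module_scheme" (structure) +
  assumes field: "field K"
    and smult_mult_left: "\<lbrakk>c \<in> carrier K; a \<in> carrier A; b \<in> carrier A\<rbrakk> \<Longrightarrow>
      (c \<odot>\<^bsub>A\<^esub> a) \<otimes>\<^bsub>A\<^esub> b = c \<odot>\<^bsub>A\<^esub> (a \<otimes>\<^bsub>A\<^esub> b)"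
    and smult_mult_right: "\<lbrakk>c \<in> carrier K; a \<in> carrier A; b \<in> carrier A\<rbrakk> \<Longrightarrow>
      a \<otimes>\<^bsub>A\<^esub> (c \<odot>\<^bsub>A\<^esub> b) = c \<odot>\<^bsub>A\<^esub> (a \<otimes>\<^bsub>A\<^esub> b)"

definition subalgebra_of ::
  "('k, 'm) ring_scheme \<Rightarrow> ('k, 'a, 'n) module_scheme \<Rightarrow> 'a set \<Rightarrow> bool" where
  "subalgebra_of K A S \<longleftrightarrow>
     subring S A \<and> (\<forall>c\<in>carrier K. \<forall>a\<in>S. c \<odot>\<^bsub>A\<^esub> a \<in> S)"

definition algebra_generated ::
  "('k, 'm) ring_scheme \<Rightarrow> ('k, 'a, 'n) module_scheme \<Rightarrow> 'a set \<Rightarrow> 'a set" where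
  "algebra_generated K A Y = \<Inter> {S. subalgebra_of K A S \<and> Y \<subseteq> S}"

definition linear_on ::
  "('k, 'm) ring_scheme \<Rightarrow> ('k, 'a, 'n) module_scheme \<Rightarrow> 'a set \<Rightarrow> ('a \<Rightarrow> 'a) \<Rightarrow> bool" where
  "linear_on K A S f \<longleftrightarrow> f \<in> S \<rightarrow> S \<and>
     (\<forall>a\<in>S. \<forall>b\<in>S. f (a \<oplus>\<^bsub>A\<^esub> b) = f a \<oplus>\<^bsub>A\<^esub> f b) \<and>
     (\<forall>c\<in>carrier K. \<forall>a\<in>S. f (c \<odot>\<^bsub>A\<^esub> a) = c \<odot>\<^bsub>A\<^esub> f a)"

definition algebra_automorphism ::
  "('k, 'm) ring_scheme \<Rightarrow> ('k, 'a, 'n) module_scheme \<Rightarrow> 'a set \<Rightarrow> ('a \<Rightarrow> 'a) \<Rightarrow> bool" where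
  "algebra_automorphism K A S f \<longleftrightarrow>
     f \<in> ring_iso (A\<lparr>carrier := S\<rparr>) (A\<lparr>carrier := S\<rparr>) \<and> linear_on K A S f"

definition skew_derivation ::
  "('k, 'm) ring_scheme \<Rightarrow> ('k, 'a, 'n) module_scheme \<Rightarrow> 'a set \<Rightarrow> ('a \<Rightarrow> 'a) \<Rightarrow> ('a \<Rightarrow> 'a) \<Rightarrow> bool" where
  "skew_derivation K A S \<sigma> \<delta> \<longleftrightarrow> linear_on K A S \<delta> \<and>
     (\<forall>a\<in>S. \<forall>b\<in>S. \<delta> (a \<otimes>\<^bsub>A\<^esub> b) = \<sigma> a \<otimes>\<^bsub>A\<^esub> \<delta> b \<oplus>\<^bsub>A\<^esub> \<delta> a \<otimes>\<^bsub>A\<^esub> b)"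

definition eigenvalue ::
  "('k, 'm) ring_scheme \<Rightarrow> ('k, 'a, 'n) module_scheme \<Rightarrow> ('a \<Rightarrow> 'a) \<Rightarrow> 'a \<Rightarrow> 'k" where
  "eigenvalue K A f v = (THE c. c \<in> carrier K \<and> f v = c \<odot>\<^bsub>A\<^esub> v)"

definition root_of_unity :: "('k, 'm) ring_scheme \<Rightarrow> 'k \<Rightarrow> bool" where
  "root_of_unity K c \<longleftrightarrow> (\<exists>n::nat. 0 < n \<and> c [^]\<^bsub>K\<^esub> n = \<one>\<^bsub>K\<^esub>)"


section \<open>Tori and rational actions\<close>

text \<open>Up to isomorphism of algebraic groups, a torus of rank \<open>r\<close> is \<open>(K\<^sup>*)\<^sup>r\<close>; its elements are
  the extensional functions from \<open>{..<r}\<close> to \<open>K\<^sup>*\<close>. The regular functions on it are the Laurent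
  polynomials in the coordinates.\<close>

definition torus :: "('k, 'm) ring_scheme \<Rightarrow> nat \<Rightarrow> (nat \<Rightarrow> 'k) monoid" where
  "torus K r = product_group {..<r} (\<lambda>_. units_of K)"

definition laurent_monomial :: "('k, 'm) ring_scheme \<Rightarrow> nat \<Rightarrow> (nat \<Rightarrow> int) \<Rightarrow> (nat \<Rightarrow> 'k) \<Rightarrow> 'k" where
  "laurent_monomial K r m h = finprod (units_of K) (\<lambda>i. h i [^]\<^bsub>units_of K\<^esub> m i) {..<r}"

definition regular_function :: "('k, 'm) ring_scheme \<Rightarrow> nat \<Rightarrow> ((nat \<Rightarrow> 'k) \<Rightarrow> 'k) \<Rightarrow> bool" where
  "regular_function K r f \<longleftrightarrow> (\<exists>F c. finite F \<and> c \<in> F \<rightarrow> carrier K \<and>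
     (\<forall>h\<in>carrier (torus K r). f h = (\<Oplus>\<^bsub>K\<^esub>m\<in>F. c m \<otimes>\<^bsub>K\<^esub> laurent_monomial K r m h)))"

text \<open>The group of rational characters, written multiplicatively. Characters are extensional, so
  that equality of elements is equality of characters.\<close>

definition character_group :: "('k, 'm) ring_scheme \<Rightarrow> nat \<Rightarrow> ((nat \<Rightarrow> 'k) \<Rightarrow> 'k) monoid" where
  "character_group K r =
     \<lparr>carrier = {\<chi> \<in> hom (torus K r) (units_of K) \<inter> extensional (carrier (torus K r)).
                  regular_function K r \<chi>},
      monoid.mult = (\<lambda>\<chi> \<psi>. \<lambda>h\<in>carrier (torus K r). \<chi> h \<otimes>\<^bsub>K\<^esub> \<psi> h),
      one = (\<lambda>h\<in>carrier (torus K r). \<one>\<^bsub>K\<^esub>)\<rparr>"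

text \<open>\<open>V\<close> is a finite-dimensional subspace, stable under the torus, such that the induced map from
  the torus to \<open>GL(V)\<close> has regular matrix coefficients \<open>m i j\<close> with respect to a basis \<open>v\<close>.\<close>

definition rational_subspace ::
  "('k, 'm) ring_scheme \<Rightarrow> ('k, 'a, 'n) module_scheme \<Rightarrow> nat \<Rightarrow> ((nat \<Rightarrow> 'k) \<Rightarrow> 'a \<Rightarrow> 'a) \<Rightarrow> 'a set \<Rightarrow> bool"
  where
  "rational_subspace K A r act V \<longleftrightarrow> (\<exists>(d::nat) v m.
     v \<in> {..<d} \<rightarrow> carrier A \<and>
     V = {\<Oplus>\<^bsub>A\<^esub>i\<in>{..<d}. c i \<odot>\<^bsub>A\<^esub> v i | c. c \<in> {..<d} \<rightarrow> carrier K} \<and>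
     (\<forall>c\<in>{..<d} \<rightarrow> carrier K. (\<Oplus>\<^bsub>A\<^esub>i\<in>{..<d}. c i \<odot>\<^bsub>A\<^esub> v i) = \<zero>\<^bsub>A\<^esub> \<longrightarrow> (\<forall>i<d. c i = \<zero>\<^bsub>K\<^esub>)) \<and>
     (\<forall>i<d. \<forall>j<d. regular_function K r (m i j)) \<and>
     (\<forall>h\<in>carrier (torus K r). \<forall>j<d. act h (v j) = (\<Oplus>\<^bsub>A\<^esub>i\<in>{..<d}. m i j h \<odot>\<^bsub>A\<^esub> v i)))"

text \<open>An action by algebra automorphisms for which the algebra is a directed union of
  finite-dimensional rational subrepresentations.\<close>

definition rational_torus_action ::
  "('k, 'm) ring_scheme \<Rightarrow> ('k, 'a, 'n) module_scheme \<Rightarrow> nat \<Rightarrow> ((nat \<Rightarrow> 'k) \<Rightarrow> 'a \<Rightarrow> 'a) \<Rightarrow> bool" where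
  "rational_torus_action K A r act \<longleftrightarrow>
     group_action (torus K r) (carrier A) act \<and>
     (\<forall>h\<in>carrier (torus K r). algebra_automorphism K A (carrier A) (act h)) \<and>
     (\<exists>\<V>. (\<forall>V\<in>\<V>. rational_subspace K A r act V) \<and>
          (\<forall>V\<in>\<V>. \<forall>W\<in>\<V>. \<exists>U\<in>\<V>. V \<union> W \<subseteq> U) \<and> \<Union>\<V> = carrier A)"

definition torus_eigenvector ::
  "('k, 'm) ring_scheme \<Rightarrow> ('k, 'a, 'n) module_scheme \<Rightarrow> nat \<Rightarrow> ((nat \<Rightarrow> 'k) \<Rightarrow> 'a \<Rightarrow> 'a) \<Rightarrow> 'a \<Rightarrow> bool" where
  "torus_eigenvector K A r act a \<longleftrightarrow> a \<in> carrier A \<and> a \<noteq> \<zero>\<^bsub>A\<^esub> \<and>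
     (\<forall>h\<in>carrier (torus K r). \<exists>c\<in>carrier K. act h a = c \<odot>\<^bsub>A\<^esub> a)"

definition eigenspace ::
  "('k, 'm) ring_scheme \<Rightarrow> ('k, 'a, 'n) module_scheme \<Rightarrow> nat \<Rightarrow> ((nat \<Rightarrow> 'k) \<Rightarrow> 'a \<Rightarrow> 'a) \<Rightarrow>
     ((nat \<Rightarrow> 'k) \<Rightarrow> 'k) \<Rightarrow> 'a set" where
  "eigenspace K A r act \<chi> =
     {a \<in> carrier A. \<forall>h\<in>carrier (torus K r). act h a = \<chi> h \<odot>\<^bsub>A\<^esub> a}"


section \<open>CGL extensions\<close>

text \<open>\<open>S = R[x; \<sigma>, \<delta>]\<close> for subrings \<open>R \<subseteq> S\<close> of \<open>A\<close>: \<open>S\<close> is a free left \<open>R\<close>-module on the powers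
  of \<open>x\<close>.\<close>

definition skew_polynomial_over ::
  "('a, 'n) ring_scheme \<Rightarrow> 'a set \<Rightarrow> 'a set \<Rightarrow> 'a \<Rightarrow> ('a \<Rightarrow> 'a) \<Rightarrow> ('a \<Rightarrow> 'a) \<Rightarrow> bool" where
  "skew_polynomial_over A S R x \<sigma> \<delta> \<longleftrightarrow>
     subring R A \<and> subring S A \<and> R \<subseteq> S \<and> x \<in> S \<and>
     (\<forall>a\<in>R. x \<otimes>\<^bsub>A\<^esub> a = \<sigma> a \<otimes>\<^bsub>A\<^esub> x \<oplus>\<^bsub>A\<^esub> \<delta> a) \<and>
     (\<forall>s\<in>S. \<exists>(n::nat) c. c \<in> {..<n} \<rightarrow> R \<and> s = (\<Oplus>\<^bsub>A\<^esub>i\<in>{..<n}. c i \<otimes>\<^bsub>A\<^esub> x [^]\<^bsub>A\<^esub> i)) \<and>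
     (\<forall>(n::nat) c. c \<in> {..<n} \<rightarrow> R \<longrightarrow> (\<Oplus>\<^bsub>A\<^esub>i\<in>{..<n}. c i \<otimes>\<^bsub>A\<^esub> x [^]\<^bsub>A\<^esub> i) = \<zero>\<^bsub>A\<^esub> \<longrightarrow>
        (\<forall>i<n. c i = \<zero>\<^bsub>A\<^esub>))"

text \<open>\<open>A\<^sub>[\<^sub>j\<^sub>,\<^sub>k\<^sub>]\<close>; it is \<open>K\<close> if \<open>j > k\<close>. In a CGL extension, \<open>A\<^sub>k\<close> is \<open>A\<^sub>[\<^sub>1\<^sub>,\<^sub>k\<^sub>]\<close>.\<close>

definition interval_subalgebra ::
  "('k, 'm) ring_scheme \<Rightarrow> ('k, 'a, 'n) module_scheme \<Rightarrow> (nat \<Rightarrow> 'a) \<Rightarrow> nat \<Rightarrow> nat \<Rightarrow> 'a set" where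
  "interval_subalgebra K A x j k = algebra_generated K A (x ` {j..k})"

text \<open>The maps \<open>\<sigma> k\<close>, \<open>\<delta> k\<close> are defined for all \<open>k \<in> [1,N]\<close>; on \<open>A\<^sub>0 = K\<close> they are forced to be
  \<open>\<sigma> 1 = id\<close> and \<open>\<delta> 1 = 0\<close>, so that \<open>A\<^sub>1 = K[x 1]\<close>. Only their values on \<open>A\<^sub>k\<^sub>-\<^sub>1\<close> matter.
  The elements \<open>h k\<close> are part of the data.\<close>

locale CGL_extension = assoc_algebra K A
  for K :: "('k, 'm) ring_scheme" (structure) and A :: "('k, 'a, 'n) module_scheme" (structure) +
  fixes N :: nat and x :: "nat \<Rightarrow> 'a" and \<sigma> \<delta> :: "nat \<Rightarrow> 'a \<Rightarrow> 'a"
    and r :: nat and act :: "(nat \<Rightarrow> 'k) \<Rightarrow> 'a \<Rightarrow> 'a" and h :: "nat \<Rightarrow> nat \<Rightarrow> 'k"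
  assumes N_pos: "1 \<le> N"
    and one_not_zero: "\<one>\<^bsub>A\<^esub> \<noteq> \<zero>\<^bsub>A\<^esub>"
    and generators: "x \<in> {1..N} \<rightarrow> carrier A"
    and generated: "interval_subalgebra K A x 1 N = carrier A"
    and \<sigma>_automorphism: "\<And>k. k \<in> {1..N} \<Longrightarrow>
      algebra_automorphism K A (interval_subalgebra K A x 1 (k - 1)) (\<sigma> k)"
    and \<delta>_derivation: "\<And>k. k \<in> {1..N} \<Longrightarrow>
      skew_derivation K A (interval_subalgebra K A x 1 (k - 1)) (\<sigma> k) (\<delta> k)"
    and skew_polynomial: "\<And>k. k \<in> {1..N} \<Longrightarrow>
      skew_polynomial_over A (interval_subalgebra K A x 1 k) (interval_subalgebra K A x 1 (k - 1))
        (x k) (\<sigma> k) (\<delta> k)"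
    and rational_action: "rational_torus_action K A r act"
    and eigenvectors: "\<And>k. k \<in> {1..N} \<Longrightarrow> torus_eigenvector K A r act (x k)"
    and locally_nilpotent: "\<And>k a. k \<in> {2..N} \<Longrightarrow> a \<in> interval_subalgebra K A x 1 (k - 1) \<Longrightarrow>
      \<exists>n. (\<delta> k ^^ n) a = \<zero>\<^bsub>A\<^esub>"
    and h_torus: "\<And>k. k \<in> {1..N} \<Longrightarrow> h k \<in> carrier (torus K r)"
    and \<sigma>_eq_h: "\<And>k a. k \<in> {1..N} \<Longrightarrow> a \<in> interval_subalgebra K A x 1 (k - 1) \<Longrightarrow>
      \<sigma> k a = act (h k) a"
    and not_root_of_unity: "\<And>k. k \<in> {1..N} \<Longrightarrow> \<not> root_of_unity K (eigenvalue K A (act (h k)) (x k))"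

text \<open>\<open>\<lambda>\<^sub>k\<close>\<close>

definition CGL_lambda ::
  "('k, 'm) ring_scheme \<Rightarrow> ('k, 'a, 'n) module_scheme \<Rightarrow> (nat \<Rightarrow> 'a) \<Rightarrow>
     ((nat \<Rightarrow> 'k) \<Rightarrow> 'a \<Rightarrow> 'a) \<Rightarrow> (nat \<Rightarrow> nat \<Rightarrow> 'k) \<Rightarrow> nat \<Rightarrow> 'k" where
  "CGL_lambda K A x act h k = eigenvalue K A (act (h k)) (x k)"

text \<open>\<open>\<lambda>\<^sub>k\<^sub>j\<close>\<close>

definition CGL_lambda2 ::
  "('k, 'm) ring_scheme \<Rightarrow> ('k, 'a, 'n) module_scheme \<Rightarrow> (nat \<Rightarrow> 'a) \<Rightarrow>
     (nat \<Rightarrow> 'a \<Rightarrow> 'a) \<Rightarrow> nat \<Rightarrow> nat \<Rightarrow> 'k" where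
  "CGL_lambda2 K A x \<sigma> k j =
     (if j < k then eigenvalue K A (\<sigma> k) (x j)
      else if j = k then \<one>\<^bsub>K\<^esub>
      else inv\<^bsub>K\<^esub> (eigenvalue K A (\<sigma> j) (x k)))"

definition CGL_V ::
  "('k, 'm) ring_scheme \<Rightarrow> ('k, 'a, 'n) module_scheme \<Rightarrow> nat \<Rightarrow> (nat \<Rightarrow> 'a) \<Rightarrow>
     (nat \<Rightarrow> 'a \<Rightarrow> 'a) \<Rightarrow> nat set" where
  "CGL_V K A N x \<delta> =
     {k \<in> {1..N}. \<forall>a\<in>interval_subalgebra K A x 1 (k - 1). \<delta> k a = \<zero>\<^bsub>A\<^esub>}"

definition CGL_N ::
  "('k, 'm) ring_scheme \<Rightarrow> ('k, 'a, 'n) module_scheme \<Rightarrow> nat \<Rightarrow> (nat \<Rightarrow> 'a) \<Rightarrow>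
     (nat \<Rightarrow> 'a \<Rightarrow> 'a) \<Rightarrow> nat set" where
  "CGL_N K A N x \<delta> = {1..N} - CGL_V K A N x \<delta>"

locale symmetric_CGL_extension = CGL_extension +
  assumes symmetric_\<delta>: "\<And>j k. 1 \<le> j \<Longrightarrow> j < k \<Longrightarrow> k \<le> N \<Longrightarrow>
      \<delta> k (x j) \<in> interval_subalgebra K A x (j + 1) (k - 1)"
    and symmetric_h: "\<And>j. j \<in> {1..N} \<Longrightarrow>
      \<exists>h'\<in>carrier (torus K r).
        (\<forall>k\<in>{j + 1..N}. act h' (x k) = inv\<^bsub>K\<^esub> (CGL_lambda2 K A x \<sigma> k j) \<odot>\<^bsub>A\<^esub> x k) \<and>
        (\<exists>c\<in>Units K. act h' (x j) = c \<odot>\<^bsub>A\<^esub> x j \<and> \<not> root_of_unity K c)"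


section \<open>Abelian groups\<close>

definition int_lattice :: "nat \<Rightarrow> (nat \<Rightarrow> int) monoid" where
  "int_lattice N = product_group {1..N} (\<lambda>_. integer_group)"

definition basis_vector :: "nat \<Rightarrow> nat \<Rightarrow> nat \<Rightarrow> int" where
  "basis_vector N i = (\<lambda>j\<in>{1..N}. if j = i then 1 else 0)"

text \<open>Linear independence over the integers, in a multiplicatively written abelian group.\<close>

definition int_independent :: "('g, 'm) monoid_scheme \<Rightarrow> 'i set \<Rightarrow> ('i \<Rightarrow> 'g) \<Rightarrow> bool" where
  "int_independent G I f \<longleftrightarrow>
     (\<forall>n::'i \<Rightarrow> int. finprod G (\<lambda>i. f i [^]\<^bsub>G\<^esub> n i) I = \<one>\<^bsub>G\<^esub> \<longrightarrow> (\<forall>i\<in>I. n i = 0))"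

definition alternating_bicharacter ::
  "('g, 'n) monoid_scheme \<Rightarrow> ('k, 'm) ring_scheme \<Rightarrow> ('g \<Rightarrow> 'g \<Rightarrow> 'k) \<Rightarrow> bool" where
  "alternating_bicharacter G K \<chi> \<longleftrightarrow>
     (\<forall>s\<in>carrier G. (\<lambda>t. \<chi> s t) \<in> hom G (units_of K)) \<and>
     (\<forall>t\<in>carrier G. (\<lambda>s. \<chi> s t) \<in> hom G (units_of K)) \<and>
     (\<forall>s\<in>carrier G. \<chi> s s = \<one>\<^bsub>K\<^esub>)"


section \<open>Quotient rings, twists and the invariant tw\<close>

definition regular_element :: "('a, 'n) ring_scheme \<Rightarrow> 'a \<Rightarrow> bool" where
  "regular_element B s \<longleftrightarrow> s \<in> carrier B \<and>
     (\<forall>a\<in>carrier B. (s \<otimes>\<^bsub>B\<^esub> a = \<zero>\<^bsub>B\<^esub> \<longrightarrow> a = \<zero>\<^bsub>B\<^esub>) \<and> (a \<otimes>\<^bsub>B\<^esub> s = \<zero>\<^bsub>B\<^esub> \<longrightarrow> a = \<zero>\<^bsub>B\<^esub>))"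

definition classical_right_quotient_ring ::
  "('a, 'n) ring_scheme \<Rightarrow> ('q, 'p) ring_scheme \<Rightarrow> ('a \<Rightarrow> 'q) \<Rightarrow> bool" where
  "classical_right_quotient_ring B Q \<phi> \<longleftrightarrow>
     ring Q \<and> \<phi> \<in> ring_hom B Q \<and> inj_on \<phi> (carrier B) \<and>
     (\<forall>s. regular_element B s \<longrightarrow> \<phi> s \<in> Units Q) \<and>
     (\<forall>q\<in>carrier Q. \<exists>a s. a \<in> carrier B \<and> regular_element B s \<and> q = \<phi> a \<otimes>\<^bsub>Q\<^esub> inv\<^bsub>Q\<^esub> (\<phi> s))"

text \<open>A classical right quotient ring is unique up to isomorphism over \<open>B\<close>, so the following set
  does not depend on the choice of \<open>Q\<close>. An element of \<open>Q\<close> can be identified with the set of all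
  pairs \<open>(a, s)\<close> such that it equals \<open>a s\<^sup>-\<^sup>1\<close>, so it is no restriction to take \<open>Q\<close> over the type
  \<^typ>\<open>('a \<times> 'a) set\<close>. The scalar \<open>\<alpha>\<close> is identified with \<open>\<alpha> 1\<close>.\<close>

definition AD :: "('k, 'm) ring_scheme \<Rightarrow> ('k, 'a, 'n) module_scheme \<Rightarrow> 'k set" where
  "AD K B = {\<alpha> \<in> Units K. \<exists>(Q :: ('a \<times> 'a) set ring) \<phi>.
     classical_right_quotient_ring B Q \<phi> \<and>
     \<phi> (\<alpha> \<odot>\<^bsub>B\<^esub> \<one>\<^bsub>B\<^esub>) \<in> derived (units_of Q) (carrier (units_of Q))}"

definition cocycles :: "('g, 'n) monoid_scheme \<Rightarrow> ('k, 'm) ring_scheme \<Rightarrow> ('g \<Rightarrow> 'g \<Rightarrow> 'k) set" where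
  "cocycles \<Gamma> K = {c.
     (\<forall>s\<in>carrier \<Gamma>. \<forall>t\<in>carrier \<Gamma>. c s t \<in> Units K) \<and>
     (\<forall>s\<in>carrier \<Gamma>. \<forall>t\<in>carrier \<Gamma>. \<forall>u\<in>carrier \<Gamma>.
        c s (t \<otimes>\<^bsub>\<Gamma>\<^esub> u) \<otimes>\<^bsub>K\<^esub> c t u = c (s \<otimes>\<^bsub>\<Gamma>\<^esub> t) u \<otimes>\<^bsub>K\<^esub> c s t)}"

text \<open>For a \<open>\<Gamma>\<close>-grading of \<open>B\<close> with homogeneous components \<open>D s\<close>: the family of homogeneous
  components of an element.\<close>

definition hom_components ::
  "('g, 'm) monoid_scheme \<Rightarrow> ('a, 'n) ring_scheme \<Rightarrow> ('g \<Rightarrow> 'a set) \<Rightarrow> 'a \<Rightarrow> 'g \<Rightarrow> 'a" where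
  "hom_components \<Gamma> B D a = (THE f.
     (\<forall>s\<in>carrier \<Gamma>. f s \<in> D s) \<and> (\<forall>s. s \<notin> carrier \<Gamma> \<longrightarrow> f s = \<zero>\<^bsub>B\<^esub>) \<and>
     finite {s. f s \<noteq> \<zero>\<^bsub>B\<^esub>} \<and> a = (\<Oplus>\<^bsub>B\<^esub>s\<in>{s. f s \<noteq> \<zero>\<^bsub>B\<^esub>}. f s))"

definition hom_degree :: "('g, 'm) monoid_scheme \<Rightarrow> ('g \<Rightarrow> 'a set) \<Rightarrow> 'a \<Rightarrow> 'g" where
  "hom_degree \<Gamma> D a = (THE s. s \<in> carrier \<Gamma> \<and> a \<in> D s)"

definition twist ::
  "('g, 'l) monoid_scheme \<Rightarrow> ('k, 'm) ring_scheme \<Rightarrow> ('k, 'a, 'n) module_scheme \<Rightarrow> ('g \<Rightarrow> 'a set) \<Rightarrow>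
     ('g \<Rightarrow> 'g \<Rightarrow> 'k) \<Rightarrow> ('k, 'a, 'n) module_scheme" where
  "twist \<Gamma> K B D c = B\<lparr>
     monoid.mult := (\<lambda>a b.
       let f = hom_components \<Gamma> B D a; g = hom_components \<Gamma> B D b in
       \<Oplus>\<^bsub>B\<^esub>s\<in>{s. f s \<noteq> \<zero>\<^bsub>B\<^esub>}. \<Oplus>\<^bsub>B\<^esub>t\<in>{t. g t \<noteq> \<zero>\<^bsub>B\<^esub>}. c s t \<odot>\<^bsub>B\<^esub> (f s \<otimes>\<^bsub>B\<^esub> g t)),
     one := inv\<^bsub>K\<^esub> (c \<one>\<^bsub>\<Gamma>\<^esub> \<one>\<^bsub>\<Gamma>\<^esub>) \<odot>\<^bsub>B\<^esub> \<one>\<^bsub>B\<^esub>\<rparr>"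

definition tw ::
  "('g, 'l) monoid_scheme \<Rightarrow> ('k, 'm) ring_scheme \<Rightarrow> ('k, 'a, 'n) module_scheme \<Rightarrow> ('g \<Rightarrow> 'a set) \<Rightarrow>
     'k set" where
  "tw \<Gamma> K B D = (\<Inter>c\<in>cocycles \<Gamma> K. AD K (twist \<Gamma> K B D c))"

end

(* For a cocycle c on X(H), let c'(s,t) = c(s,t) / c(t,s), an alternating bicharacter. The twist A^c
   is again an iterated skew polynomial algebra in which the scalar lambda_kj is replaced by
   lambda_kj c'(deg x_k, deg x_j).

   These scalars generate AD(A^c). Each of them is a commutator, because a correction of
   x_j x_k^n by the elements delta_k^m(x_j), which vanish for large m, produces a homogeneous
   z <> 0 with x_k z = lambda_kj z x_k. Conversely, taking leading coefficients with respect to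
   x_N, ..., x_1 is multiplicative modulo the group F they generate, so it extends to a homomorphism
   from the units of Fract A^c to K^*/F which kills all commutators but no scalar outside F.

   The bicharacters chi' and chi'(s,t) c'(pi s, pi t) agree as soon as s lies in ker pi, so the
   values chi'(b_k, -) belong to AD(A^c) for every c. For the other inclusion, K contains an element
   which is not a root of unity, hence K^* has infinite rank (Euclid's argument in Z or in F_p[q]),
   and c can be chosen on X(H) = Z^r with values independent modulo the finitely generated group of
   the lambda_ij. As the pi(e_j), j in V(A), are independent, membership in both AD(A) and AD(A^c)
   then leaves only the subgroup generated by the chi'(b_k, e_i).

   The vectors b_k come from the homogeneous element w = delta_k(x_j) <> 0: if m is its iterated
   leading exponent, then b_k = e_k + e_j - m lies in ker pi, and x_i w = mu w x_i forces
   mu = chi'(e_i, m). In the symmetric case, j is taken maximal. *)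

theory Submission
  imports Defs
begin


section \<open>Localisation of right Ore domains\<close>

text \<open>The twist A^c is never shown to be a CGL extension. Only \<open>skew_step\<close> is
  carried over from A, where the derivation has become an anonymous remainder; this is enough for
  the Ore condition and for leading coefficients. The leading coefficient of fg involves a power of
  the step automorphism applied to that of g, so the induction over the variables must also carry
  invariance under suitable diagonal maps. The type of Q in \<open>AD\<close>, sets of pairs, fixes
  the model of the quotient ring: a fraction is the set of all pairs (s, a) for which it equals a
  s^-1. The values of the generic cocycle must avoid a finitely generated group even after taking
  powers. One element that is not a root of unity does not achieve this, hence the detour through
  infinite rank. The same element is used again to make the exponents of a character unique.
  Maximality of j in the symmetric case makes delta_k vanish on the variables between x_j and x_k.
  They then commute with w up to scalars, and the rule for mu gives chi'(b_k, e_i) = 1 for j < i <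
  k.\<close>

locale right_ore_domain = ring +
  assumes one_neq_zero: "\<one> \<noteq> \<zero>"
    and no_zero_divisors: "\<lbrakk>a \<in> carrier R; b \<in> carrier R; a \<otimes> b = \<zero>\<rbrakk> \<Longrightarrow> a = \<zero> \<or> b = \<zero>"
    and right_ore: "\<lbrakk>a \<in> carrier R; b \<in> carrier R; a \<noteq> \<zero>; b \<noteq> \<zero>\<rbrakk> \<Longrightarrow>
      \<exists>u\<in>carrier R. \<exists>v\<in>carrier R. a \<otimes> u = b \<otimes> v \<and> a \<otimes> u \<noteq> \<zero>"
begin

text \<open>A pair \<open>(s, a)\<close> stands for the fraction a s^-1. So a fraction is recorded
  as a partial map s \<mapsto> a, right linear on a nonzero right ideal; the last clause makes it
  single valued.\<close>

definition linear_graph :: "('a \<times> 'a) set \<Rightarrow> bool" where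
  "linear_graph q \<longleftrightarrow> q \<subseteq> carrier R \<times> carrier R \<and>
     (\<forall>s a t b. (s, a) \<in> q \<longrightarrow> (t, b) \<in> q \<longrightarrow> (s \<oplus> t, a \<oplus> b) \<in> q) \<and>
     (\<forall>s a. \<forall>c\<in>carrier R. (s, a) \<in> q \<longrightarrow> (s \<otimes> c, a \<otimes> c) \<in> q) \<and>
     (\<exists>s a. (s, a) \<in> q \<and> s \<noteq> \<zero>) \<and>
     (\<forall>a. (\<zero>, a) \<in> q \<longrightarrow> a = \<zero>)"

text \<open>Enlarges the domain as far as possible, following a s^-1 = (a u) (s u)^-1 for nonzero
  \<open>u\<close>. Maximal domains give each element of the quotient ring exactly one
  representative.\<close>

definition saturation :: "('a \<times> 'a) set \<Rightarrow> ('a \<times> 'a) set" where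
  "saturation q = {(s, a). s \<in> carrier R \<and> a \<in> carrier R \<and>
     (\<exists>u\<in>carrier R. u \<noteq> \<zero> \<and> (s \<otimes> u, a \<otimes> u) \<in> q)}"

definition fraction :: "('a \<times> 'a) set \<Rightarrow> bool" where
  "fraction q \<longleftrightarrow> linear_graph q \<and> saturation q \<subseteq> q"

lemma saturationE:
  assumes "(s, a) \<in> saturation q"
  obtains u where "s \<in> carrier R" "a \<in> carrier R" "u \<in> carrier R" "u \<noteq> \<zero>"
    "(s \<otimes> u, a \<otimes> u) \<in> q"
  using assms unfolding saturation_def by blast

lemma nonzero_mult:
  "\<lbrakk>a \<in> carrier R; b \<in> carrier R; a \<noteq> \<zero>; b \<noteq> \<zero>\<rbrakk> \<Longrightarrow> a \<otimes> b \<noteq> \<zero>"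
  using no_zero_divisors by blast

text \<open>In this form of the Ore condition \<open>a\<close> may be zero and it is the factor
  \<open>u\<close> that is nonzero. It is applied with an arbitrary ring element as \<open>a\<close>
  and a denominator as \<open>b\<close>.\<close>

lemma common_multiple:
  assumes "a \<in> carrier R" "b \<in> carrier R" "b \<noteq> \<zero>"
  obtains u v where "u \<in> carrier R" "v \<in> carrier R" "u \<noteq> \<zero>" "a \<otimes> u = b \<otimes> v"
proof (cases "a = \<zero>")
  case True
  then show ?thesis using that[of \<one> \<zero>] assms one_neq_zero by simp
next
  case False
  then obtain u v where uv: "u \<in> carrier R" "v \<in> carrier R" "a \<otimes> u = b \<otimes> v" "a \<otimes> u \<noteq> \<zero>"
    using right_ore[of a b] assms by blast
  then have "u \<noteq> \<zero>" using assms by auto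
  then show ?thesis using that uv by blast
qed

lemma linear_graphD:
  assumes "linear_graph q"
  shows "(s, a) \<in> q \<Longrightarrow> s \<in> carrier R" "(s, a) \<in> q \<Longrightarrow> a \<in> carrier R"
    "(s, a) \<in> q \<Longrightarrow> (t, b) \<in> q \<Longrightarrow> (s \<oplus> t, a \<oplus> b) \<in> q"
    "(s, a) \<in> q \<Longrightarrow> c \<in> carrier R \<Longrightarrow> (s \<otimes> c, a \<otimes> c) \<in> q"
    "(\<zero>, a) \<in> q \<Longrightarrow> a = \<zero>"
  using assms unfolding linear_graph_def by blast+

lemma linear_graphI:
  assumes "q \<subseteq> carrier R \<times> carrier R"
    and "\<And>s a t b. (s, a) \<in> q \<Longrightarrow> (t, b) \<in> q \<Longrightarrow> (s \<oplus> t, a \<oplus> b) \<in> q"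
    and "\<And>s a c. (s, a) \<in> q \<Longrightarrow> c \<in> carrier R \<Longrightarrow> (s \<otimes> c, a \<otimes> c) \<in> q"
    and "\<exists>s a. (s, a) \<in> q \<and> s \<noteq> \<zero>"
    and "\<And>a. (\<zero>, a) \<in> q \<Longrightarrow> a = \<zero>"
  shows "linear_graph q"
  using assms unfolding linear_graph_def by simp

text \<open>By linearity two values at \<open>s\<close> differ by a value at zero, which is
  zero.\<close>

lemma linear_graph_functional:
  assumes q: "linear_graph q" and "(s, a) \<in> q" "(s, b) \<in> q"
  shows "a = b"
proof -
  have c: "s \<in> carrier R" "a \<in> carrier R" "b \<in> carrier R" using assms linear_graphD by blast+
  have "(s \<oplus> s \<otimes> (\<ominus> \<one>), a \<oplus> b \<otimes> (\<ominus> \<one>)) \<in> q"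
    by (intro linear_graphD(3)[OF q] linear_graphD(4)[OF q] assms) auto
  moreover have "s \<oplus> s \<otimes> (\<ominus> \<one>) = \<zero>" using c by (simp add: r_minus r_neg)
  ultimately have "a \<oplus> b \<otimes> (\<ominus> \<one>) = \<zero>" using linear_graphD(5)[OF q] by simp
  then show ?thesis using c by (metis minus_equality minus_minus r_minus r_one one_closed a_inv_closed)
qed

text \<open>The domain is a nonzero right ideal, so by the Ore condition it is essential: every
  element can be moved into it by a nonzero right factor.\<close>

lemma linear_graph_domain:
  assumes q: "linear_graph q" and b: "b \<in> carrier R"
  obtains u a where "u \<in> carrier R" "u \<noteq> \<zero>" "(b \<otimes> u, a) \<in> q"
proof -
  obtain s a where sa: "(s, a) \<in> q" "s \<noteq> \<zero>" using q unfolding linear_graph_def by blast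
  obtain u v where uv: "u \<in> carrier R" "v \<in> carrier R" "u \<noteq> \<zero>" "b \<otimes> u = s \<otimes> v"
    using common_multiple b sa linear_graphD(1)[OF q] by metis
  have "(s \<otimes> v, a \<otimes> v) \<in> q" using linear_graphD(4)[OF q] sa uv by blast
  then show ?thesis using that uv by metis
qed

lemma fraction_linear_graph: "fraction q \<Longrightarrow> linear_graph q"
  by (simp add: fraction_def)

lemma fraction_saturated:
  "\<lbrakk>fraction q; (s \<otimes> u, a \<otimes> u) \<in> q; s \<in> carrier R; a \<in> carrier R; u \<in> carrier R; u \<noteq> \<zero>\<rbrakk>
    \<Longrightarrow> (s, a) \<in> q"
  unfolding fraction_def saturation_def by blast

lemma subset_saturation: "linear_graph q \<Longrightarrow> q \<subseteq> saturation q"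
  unfolding saturation_def using one_neq_zero linear_graphD(1,2)
  by (auto intro!: bexI[of _ \<one>])

text \<open>Closure under sums and right multiples is where the Ore condition enters: the factors
  that witness membership are replaced by a common right multiple.\<close>

lemma saturation_fraction:
  assumes q: "linear_graph q"
  shows "fraction (saturation q)"
proof -
  note Q = linear_graphD[OF q]
  have "(s \<oplus> t, a \<oplus> b) \<in> saturation q" if st: "(s, a) \<in> saturation q" "(t, b) \<in> saturation q" for s a t b
  proof -
    obtain u where u: "s \<in> carrier R" "a \<in> carrier R" "u \<in> carrier R" "u \<noteq> \<zero>"
      "(s \<otimes> u, a \<otimes> u) \<in> q" using saturationE[OF st(1)] by metis
    obtain v where v: "t \<in> carrier R" "b \<in> carrier R" "v \<in> carrier R" "v \<noteq> \<zero>"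
      "(t \<otimes> v, b \<otimes> v) \<in> q" using saturationE[OF st(2)] by metis
    note uv = u(3-5) v(3-5) and c = u(1,2) v(1,2)
    obtain u' v' where w: "u' \<in> carrier R" "v' \<in> carrier R" "u' \<noteq> \<zero>" "u \<otimes> u' = v \<otimes> v'"
      using common_multiple uv by metis
    have "(s \<otimes> u \<otimes> u' \<oplus> t \<otimes> v \<otimes> v', a \<otimes> u \<otimes> u' \<oplus> b \<otimes> v \<otimes> v') \<in> q"
      by (intro Q(3,4) uv w)
    then have "((s \<oplus> t) \<otimes> (u \<otimes> u'), (a \<oplus> b) \<otimes> (u \<otimes> u')) \<in> q"
      using c uv w by (simp add: l_distr m_assoc)
    moreover have "u \<otimes> u' \<noteq> \<zero>" using uv w nonzero_mult by blast
    ultimately show ?thesis unfolding saturation_def using c uv w by blast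
  qed
  moreover have "(s \<otimes> c, a \<otimes> c) \<in> saturation q" if st: "(s, a) \<in> saturation q" "c \<in> carrier R" for s a c
  proof -
    obtain u where u: "u \<in> carrier R" "u \<noteq> \<zero>" "(s \<otimes> u, a \<otimes> u) \<in> q" "s \<in> carrier R" "a \<in> carrier R"
      using saturationE[OF st(1)] by metis
    obtain c' u' where w: "c' \<in> carrier R" "u' \<in> carrier R" "c' \<noteq> \<zero>" "c \<otimes> c' = u \<otimes> u'"
      using common_multiple u st by metis
    have "(s \<otimes> u \<otimes> u', a \<otimes> u \<otimes> u') \<in> q" using Q u w by blast
    then have "(s \<otimes> c \<otimes> c', a \<otimes> c \<otimes> c') \<in> q" using u w st by (simp add: m_assoc)
    then show ?thesis unfolding saturation_def using u w st by blast
  qed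
  moreover have "a = \<zero>" if "(\<zero>, a) \<in> saturation q" for a
    using that Q(5) no_zero_divisors unfolding saturation_def by fastforce
  moreover have "\<exists>s a. (s, a) \<in> saturation q \<and> s \<noteq> \<zero>"
    using subset_saturation[OF q] q unfolding linear_graph_def by blast
  moreover have "saturation (saturation q) \<subseteq> saturation q"
  proof safe
    fix s a assume "(s, a) \<in> saturation (saturation q)"
    then obtain u v where "s \<in> carrier R" "a \<in> carrier R" "u \<in> carrier R" "v \<in> carrier R"
      "u \<noteq> \<zero>" "v \<noteq> \<zero>" "(s \<otimes> u \<otimes> v, a \<otimes> u \<otimes> v) \<in> q" unfolding saturation_def by blast
    then show "(s, a) \<in> saturation q"
      using nonzero_mult[of u v] unfolding saturation_def
      by (auto intro!: bexI[of _ "u \<otimes> v"] simp: m_assoc)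
  qed
  moreover have "saturation q \<subseteq> carrier R \<times> carrier R" by (auto simp: saturation_def)
  ultimately show ?thesis unfolding fraction_def by (intro conjI linear_graphI)
qed

text \<open>Any other denominator has a common right multiple with \<open>s\<close>, and saturation
  descends from there. The ring identities below are all verified on one common pair by this
  rule.\<close>

lemma fraction_eqI:
  assumes p: "fraction p" and q: "fraction q" and "(s, a) \<in> p" "(s, a) \<in> q" "s \<noteq> \<zero>"
  shows "p = q"
proof -
  have "p \<subseteq> q" if p: "fraction p" and q: "fraction q" and sa: "(s, a) \<in> p" "(s, a) \<in> q" for p q
  proof safe
    fix t b assume tb: "(t, b) \<in> p"
    note P = linear_graphD[OF fraction_linear_graph[OF p]]
    note Q = linear_graphD[OF fraction_linear_graph[OF q]]
    have c: "s \<in> carrier R" "a \<in> carrier R" "t \<in> carrier R" "b \<in> carrier R" using P tb sa by blast+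
    obtain u v where uv: "u \<in> carrier R" "v \<in> carrier R" "u \<noteq> \<zero>" "t \<otimes> u = s \<otimes> v"
      using common_multiple c assms by metis
    have "b \<otimes> u = a \<otimes> v"
      using linear_graph_functional[OF fraction_linear_graph[OF p]] P(4)[OF tb uv(1)]
        P(4)[OF sa(1) uv(2)] uv(4) by metis
    then have "(t \<otimes> u, b \<otimes> u) \<in> q" using Q(4)[OF sa(2) uv(2)] uv(4) by metis
    then show "(t, b) \<in> q" using fraction_saturated[OF q] c uv by blast
  qed
  then show ?thesis using assms by blast
qed

section \<open>Sums and products of fractions\<close>

definition graph_of :: "'a \<Rightarrow> ('a \<times> 'a) set" where
  "graph_of b = {(s, b \<otimes> s) | s. s \<in> carrier R}"

definition graph_add :: "('a \<times> 'a) set \<Rightarrow> ('a \<times> 'a) set \<Rightarrow> ('a \<times> 'a) set" where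
  "graph_add p q = {(s, a \<oplus> b) | s a b. (s, a) \<in> p \<and> (s, b) \<in> q}"

text \<open>The composition \<open>q O p\<close> applies \<open>q\<close> first, so it is the
  product of \<open>p\<close> and \<open>q\<close> seen as left multiplications. Sums and composites
  of maximal graphs need not be maximal, hence the saturations.\<close>

definition fraction_ring :: "('a \<times> 'a) set ring" where
  "fraction_ring = \<lparr>carrier = {q. fraction q}, monoid.mult = (\<lambda>p q. saturation (q O p)),
     one = graph_of \<one>, ring.zero = graph_of \<zero>, ring.add = (\<lambda>p q. saturation (graph_add p q))\<rparr>"

lemma linear_graph_add:
  assumes "linear_graph p" "linear_graph q"
  shows "linear_graph (graph_add p q)"
proof -
  note P = linear_graphD[OF assms(1)] and Q = linear_graphD[OF assms(2)]
  have "\<exists>s a. (s, a) \<in> graph_add p q \<and> s \<noteq> \<zero>"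
  proof -
    obtain s a where sa: "(s, a) \<in> p" "s \<noteq> \<zero>" using assms unfolding linear_graph_def by blast
    obtain u b where ub: "u \<in> carrier R" "u \<noteq> \<zero>" "(s \<otimes> u, b) \<in> q"
      using linear_graph_domain[OF assms(2)] P sa by metis
    moreover have "(s \<otimes> u, a \<otimes> u) \<in> p" "s \<otimes> u \<noteq> \<zero>"
      using P(4) sa ub nonzero_mult[OF P(1)[OF sa(1)] ub(1)] by blast+
    ultimately show ?thesis unfolding graph_add_def by blast
  qed
  moreover have "(s \<oplus> s', a \<oplus> a') \<in> graph_add p q"
    if st: "(s, a) \<in> graph_add p q" "(s', a') \<in> graph_add p q" for s a s' a'
  proof -
    obtain c d c' d' where *: "(s, c) \<in> p" "(s, d) \<in> q" "a = c \<oplus> d" "(s', c') \<in> p" "(s', d') \<in> q"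
      "a' = c' \<oplus> d'" using st unfolding graph_add_def by blast
    have "a \<oplus> a' = (c \<oplus> c') \<oplus> (d \<oplus> d')" using * P(2) Q(2) 
      by (metis (no_types, lifting) a_ac add.m_closed)
    then show ?thesis unfolding graph_add_def using P(3) Q(3) * by blast
  qed
  moreover have "(s \<otimes> r, a \<otimes> r) \<in> graph_add p q"
    if st: "(s, a) \<in> graph_add p q" "r \<in> carrier R" for s a r
  proof -
    obtain c d where *: "(s, c) \<in> p" "(s, d) \<in> q" "a = c \<oplus> d" using st unfolding graph_add_def by blast
    have "a \<otimes> r = c \<otimes> r \<oplus> d \<otimes> r" using * P(2) Q(2) st by (simp add: l_distr)
    then show ?thesis unfolding graph_add_def using P(4) Q(4) * st by blast
  qed
  moreover have "graph_add p q \<subseteq> carrier R \<times> carrier R"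
    using P(1,2) Q(2) by (fastforce simp: graph_add_def)
  moreover have "a = \<zero>" if "(\<zero>, a) \<in> graph_add p q" for a
    using that P(5) Q(5) by (fastforce simp: graph_add_def)
  ultimately show ?thesis by (intro linear_graphI)
qed

lemma linear_graph_comp:
  assumes "linear_graph p" "linear_graph q"
  shows "linear_graph (q O p)"
proof -
  note P = linear_graphD[OF assms(1)] and Q = linear_graphD[OF assms(2)]
  have "\<exists>s a. (s, a) \<in> q O p \<and> s \<noteq> \<zero>"
  proof -
    obtain s b where sb: "(s, b) \<in> q" "s \<noteq> \<zero>" using assms unfolding linear_graph_def by blast
    obtain u a where u: "u \<in> carrier R" "u \<noteq> \<zero>" "(b \<otimes> u, a) \<in> p"
      using linear_graph_domain[OF assms(1)] Q sb by metis
    then have "(s \<otimes> u, b \<otimes> u) \<in> q" "s \<otimes> u \<noteq> \<zero>"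
      using Q(4)[OF sb(1) u(1)] nonzero_mult[OF Q(1)[OF sb(1)] u(1) sb(2) u(2)] by auto
    then show ?thesis using u by blast
  qed
  moreover have "q O p \<subseteq> carrier R \<times> carrier R" using P(2) Q(1) by auto
  moreover have "(s \<oplus> t, a \<oplus> b) \<in> q O p" if st: "(s, a) \<in> q O p" "(t, b) \<in> q O p" for s a t b
  proof -
    obtain c d where "(s, c) \<in> q" "(c, a) \<in> p" "(t, d) \<in> q" "(d, b) \<in> p" using st by blast
    then show ?thesis using P(3)[of c a d b] Q(3)[of s c t d] by blast
  qed
  moreover have "(s \<otimes> c, a \<otimes> c) \<in> q O p" if "(s, a) \<in> q O p" "c \<in> carrier R" for s a c
    using that P(4) Q(4) by (meson relcomp.relcompI relcompEpair)
  moreover have "a = \<zero>" if "(\<zero>, a) \<in> q O p" for a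
    using that P(5) Q(5) by (metis relcompEpair)
  ultimately show ?thesis by (intro linear_graphI)
qed

lemma graph_of_fraction:
  assumes b: "b \<in> carrier R" shows "fraction (graph_of b)"
proof -
  have "linear_graph (graph_of b)" unfolding linear_graph_def
    using b one_neq_zero by (intro conjI) (auto simp: graph_of_def r_distr m_assoc)
  moreover have "(s, a) \<in> graph_of b" if sa: "(s, a) \<in> saturation (graph_of b)" for s a
  proof -
    obtain u where u: "s \<in> carrier R" "a \<in> carrier R" "u \<in> carrier R" "u \<noteq> \<zero>" "a \<otimes> u = b \<otimes> (s \<otimes> u)"
      using saturationE[OF sa] by (auto simp: graph_of_def)
    then have "(a \<ominus> b \<otimes> s) \<otimes> u = \<zero>" using b
      by (simp add: a_minus_def l_distr l_minus m_assoc r_neg)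
    then have "a \<ominus> b \<otimes> s = \<zero>"
      using no_zero_divisors[of "a \<ominus> b \<otimes> s" u] u(1-4) b by auto
    then have "a = b \<otimes> s" using u b by (simp add: r_right_minus_eq)
    then show ?thesis using u(1) by (simp add: graph_of_def)
  qed
  ultimately show ?thesis unfolding fraction_def by auto
qed

lemma fraction_ring_carrier: "q \<in> carrier fraction_ring \<longleftrightarrow> fraction q"
  by (simp add: fraction_ring_def)

lemma fraction_add_mem:
  assumes "fraction p" "fraction q" "(s, a) \<in> p" "(s, b) \<in> q"
  shows "(s, a \<oplus> b) \<in> p \<oplus>\<^bsub>fraction_ring\<^esub> q"
proof -
  have "(s, a \<oplus> b) \<in> graph_add p q" using assms unfolding graph_add_def by blast
  then show ?thesis
    using subset_saturation[OF linear_graph_add] assms fraction_linear_graph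
    by (auto simp: fraction_ring_def)
qed

lemma fraction_mult_mem:
  assumes "fraction p" "fraction q" "(s, b) \<in> q" "(b, a) \<in> p"
  shows "(s, a) \<in> p \<otimes>\<^bsub>fraction_ring\<^esub> q"
  using assms subset_saturation[OF linear_graph_comp] fraction_linear_graph
  by (auto simp: fraction_ring_def)

lemma fraction_add: "\<lbrakk>fraction p; fraction q\<rbrakk> \<Longrightarrow> fraction (p \<oplus>\<^bsub>fraction_ring\<^esub> q)"
  by (simp add: fraction_ring_def saturation_fraction linear_graph_add fraction_linear_graph)

lemma fraction_mult: "\<lbrakk>fraction p; fraction q\<rbrakk> \<Longrightarrow> fraction (p \<otimes>\<^bsub>fraction_ring\<^esub> q)"
  by (simp add: fraction_ring_def saturation_fraction linear_graph_comp fraction_linear_graph)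

lemma fraction_one: "fraction \<one>\<^bsub>fraction_ring\<^esub>"
  and fraction_zero: "fraction \<zero>\<^bsub>fraction_ring\<^esub>"
  by (simp_all add: fraction_ring_def graph_of_fraction)

lemma fraction_one_mem: "s \<in> carrier R \<Longrightarrow> (s, s) \<in> \<one>\<^bsub>fraction_ring\<^esub>"
  and fraction_zero_mem: "s \<in> carrier R \<Longrightarrow> (s, \<zero>) \<in> \<zero>\<^bsub>fraction_ring\<^esub>"
  by (auto simp: fraction_ring_def graph_of_def)

lemma fraction_domain:
  assumes "fraction q" "b \<in> carrier R" "b \<noteq> \<zero>"
  obtains u a where "u \<in> carrier R" "u \<noteq> \<zero>" "b \<otimes> u \<noteq> \<zero>" "(b \<otimes> u, a) \<in> q"
    "b \<otimes> u \<in> carrier R" "a \<in> carrier R"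
  using linear_graph_domain[OF fraction_linear_graph[OF assms(1)] assms(2)] assms(2,3)
    nonzero_mult[of b] linear_graphD(2)[OF fraction_linear_graph[OF assms(1)]]
  by (metis m_closed)

lemma fraction_nonzero_pair:
  assumes "fraction q"
  obtains s a where "s \<in> carrier R" "s \<noteq> \<zero>" "a \<in> carrier R" "(s, a) \<in> q"
  using assms unfolding fraction_def linear_graph_def by blast

lemma fraction_pair2:
  assumes p: "fraction p" and q: "fraction q"
  obtains s a b where "s \<in> carrier R" "s \<noteq> \<zero>" "a \<in> carrier R" "b \<in> carrier R"
    "(s, a) \<in> p" "(s, b) \<in> q"
proof -
  obtain s a where sa: "s \<in> carrier R" "s \<noteq> \<zero>" "a \<in> carrier R" "(s, a) \<in> p"
    using fraction_nonzero_pair p by metis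
  obtain u b where "u \<in> carrier R" "s \<otimes> u \<noteq> \<zero>" "(s \<otimes> u, b) \<in> q" "s \<otimes> u \<in> carrier R" "b \<in> carrier R"
    using fraction_domain q sa by metis
  then show ?thesis
    using that linear_graphD(4)[OF fraction_linear_graph[OF p]] sa by (meson m_closed)
qed

lemma fraction_pair3:
  assumes p: "fraction p" and q: "fraction q" and r: "fraction r"
  obtains s a b c where "s \<in> carrier R" "s \<noteq> \<zero>" "a \<in> carrier R" "b \<in> carrier R" "c \<in> carrier R"
    "(s, a) \<in> p" "(s, b) \<in> q" "(s, c) \<in> r"
proof -
  obtain s a b where sa: "s \<in> carrier R" "s \<noteq> \<zero>" "a \<in> carrier R" "b \<in> carrier R"
    "(s, a) \<in> p" "(s, b) \<in> q"
    using fraction_pair2 p q by metis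
  obtain u c where "u \<in> carrier R" "s \<otimes> u \<noteq> \<zero>" "(s \<otimes> u, c) \<in> r" "s \<otimes> u \<in> carrier R" "c \<in> carrier R"
    using fraction_domain r sa by metis
  then show ?thesis
    using that linear_graphD(4)[OF fraction_linear_graph[OF p]]
      linear_graphD(4)[OF fraction_linear_graph[OF q]] sa by (meson m_closed)
qed

lemma fraction_comp_pair:
  assumes p: "fraction p" and q: "fraction q" and "t \<in> carrier R" "t \<noteq> \<zero>"
  obtains u a b where "u \<in> carrier R" "t \<otimes> u \<in> carrier R" "t \<otimes> u \<noteq> \<zero>" "a \<in> carrier R" "b \<in> carrier R"
    "(t \<otimes> u, b) \<in> q" "(b, a) \<in> p"
proof -
  obtain u b where ub: "u \<in> carrier R" "u \<noteq> \<zero>" "t \<otimes> u \<noteq> \<zero>" "(t \<otimes> u, b) \<in> q" "b \<in> carrier R"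
    using fraction_domain q assms(3,4) by metis
  obtain v a where va: "v \<in> carrier R" "v \<noteq> \<zero>" "(b \<otimes> v, a) \<in> p"
    using linear_graph_domain fraction_linear_graph p ub by metis
  have "(t \<otimes> (u \<otimes> v), b \<otimes> v) \<in> q"
    using linear_graphD(4)[OF fraction_linear_graph[OF q]] ub va assms by (metis m_assoc)
  moreover have "t \<otimes> (u \<otimes> v) \<noteq> \<zero>" using ub va assms nonzero_mult by (metis m_assoc m_closed)
  ultimately show ?thesis
    using that[of "u \<otimes> v" a "b \<otimes> v"] va ub assms linear_graphD(2)[OF fraction_linear_graph[OF p]]
    by (metis m_closed)
qed

lemma fraction_right_mult:
  "\<lbrakk>fraction q; (s, a) \<in> q; c \<in> carrier R\<rbrakk> \<Longrightarrow> (s \<otimes> c, a \<otimes> c) \<in> q"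
  using linear_graphD(4) fraction_linear_graph by blast

lemma fraction_graph_add:
  "\<lbrakk>fraction q; (s, a) \<in> q; (t, b) \<in> q\<rbrakk> \<Longrightarrow> (s \<oplus> t, a \<oplus> b) \<in> q"
  using linear_graphD(3) fraction_linear_graph by blast

lemma abelian_group_fraction_ring: "abelian_group fraction_ring"
proof (rule abelian_groupI; unfold fraction_ring_carrier)
  show "fraction (p \<oplus>\<^bsub>fraction_ring\<^esub> q)" if "fraction p" "fraction q" for p q
    using fraction_add that .
next
  fix p q r assume p: "fraction p" and q: "fraction q" and r: "fraction r"
  obtain s a b c where s: "s \<in> carrier R" "s \<noteq> \<zero>" "a \<in> carrier R" "b \<in> carrier R" "c \<in> carrier R"
    "(s, a) \<in> p" "(s, b) \<in> q" "(s, c) \<in> r" using fraction_pair3 p q r by metis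
  have "(s, (a \<oplus> b) \<oplus> c) \<in> (p \<oplus>\<^bsub>fraction_ring\<^esub> q) \<oplus>\<^bsub>fraction_ring\<^esub> r"
    "(s, a \<oplus> (b \<oplus> c)) \<in> p \<oplus>\<^bsub>fraction_ring\<^esub> (q \<oplus>\<^bsub>fraction_ring\<^esub> r)"
    by (intro fraction_add_mem fraction_add p q r s)+
  then show "(p \<oplus>\<^bsub>fraction_ring\<^esub> q) \<oplus>\<^bsub>fraction_ring\<^esub> r = p \<oplus>\<^bsub>fraction_ring\<^esub> (q \<oplus>\<^bsub>fraction_ring\<^esub> r)"
    using fraction_eqI fraction_add p q r s by (metis a_assoc)
next
  fix p q assume p: "fraction p" and q: "fraction q"
  obtain s a b where s: "s \<in> carrier R" "s \<noteq> \<zero>" "a \<in> carrier R" "b \<in> carrier R"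
    "(s, a) \<in> p" "(s, b) \<in> q" using fraction_pair2 p q by metis
  have "(s, a \<oplus> b) \<in> p \<oplus>\<^bsub>fraction_ring\<^esub> q" "(s, b \<oplus> a) \<in> q \<oplus>\<^bsub>fraction_ring\<^esub> p"
    by (intro fraction_add_mem p q s)+
  then show "p \<oplus>\<^bsub>fraction_ring\<^esub> q = q \<oplus>\<^bsub>fraction_ring\<^esub> p"
    using fraction_eqI fraction_add p q s by (metis a_comm)
next
  show "fraction \<zero>\<^bsub>fraction_ring\<^esub>" by (rule fraction_zero)
next
  fix p assume p: "fraction p"
  obtain s a where s: "s \<in> carrier R" "s \<noteq> \<zero>" "a \<in> carrier R" "(s, a) \<in> p"
    using fraction_nonzero_pair p by metis
  have "(s, \<zero> \<oplus> a) \<in> \<zero>\<^bsub>fraction_ring\<^esub> \<oplus>\<^bsub>fraction_ring\<^esub> p"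
    by (intro fraction_add_mem fraction_zero fraction_zero_mem p s)
  then show "\<zero>\<^bsub>fraction_ring\<^esub> \<oplus>\<^bsub>fraction_ring\<^esub> p = p"
    using fraction_eqI fraction_add fraction_zero p s by (metis l_zero)
  \<comment> \<open>The negative is obtained by composing with left multiplication by -1.\<close>
  let ?n = "graph_of (\<ominus> \<one>) \<otimes>\<^bsub>fraction_ring\<^esub> p"
  have n: "fraction ?n" by (simp add: fraction_mult graph_of_fraction p)
  have "(s, \<ominus> a) \<in> ?n"
  proof (rule fraction_mult_mem[OF _ p s(4)])
    show "(a, \<ominus> a) \<in> graph_of (\<ominus> \<one>)"
      using s by (auto simp: graph_of_def l_minus)
  qed (simp add: graph_of_fraction)
  then have "(s, \<ominus> a \<oplus> a) \<in> ?n \<oplus>\<^bsub>fraction_ring\<^esub> p" using fraction_add_mem n p s by blast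
  then have "?n \<oplus>\<^bsub>fraction_ring\<^esub> p = \<zero>\<^bsub>fraction_ring\<^esub>"
    using fraction_eqI fraction_add fraction_zero fraction_zero_mem n p s by (metis l_neg)
  then show "\<exists>n\<in>carrier fraction_ring. n \<oplus>\<^bsub>fraction_ring\<^esub> p = \<zero>\<^bsub>fraction_ring\<^esub>"
    using n fraction_ring_carrier by blast
qed

lemma ring_fraction_ring: "ring fraction_ring"
proof (intro ringI abelian_group_fraction_ring monoidI; unfold fraction_ring_carrier)
  show "fraction (p \<otimes>\<^bsub>fraction_ring\<^esub> q)" if "fraction p" "fraction q" for p q
    using fraction_mult that .
next
  fix p q r assume p: "fraction p" and q: "fraction q" and r: "fraction r"
  obtain s b c where s: "s \<in> carrier R" "s \<noteq> \<zero>" "b \<in> carrier R" "c \<in> carrier R"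
    "(s, c) \<in> r" "(c, b) \<in> q" using fraction_comp_pair[OF q r one_closed one_neq_zero] by metis
  obtain u a where u: "u \<in> carrier R" "u \<noteq> \<zero>" "(b \<otimes> u, a) \<in> p"
    using linear_graph_domain fraction_linear_graph p s by metis
  have su: "(s \<otimes> u, c \<otimes> u) \<in> r" "(c \<otimes> u, b \<otimes> u) \<in> q" "s \<otimes> u \<noteq> \<zero>"
    using fraction_right_mult q r s u nonzero_mult by blast+
  have "(s \<otimes> u, a) \<in> (p \<otimes>\<^bsub>fraction_ring\<^esub> q) \<otimes>\<^bsub>fraction_ring\<^esub> r"
    "(s \<otimes> u, a) \<in> p \<otimes>\<^bsub>fraction_ring\<^esub> (q \<otimes>\<^bsub>fraction_ring\<^esub> r)"
    by (rule fraction_mult_mem[OF _ _ su(1)] fraction_mult_mem[OF _ _ su(2)]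
        fraction_mult fraction_mult_mem[OF _ _ _ u(3)] p q r su)+
  then show "(p \<otimes>\<^bsub>fraction_ring\<^esub> q) \<otimes>\<^bsub>fraction_ring\<^esub> r = p \<otimes>\<^bsub>fraction_ring\<^esub> (q \<otimes>\<^bsub>fraction_ring\<^esub> r)"
    using fraction_eqI fraction_mult p q r su by metis
next
  show "fraction \<one>\<^bsub>fraction_ring\<^esub>" by (rule fraction_one)
next
  fix p assume p: "fraction p"
  obtain s a where s: "s \<in> carrier R" "s \<noteq> \<zero>" "a \<in> carrier R" "(s, a) \<in> p"
    using fraction_nonzero_pair p by metis
  show "\<one>\<^bsub>fraction_ring\<^esub> \<otimes>\<^bsub>fraction_ring\<^esub> p = p" "p \<otimes>\<^bsub>fraction_ring\<^esub> \<one>\<^bsub>fraction_ring\<^esub> = p"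
    using fraction_eqI fraction_mult fraction_one fraction_mult_mem fraction_one_mem p s by metis+
next
  fix p q r assume p: "fraction p" and q: "fraction q" and r: "fraction r"
  obtain t c where t: "t \<in> carrier R" "t \<noteq> \<zero>" "c \<in> carrier R" "(t, c) \<in> r"
    using fraction_nonzero_pair r by metis
  note LP = linear_graph_domain[OF fraction_linear_graph[OF p]]
  note LQ = linear_graph_domain[OF fraction_linear_graph[OF q]]
  obtain u a where u: "u \<in> carrier R" "u \<noteq> \<zero>" "(c \<otimes> u, a) \<in> p" using LP t by metis
  obtain v b where v: "v \<in> carrier R" "v \<noteq> \<zero>" "(c \<otimes> u \<otimes> v, b) \<in> q" using LQ t u m_closed by metis
  have 1: "(c \<otimes> u \<otimes> v, a \<otimes> v) \<in> p" "(t \<otimes> u \<otimes> v, c \<otimes> u \<otimes> v) \<in> r"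
    by (intro fraction_right_mult p r t u v)+
  have 2: "t \<otimes> u \<otimes> v \<noteq> \<zero>" by (intro nonzero_mult m_closed t u v)
  have "(t \<otimes> u \<otimes> v, a \<otimes> v \<oplus> b) \<in> (p \<oplus>\<^bsub>fraction_ring\<^esub> q) \<otimes>\<^bsub>fraction_ring\<^esub> r"
    "(t \<otimes> u \<otimes> v, a \<otimes> v \<oplus> b) \<in> p \<otimes>\<^bsub>fraction_ring\<^esub> r \<oplus>\<^bsub>fraction_ring\<^esub> q \<otimes>\<^bsub>fraction_ring\<^esub> r"
    by (rule fraction_mult_mem[OF fraction_add[OF p q] r 1(2) fraction_add_mem[OF p q 1(1) v(3)]]
        fraction_add_mem[OF fraction_mult[OF p r] fraction_mult[OF q r]
          fraction_mult_mem[OF p r 1(2,1)] fraction_mult_mem[OF q r 1(2) v(3)]])+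
  then show "(p \<oplus>\<^bsub>fraction_ring\<^esub> q) \<otimes>\<^bsub>fraction_ring\<^esub> r = p \<otimes>\<^bsub>fraction_ring\<^esub> r \<oplus>\<^bsub>fraction_ring\<^esub> q \<otimes>\<^bsub>fraction_ring\<^esub> r"
    using fraction_eqI fraction_mult fraction_add p q r 2 by metis
next
  fix p q r assume p: "fraction p" and q: "fraction q" and r: "fraction r"
  obtain t b c where t: "t \<in> carrier R" "t \<noteq> \<zero>" "b \<in> carrier R" "c \<in> carrier R" "(t, b) \<in> p" "(t, c) \<in> q"
    using fraction_pair2 p q by metis
  note LR = linear_graph_domain[OF fraction_linear_graph[OF r]]
  obtain u d where u: "u \<in> carrier R" "u \<noteq> \<zero>" "(b \<otimes> u, d) \<in> r" using LR t by metis
  obtain v e where v: "v \<in> carrier R" "v \<noteq> \<zero>" "(c \<otimes> u \<otimes> v, e) \<in> r" using LR t u m_closed by metis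
  have 1: "(t \<otimes> u \<otimes> v, b \<otimes> u \<otimes> v) \<in> p" "(t \<otimes> u \<otimes> v, c \<otimes> u \<otimes> v) \<in> q" "(b \<otimes> u \<otimes> v, d \<otimes> v) \<in> r"
    by (intro fraction_right_mult p q r t u v)+
  have 2: "t \<otimes> u \<otimes> v \<noteq> \<zero>" by (intro nonzero_mult m_closed t u v)
  have "(b \<otimes> u \<otimes> v \<oplus> c \<otimes> u \<otimes> v, d \<otimes> v \<oplus> e) \<in> r" using fraction_graph_add r 1 v by blast
  then have "(t \<otimes> u \<otimes> v, d \<otimes> v \<oplus> e) \<in> r \<otimes>\<^bsub>fraction_ring\<^esub> (p \<oplus>\<^bsub>fraction_ring\<^esub> q)"
    by (rule fraction_mult_mem[OF r fraction_add[OF p q] fraction_add_mem[OF p q 1(1,2)]])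
  moreover have "(t \<otimes> u \<otimes> v, d \<otimes> v \<oplus> e) \<in> r \<otimes>\<^bsub>fraction_ring\<^esub> p \<oplus>\<^bsub>fraction_ring\<^esub> r \<otimes>\<^bsub>fraction_ring\<^esub> q"
    by (rule fraction_add_mem[OF fraction_mult[OF r p] fraction_mult[OF r q]
          fraction_mult_mem[OF r p 1(1,3)] fraction_mult_mem[OF r q 1(2) v(3)]])
  ultimately show "r \<otimes>\<^bsub>fraction_ring\<^esub> (p \<oplus>\<^bsub>fraction_ring\<^esub> q) = r \<otimes>\<^bsub>fraction_ring\<^esub> p \<oplus>\<^bsub>fraction_ring\<^esub> r \<otimes>\<^bsub>fraction_ring\<^esub> q"
    using fraction_eqI fraction_mult fraction_add p q r 2 by metis
qed

section \<open>Inverses and the quotient ring property\<close>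

lemma regular_element_iff: "regular_element R s \<longleftrightarrow> s \<in> carrier R \<and> s \<noteq> \<zero>"
  unfolding regular_element_def using no_zero_divisors one_neq_zero r_null l_null
  by (metis one_closed)

lemma graph_of_mem: "s \<in> carrier R \<Longrightarrow> (s, b \<otimes> s) \<in> graph_of b"
  by (auto simp: graph_of_def)

text \<open>A fraction with a nonzero value is injective. If a nonzero \<open>t\<close> had value
  zero, a common right multiple of \<open>s\<close> and \<open>t\<close> would carry this zero to a
  nonzero right multiple of \<open>a\<close>.\<close>

lemma fraction_converse:
  assumes q: "fraction q" and sa: "(s, a) \<in> q" "a \<noteq> \<zero>"
  shows "fraction (q\<inverse>)"
proof -
  note Q = linear_graphD[OF fraction_linear_graph[OF q]]
  have s: "s \<in> carrier R" "a \<in> carrier R" "s \<noteq> \<zero>" using sa Q by blast+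
  have "t = \<zero>" if t: "(t, \<zero>) \<in> q" for t
  proof (rule ccontr)
    assume "t \<noteq> \<zero>"
    then obtain u v where uv: "u \<in> carrier R" "v \<in> carrier R" "u \<noteq> \<zero>" "s \<otimes> u = t \<otimes> v"
      using common_multiple s t Q(1) by metis
    have "(s \<otimes> u, a \<otimes> u) \<in> q" "(t \<otimes> v, \<zero> \<otimes> v) \<in> q" using Q(4) sa t uv by blast+
    then have "a \<otimes> u = \<zero>"
      using linear_graph_functional[OF fraction_linear_graph[OF q]] uv by (metis l_null)
    then show False using nonzero_mult s sa uv by blast
  qed
  then have "linear_graph (q\<inverse>)" using sa Q(1-4) unfolding linear_graph_def by auto
  moreover have "saturation (q\<inverse>) \<subseteq> q\<inverse>"
    using fraction_saturated[OF q] by (auto simp: saturation_def)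
  ultimately show ?thesis by (simp add: fraction_def)
qed

lemma fraction_ring_inverse:
  assumes q: "fraction q" and sa: "(s, a) \<in> q" "a \<noteq> \<zero>"
  shows "q \<otimes>\<^bsub>fraction_ring\<^esub> q\<inverse> = \<one>\<^bsub>fraction_ring\<^esub>" "q\<inverse> \<otimes>\<^bsub>fraction_ring\<^esub> q = \<one>\<^bsub>fraction_ring\<^esub>"
proof -
  have c: "s \<in> carrier R" "a \<in> carrier R" and s: "s \<noteq> \<zero>"
    using linear_graphD[OF fraction_linear_graph[OF q]] sa by blast+
  have q': "fraction (q\<inverse>)" using fraction_converse assms by blast
  have "(a, a) \<in> q \<otimes>\<^bsub>fraction_ring\<^esub> q\<inverse>" "(s, s) \<in> q\<inverse> \<otimes>\<^bsub>fraction_ring\<^esub> q"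
    using fraction_mult_mem q q' sa by blast+
  then show "q \<otimes>\<^bsub>fraction_ring\<^esub> q\<inverse> = \<one>\<^bsub>fraction_ring\<^esub>" "q\<inverse> \<otimes>\<^bsub>fraction_ring\<^esub> q = \<one>\<^bsub>fraction_ring\<^esub>"
    using fraction_eqI fraction_mult fraction_one fraction_one_mem q q' c s sa(2) by metis+
qed

lemma graph_of_Units:
  assumes "b \<in> carrier R" "b \<noteq> \<zero>"
  shows "graph_of b \<in> Units fraction_ring"
    "inv\<^bsub>fraction_ring\<^esub> graph_of b = (graph_of b)\<inverse>"
proof -
  interpret Q: ring fraction_ring by (rule ring_fraction_ring)
  have m: "(\<one>, b) \<in> graph_of b" using graph_of_mem[of \<one> b] assms by simp
  have f: "graph_of b \<in> carrier fraction_ring" "(graph_of b)\<inverse> \<in> carrier fraction_ring"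
    using graph_of_fraction fraction_converse m assms fraction_ring_carrier by blast+
  note I = fraction_ring_inverse[OF graph_of_fraction[OF assms(1)] m assms(2)]
  show "graph_of b \<in> Units fraction_ring" using f I unfolding Units_def by blast
  show "inv\<^bsub>fraction_ring\<^esub> graph_of b = (graph_of b)\<inverse>" using f I Q.inv_char by metis
qed

theorem classical_right_quotient_ring_fraction_ring:
  "classical_right_quotient_ring R fraction_ring graph_of"
proof -
  interpret Q: ring fraction_ring by (rule ring_fraction_ring)
  have m1: "(\<one>, a) \<in> graph_of a" if "a \<in> carrier R" for a using graph_of_mem[of \<one> a] that by simp
  have "graph_of \<in> ring_hom R fraction_ring"
  proof (rule ring_hom_memI)
    fix a b assume a: "a \<in> carrier R" and b: "b \<in> carrier R"
    note f = graph_of_fraction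
    show "graph_of a \<in> carrier fraction_ring" using f a fraction_ring_carrier by blast
    have "(\<one>, a \<otimes> b) \<in> graph_of a \<otimes>\<^bsub>fraction_ring\<^esub> graph_of b"
      using fraction_mult_mem[OF f[OF a] f[OF b] m1[OF b]] graph_of_mem b by blast
    then show "graph_of (a \<otimes> b) = graph_of a \<otimes>\<^bsub>fraction_ring\<^esub> graph_of b"
      using fraction_eqI f fraction_mult m1 a b one_neq_zero m_closed by metis
    have "(\<one>, a \<oplus> b) \<in> graph_of a \<oplus>\<^bsub>fraction_ring\<^esub> graph_of b"
      using fraction_add_mem f m1 a b by blast
    then show "graph_of (a \<oplus> b) = graph_of a \<oplus>\<^bsub>fraction_ring\<^esub> graph_of b"
      using fraction_eqI f fraction_add m1 a b one_neq_zero add.m_closed by metis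
  qed (simp add: fraction_ring_def)
  moreover have "inj_on graph_of (carrier R)"
    using m1 linear_graph_functional fraction_linear_graph graph_of_fraction by (metis inj_onI)
  moreover have "\<exists>a s. a \<in> carrier R \<and> regular_element R s \<and>
      q = graph_of a \<otimes>\<^bsub>fraction_ring\<^esub> inv\<^bsub>fraction_ring\<^esub> graph_of s"
    if "q \<in> carrier fraction_ring" for q
  proof -
    have q: "fraction q" using that fraction_ring_carrier by blast
    obtain s a where s: "s \<in> carrier R" "s \<noteq> \<zero>" "a \<in> carrier R" "(s, a) \<in> q"
      using fraction_nonzero_pair q by metis
    \<comment> \<open>The pair \<open>(s, \<one>)\<close> lies in the converse of
      \<open>graph_of s\<close> and \<open>(\<one>, a)\<close> lies in
      \<open>graph_of a\<close>.\<close>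
    have "(s, a) \<in> graph_of a \<otimes>\<^bsub>fraction_ring\<^esub> (graph_of s)\<inverse>"
      by (rule fraction_mult_mem[of _ _ _ \<one>])
        (use s m1 graph_of_fraction fraction_converse in blast)+
    moreover have "fraction (graph_of a \<otimes>\<^bsub>fraction_ring\<^esub> (graph_of s)\<inverse>)"
      using fraction_mult graph_of_fraction fraction_converse s m1 by blast
    ultimately have "q = graph_of a \<otimes>\<^bsub>fraction_ring\<^esub> inv\<^bsub>fraction_ring\<^esub> graph_of s"
      using fraction_eqI q s graph_of_Units by metis
    then show ?thesis using s regular_element_iff by blast
  qed
  ultimately show ?thesis unfolding classical_right_quotient_ring_def
    by (simp add: ring_fraction_ring graph_of_Units regular_element_iff)
qed

end

section \<open>Skew polynomial steps\<close>

text \<open>Left polynomials in \<open>x\<close> over \<open>T\<close> of degree below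
  \<open>n\<close>. The recursion refers to no commutation rule, so these sets can be compared
  between a ring and its twist.\<close>

primrec skew_filtration :: "('a, 'n) ring_scheme \<Rightarrow> 'a set \<Rightarrow> 'a \<Rightarrow> nat \<Rightarrow> 'a set" where
  "skew_filtration B T x 0 = {\<zero>\<^bsub>B\<^esub>}"
| "skew_filtration B T x (Suc n) =
    {p \<oplus>\<^bsub>B\<^esub> a \<otimes>\<^bsub>B\<^esub> x [^]\<^bsub>B\<^esub> n | p a. p \<in> skew_filtration B T x n \<and> a \<in> T}"

declare skew_filtration.simps(2) [simp del]

text \<open>The Ore domain condition is formulated inside an ambient ring, so that the induction
  along the chain of subalgebras never changes the ring.\<close>

definition ore_subset :: "('a, 'n) ring_scheme \<Rightarrow> 'a set \<Rightarrow> bool" where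
  "ore_subset B T \<longleftrightarrow>
     (\<forall>a\<in>T. \<forall>b\<in>T. a \<otimes>\<^bsub>B\<^esub> b = \<zero>\<^bsub>B\<^esub> \<longrightarrow> a = \<zero>\<^bsub>B\<^esub> \<or> b = \<zero>\<^bsub>B\<^esub>) \<and>
     (\<forall>a\<in>T - {\<zero>\<^bsub>B\<^esub>}. \<forall>b\<in>T - {\<zero>\<^bsub>B\<^esub>}. \<exists>u\<in>T. \<exists>v\<in>T. a \<otimes>\<^bsub>B\<^esub> u = b \<otimes>\<^bsub>B\<^esub> v \<and> a \<otimes>\<^bsub>B\<^esub> u \<noteq> \<zero>\<^bsub>B\<^esub>)"

lemma (in ring) subringD:
  assumes "subring T R"
  shows "T \<subseteq> carrier R" "\<zero> \<in> T" "\<one> \<in> T" "a \<in> T \<Longrightarrow> b \<in> T \<Longrightarrow> a \<oplus> b \<in> T"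
    "a \<in> T \<Longrightarrow> b \<in> T \<Longrightarrow> a \<otimes> b \<in> T" "a \<in> T \<Longrightarrow> \<ominus> a \<in> T" "a \<in> T \<Longrightarrow> a \<in> carrier R"
  using subringE[OF assms] by auto

locale skew_filtered = ring +
  fixes T :: "'a set" and x :: 'a
  assumes T: "subring T R"
    and x_carrier: "x \<in> carrier R"
begin

abbreviation P :: "nat \<Rightarrow> 'a set" where "P \<equiv> skew_filtration R T x"

lemmas Ts = subringD[OF T]

lemma P_SucI: "\<lbrakk>p \<in> P n; a \<in> T; f = p \<oplus> a \<otimes> x [^] n\<rbrakk> \<Longrightarrow> f \<in> P (Suc n)"
  by (auto simp: skew_filtration.simps(2))

lemma P_SucE:
  assumes "f \<in> P (Suc n)"
  obtains p a where "p \<in> P n" "a \<in> T" "f = p \<oplus> a \<otimes> x [^] n"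
  using assms by (auto simp: skew_filtration.simps(2))

lemma P_carrier: "f \<in> P n \<Longrightarrow> f \<in> carrier R"
  by (induction n arbitrary: f) (use Ts x_carrier in \<open>auto elim!: P_SucE\<close>)

lemma P_zero: "\<zero> \<in> P n"
proof (induction n)
  case (Suc n)
  show ?case by (rule P_SucI[OF Suc Ts(2)]) (simp add: x_carrier)
qed simp

lemma P_Suc: "f \<in> P n \<Longrightarrow> f \<in> P (Suc n)"
  by (rule P_SucI[OF _ Ts(2)]) (auto simp: x_carrier P_carrier)

lemma P_mono: "n \<le> m \<Longrightarrow> f \<in> P n \<Longrightarrow> f \<in> P m"
  by (induction m rule: dec_induct) (auto intro: P_Suc)

lemma P_add: "f \<in> P n \<Longrightarrow> g \<in> P n \<Longrightarrow> f \<oplus> g \<in> P n"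
proof (induction n arbitrary: f g)
  case (Suc n)
  obtain p a where f: "p \<in> P n" "a \<in> T" "f = p \<oplus> a \<otimes> x [^] n" using P_SucE Suc.prems(1) .
  obtain q b where g: "q \<in> P n" "b \<in> T" "g = q \<oplus> b \<otimes> x [^] n" using P_SucE Suc.prems(2) .
  have c: "p \<in> carrier R" "q \<in> carrier R" "a \<in> carrier R" "b \<in> carrier R" "x [^] n \<in> carrier R"
    using f g P_carrier Ts(7) x_carrier by auto
  show ?case
    by (rule P_SucI[OF Suc.IH[OF f(1) g(1)] Ts(4)[OF f(2) g(2)]])
      (use c in \<open>simp add: f(3) g(3) l_distr a_ac\<close>)
qed simp

lemma P_smult: "f \<in> P n \<Longrightarrow> b \<in> T \<Longrightarrow> b \<otimes> f \<in> P n"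
proof (induction n arbitrary: f)
  case (Suc n)
  obtain p a where f: "p \<in> P n" "a \<in> T" "f = p \<oplus> a \<otimes> x [^] n" using P_SucE Suc.prems(1) .
  have c: "p \<in> carrier R" "a \<in> carrier R" "b \<in> carrier R" "x [^] n \<in> carrier R"
    using f Suc.prems P_carrier Ts(7) x_carrier by auto
  show ?case
    by (rule P_SucI[OF Suc.IH[OF f(1) Suc.prems(2)] Ts(5)[OF Suc.prems(2) f(2)]])
      (use c in \<open>simp add: f(3) r_distr m_assoc\<close>)
qed (use Ts(7) in simp)

lemma P_minus: "f \<in> P n \<Longrightarrow> \<ominus> f \<in> P n"
  using P_smult[of f n "\<ominus> \<one>"] Ts(3,6) P_carrier[of f n] by (simp add: l_minus)

lemma P_diff: "f \<in> P n \<Longrightarrow> g \<in> P n \<Longrightarrow> f \<ominus> g \<in> P n"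
  by (simp add: a_minus_def P_add P_minus)

lemma P_monom: "a \<in> T \<Longrightarrow> a \<otimes> x [^] n \<in> P (Suc n)"
  by (rule P_SucI[OF P_zero]) (use Ts(7) x_carrier in auto)

lemma P_mult_x: "f \<in> P n \<Longrightarrow> f \<otimes> x \<in> P (Suc n)"
proof (induction n arbitrary: f)
  case 0
  then show ?case using P_zero x_carrier by auto
next
  case (Suc n)
  obtain p a where f: "p \<in> P n" "a \<in> T" "f = p \<oplus> a \<otimes> x [^] n" using P_SucE Suc.prems(1) .
  have c: "p \<in> carrier R" "a \<in> carrier R" "x [^] n \<in> carrier R"
    using f P_carrier Ts(7) x_carrier by auto
  show ?case by (rule P_SucI[OF Suc.IH[OF f(1)] f(2)])
    (use c x_carrier in \<open>simp add: f(3) l_distr m_assoc\<close>)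
qed

lemma P_mult_pow: "f \<in> P n \<Longrightarrow> f \<otimes> x [^] m \<in> P (n + m)"
proof (induction m)
  case 0
  then show ?case using P_carrier[of f n] by simp
next
  case (Suc m)
  have "f \<otimes> x [^] m \<otimes> x \<in> P (Suc (n + m))" using P_mult_x Suc by blast
  then show ?case using P_carrier[of f n] Suc.prems x_carrier
    by (simp add: m_assoc)
qed

end

text \<open>Here \<open>s\<close> is the automorphism of the skew polynomial extension, the
  derivation is present only as a remainder \<open>d\<close> in \<open>T\<close>, and
  \<open>free\<close> is the uniqueness of top coefficients. In this form the conditions survive a
  twist, although the derivation itself changes.\<close>

locale skew_step = skew_filtered +
  fixes s :: "'a \<Rightarrow> 'a"
  assumes s_closed: "a \<in> T \<Longrightarrow> s a \<in> T"
    and s_nonzero: "a \<in> T \<Longrightarrow> s a = \<zero> \<Longrightarrow> a = \<zero>"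
    and s_surj: "a \<in> T \<Longrightarrow> \<exists>b\<in>T. s b = a"
    and s_comm: "a \<in> T \<Longrightarrow> \<exists>d\<in>T. x \<otimes> a = s a \<otimes> x \<oplus> d"
    and free: "a \<in> T \<Longrightarrow> a \<otimes> x [^] n \<in> skew_filtration R T x n \<Longrightarrow> a = \<zero>"
begin

definition ext :: "'a set" where "ext = (\<Union>n. P n)"

lemma x_mult_P: "f \<in> P n \<Longrightarrow> x \<otimes> f \<in> P (Suc n)"
proof (induction n arbitrary: f)
  case 0
  then show ?case using P_zero x_carrier by auto
next
  case (Suc n)
  obtain p a where f: "p \<in> P n" "a \<in> T" "f = p \<oplus> a \<otimes> x [^] n" using P_SucE Suc.prems(1) .
  obtain d where d: "d \<in> T" "x \<otimes> a = s a \<otimes> x \<oplus> d" using s_comm f by blast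
  have c: "p \<in> carrier R" "a \<in> carrier R" "d \<in> carrier R" "s a \<in> carrier R" "x [^] n \<in> carrier R"
    using f d P_carrier Ts(7) x_carrier s_closed by auto
  have "x \<otimes> f = x \<otimes> p \<oplus> (x \<otimes> a) \<otimes> x [^] n"
    using c x_carrier by (simp add: f(3) r_distr m_assoc)
  also have "\<dots> = (x \<otimes> p \<oplus> d \<otimes> x [^] n) \<oplus> s a \<otimes> x [^] Suc n"
    using c x_carrier by (simp only: d(2) nat_pow_Suc2 l_distr m_assoc m_closed a_ac add.m_closed nat_pow_closed)
  finally have "x \<otimes> f = (x \<otimes> p \<oplus> d \<otimes> x [^] n) \<oplus> s a \<otimes> x [^] Suc n" .
  moreover have "x \<otimes> p \<oplus> d \<otimes> x [^] n \<in> P (Suc n)"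
    using P_add P_monom Suc.IH f d by blast
  ultimately show ?case using P_SucI s_closed f by blast
qed

lemma pow_mult_P: "f \<in> P n \<Longrightarrow> x [^] m \<otimes> f \<in> P (m + n)"
proof (induction m)
  case 0
  then show ?case using P_carrier[of f n] by simp
next
  case (Suc m)
  have "x \<otimes> (x [^] m \<otimes> f) \<in> P (Suc (m + n))" using x_mult_P Suc by blast
  then show ?case using P_carrier[of f n] Suc.prems x_carrier
    by (simp add: m_assoc[symmetric] nat_pow_Suc2[symmetric] del: nat_pow_Suc)
qed

lemma s_pow_closed: "a \<in> T \<Longrightarrow> (s ^^ n) a \<in> T"
  by (induction n) (auto intro: s_closed)

lemma s_pow_nonzero: "a \<in> T \<Longrightarrow> (s ^^ n) a = \<zero> \<Longrightarrow> a = \<zero>"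
  by (induction n) (auto dest: s_nonzero[OF s_pow_closed])

lemma s_pow_surj: "a \<in> T \<Longrightarrow> \<exists>b\<in>T. (s ^^ n) b = a"
proof (induction n arbitrary: a)
  case (Suc n)
  then show ?case using s_surj by (metis comp_apply funpow.simps(2))
qed auto

lemma pow_mult_T: "b \<in> T \<Longrightarrow> \<exists>p\<in>P n. x [^] n \<otimes> b = p \<oplus> (s ^^ n) b \<otimes> x [^] n"
proof (induction n)
  case 0
  then show ?case using Ts(7) by (auto intro!: bexI[of _ \<zero>])
next
  case (Suc n)
  let ?b = "(s ^^ n) b"
  obtain p where p: "p \<in> P n" "x [^] n \<otimes> b = p \<oplus> ?b \<otimes> x [^] n" using Suc by blast
  have bT: "?b \<in> T" using s_pow_closed Suc by blast
  obtain d where d: "d \<in> T" "x \<otimes> ?b = s ?b \<otimes> x \<oplus> d" using s_comm bT by blast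
  have c: "p \<in> carrier R" "?b \<in> carrier R" "d \<in> carrier R" "s ?b \<in> carrier R" "x [^] n \<in> carrier R"
    "b \<in> carrier R" using p d bT P_carrier Ts(7) x_carrier s_closed Suc by auto
  have "x [^] Suc n \<otimes> b = x \<otimes> (x [^] n \<otimes> b)"
    using c x_carrier by (simp only: nat_pow_Suc2 m_assoc)
  also have "\<dots> = x \<otimes> p \<oplus> (x \<otimes> ?b) \<otimes> x [^] n"
    using c x_carrier by (simp add: p(2) r_distr m_assoc)
  also have "\<dots> = (x \<otimes> p \<oplus> d \<otimes> x [^] n) \<oplus> s ?b \<otimes> x [^] Suc n"
    using c x_carrier by (simp only: d(2) nat_pow_Suc2 l_distr m_assoc m_closed a_ac add.m_closed nat_pow_closed)
  finally have "x [^] Suc n \<otimes> b = (x \<otimes> p \<oplus> d \<otimes> x [^] n) \<oplus> s ?b \<otimes> x [^] Suc n" .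
  moreover have "x \<otimes> p \<oplus> d \<otimes> x [^] n \<in> P (Suc n)"
    using P_add P_monom x_mult_P p d by blast
  ultimately show ?case unfolding funpow.simps comp_apply by blast
qed

text \<open>The off-by-one is intended: degree below \<open>n\<close> times degree at most
  \<open>m\<close> has degree below \<open>n + m\<close>.\<close>

lemma P_mult: "f \<in> P n \<Longrightarrow> g \<in> P (Suc m) \<Longrightarrow> f \<otimes> g \<in> P (n + m)"
proof (induction n arbitrary: f)
  case 0
  then show ?case using P_zero P_carrier[of g "Suc m"] by auto
next
  case (Suc n)
  obtain p a where f: "p \<in> P n" "a \<in> T" "f = p \<oplus> a \<otimes> x [^] n" using P_SucE Suc.prems(1) .
  have c: "p \<in> carrier R" "a \<in> carrier R" "x [^] n \<in> carrier R" "g \<in> carrier R"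
    using f Suc.prems(2) P_carrier Ts(7) x_carrier by auto
  have "f \<otimes> g = p \<otimes> g \<oplus> a \<otimes> (x [^] n \<otimes> g)" using c by (simp add: f(3) l_distr m_assoc)
  moreover have "p \<otimes> g \<in> P (Suc n + m)"
    using Suc.IH[OF f(1) Suc.prems(2)] P_mono[of "n + m" "Suc n + m"] by simp
  moreover have "a \<otimes> (x [^] n \<otimes> g) \<in> P (Suc n + m)"
    using P_smult[OF pow_mult_P[OF Suc.prems(2), of n] f(2)] by simp
  ultimately show ?case using P_add by simp
qed

text \<open>Only the two top terms reach degree \<open>n + m\<close>, and moving
  \<open>x [^] n\<close> past \<open>b\<close> contributes the power of \<open>s\<close>.\<close>

lemma lead_mult:
  assumes "p \<in> P n" "q \<in> P m" "a \<in> T" "b \<in> T"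
  shows "\<exists>r\<in>P (n + m). (p \<oplus> a \<otimes> x [^] n) \<otimes> (q \<oplus> b \<otimes> x [^] m) = r \<oplus> (a \<otimes> (s ^^ n) b) \<otimes> x [^] (n + m)"
proof -
  obtain t where t: "t \<in> P n" "x [^] n \<otimes> b = t \<oplus> (s ^^ n) b \<otimes> x [^] n"
    using pow_mult_T assms by blast
  let ?g = "q \<oplus> b \<otimes> x [^] m"
  have g: "?g \<in> P (Suc m)" using assms by (blast intro: P_SucI)
  have c: "p \<in> carrier R" "a \<in> carrier R" "b \<in> carrier R" "q \<in> carrier R" "x [^] n \<in> carrier R"
    "x [^] m \<in> carrier R" "(s ^^ n) b \<in> carrier R" "t \<in> carrier R" "?g \<in> carrier R"
    using assms P_carrier Ts(7) x_carrier s_pow_closed t P_carrier[OF g] by auto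
  have "(p \<oplus> a \<otimes> x [^] n) \<otimes> ?g = p \<otimes> ?g \<oplus> a \<otimes> x [^] n \<otimes> ?g" using c by (simp only: l_distr m_closed)
  also have "a \<otimes> x [^] n \<otimes> ?g = a \<otimes> (x [^] n \<otimes> q) \<oplus> a \<otimes> ((x [^] n \<otimes> b) \<otimes> x [^] m)"
    using c by (simp add: r_distr m_assoc)
  also have "(x [^] n \<otimes> b) \<otimes> x [^] m = t \<otimes> x [^] m \<oplus> (s ^^ n) b \<otimes> x [^] (n + m)"
    unfolding t(2) using c x_carrier by (simp add: l_distr m_assoc nat_pow_mult)
  also have "a \<otimes> (t \<otimes> x [^] m \<oplus> (s ^^ n) b \<otimes> x [^] (n + m)) =
    a \<otimes> (t \<otimes> x [^] m) \<oplus> (a \<otimes> (s ^^ n) b) \<otimes> x [^] (n + m)"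
    using c x_carrier by (simp add: r_distr m_assoc)
  finally have "(p \<oplus> a \<otimes> x [^] n) \<otimes> ?g =
    (p \<otimes> ?g \<oplus> (a \<otimes> (x [^] n \<otimes> q) \<oplus> a \<otimes> (t \<otimes> x [^] m))) \<oplus> (a \<otimes> (s ^^ n) b) \<otimes> x [^] (n + m)"
    using c x_carrier by (simp add: a_assoc)
  moreover have "p \<otimes> ?g \<oplus> (a \<otimes> (x [^] n \<otimes> q) \<oplus> a \<otimes> (t \<otimes> x [^] m)) \<in> P (n + m)"
    by (intro P_add P_mult[OF assms(1) g] P_smult pow_mult_P P_mult_pow assms t)
  ultimately show ?thesis by blast
qed

text \<open>Unlike \<open>lead_unique\<close>, this version admits zero coefficients. It is the one
  used to compare both sides of an identity in a fixed degree.\<close>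

lemma coeff_unique:
  assumes "p \<in> P n" "q \<in> P n" "a \<in> T" "b \<in> T" and eq: "p \<oplus> a \<otimes> x [^] n = q \<oplus> b \<otimes> x [^] n"
  shows "a = b"
proof -
  have c: "p \<in> carrier R" "a \<in> carrier R" "b \<in> carrier R" "q \<in> carrier R" "x [^] n \<in> carrier R"
    using assms P_carrier Ts(7) x_carrier by auto
  have "(a \<ominus> b) \<otimes> x [^] n = (p \<oplus> a \<otimes> x [^] n) \<ominus> p \<ominus> b \<otimes> x [^] n"
    using c by (simp add: a_minus_def a_ac l_distr l_minus r_neg2)
  also have "\<dots> = q \<ominus> p" using c unfolding eq by (simp add: a_minus_def a_ac r_neg2 r_neg)
  finally have "(a \<ominus> b) \<otimes> x [^] n \<in> P n" using P_diff assms by simp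
  moreover have "a \<ominus> b \<in> T" using assms Ts by (simp add: a_minus_def)
  ultimately have "a \<ominus> b = \<zero>" using free by blast
  then show ?thesis using c by (simp add: r_right_minus_eq)
qed

lemma lead_unique:
  assumes "p \<in> P n" "q \<in> P m" "a \<in> T" "b \<in> T" "a \<noteq> \<zero>" "b \<noteq> \<zero>"
    and eq: "p \<oplus> a \<otimes> x [^] n = q \<oplus> b \<otimes> x [^] m"
  shows "n = m \<and> a = b"
proof -
  have False if "p \<in> P n" "q \<in> P m" "a \<in> T" "b \<in> T" "b \<noteq> \<zero>"
    "p \<oplus> a \<otimes> x [^] n = q \<oplus> b \<otimes> x [^] m" "n < m" for p q a b n m
  proof -
    have c: "p \<in> carrier R" "a \<in> carrier R" "b \<in> carrier R" "q \<in> carrier R" "x [^] n \<in> carrier R"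
      "x [^] m \<in> carrier R" using that P_carrier Ts(7) x_carrier by auto
    have "b \<otimes> x [^] m = (p \<oplus> a \<otimes> x [^] n) \<ominus> q"
      using c that(6) by (simp add: a_minus_def a_ac r_neg2 r_neg)
    moreover have "p \<oplus> a \<otimes> x [^] n \<in> P m"
      using P_mono[of "Suc n" m] P_SucI that(1,3,7) by (metis Suc_leI)
    ultimately have "b \<otimes> x [^] m \<in> P m" using P_diff that(2) by metis
    then show False using free that by blast
  qed
  then have nm: "n = m" using assms by (metis linorder_neqE_nat)
  then show ?thesis using coeff_unique[of p n q a b] assms by simp
qed

lemma lead_nonzero:
  assumes "p \<in> P n" "a \<in> T" "a \<noteq> \<zero>"
  shows "p \<oplus> a \<otimes> x [^] n \<noteq> \<zero>"
proof
  assume "p \<oplus> a \<otimes> x [^] n = \<zero>"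
  then have "a \<otimes> x [^] n = \<ominus> p"
    using P_carrier[OF assms(1)] Ts(7)[OF assms(2)] x_carrier
    by (metis a_comm m_closed minus_equality nat_pow_closed)
  then have "a \<otimes> x [^] n \<in> P n" using P_minus assms by simp
  then show False using free assms by blast
qed

lemma lead_exists:
  assumes "f \<in> P k" "f \<noteq> \<zero>"
  obtains n p a where "n < k" "p \<in> P n" "a \<in> T" "a \<noteq> \<zero>" "f = p \<oplus> a \<otimes> x [^] n"
  using assms
proof (induction k arbitrary: thesis)
  case (Suc k)
  obtain p a where f: "p \<in> P k" "a \<in> T" "f = p \<oplus> a \<otimes> x [^] k" using P_SucE Suc.prems(2) .
  show ?case
  proof (cases "a = \<zero>")
    case True
    then have "f = p" using f P_carrier x_carrier by simp
    then show ?thesis using Suc f by (metis less_SucI)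
  next
    case False
    then show ?thesis using Suc.prems(1)[of k p a] f by blast
  qed
qed simp

section \<open>The whole extension: zero divisors, the Ore condition, leading coefficients\<close>

lemma extI: "f \<in> P n \<Longrightarrow> f \<in> ext"
  unfolding ext_def by blast

lemma extE:
  assumes "f \<in> ext" "f \<noteq> \<zero>"
  obtains n p a where "p \<in> P n" "a \<in> T" "a \<noteq> \<zero>" "f = p \<oplus> a \<otimes> x [^] n"
  using assms lead_exists unfolding ext_def by (metis UN_E)

lemma T_subset_ext: "T \<subseteq> ext"
  using P_monom[of _ 0] Ts(7) extI by fastforce

lemma x_ext: "x \<in> ext"
  using P_monom[OF Ts(3), of 1] x_carrier extI by fastforce

lemma ext_add: "f \<in> ext \<Longrightarrow> g \<in> ext \<Longrightarrow> f \<oplus> g \<in> ext"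
  unfolding ext_def using P_add P_mono by (metis UN_E UN_I UNIV_I max.cobounded1 max.cobounded2)

lemma ext_mult: "f \<in> ext \<Longrightarrow> g \<in> ext \<Longrightarrow> f \<otimes> g \<in> ext"
  unfolding ext_def using P_mult P_Suc by (metis UN_E UN_I UNIV_I)

lemma subring_ext: "subring ext R"
proof (rule subringI)
  show "ext \<subseteq> carrier R" unfolding ext_def using P_carrier by blast
  show "\<one> \<in> ext" using T_subset_ext Ts by blast
  show "\<ominus> f \<in> ext" if "f \<in> ext" for f using that P_minus unfolding ext_def by blast
qed (auto intro: ext_add ext_mult)

text \<open>One step of right pseudo-division. The Ore condition in \<open>T\<close> equalizes the
  leading coefficients \<open>a\<close> and \<open>b\<close>; since \<open>s\<close> is surjective,
  the factors \<open>u\<close> and \<open>v\<close> can be pulled back through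
  \<open>s ^^ n\<close>, and multiplying \<open>f\<close> by \<open>r\<close> and \<open>g\<close>
  by \<open>x [^] (n - m) \<otimes> t\<close> cancels the leading terms.\<close>

lemma ore_descent:
  assumes oreT: "ore_subset R T"
    and f: "p \<in> P n" "a \<in> T" "a \<noteq> \<zero>" "f = p \<oplus> a \<otimes> x [^] n"
    and g: "q \<in> P m" "b \<in> T" "b \<noteq> \<zero>" "g = q \<oplus> b \<otimes> x [^] m" and mn: "m \<le> n"
  shows "\<exists>h\<in>P n. \<exists>r\<in>ext. \<exists>w\<in>ext. f \<otimes> r = h \<oplus> g \<otimes> w \<and> f \<otimes> r \<noteq> \<zero>"
proof -
  obtain u v where uv: "u \<in> T" "v \<in> T" "a \<otimes> u = b \<otimes> v" "a \<otimes> u \<noteq> \<zero>"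
    using oreT f g unfolding ore_subset_def by blast
  obtain r where r: "r \<in> T" "(s ^^ n) r = u" using s_pow_surj uv by blast
  obtain t where t: "t \<in> T" "(s ^^ n) t = v" using s_pow_surj uv by blast
  obtain y where y: "y \<in> P (n - m)" "x [^] (n - m) \<otimes> t = y \<oplus> (s ^^ (n - m)) t \<otimes> x [^] (n - m)"
    using pow_mult_T t by blast
  let ?w = "y \<oplus> (s ^^ (n - m)) t \<otimes> x [^] (n - m)"
  have w: "?w \<in> ext" using extI[OF P_SucI[OF y(1) s_pow_closed[OF t(1)]]] by blast
  have "(s ^^ m) ((s ^^ (n - m)) t) = v"
    using t(2) mn by (metis comp_apply funpow_add le_add_diff_inverse)
  then obtain z where z: "z \<in> P n" "g \<otimes> ?w = z \<oplus> (b \<otimes> v) \<otimes> x [^] n"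
    using lead_mult[OF g(1) y(1) g(2) s_pow_closed[OF t(1)]] mn g(4) by auto
  obtain z' where z': "z' \<in> P n" "f \<otimes> (\<zero> \<oplus> r \<otimes> x [^] (0::nat)) = z' \<oplus> (a \<otimes> u) \<otimes> x [^] n"
    using lead_mult[OF f(1) P_zero[of 0] f(2) r(1)] f(4) r(2) by auto
  have rc: "\<zero> \<oplus> r \<otimes> x [^] (0::nat) = r" using r Ts(7) by simp
  have au: "a \<otimes> u \<in> T" using Ts(5) f uv by blast
  have c: "z \<in> carrier R" "z' \<in> carrier R" "(a \<otimes> u) \<otimes> x [^] n \<in> carrier R"
    using P_carrier z z' au Ts(7) x_carrier by auto
  have "f \<otimes> r = (z' \<ominus> z) \<oplus> g \<otimes> ?w" unfolding z(2) uv(3)[symmetric] z'(2)[unfolded rc]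
    using c by (simp add: a_minus_def a_assoc r_neg1)
  moreover have "f \<otimes> r \<noteq> \<zero>" unfolding z'(2)[unfolded rc] using lead_nonzero z' au uv by blast
  moreover have "z' \<ominus> z \<in> P n" using P_diff z z' by blast
  ultimately show ?thesis using r T_subset_ext w by blast
qed

lemma ext_no_zero_divisors:
  assumes oreT: "ore_subset R T" and fg: "f \<in> ext" "g \<in> ext" "f \<noteq> \<zero>" "g \<noteq> \<zero>"
  shows "f \<otimes> g \<noteq> \<zero>"
proof -
  obtain n p a where f: "p \<in> P n" "a \<in> T" "a \<noteq> \<zero>" "f = p \<oplus> a \<otimes> x [^] n"
    using extE fg by metis
  obtain m q b where g: "q \<in> P m" "b \<in> T" "b \<noteq> \<zero>" "g = q \<oplus> b \<otimes> x [^] m"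
    using extE fg by metis
  have sb: "(s ^^ n) b \<in> T" "(s ^^ n) b \<noteq> \<zero>"
    using s_pow_closed[OF g(2)] s_pow_nonzero[OF g(2)] g(3) by blast+
  then have "a \<otimes> (s ^^ n) b \<noteq> \<zero>" using oreT f(2,3) unfolding ore_subset_def by blast
  moreover have "a \<otimes> (s ^^ n) b \<in> T" using Ts(5)[OF f(2) sb(1)] .
  moreover obtain r where "r \<in> P (n + m)" "f \<otimes> g = r \<oplus> (a \<otimes> (s ^^ n) b) \<otimes> x [^] (n + m)"
    using lead_mult[OF f(1) g(1) f(2) g(2)] f(4) g(4) by blast
  ultimately show ?thesis using lead_nonzero by metis
qed

text \<open>Euclid's algorithm as an induction on the sum of two degree bounds. The element of
  larger degree is replaced by its remainder from \<open>ore_descent\<close>; a zero remainder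
  already yields a common multiple.\<close>

lemma ore_subset_ext:
  assumes oreT: "ore_subset R T"
  shows "ore_subset R ext"
proof -
  define meets where "meets f g \<longleftrightarrow> (\<exists>u\<in>ext. \<exists>v\<in>ext. f \<otimes> u = g \<otimes> v \<and> f \<otimes> u \<noteq> \<zero>)" for f g
  have sym: "meets f g \<Longrightarrow> meets g f" for f g unfolding meets_def by metis
  have c: "f \<in> ext \<Longrightarrow> f \<in> carrier R" for f using subringD(7)[OF subring_ext] .
  have dom: "f \<otimes> g \<noteq> \<zero>" if "f \<in> ext" "g \<in> ext" "f \<noteq> \<zero>" "g \<noteq> \<zero>" for f g
    using ext_no_zero_divisors oreT that by blast
  have reduce: "meets f g"
    if f: "p \<in> P n" "a \<in> T" "a \<noteq> \<zero>" "f = p \<oplus> a \<otimes> x [^] n"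
      and g: "q \<in> P m" "b \<in> T" "b \<noteq> \<zero>" "g = q \<oplus> b \<otimes> x [^] m" and mn: "m \<le> n"
      and IH: "\<And>h. h \<in> P n \<Longrightarrow> h \<noteq> \<zero> \<Longrightarrow> meets h g" for f g n m p q a b
  proof -
    obtain h r w where h: "h \<in> P n" "r \<in> ext" "w \<in> ext" "f \<otimes> r = h \<oplus> g \<otimes> w" "f \<otimes> r \<noteq> \<zero>"
      using ore_descent[OF oreT f g mn] by blast
    have fe: "f \<in> ext" "g \<in> ext" using extI P_SucI f g by blast+
    note cc = c[OF fe(1)] c[OF fe(2)] c[OF h(2)] c[OF h(3)] P_carrier[OF h(1)]
    show ?thesis
    proof (cases "h = \<zero>")
      case True
      then have "f \<otimes> r = g \<otimes> w" using h(4) cc by simp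
      then show ?thesis unfolding meets_def using h by blast
    next
      case False
      then obtain u v where uv: "u \<in> ext" "v \<in> ext" "h \<otimes> u = g \<otimes> v" "h \<otimes> u \<noteq> \<zero>"
        using IH h unfolding meets_def by blast
      note cu = c[OF uv(1)] c[OF uv(2)]
      have "f \<otimes> (r \<otimes> u) = (h \<oplus> g \<otimes> w) \<otimes> u" using cc cu h(4) by (simp add: m_assoc[symmetric])
      also have "\<dots> = g \<otimes> (v \<oplus> w \<otimes> u)" using cc cu uv(3) by (simp add: l_distr r_distr m_assoc)
      finally have 1: "f \<otimes> (r \<otimes> u) = g \<otimes> (v \<oplus> w \<otimes> u)" .
      have "u \<noteq> \<zero>" using uv(4) cc by auto
      then have "(f \<otimes> r) \<otimes> u \<noteq> \<zero>" using dom h uv ext_mult[OF fe(1) h(2)] by blast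
      then have "f \<otimes> (r \<otimes> u) \<noteq> \<zero>" using cc cu by (simp add: m_assoc)
      then show ?thesis unfolding meets_def
        using 1 ext_mult ext_add h uv by blast
    qed
  qed
  have "meets f g" if "f \<in> P k" "g \<in> P l" "f \<noteq> \<zero>" "g \<noteq> \<zero>" for f g k l
    using that
  proof (induction "k + l" arbitrary: f g k l rule: less_induct)
    case less
    obtain n p a where f: "n < k" "p \<in> P n" "a \<in> T" "a \<noteq> \<zero>" "f = p \<oplus> a \<otimes> x [^] n"
      using lead_exists less.prems by metis
    obtain m q b where g: "m < l" "q \<in> P m" "b \<in> T" "b \<noteq> \<zero>" "g = q \<oplus> b \<otimes> x [^] m"
      using lead_exists less.prems by metis
    show ?case
    proof (cases "m \<le> n")
      case True
      show ?thesis
        by (rule reduce[OF f(2-5) g(2-5) True])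
          (rule less.hyps[OF _ _ less.prems(2) _ less.prems(4), of n], use f(1) in auto)
    next
      case False
      have "meets g f"
        by (rule reduce[OF g(2-5) f(2-5)])
          (use False in simp, rule less.hyps[OF _ _ less.prems(1) _ less.prems(3), of m], use g(1) in auto)
      then show ?thesis by (rule sym)
    qed
  qed
  then have "\<exists>u\<in>ext. \<exists>v\<in>ext. f \<otimes> u = g \<otimes> v \<and> f \<otimes> u \<noteq> \<zero>" if "f \<in> ext - {\<zero>}" "g \<in> ext - {\<zero>}" for f g
    using that unfolding meets_def ext_def by blast
  then show ?thesis unfolding ore_subset_def using dom by blast
qed

definition lead :: "'a \<Rightarrow> 'a" where
  "lead f = (THE a. a \<in> T \<and> a \<noteq> \<zero> \<and> (\<exists>n. \<exists>p\<in>P n. f = p \<oplus> a \<otimes> x [^] n))"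

lemma lead_eq:
  assumes "p \<in> P n" "a \<in> T" "a \<noteq> \<zero>"
  shows "lead (p \<oplus> a \<otimes> x [^] n) = a"
  unfolding lead_def
proof (rule the_equality)
  show "a \<in> T \<and> a \<noteq> \<zero> \<and> (\<exists>m. \<exists>q\<in>P m. p \<oplus> a \<otimes> x [^] n = q \<oplus> a \<otimes> x [^] m)"
    using assms by blast
qed (use lead_unique assms in metis)

lemma lead_T: "a \<in> T \<Longrightarrow> a \<noteq> \<zero> \<Longrightarrow> lead a = a"
  using lead_eq[OF P_zero, of a 0] Ts(7) by simp

lemma lead_mem: "f \<in> ext \<Longrightarrow> f \<noteq> \<zero> \<Longrightarrow> lead f \<in> T - {\<zero>}"
  by (metis extE lead_eq DiffI singletonD)

text \<open>The exponent is the degree of \<open>f\<close>. It stays existential because the later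
  argument uses invariance under every power of \<open>s\<close>.\<close>

lemma lead_mult_power:
  assumes oreT: "ore_subset R T" and fg: "f \<in> ext" "g \<in> ext" "f \<noteq> \<zero>" "g \<noteq> \<zero>"
  obtains n where "lead (f \<otimes> g) = lead f \<otimes> (s ^^ n) (lead g)"
proof -
  obtain n p a where f: "p \<in> P n" "a \<in> T" "a \<noteq> \<zero>" "f = p \<oplus> a \<otimes> x [^] n"
    using extE fg by metis
  obtain m q b where g: "q \<in> P m" "b \<in> T" "b \<noteq> \<zero>" "g = q \<oplus> b \<otimes> x [^] m"
    using extE fg by metis
  have sb: "(s ^^ n) b \<in> T" "(s ^^ n) b \<noteq> \<zero>"
    using s_pow_closed[OF g(2)] s_pow_nonzero[OF g(2)] g(3) by blast+
  then have ab: "a \<otimes> (s ^^ n) b \<noteq> \<zero>" using oreT f(2,3) unfolding ore_subset_def by blast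
  obtain r where "r \<in> P (n + m)" "f \<otimes> g = r \<oplus> (a \<otimes> (s ^^ n) b) \<otimes> x [^] (n + m)"
    using lead_mult[OF f(1) g(1) f(2) g(2)] f(4) g(4) by blast
  then have "lead (f \<otimes> g) = a \<otimes> (s ^^ n) b"
    using lead_eq[OF _ Ts(5)[OF f(2) sb(1)] ab] by simp
  moreover have "lead f = a" "lead g = b" using lead_eq f g by blast+
  ultimately show ?thesis using that by simp
qed

end

section \<open>Graded algebras and their twists\<close>

context assoc_algebra
begin

sublocale KF: field K by (rule field)

lemma Units_K: "Units K = carrier K - {\<zero>\<^bsub>K\<^esub>}"
  using KF.field_Units by blast

lemma smult_zero_iff:
  assumes "c \<in> Units K" "a \<in> carrier A" "c \<odot>\<^bsub>A\<^esub> a = \<zero>\<^bsub>A\<^esub>"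
  shows "a = \<zero>\<^bsub>A\<^esub>"
proof -
  have "inv\<^bsub>K\<^esub> c \<odot>\<^bsub>A\<^esub> (c \<odot>\<^bsub>A\<^esub> a) = a"
    using assms smult_assoc1[of "inv\<^bsub>K\<^esub> c" c a] by (simp add: R.Units_l_inv R.Units_closed)
  then show ?thesis using assms by (simp add: R.Units_closed smult_r_null)
qed

lemma smult_cancel:
  assumes "c \<in> carrier K" "d \<in> carrier K" "a \<in> carrier A" "a \<noteq> \<zero>\<^bsub>A\<^esub>" "c \<odot>\<^bsub>A\<^esub> a = d \<odot>\<^bsub>A\<^esub> a"
  shows "c = d"
proof (rule ccontr)
  assume "c \<noteq> d"
  then have "c \<ominus>\<^bsub>K\<^esub> d \<in> Units K" using assms by (simp add: Units_K R.r_right_minus_eq)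
  moreover have "(c \<ominus>\<^bsub>K\<^esub> d) \<odot>\<^bsub>A\<^esub> a = \<zero>\<^bsub>A\<^esub>"
    using assms by (simp add: R.minus_eq smult_l_distr smult_l_minus M.r_neg)
  ultimately show False using smult_zero_iff assms by blast
qed

end

text \<open>The direct sum decomposition is split into \<open>D_independent\<close> and
  \<open>D_span\<close>. The latter says in the form of an induction rule that every element is
  reached from zero by adding homogeneous ones.\<close>

locale graded_algebra = assoc_algebra K A + G: comm_group \<Gamma>
  for K :: "('k, 'm) ring_scheme" and A :: "('k, 'a, 'n) module_scheme" (structure)
    and \<Gamma> :: "('g, 'l) monoid_scheme" +
  fixes D :: "'g \<Rightarrow> 'a set"
  assumes D_carrier: "s \<in> carrier \<Gamma> \<Longrightarrow> a \<in> D s \<Longrightarrow> a \<in> carrier A"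
    and D_zero: "s \<in> carrier \<Gamma> \<Longrightarrow> \<zero> \<in> D s"
    and D_add: "s \<in> carrier \<Gamma> \<Longrightarrow> a \<in> D s \<Longrightarrow> b \<in> D s \<Longrightarrow> a \<oplus> b \<in> D s"
    and D_smult: "s \<in> carrier \<Gamma> \<Longrightarrow> k \<in> carrier K \<Longrightarrow> a \<in> D s \<Longrightarrow> k \<odot> a \<in> D s"
    and D_one: "\<one> \<in> D \<one>\<^bsub>\<Gamma>\<^esub>"
    and D_mult: "s \<in> carrier \<Gamma> \<Longrightarrow> t \<in> carrier \<Gamma> \<Longrightarrow> a \<in> D s \<Longrightarrow> b \<in> D t \<Longrightarrow>
      a \<otimes> b \<in> D (s \<otimes>\<^bsub>\<Gamma>\<^esub> t)"
    and D_independent: "\<lbrakk>finite F; F \<subseteq> carrier \<Gamma>; \<And>s. s \<in> F \<Longrightarrow> f s \<in> D s;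
      (\<Oplus>s\<in>F. f s) = \<zero>\<rbrakk> \<Longrightarrow> \<forall>s\<in>F. f s = \<zero>"
    and D_span: "\<lbrakk>a \<in> carrier A; Q \<zero>; \<And>p h s. \<lbrakk>p \<in> carrier A; Q p; s \<in> carrier \<Gamma>; h \<in> D s\<rbrakk> \<Longrightarrow>
      Q (p \<oplus> h)\<rbrakk> \<Longrightarrow> Q a"
begin

lemmas D_closed = D_carrier

definition family :: "'a \<Rightarrow> ('g \<Rightarrow> 'a) \<Rightarrow> bool" where
  "family a f \<longleftrightarrow> (\<forall>s\<in>carrier \<Gamma>. f s \<in> D s) \<and> (\<forall>s. s \<notin> carrier \<Gamma> \<longrightarrow> f s = \<zero>) \<and>
     finite {s. f s \<noteq> \<zero>} \<and> a = (\<Oplus>s\<in>{s. f s \<noteq> \<zero>}. f s)"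

abbreviation comp :: "'a \<Rightarrow> 'g \<Rightarrow> 'a" where "comp \<equiv> hom_components \<Gamma> A D"

lemma comp_def: "comp a = (THE f. family a f)"
  unfolding hom_components_def family_def ..

lemma familyD:
  assumes "family a f"
  shows "s \<in> carrier \<Gamma> \<Longrightarrow> f s \<in> D s" "s \<notin> carrier \<Gamma> \<Longrightarrow> f s = \<zero>" "f s \<in> carrier A"
    "finite {s. f s \<noteq> \<zero>}" "{s. f s \<noteq> \<zero>} \<subseteq> carrier \<Gamma>"
proof -
  show 1: "s \<in> carrier \<Gamma> \<Longrightarrow> f s \<in> D s" and 2: "s \<notin> carrier \<Gamma> \<Longrightarrow> f s = \<zero>" for s
    using assms unfolding family_def by auto
  show "f s \<in> carrier A" using 1 2 D_closed by (metis M.zero_closed)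
  show "finite {s. f s \<noteq> \<zero>}" using assms unfolding family_def by auto
  show "{s. f s \<noteq> \<zero>} \<subseteq> carrier \<Gamma>" using 2 by auto
qed

lemma finsum_superset:
  assumes "finite F" "{s. f s \<noteq> \<zero>} \<subseteq> F" "\<And>s. g s \<in> carrier A" "\<And>s. f s = \<zero> \<Longrightarrow> g s = \<zero>"
  shows "(\<Oplus>s\<in>{s. f s \<noteq> \<zero>}. g s) = (\<Oplus>s\<in>F. g s)"
  by (rule M.add.finprod_mono_neutral_cong_left) (use assms in auto)

lemma familyI:
  assumes "finite F" "F \<subseteq> carrier \<Gamma>" "\<And>s. s \<in> F \<Longrightarrow> f s \<in> D s" "\<And>s. s \<notin> F \<Longrightarrow> f s = \<zero>"
    "a = (\<Oplus>s\<in>F. f s)"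
  shows "family a f"
proof -
  have sub: "{s. f s \<noteq> \<zero>} \<subseteq> F" using assms by auto
  have c: "f s \<in> carrier A" for s using assms D_closed by (metis M.zero_closed subsetD)
  have "f s \<in> D s" if "s \<in> carrier \<Gamma>" for s
    using assms(3,4)[of s] D_zero that by (cases "s \<in> F") auto
  moreover have "f s = \<zero>" if "s \<notin> carrier \<Gamma>" for s using assms(2,4) that by blast
  moreover have "a = (\<Oplus>s\<in>{s. f s \<noteq> \<zero>}. f s)"
    using finsum_superset[OF assms(1) sub c] assms(5) by simp
  ultimately show ?thesis unfolding family_def using finite_subset[OF sub assms(1)] by blast
qed

lemma family_superset:
  assumes "family a f" "finite F" "{s. f s \<noteq> \<zero>} \<subseteq> F"
  shows "a = (\<Oplus>s\<in>F. f s)"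
  using finsum_superset[OF assms(2,3) familyD(3)[OF assms(1)]] assms(1) unfolding family_def by auto

lemma family_add:
  assumes f: "family a f" and g: "family b g"
  shows "family (a \<oplus> b) (\<lambda>s. f s \<oplus> g s)"
proof -
  let ?F = "{s. f s \<noteq> \<zero>} \<union> {s. g s \<noteq> \<zero>}"
  have F: "finite ?F" "?F \<subseteq> carrier \<Gamma>" using familyD f g by blast+
  have "a = (\<Oplus>s\<in>?F. f s)" "b = (\<Oplus>s\<in>?F. g s)"
    using family_superset f g F by blast+
  then have "a \<oplus> b = (\<Oplus>s\<in>?F. f s \<oplus> g s)"
    using M.finsum_addf[of f ?F g] familyD(3) f g by simp
  then show ?thesis
    by (intro familyI[OF F]) (use familyD[OF f] familyD[OF g] D_add F in auto)
qed

lemma family_smult: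
  assumes f: "family a f" and k: "k \<in> carrier K"
  shows "family (k \<odot> a) (\<lambda>s. k \<odot> f s)"
proof -
  let ?F = "{s. f s \<noteq> \<zero>}"
  have F: "finite ?F" "?F \<subseteq> carrier \<Gamma>" using familyD f by blast+
  have "a = (\<Oplus>s\<in>?F. f s)" using family_superset f F by blast
  then have "k \<odot> a = (\<Oplus>s\<in>?F. k \<odot> f s)"
    using finsum_smult_ldistr[OF F(1) k, of f] familyD(3)[OF f] by simp
  then show ?thesis
    by (intro familyI[OF F]) (use familyD[OF f] k D_smult F in auto)
qed

lemma family_hom:
  assumes "s \<in> carrier \<Gamma>" "h \<in> D s"
  shows "family h (\<lambda>t. if t = s then h else \<zero>)"
  by (rule familyI[of "{s}"]) (use assms D_closed in auto)

lemma family_zero: "family \<zero> (\<lambda>_. \<zero>)"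
  by (rule familyI[of "{}"]) auto

lemma family_exists: assumes "a \<in> carrier A" shows "\<exists>f. family a f"
proof (rule D_span[OF assms, where Q = "\<lambda>a. \<exists>f. family a f"])
  show "\<exists>f. family \<zero> f" using family_zero exI[of "family \<zero>"] by blast
  show "\<exists>f. family (p \<oplus> h) f" if "\<exists>f. family p f" "s \<in> carrier \<Gamma>" "h \<in> D s" for p h s
    using family_add family_hom that by blast
qed

text \<open>Subtracting two decompositions gives a decomposition of zero. The negative is written as
  a scalar multiple so that \<open>family_smult\<close> covers it.\<close>

lemma family_unique:
  assumes f: "family a f" and g: "family a g"
  shows "f = g"
proof
  fix s
  have a: "a \<in> carrier A" using f familyD(3)[OF f] unfolding family_def by auto
  have m: "\<ominus>\<^bsub>K\<^esub> \<one>\<^bsub>K\<^esub> \<odot> b = \<ominus> b" if "b \<in> carrier A" for b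
    using that by (simp add: smult_l_minus)
  let ?d = "\<lambda>s. f s \<oplus> \<ominus>\<^bsub>K\<^esub> \<one>\<^bsub>K\<^esub> \<odot> g s"
  have d: "family (a \<oplus> \<ominus>\<^bsub>K\<^esub> \<one>\<^bsub>K\<^esub> \<odot> a) ?d"
    by (rule family_add[OF f family_smult[OF g]]) simp
  then have "family \<zero> ?d" using a m M.r_neg by simp
  then have z: "(\<Oplus>s\<in>{s. ?d s \<noteq> \<zero>}. ?d s) = \<zero>" unfolding family_def by auto
  have "?d s = \<zero>"
  proof (rule ccontr)
    assume ne: "?d s \<noteq> \<zero>"
    have "\<forall>s\<in>{s. ?d s \<noteq> \<zero>}. ?d s = \<zero>"
      by (rule D_independent[OF familyD(4)[OF d] familyD(5)[OF d] _ z])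
        (use familyD(1,5)[OF d] in blast)
    then show False using ne by blast
  qed
  then show "f s = g s" using m familyD(3)[OF f] familyD(3)[OF g]
    by (metis M.add.inv_equality M.minus_minus M.add.inv_closed)
qed

lemma comp_family: "a \<in> carrier A \<Longrightarrow> family a (comp a)"
  unfolding comp_def using family_exists family_unique by (metis theI)

lemma comp_eq: "family a f \<Longrightarrow> comp a = f"
  unfolding comp_def using family_unique by blast

definition supp :: "'a \<Rightarrow> 'g set" where "supp a = {s. comp a s \<noteq> \<zero>}"

lemma supp_finite: "a \<in> carrier A \<Longrightarrow> finite (supp a)"
  and supp_subset: "a \<in> carrier A \<Longrightarrow> supp a \<subseteq> carrier \<Gamma>"
  and comp_closed: "a \<in> carrier A \<Longrightarrow> comp a s \<in> carrier A"
  and comp_mem: "a \<in> carrier A \<Longrightarrow> s \<in> carrier \<Gamma> \<Longrightarrow> comp a s \<in> D s"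
  unfolding supp_def
  by (rule familyD(4), erule comp_family) (rule familyD(5), erule comp_family, rule familyD(3),
    erule comp_family, rule familyD(1), erule comp_family)

lemma comp_add: "\<lbrakk>a \<in> carrier A; b \<in> carrier A\<rbrakk> \<Longrightarrow> comp (a \<oplus> b) = (\<lambda>s. comp a s \<oplus> comp b s)"
  by (intro comp_eq family_add comp_family)

lemma comp_hom: "\<lbrakk>s \<in> carrier \<Gamma>; h \<in> D s\<rbrakk> \<Longrightarrow> comp h = (\<lambda>t. if t = s then h else \<zero>)"
  by (intro comp_eq family_hom)

lemma comp_zero: "comp \<zero> = (\<lambda>_. \<zero>)"
  by (intro comp_eq family_zero)

lemma hom_degree_unique:
  assumes "s \<in> carrier \<Gamma>" "t \<in> carrier \<Gamma>" "a \<in> D s" "a \<in> D t" "a \<noteq> \<zero>"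
  shows "s = t"
  using comp_hom[OF assms(1,3)] comp_hom[OF assms(2,4)] assms(5) by metis

text \<open>Glues maps given on the single degrees to a map of the whole algebra. The twisted
  product, in each of its arguments, and the torus action both arise in this way.\<close>

definition gsum :: "('g \<Rightarrow> 'a \<Rightarrow> 'a) \<Rightarrow> 'a \<Rightarrow> 'a" where
  "gsum \<phi> a = (\<Oplus>s\<in>supp a. \<phi> s (comp a s))"

definition additive :: "('a \<Rightarrow> 'a) \<Rightarrow> bool" where
  "additive f \<longleftrightarrow> f \<in> carrier A \<rightarrow> carrier A \<and>
     (\<forall>a\<in>carrier A. \<forall>b\<in>carrier A. f (a \<oplus> b) = f a \<oplus> f b)"

lemma additive_zero: assumes "additive f" shows "f \<zero> = \<zero>"
proof -
  have "f \<zero> \<in> carrier A" "f \<zero> \<oplus> f \<zero> = f \<zero>"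
    using assms unfolding additive_def by (auto, metis M.l_zero M.zero_closed)
  then show ?thesis by simp
qed

lemma gsum_superset:
  assumes "\<And>s. s \<in> carrier \<Gamma> \<Longrightarrow> additive (\<phi> s)" "a \<in> carrier A" "finite F" "supp a \<subseteq> F" "F \<subseteq> carrier \<Gamma>"
  shows "gsum \<phi> a = (\<Oplus>s\<in>F. \<phi> s (comp a s))"
  unfolding gsum_def
  by (rule M.add.finprod_mono_neutral_cong_left)
    (use assms additive_zero comp_closed[OF assms(2)] in \<open>auto simp: supp_def additive_def Pi_iff subset_iff\<close>)

lemma gsum_closed:
  assumes "\<And>s. s \<in> carrier \<Gamma> \<Longrightarrow> additive (\<phi> s)" "a \<in> carrier A"
  shows "gsum \<phi> a \<in> carrier A"
  unfolding gsum_def using assms supp_subset comp_closed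
  by (intro M.finsum_closed) (auto simp: additive_def Pi_iff subset_iff)

lemma gsum_additive:
  assumes \<phi>: "\<And>s. s \<in> carrier \<Gamma> \<Longrightarrow> additive (\<phi> s)"
  shows "additive (gsum \<phi>)"
proof -
  have "gsum \<phi> (a \<oplus> b) = gsum \<phi> a \<oplus> gsum \<phi> b" if a: "a \<in> carrier A" and b: "b \<in> carrier A" for a b
  proof -
    let ?F = "supp a \<union> supp b \<union> supp (a \<oplus> b)"
    have F: "finite ?F" "?F \<subseteq> carrier \<Gamma>" using supp_finite supp_subset a b by auto
    have \<phi>c: "\<phi> s (comp c s) \<in> carrier A" if "s \<in> ?F" "c \<in> carrier A" for s c
      using \<phi>[of s] that F comp_closed unfolding additive_def by blast
    have "gsum \<phi> (a \<oplus> b) = (\<Oplus>s\<in>?F. \<phi> s (comp (a \<oplus> b) s))"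
      by (rule gsum_superset[OF \<phi>]) (use F a b in auto)
    also have "\<dots> = (\<Oplus>s\<in>?F. \<phi> s (comp a s) \<oplus> \<phi> s (comp b s))"
    proof (rule M.finsum_cong')
      fix s assume s: "s \<in> ?F"
      then have "additive (\<phi> s)" using F \<phi> by blast
      then show "\<phi> s (comp (a \<oplus> b) s) = \<phi> s (comp a s) \<oplus> \<phi> s (comp b s)"
        using comp_closed a b unfolding comp_add[OF a b] additive_def by blast
    qed (use \<phi>c a b in auto)
    also have "\<dots> = (\<Oplus>s\<in>?F. \<phi> s (comp a s)) \<oplus> (\<Oplus>s\<in>?F. \<phi> s (comp b s))"
      by (rule M.finsum_addf) (use \<phi>c a b in auto)
    also have "(\<Oplus>s\<in>?F. \<phi> s (comp a s)) = gsum \<phi> a"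
      by (rule gsum_superset[OF \<phi>, symmetric]) (use F a b in auto)
    also have "(\<Oplus>s\<in>?F. \<phi> s (comp b s)) = gsum \<phi> b"
      by (rule gsum_superset[OF \<phi>, symmetric]) (use F a b in auto)
    finally show ?thesis .
  qed
  then show ?thesis using gsum_closed[OF \<phi>] unfolding additive_def by auto
qed

lemma gsum_hom:
  assumes \<phi>: "\<And>s. s \<in> carrier \<Gamma> \<Longrightarrow> additive (\<phi> s)" and s: "s \<in> carrier \<Gamma>" and h: "h \<in> D s"
  shows "gsum \<phi> h = \<phi> s h"
proof -
  have "gsum \<phi> h = (\<Oplus>t\<in>{s}. \<phi> t (comp h t))"
    by (rule gsum_superset[OF \<phi>]) (use s h D_closed comp_hom[OF s h] in \<open>auto simp: supp_def split: if_splits\<close>)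
  also have "\<dots> = \<phi> s h" using comp_hom[OF s h] \<phi>[OF s] D_closed[OF s h] by (auto simp: additive_def Pi_iff)
  finally show ?thesis .
qed

lemma additive_smult: "k \<in> carrier K \<Longrightarrow> additive (\<lambda>a. k \<odot> a)"
  by (simp add: additive_def smult_r_distr)

text \<open>Diagonal maps of the grading. Evaluation at a torus element gives the action of that
  element, and the automorphism of each step of a twist is again of this kind; this is why all steps
  are described through \<open>scale\<close>.\<close>

definition scale :: "('g \<Rightarrow> 'k) \<Rightarrow> 'a \<Rightarrow> 'a" where
  "scale u = gsum (\<lambda>s a. u s \<odot> a)"

lemma scale_additive: "(\<And>s. s \<in> carrier \<Gamma> \<Longrightarrow> u s \<in> carrier K) \<Longrightarrow> additive (scale u)"
  unfolding scale_def by (intro gsum_additive additive_smult)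

lemma scale_hom:
  "\<lbrakk>\<And>s. s \<in> carrier \<Gamma> \<Longrightarrow> u s \<in> carrier K; s \<in> carrier \<Gamma>; h \<in> D s\<rbrakk> \<Longrightarrow> scale u h = u s \<odot> h"
  unfolding scale_def using gsum_hom[of "\<lambda>s a. u s \<odot> a"] additive_smult by blast

definition graded_subset :: "'a set \<Rightarrow> bool" where
  "graded_subset T \<longleftrightarrow> T \<subseteq> carrier A \<and> \<zero> \<in> T \<and> (\<forall>a\<in>T. \<forall>b\<in>T. a \<oplus> b \<in> T) \<and>
     (\<forall>k\<in>carrier K. \<forall>a\<in>T. k \<odot> a \<in> T) \<and>
     (\<forall>a\<in>T. \<forall>s\<in>carrier \<Gamma>. comp a s \<in> T)"

lemma graded_subset_induct [consumes 2, case_names zero add]: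
  assumes T: "graded_subset T" and a: "a \<in> T" and zero: "Q \<zero>"
    and add: "\<And>p h s. \<lbrakk>p \<in> T; Q p; s \<in> carrier \<Gamma>; h \<in> T; h \<in> D s\<rbrakk> \<Longrightarrow> Q (p \<oplus> h)"
  shows "Q a"
proof -
  have Tc: "T \<subseteq> carrier A" and Ta: "p \<in> T \<Longrightarrow> q \<in> T \<Longrightarrow> p \<oplus> q \<in> T" and T0: "\<zero> \<in> T"
    and Tcomp: "s \<in> carrier \<Gamma> \<Longrightarrow> comp a s \<in> T" for p q s
    using T a unfolding graded_subset_def by blast+
  have ac: "a \<in> carrier A" using Tc a by blast
  have "(\<Oplus>s\<in>F. comp a s) \<in> T \<and> Q (\<Oplus>s\<in>F. comp a s)" if "finite F" "F \<subseteq> carrier \<Gamma>" for F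
    using that
  proof (induction F)
    case empty
    then show ?case using T0 zero by simp
  next
    case (insert s F)
    let ?p = "\<Oplus>s\<in>F. comp a s"
    have s: "s \<in> carrier \<Gamma>" and p: "?p \<in> T" "Q ?p" using insert by auto
    have "(\<Oplus>s\<in>insert s F. comp a s) = comp a s \<oplus> ?p"
      using insert(1,2) comp_closed[OF ac] by (intro M.finsum_insert) auto
    also have "\<dots> = ?p \<oplus> comp a s" using comp_closed[OF ac] Tc p(1) by (intro M.a_comm) auto
    finally have eq: "(\<Oplus>s\<in>insert s F. comp a s) = ?p \<oplus> comp a s" .
    show ?case unfolding eq using add[OF p s Tcomp[OF s] comp_mem[OF ac s]] Ta[OF p(1) Tcomp[OF s]] by blast
  qed
  moreover have "a = (\<Oplus>s\<in>supp a. comp a s)"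
    by (rule family_superset[OF comp_family[OF ac] supp_finite[OF ac]]) (simp add: supp_def)
  ultimately show ?thesis using supp_finite[OF ac] supp_subset[OF ac] by metis
qed

lemma graded_subsetD:
  assumes "graded_subset T"
  shows "a \<in> T \<Longrightarrow> a \<in> carrier A" "\<zero> \<in> T" "a \<in> T \<Longrightarrow> b \<in> T \<Longrightarrow> a \<oplus> b \<in> T"
    "k \<in> carrier K \<Longrightarrow> a \<in> T \<Longrightarrow> k \<odot> a \<in> T"
  using assms unfolding graded_subset_def by blast+

lemma graded_carrier: "graded_subset (carrier A)"
  unfolding graded_subset_def using comp_closed by auto

text \<open>Applied once in each variable, this reduces associativity and the scalar laws of a
  twisted product to homogeneous elements, where they are identities between values of the
  cocycle.\<close>

lemma additive_eqI:
  assumes f: "additive f" and g: "additive g" and T: "graded_subset T" and a: "a \<in> T"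
    and eq: "\<And>s h. s \<in> carrier \<Gamma> \<Longrightarrow> h \<in> T \<Longrightarrow> h \<in> D s \<Longrightarrow> f h = g h"
  shows "f a = g a"
  using T a
proof (induction rule: graded_subset_induct)
  case zero
  then show ?case using additive_zero[OF f] additive_zero[OF g] by simp
next
  case (add p h s)
  then show ?case using f g eq[of s h] graded_subsetD(1)[OF T] unfolding additive_def by simp
qed

lemma additive_memI:
  assumes f: "additive f" and T: "graded_subset T" and a: "a \<in> T"
    and U: "\<zero> \<in> U" "\<And>p q. p \<in> U \<Longrightarrow> q \<in> U \<Longrightarrow> p \<oplus> q \<in> U"
    and eq: "\<And>s h. s \<in> carrier \<Gamma> \<Longrightarrow> h \<in> T \<Longrightarrow> h \<in> D s \<Longrightarrow> f h \<in> U"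
  shows "f a \<in> U"
  using T a
proof (induction rule: graded_subset_induct)
  case zero
  then show ?case using additive_zero[OF f] U(1) by simp
next
  case (add p h s)
  have "f (p \<oplus> h) = f p \<oplus> f h"
    using f graded_subsetD(1)[OF T] add unfolding additive_def by blast
  then show ?case using U(2)[OF add(5) eq[OF add(2,3,4)]] by simp
qed

lemma additive_comp: "additive f \<Longrightarrow> additive g \<Longrightarrow> additive (\<lambda>a. f (g a))"
  unfolding additive_def Pi_iff by auto

lemma additive_mult_left: "b \<in> carrier A \<Longrightarrow> additive (\<lambda>a. b \<otimes> a)"
  and additive_mult_right: "b \<in> carrier A \<Longrightarrow> additive (\<lambda>a. a \<otimes> b)"
  unfolding additive_def by (auto simp: l_distr r_distr)

lemma additive_add:
  "additive f \<Longrightarrow> additive g \<Longrightarrow> additive (\<lambda>a. f a \<oplus> g a)"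
  unfolding additive_def Pi_iff by (auto simp: M.add.m_ac)

lemma additive_id: "additive (\<lambda>a. a)"
  unfolding additive_def by simp

lemma scale_mem:
  assumes u: "\<And>s. s \<in> carrier \<Gamma> \<Longrightarrow> u s \<in> carrier K" and T: "graded_subset T" and a: "a \<in> T"
  shows "scale u a \<in> T"
  by (rule additive_memI[OF scale_additive[OF u] T a])
    (use graded_subsetD[OF T] scale_hom[OF u] u in auto)

lemma scale_scale:
  assumes u: "\<And>s. s \<in> carrier \<Gamma> \<Longrightarrow> u s \<in> carrier K" and v: "\<And>s. s \<in> carrier \<Gamma> \<Longrightarrow> v s \<in> carrier K"
    and a: "a \<in> carrier A"
  shows "scale u (scale v a) = scale (\<lambda>s. u s \<otimes>\<^bsub>K\<^esub> v s) a"
proof (rule additive_eqI[OF additive_comp[OF scale_additive[OF u] scale_additive[OF v]]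
      scale_additive graded_carrier a])
  fix s h assume s: "s \<in> carrier \<Gamma>" and h: "h \<in> D s"
  have "scale u (scale v h) = u s \<odot> (v s \<odot> h)"
    using scale_hom[OF v s h] scale_hom[OF u s D_smult[OF s v[OF s] h]] by simp
  also have "\<dots> = scale (\<lambda>s. u s \<otimes>\<^bsub>K\<^esub> v s) h"
    using scale_hom[of "\<lambda>s. u s \<otimes>\<^bsub>K\<^esub> v s" s h] u v s h D_closed smult_assoc1 by simp
  finally show "scale u (scale v h) = scale (\<lambda>s. u s \<otimes>\<^bsub>K\<^esub> v s) h" .
qed (use u v in auto)

lemma scale_one: "a \<in> carrier A \<Longrightarrow> (\<And>s. s \<in> carrier \<Gamma> \<Longrightarrow> u s = \<one>\<^bsub>K\<^esub>) \<Longrightarrow> scale u a = a"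
  by (rule additive_eqI[OF scale_additive additive_id graded_carrier])
    (auto simp: scale_hom D_closed)

lemma scale_inv:
  assumes u: "\<And>s. s \<in> carrier \<Gamma> \<Longrightarrow> u s \<in> Units K" and a: "a \<in> carrier A"
  shows "scale u (scale (\<lambda>s. inv\<^bsub>K\<^esub> u s) a) = a" "scale (\<lambda>s. inv\<^bsub>K\<^esub> u s) (scale u a) = a"
  by (simp_all add: scale_scale u R.Units_closed R.Units_inv_Units R.Units_r_inv R.Units_l_inv a
      scale_one)

end

context graded_algebra
begin

lemma additive_finsum:
  assumes "finite F" "\<And>s. s \<in> F \<Longrightarrow> additive (f s)"
  shows "additive (\<lambda>b. \<Oplus>s\<in>F. f s b)"
  using assms
proof (induction F)
  case empty
  then show ?case by (simp add: additive_def)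
next
  case (insert s F)
  have "(\<Oplus>s\<in>insert s F. f s b) = f s b \<oplus> (\<Oplus>s\<in>F. f s b)" if "b \<in> carrier A" for b
    using insert that by (intro M.finsum_insert) (auto simp: additive_def Pi_iff)
  moreover have "additive (\<lambda>b. f s b \<oplus> (\<Oplus>s\<in>F. f s b))"
    using insert by (intro additive_add) auto
  ultimately show ?case unfolding additive_def by (auto simp: Pi_iff)
qed

lemma units_mult_closed: "a \<in> Units K \<Longrightarrow> b \<in> Units K \<Longrightarrow> a \<otimes>\<^bsub>K\<^esub> b \<in> Units K"
  by (rule R.Units_m_closed)

end

section \<open>The product twisted by a cocycle\<close>

locale twisted_algebra = graded_algebra K A \<Gamma> D
  for K :: "('k, 'm) ring_scheme" and A :: "('k, 'a, 'n) module_scheme" (structure)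
    and \<Gamma> :: "('g, 'l) monoid_scheme" and D +
  fixes c :: "'g \<Rightarrow> 'g \<Rightarrow> 'k"
  assumes cocycle: "c \<in> cocycles \<Gamma> K"
begin

definition B where "B = twist \<Gamma> K A D c"

lemma c_Units: "s \<in> carrier \<Gamma> \<Longrightarrow> t \<in> carrier \<Gamma> \<Longrightarrow> c s t \<in> Units K"
  and c_cocycle: "\<lbrakk>s \<in> carrier \<Gamma>; t \<in> carrier \<Gamma>; u \<in> carrier \<Gamma>\<rbrakk> \<Longrightarrow>
    c s (t \<otimes>\<^bsub>\<Gamma>\<^esub> u) \<otimes>\<^bsub>K\<^esub> c t u = c (s \<otimes>\<^bsub>\<Gamma>\<^esub> t) u \<otimes>\<^bsub>K\<^esub> c s t"
  using cocycle unfolding cocycles_def by auto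

lemma c_carrier: "s \<in> carrier \<Gamma> \<Longrightarrow> t \<in> carrier \<Gamma> \<Longrightarrow> c s t \<in> carrier K"
  using c_Units R.Units_closed by blast

lemma B_simps [simp]:
  "carrier B = carrier A" "add B = add A" "\<zero>\<^bsub>B\<^esub> = \<zero>" "smult B = smult A"
  by (simp_all add: B_def twist_def)

lemma B_one: "\<one>\<^bsub>B\<^esub> = inv\<^bsub>K\<^esub> (c \<one>\<^bsub>\<Gamma>\<^esub> \<one>\<^bsub>\<Gamma>\<^esub>) \<odot> \<one>"
  by (simp add: B_def twist_def)

text \<open>The same double sum read as a \<open>gsum\<close> in the second and in the first
  argument, which gives additivity in each of them.\<close>

lemma B_mult: "a \<otimes>\<^bsub>B\<^esub> b =
    (\<Oplus>s\<in>supp a. gsum (\<lambda>t z. c s t \<odot> (comp a s \<otimes> z)) b)"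
  "a \<otimes>\<^bsub>B\<^esub> b = gsum (\<lambda>s y. \<Oplus>t\<in>supp b. c s t \<odot> (y \<otimes> comp b t)) a"
  by (simp_all add: B_def twist_def Let_def gsum_def supp_def)

lemma add_monoid_B: "add_monoid B = add_monoid A"
  by simp

lemma abelian_group_B: "abelian_group B"
  using M.abelian_group_axioms add_monoid_B
  unfolding abelian_group_def abelian_monoid_def abelian_group_axioms_def by simp

lemma additive_pair_left:
  "\<lbrakk>s \<in> carrier \<Gamma>; t \<in> carrier \<Gamma>; y \<in> carrier A\<rbrakk> \<Longrightarrow> additive (\<lambda>z. c s t \<odot> (y \<otimes> z))"
  by (rule additive_comp[OF additive_smult additive_mult_left]) (auto simp: c_carrier)

lemma additive_pair_right:
  "\<lbrakk>s \<in> carrier \<Gamma>; t \<in> carrier \<Gamma>; y \<in> carrier A\<rbrakk> \<Longrightarrow> additive (\<lambda>z. c s t \<odot> (z \<otimes> y))"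
  by (rule additive_comp[OF additive_smult additive_mult_right]) (auto simp: c_carrier)

lemma B_additive_left: "b \<in> carrier A \<Longrightarrow> additive (\<lambda>a. a \<otimes>\<^bsub>B\<^esub> b)"
  unfolding B_mult(2)
  by (intro gsum_additive additive_finsum supp_finite additive_pair_right)
    (use supp_subset comp_closed in auto)

lemma B_additive_right: "a \<in> carrier A \<Longrightarrow> additive (\<lambda>b. a \<otimes>\<^bsub>B\<^esub> b)"
  unfolding B_mult(1)
  by (intro additive_finsum supp_finite gsum_additive additive_pair_left)
    (use supp_subset comp_closed in auto)

lemma B_closed: "a \<in> carrier A \<Longrightarrow> b \<in> carrier A \<Longrightarrow> a \<otimes>\<^bsub>B\<^esub> b \<in> carrier A"
  using B_additive_left[of b] unfolding additive_def by auto

lemma B_hom: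
  assumes s: "s \<in> carrier \<Gamma>" and t: "t \<in> carrier \<Gamma>" and h: "h \<in> D s" and g: "g \<in> D t"
  shows "h \<otimes>\<^bsub>B\<^esub> g = c s t \<odot> (h \<otimes> g)"
proof -
  have hc: "h \<in> carrier A" and gc: "g \<in> carrier A" using assms D_closed by blast+
  have "h \<otimes>\<^bsub>B\<^esub> g = (\<Oplus>u\<in>supp g. c s u \<odot> (h \<otimes> comp g u))"
    unfolding B_mult(2)
    by (rule gsum_hom[OF _ s h], intro additive_finsum supp_finite gc additive_pair_right)
      (use supp_subset comp_closed gc in auto)
  also have "\<dots> = gsum (\<lambda>u z. c s u \<odot> (h \<otimes> z)) g" by (simp add: gsum_def)
  also have "\<dots> = c s t \<odot> (h \<otimes> g)"
    by (rule gsum_hom[OF _ t g], intro additive_pair_left) (use s hc in auto)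
  finally show ?thesis .
qed

lemma B_smult_left:
  assumes k: "k \<in> carrier K" and a: "a \<in> carrier A" and b: "b \<in> carrier A"
  shows "(k \<odot> a) \<otimes>\<^bsub>B\<^esub> b = k \<odot> (a \<otimes>\<^bsub>B\<^esub> b)"
proof (rule additive_eqI[OF B_additive_right additive_comp[OF additive_smult B_additive_right] graded_carrier b])
  fix t g assume t: "t \<in> carrier \<Gamma>" and g: "g \<in> D t"
  have gc: "g \<in> carrier A" using t g D_closed by blast
  show "(k \<odot> a) \<otimes>\<^bsub>B\<^esub> g = k \<odot> (a \<otimes>\<^bsub>B\<^esub> g)"
  proof (rule additive_eqI[OF additive_comp[OF B_additive_left additive_smult]
        additive_comp[OF additive_smult B_additive_left] graded_carrier a])
    fix s h assume s: "s \<in> carrier \<Gamma>" and h: "h \<in> D s"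
    have hc: "h \<in> carrier A" using s h D_closed by blast
    show "(k \<odot> h) \<otimes>\<^bsub>B\<^esub> g = k \<odot> (h \<otimes>\<^bsub>B\<^esub> g)"
      using B_hom[OF s t D_smult[OF s k h] g] B_hom[OF s t h g] k c_carrier[OF s t] hc gc
      by (simp add: smult_mult_left smult_assoc1[symmetric] R.m_comm)
  qed (use k gc in auto)
qed (use k a in auto)

lemma B_smult_right:
  assumes k: "k \<in> carrier K" and a: "a \<in> carrier A" and b: "b \<in> carrier A"
  shows "a \<otimes>\<^bsub>B\<^esub> (k \<odot> b) = k \<odot> (a \<otimes>\<^bsub>B\<^esub> b)"
proof (rule additive_eqI[OF additive_comp[OF B_additive_right additive_smult]
      additive_comp[OF additive_smult B_additive_right] graded_carrier b])
  fix t g assume t: "t \<in> carrier \<Gamma>" and g: "g \<in> D t"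
  have gc: "g \<in> carrier A" using t g D_closed by blast
  show "a \<otimes>\<^bsub>B\<^esub> (k \<odot> g) = k \<odot> (a \<otimes>\<^bsub>B\<^esub> g)"
  proof (rule additive_eqI[OF B_additive_left
        additive_comp[OF additive_smult B_additive_left] graded_carrier a])
    fix s h assume s: "s \<in> carrier \<Gamma>" and h: "h \<in> D s"
    have hc: "h \<in> carrier A" using s h D_closed by blast
    show "h \<otimes>\<^bsub>B\<^esub> (k \<odot> g) = k \<odot> (h \<otimes>\<^bsub>B\<^esub> g)"
      using B_hom[OF s t h D_smult[OF t k g]] B_hom[OF s t h g] k c_carrier[OF s t] hc gc
      by (simp add: smult_mult_right smult_assoc1[symmetric] R.m_comm)
  qed (use k gc in auto)
qed (use k a in auto)

text \<open>Cancel \<open>c \<one> s\<close> in the cocycle identity at (1, 1, s). Together with the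
  mirror rule below it makes the rescaled unit a two-sided identity of the twist.\<close>

lemma c_one_left: "s \<in> carrier \<Gamma> \<Longrightarrow> c \<one>\<^bsub>\<Gamma>\<^esub> s = c \<one>\<^bsub>\<Gamma>\<^esub> \<one>\<^bsub>\<Gamma>\<^esub>"
  using c_cocycle[of "\<one>\<^bsub>\<Gamma>\<^esub>" "\<one>\<^bsub>\<Gamma>\<^esub>" s] c_Units[of "\<one>\<^bsub>\<Gamma>\<^esub>" s] c_carrier[of "\<one>\<^bsub>\<Gamma>\<^esub>" "\<one>\<^bsub>\<Gamma>\<^esub>"]
  by (simp add: R.Units_closed R.Units_l_cancel)

lemma c_one_right: "s \<in> carrier \<Gamma> \<Longrightarrow> c s \<one>\<^bsub>\<Gamma>\<^esub> = c \<one>\<^bsub>\<Gamma>\<^esub> \<one>\<^bsub>\<Gamma>\<^esub>"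
  using c_cocycle[of s "\<one>\<^bsub>\<Gamma>\<^esub>" "\<one>\<^bsub>\<Gamma>\<^esub>"] c_Units[of s "\<one>\<^bsub>\<Gamma>\<^esub>"] c_carrier[of "\<one>\<^bsub>\<Gamma>\<^esub>" "\<one>\<^bsub>\<Gamma>\<^esub>"]
  by (simp add: R.Units_closed R.Units_l_cancel)

lemma B_one_unit:
  assumes a: "a \<in> carrier A"
  shows "\<one>\<^bsub>B\<^esub> \<otimes>\<^bsub>B\<^esub> a = a" "a \<otimes>\<^bsub>B\<^esub> \<one>\<^bsub>B\<^esub> = a"
proof -
  let ?c = "c \<one>\<^bsub>\<Gamma>\<^esub> \<one>\<^bsub>\<Gamma>\<^esub>"
  have u: "?c \<in> Units K" using c_Units by simp
  then have i: "inv\<^bsub>K\<^esub> ?c \<in> carrier K" "?c \<in> carrier K" by (auto intro: R.Units_closed)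
  have o: "\<one> \<otimes>\<^bsub>B\<^esub> a = ?c \<odot> a"
  proof (rule additive_eqI[OF B_additive_right additive_smult graded_carrier a])
    fix s h assume s: "s \<in> carrier \<Gamma>" and h: "h \<in> D s"
    show "\<one> \<otimes>\<^bsub>B\<^esub> h = ?c \<odot> h"
      using B_hom[OF G.one_closed s D_one h] c_one_left[OF s] D_closed[OF s h] by simp
  qed (use i in simp_all)
  have o': "a \<otimes>\<^bsub>B\<^esub> \<one> = ?c \<odot> a"
  proof (rule additive_eqI[OF B_additive_left additive_smult graded_carrier a])
    fix s h assume s: "s \<in> carrier \<Gamma>" and h: "h \<in> D s"
    show "h \<otimes>\<^bsub>B\<^esub> \<one> = ?c \<odot> h"
      using B_hom[OF s G.one_closed h D_one] c_one_right[OF s] D_closed[OF s h] by simp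
  qed (use i in simp_all)
  show "\<one>\<^bsub>B\<^esub> \<otimes>\<^bsub>B\<^esub> a = a" unfolding B_one
    using B_smult_left[OF i(1) _ a] o i u a by (simp add: smult_assoc1[symmetric] R.Units_l_inv)
  show "a \<otimes>\<^bsub>B\<^esub> \<one>\<^bsub>B\<^esub> = a" unfolding B_one
    using B_smult_right[OF i(1) a] o' i u a by (simp add: smult_assoc1[symmetric] R.Units_l_inv)
qed

lemma B_assoc:
  assumes a: "a \<in> carrier A" and b: "b \<in> carrier A" and d: "d \<in> carrier A"
  shows "(a \<otimes>\<^bsub>B\<^esub> b) \<otimes>\<^bsub>B\<^esub> d = a \<otimes>\<^bsub>B\<^esub> (b \<otimes>\<^bsub>B\<^esub> d)"
proof (rule additive_eqI[OF B_additive_right additive_comp[OF B_additive_right B_additive_right] graded_carrier d])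
  fix u f assume u: "u \<in> carrier \<Gamma>" and f: "f \<in> D u"
  have fc: "f \<in> carrier A" using u f D_closed by blast
  show "(a \<otimes>\<^bsub>B\<^esub> b) \<otimes>\<^bsub>B\<^esub> f = a \<otimes>\<^bsub>B\<^esub> (b \<otimes>\<^bsub>B\<^esub> f)"
  proof (rule additive_eqI[OF additive_comp[OF B_additive_left B_additive_right]
        additive_comp[OF B_additive_right B_additive_left] graded_carrier b])
    fix t g assume t: "t \<in> carrier \<Gamma>" and g: "g \<in> D t"
    have gc: "g \<in> carrier A" using t g D_closed by blast
    show "(a \<otimes>\<^bsub>B\<^esub> g) \<otimes>\<^bsub>B\<^esub> f = a \<otimes>\<^bsub>B\<^esub> (g \<otimes>\<^bsub>B\<^esub> f)"
    proof (rule additive_eqI[OF additive_comp[OF B_additive_left B_additive_left]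
          B_additive_left graded_carrier a])
      fix s h assume s: "s \<in> carrier \<Gamma>" and h: "h \<in> D s"
      have hc: "h \<in> carrier A" using s h D_closed by blast
      have st: "s \<otimes>\<^bsub>\<Gamma>\<^esub> t \<in> carrier \<Gamma>" and tu: "t \<otimes>\<^bsub>\<Gamma>\<^esub> u \<in> carrier \<Gamma>" using s t u by auto
      have hg: "h \<otimes> g \<in> D (s \<otimes>\<^bsub>\<Gamma>\<^esub> t)" and gf: "g \<otimes> f \<in> D (t \<otimes>\<^bsub>\<Gamma>\<^esub> u)"
        using D_mult s t u h g f by blast+
      note cs = c_carrier[OF s t] c_carrier[OF st u] c_carrier[OF t u] c_carrier[OF s tu]
      have "(h \<otimes>\<^bsub>B\<^esub> g) \<otimes>\<^bsub>B\<^esub> f = (c (s \<otimes>\<^bsub>\<Gamma>\<^esub> t) u \<otimes>\<^bsub>K\<^esub> c s t) \<odot> (h \<otimes> g \<otimes> f)"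
        using B_hom[OF s t h g] B_smult_left[OF cs(1) _ fc] B_hom[OF st u hg f] cs hc gc fc
        by (simp add: smult_assoc1[symmetric] R.m_comm)
      also have "\<dots> = (c s (t \<otimes>\<^bsub>\<Gamma>\<^esub> u) \<otimes>\<^bsub>K\<^esub> c t u) \<odot> (h \<otimes> (g \<otimes> f))"
        using c_cocycle[OF s t u] hc gc fc by (simp add: m_assoc)
      also have "\<dots> = h \<otimes>\<^bsub>B\<^esub> (g \<otimes>\<^bsub>B\<^esub> f)"
        using B_hom[OF t u g f] B_smult_right[OF cs(3) hc] B_hom[OF s tu h gf] cs hc gc fc
        by (simp add: smult_assoc1[symmetric] R.m_comm)
      finally show "(h \<otimes>\<^bsub>B\<^esub> g) \<otimes>\<^bsub>B\<^esub> f = h \<otimes>\<^bsub>B\<^esub> (g \<otimes>\<^bsub>B\<^esub> f)" .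
    qed (use a fc gc B_closed in auto)
  qed (use a fc B_closed in auto)
qed (use a b B_closed in auto)

lemma ring_B: "ring B"
proof (intro ringI abelian_group_B monoidI)
  fix a b d assume "a \<in> carrier B" "b \<in> carrier B" "d \<in> carrier B"
  then show "(a \<oplus>\<^bsub>B\<^esub> b) \<otimes>\<^bsub>B\<^esub> d = a \<otimes>\<^bsub>B\<^esub> d \<oplus>\<^bsub>B\<^esub> b \<otimes>\<^bsub>B\<^esub> d"
    "d \<otimes>\<^bsub>B\<^esub> (a \<oplus>\<^bsub>B\<^esub> b) = d \<otimes>\<^bsub>B\<^esub> a \<oplus>\<^bsub>B\<^esub> d \<otimes>\<^bsub>B\<^esub> b"
    using B_additive_left[of d] B_additive_right[of d] unfolding additive_def by auto
qed (auto simp: B_closed B_assoc B_one_unit, simp add: B_one c_Units)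

sublocale BR: ring B by (rule ring_B)

lemma B_minus: "a \<in> carrier A \<Longrightarrow> \<ominus>\<^bsub>B\<^esub> a = \<ominus> a"
  by (rule BR.minus_equality) (auto simp: M.l_neg)

text \<open>Homogeneous products change only by scalars, so graded subrings that are subspaces
  remain subrings.\<close>

lemma subring_B:
  assumes T: "graded_subset T" and sub: "subring T A"
  shows "subring T B"
proof (rule BR.subringI)
  note TD = graded_subsetD[OF T] and S = subringD[OF sub]
  show "T \<subseteq> carrier B" using TD by auto
  show "\<one>\<^bsub>B\<^esub> \<in> T" using B_one c_Units TD(4) S(3) by simp
  show "\<ominus>\<^bsub>B\<^esub> a \<in> T" if "a \<in> T" for a using that B_minus S TD by simp
  show "a \<oplus>\<^bsub>B\<^esub> b \<in> T" if "a \<in> T" "b \<in> T" for a b using that TD by simp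
  show "a \<otimes>\<^bsub>B\<^esub> b \<in> T" if a: "a \<in> T" and b: "b \<in> T" for a b
  proof (rule additive_memI[OF B_additive_right T b])
    fix t g assume t: "t \<in> carrier \<Gamma>" and g: "g \<in> T" "g \<in> D t"
    show "a \<otimes>\<^bsub>B\<^esub> g \<in> T"
      by (rule additive_memI[OF B_additive_left T a])
        (use t g TD S B_hom c_carrier in auto)
  qed (use a TD in auto)
qed

lemma D_pow: "\<chi> \<in> carrier \<Gamma> \<Longrightarrow> x \<in> D \<chi> \<Longrightarrow> x [^] (n::nat) \<in> D (\<chi> [^]\<^bsub>\<Gamma>\<^esub> n)"
  by (induction n) (auto simp: D_one D_mult)

lemma B_pow:
  assumes \<chi>: "\<chi> \<in> carrier \<Gamma>" and x: "x \<in> D \<chi>"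
  shows "\<exists>k\<in>Units K. x [^]\<^bsub>B\<^esub> (n::nat) = k \<odot> x [^] n"
proof (induction n)
  case 0
  then show ?case using B_one c_Units by (auto intro!: bexI[of _ "inv\<^bsub>K\<^esub> c \<one>\<^bsub>\<Gamma>\<^esub> \<one>\<^bsub>\<Gamma>\<^esub>"])
next
  case (Suc n)
  then obtain k where k: "k \<in> Units K" "x [^]\<^bsub>B\<^esub> n = k \<odot> x [^] n" by blast
  have xc: "x \<in> carrier A" using x \<chi> D_closed by blast
  have \<chi>n: "\<chi> [^]\<^bsub>\<Gamma>\<^esub> n \<in> carrier \<Gamma>" using \<chi> by simp
  have "x [^]\<^bsub>B\<^esub> Suc n = k \<odot> (x [^] n \<otimes>\<^bsub>B\<^esub> x)"
    using k xc B_smult_left[OF R.Units_closed[OF k(1)] _ xc] by simp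
  also have "x [^] n \<otimes>\<^bsub>B\<^esub> x = c (\<chi> [^]\<^bsub>\<Gamma>\<^esub> n) \<chi> \<odot> x [^] Suc n"
    using B_hom[OF \<chi>n \<chi> D_pow[OF \<chi> x] x] by simp
  also have "k \<odot> (c (\<chi> [^]\<^bsub>\<Gamma>\<^esub> n) \<chi> \<odot> x [^] Suc n) =
      (k \<otimes>\<^bsub>K\<^esub> c (\<chi> [^]\<^bsub>\<Gamma>\<^esub> n) \<chi>) \<odot> x [^] Suc n"
    using k xc c_carrier[OF \<chi>n \<chi>] by (simp add: smult_assoc1 R.Units_closed)
  finally show ?case using k c_Units[OF \<chi>n \<chi>] units_mult_closed by blast
qed

text \<open>Right multiplication by a power of a homogeneous element differs between the two rings
  by an invertible diagonal map only. Left polynomials over a graded \<open>T\<close> can therefore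
  be rewritten from one ring to the other.\<close>

lemma B_mult_pow:
  assumes \<chi>: "\<chi> \<in> carrier \<Gamma>" and x: "x \<in> D \<chi>"
  obtains v where "\<And>s. s \<in> carrier \<Gamma> \<Longrightarrow> v s \<in> Units K"
    "\<And>a. a \<in> carrier A \<Longrightarrow> a \<otimes>\<^bsub>B\<^esub> x [^]\<^bsub>B\<^esub> (n::nat) = scale v a \<otimes> x [^] n"
proof -
  obtain k where k: "k \<in> Units K" "x [^]\<^bsub>B\<^esub> n = k \<odot> x [^] n"
    using B_pow[OF \<chi> x] by blast
  have kc: "k \<in> carrier K" using k by (rule_tac R.Units_closed)
  have xc: "x [^] n \<in> carrier A" using x \<chi> D_closed by blast
  have \<chi>n: "\<chi> [^]\<^bsub>\<Gamma>\<^esub> n \<in> carrier \<Gamma>" using \<chi> by simp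
  define v where "v s = k \<otimes>\<^bsub>K\<^esub> c s (\<chi> [^]\<^bsub>\<Gamma>\<^esub> n)" for s
  have v: "v s \<in> Units K" if "s \<in> carrier \<Gamma>" for s
    unfolding v_def using k c_Units[OF that \<chi>n] units_mult_closed by blast
  then have vc: "v s \<in> carrier K" if "s \<in> carrier \<Gamma>" for s using that R.Units_closed by blast
  have "a \<otimes>\<^bsub>B\<^esub> x [^]\<^bsub>B\<^esub> n = scale v a \<otimes> x [^] n" if a: "a \<in> carrier A" for a
  proof (rule additive_eqI[OF B_additive_left additive_comp[OF additive_mult_right scale_additive] graded_carrier a])
    fix s h assume s: "s \<in> carrier \<Gamma>" and h: "h \<in> D s"
    have hc: "h \<in> carrier A" using s h D_closed by blast
    have "h \<otimes>\<^bsub>B\<^esub> x [^]\<^bsub>B\<^esub> n = k \<odot> (c s (\<chi> [^]\<^bsub>\<Gamma>\<^esub> n) \<odot> (h \<otimes> x [^] n))"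
      using k(2) B_smult_right[OF kc hc xc] B_hom[OF s \<chi>n h D_pow[OF \<chi> x]] by simp
    also have "\<dots> = scale v h \<otimes> x [^] n"
      using scale_hom[of v s h, OF vc s h] kc c_carrier[OF s \<chi>n] hc xc
      by (simp add: v_def smult_assoc1 smult_mult_left)
    finally show "h \<otimes>\<^bsub>B\<^esub> x [^]\<^bsub>B\<^esub> n = scale v h \<otimes> x [^] n" .
  qed (use k kc xc vc in auto)
  then show ?thesis using that v by blast
qed

text \<open>If \<open>x\<close> of degree \<open>\<chi>\<close> moves past elements of degree
  \<open>s\<close> with the scalar \<open>w s\<close> in \<open>A\<close>, then it does so with this
  scalar in the twist.\<close>

definition twist_scalar :: "'g \<Rightarrow> ('g \<Rightarrow> 'k) \<Rightarrow> 'g \<Rightarrow> 'k" where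
  "twist_scalar \<chi> w s = c \<chi> s \<otimes>\<^bsub>K\<^esub> inv\<^bsub>K\<^esub> (c s \<chi>) \<otimes>\<^bsub>K\<^esub> w s"

lemma twist_scalar_Units:
  "\<lbrakk>\<chi> \<in> carrier \<Gamma>; s \<in> carrier \<Gamma>; w s \<in> Units K\<rbrakk> \<Longrightarrow> twist_scalar \<chi> w s \<in> Units K"
  unfolding twist_scalar_def by (intro units_mult_closed c_Units R.Units_inv_Units)

context
  fixes T x \<chi> w
  assumes T: "graded_subset T" and \<chi>: "\<chi> \<in> carrier \<Gamma>" and x: "x \<in> D \<chi>"
    and w: "\<And>s. s \<in> carrier \<Gamma> \<Longrightarrow> w s \<in> Units K"
    and step: "skew_step A T x (scale w)"
begin

interpretation S: skew_step A T x "scale w" by (rule step)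

text \<open>The diagonal factor from \<open>B_mult_pow\<close> is invertible and maps the graded
  \<open>T\<close> onto itself, so the top terms range over the same set in both rings.\<close>

lemma skew_filtration_B: "skew_filtration B T x n = skew_filtration A T x n"
proof (induction n)
  case (Suc n)
  obtain v where v: "\<And>s. s \<in> carrier \<Gamma> \<Longrightarrow> v s \<in> Units K"
    "\<And>a. a \<in> carrier A \<Longrightarrow> a \<otimes>\<^bsub>B\<^esub> x [^]\<^bsub>B\<^esub> n = scale v a \<otimes> x [^] n"
    using B_mult_pow[OF \<chi> x] by blast
  have vc: "v s \<in> carrier K" "inv\<^bsub>K\<^esub> v s \<in> carrier K" if "s \<in> carrier \<Gamma>" for s
    using v(1)[OF that] by (auto simp: R.Units_closed)
  have m: "scale v a \<in> T" "scale (\<lambda>s. inv\<^bsub>K\<^esub> v s) a \<in> T" if "a \<in> T" for a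
    using scale_mem[OF _ T that] vc by auto
  have e: "a \<otimes> x [^] n = scale (\<lambda>s. inv\<^bsub>K\<^esub> v s) a \<otimes>\<^bsub>B\<^esub> x [^]\<^bsub>B\<^esub> n" if "a \<in> T" for a
    using v(2)[OF S.Ts(7)[OF m(2)[OF that]]] scale_inv(1)[of v, OF v(1) S.Ts(7)[OF that]] by simp
  show ?case unfolding skew_filtration.simps(2) Suc.IH B_simps
    using m e v(2) S.Ts(7) by (metis (no_types, lifting))
qed simp

text \<open>In degree \<open>s\<close> the automorphism is rescaled by c(\<chi>, s) / c(s, \<chi>)
  and the remainder by c(\<chi>, s). Freeness carries over because the two filtrations
  coincide.\<close>

lemma skew_step_B: "skew_step B T x (scale (twist_scalar \<chi> w))"
proof -
  let ?u = "twist_scalar \<chi> w"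
  have u: "?u s \<in> Units K" if "s \<in> carrier \<Gamma>" for s using twist_scalar_Units w \<chi> that by blast
  then have uc: "?u s \<in> carrier K" "inv\<^bsub>K\<^esub> ?u s \<in> carrier K" if "s \<in> carrier \<Gamma>" for s
    using that by (auto simp: R.Units_closed)
  have wc: "w s \<in> carrier K" if "s \<in> carrier \<Gamma>" for s using w that R.Units_closed by blast
  have xc: "x \<in> carrier A" by (rule S.x_carrier)
  have su: "additive (scale ?u)" by (rule scale_additive[OF uc(1)])
  show ?thesis
  proof (intro skew_step.intro skew_filtered.intro skew_filtered_axioms.intro skew_step_axioms.intro ring_B subring_B T S.T)
    show "x \<in> carrier B" using xc by simp
    show "scale ?u a \<in> T" if "a \<in> T" for a using scale_mem[OF uc(1) T that] .
    show "a = \<zero>\<^bsub>B\<^esub>" if "a \<in> T" "scale ?u a = \<zero>\<^bsub>B\<^esub>" for a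
      using scale_inv(2)[of ?u a, OF u S.Ts(7)[OF that(1)]] that(2)
        additive_zero[OF scale_additive[of "\<lambda>s. inv\<^bsub>K\<^esub> ?u s", OF uc(2)]] by simp
    show "\<exists>b\<in>T. scale ?u b = a" if "a \<in> T" for a
      using scale_inv(1)[of ?u a, OF u S.Ts(7)[OF that]] scale_mem[of "\<lambda>s. inv\<^bsub>K\<^esub> ?u s", OF uc(2) T that] by blast
    show "\<exists>d\<in>T. x \<otimes>\<^bsub>B\<^esub> a = scale ?u a \<otimes>\<^bsub>B\<^esub> x \<oplus>\<^bsub>B\<^esub> d" if "a \<in> T" for a
      using T that
    proof (induction rule: graded_subset_induct)
      case zero
      then show ?case
        using additive_zero[OF su] additive_zero[OF B_additive_left[OF xc]]
          additive_zero[OF B_additive_right[OF xc]] S.Ts(2) by (auto intro!: bexI[of _ "\<zero>"])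
    next
      case (add p h s)
      note s = \<open>s \<in> carrier \<Gamma>\<close> and h = \<open>h \<in> T\<close> \<open>h \<in> D s\<close>
      obtain d where d: "d \<in> T" "x \<otimes>\<^bsub>B\<^esub> p = scale ?u p \<otimes>\<^bsub>B\<^esub> x \<oplus>\<^bsub>B\<^esub> d" using add by blast
      obtain d' where d': "d' \<in> T" "x \<otimes> h = w s \<odot> h \<otimes> x \<oplus> d'"
        using S.s_comm[OF h(1)] scale_hom[OF wc s h(2)] by auto
      have hc: "h \<in> carrier A" "p \<in> carrier A" "d \<in> carrier A" "d' \<in> carrier A" "scale ?u p \<in> carrier A"
        using h \<open>p \<in> T\<close> d d' S.Ts(7) su unfolding additive_def by auto
      have cs: "c \<chi> s \<in> carrier K" "c s \<chi> \<in> Units K" "c s \<chi> \<in> carrier K" "inv\<^bsub>K\<^esub> c s \<chi> \<in> carrier K"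
        using c_carrier c_Units s \<chi> by auto
      have us: "?u s \<otimes>\<^bsub>K\<^esub> c s \<chi> = c \<chi> s \<otimes>\<^bsub>K\<^esub> w s" unfolding twist_scalar_def
        using cs wc[OF s] by (simp add: R.m_ac R.Units_l_inv)
      have "x \<otimes>\<^bsub>B\<^esub> h = c \<chi> s \<odot> (w s \<odot> h \<otimes> x) \<oplus> c \<chi> s \<odot> d'"
        using B_hom[OF \<chi> s x h(2)] d' cs wc[OF s] hc xc by (simp add: smult_r_distr)
      also have "c \<chi> s \<odot> (w s \<odot> h \<otimes> x) = (?u s \<otimes>\<^bsub>K\<^esub> c s \<chi>) \<odot> (h \<otimes> x)"
        using us cs wc[OF s] hc xc by (simp add: smult_assoc1 smult_mult_left)
      also have "\<dots> = scale ?u h \<otimes>\<^bsub>B\<^esub> x"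
        using scale_hom[of ?u, OF uc(1) s h(2)] B_smult_left[OF uc(1)[OF s] hc(1) xc]
          B_hom[OF s \<chi> h(2) x] uc(1)[OF s] cs hc xc by (simp add: smult_assoc1)
      finally have xh: "x \<otimes>\<^bsub>B\<^esub> h = scale ?u h \<otimes>\<^bsub>B\<^esub> x \<oplus> c \<chi> s \<odot> d'" .
      have sh: "scale ?u h \<in> carrier A" using su hc unfolding additive_def by auto
      have "x \<otimes>\<^bsub>B\<^esub> (p \<oplus> h) = x \<otimes>\<^bsub>B\<^esub> p \<oplus> x \<otimes>\<^bsub>B\<^esub> h"
        using B_additive_right[OF xc] hc unfolding additive_def by auto
      also have "\<dots> = (scale ?u p \<otimes>\<^bsub>B\<^esub> x \<oplus> scale ?u h \<otimes>\<^bsub>B\<^esub> x) \<oplus> (d \<oplus> c \<chi> s \<odot> d')"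
        unfolding xh d(2) using hc sh xc cs B_closed by (simp add: M.add.m_ac)
      also have "scale ?u p \<otimes>\<^bsub>B\<^esub> x \<oplus> scale ?u h \<otimes>\<^bsub>B\<^esub> x = scale ?u (p \<oplus> h) \<otimes>\<^bsub>B\<^esub> x"
        using additive_comp[OF B_additive_left[OF xc] su] hc unfolding additive_def by auto
      finally have "x \<otimes>\<^bsub>B\<^esub> (p \<oplus> h) = scale ?u (p \<oplus> h) \<otimes>\<^bsub>B\<^esub> x \<oplus> (d \<oplus> c \<chi> s \<odot> d')" .
      moreover have "d \<oplus> c \<chi> s \<odot> d' \<in> T" using graded_subsetD(3,4)[OF T] d d' cs by blast
      ultimately show ?case by auto
    qed
    show "a = \<zero>\<^bsub>B\<^esub>" if a: "a \<in> T" "a \<otimes>\<^bsub>B\<^esub> x [^]\<^bsub>B\<^esub> n \<in> skew_filtration B T x n" for a n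
    proof -
      obtain v where v: "\<And>s. s \<in> carrier \<Gamma> \<Longrightarrow> v s \<in> Units K"
        "\<And>a. a \<in> carrier A \<Longrightarrow> a \<otimes>\<^bsub>B\<^esub> x [^]\<^bsub>B\<^esub> n = scale v a \<otimes> x [^] n"
        using B_mult_pow[OF \<chi> x] by blast
      have vc: "v s \<in> carrier K" "inv\<^bsub>K\<^esub> v s \<in> carrier K" if "s \<in> carrier \<Gamma>" for s
        using v(1)[OF that] by (auto simp: R.Units_closed)
      have ac: "a \<in> carrier A" using S.Ts(7) a by blast
      have "scale v a \<otimes> x [^] n \<in> skew_filtration A T x n"
        using a(2) unfolding v(2)[OF ac] skew_filtration_B .
      then have "scale v a = \<zero>" using S.free[OF scale_mem[of v, OF vc(1) T a(1)]] by blast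
      then show ?thesis
        using scale_inv(2)[of v a, OF v(1) ac] additive_zero[OF scale_additive[of "\<lambda>s. inv\<^bsub>K\<^esub> v s", OF vc(2)]] by simp
    qed
  qed
qed

lemma ext_B: "skew_step.ext B T x = skew_step.ext A T x"
  unfolding skew_step.ext_def[OF skew_step_B] S.ext_def using skew_filtration_B by simp

end

end

section \<open>Rational characters of a split torus\<close>

text \<open>The span of the homogeneous components in inductive form. Once it is known to be a
  subalgebra containing the variables, its induction rule delivers \<open>D_span\<close>.\<close>

inductive_set homogeneous_sums ::
  "('a, 'n) ring_scheme \<Rightarrow> ('g, 'l) monoid_scheme \<Rightarrow> ('g \<Rightarrow> 'a set) \<Rightarrow> 'a set"
  for A :: "('a, 'n) ring_scheme" and \<Gamma> :: "('g, 'l) monoid_scheme" and D where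
  zero: "\<zero>\<^bsub>A\<^esub> \<in> homogeneous_sums A \<Gamma> D"
| add: "\<lbrakk>p \<in> homogeneous_sums A \<Gamma> D; s \<in> carrier \<Gamma>; h \<in> D s\<rbrakk> \<Longrightarrow> p \<oplus>\<^bsub>A\<^esub> h \<in> homogeneous_sums A \<Gamma> D"

context assoc_algebra
begin

lemma subalgebraD:
  assumes "subalgebra_of K A S"
  shows "subring S A" "c \<in> carrier K \<Longrightarrow> a \<in> S \<Longrightarrow> c \<odot>\<^bsub>A\<^esub> a \<in> S"
  using assms unfolding subalgebra_of_def by auto

lemma subalgebraI:
  assumes "S \<subseteq> carrier A" "\<one>\<^bsub>A\<^esub> \<in> S" "\<And>a b. a \<in> S \<Longrightarrow> b \<in> S \<Longrightarrow> a \<oplus>\<^bsub>A\<^esub> b \<in> S"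
    "\<And>a b. a \<in> S \<Longrightarrow> b \<in> S \<Longrightarrow> a \<otimes>\<^bsub>A\<^esub> b \<in> S" "\<And>c a. c \<in> carrier K \<Longrightarrow> a \<in> S \<Longrightarrow> c \<odot>\<^bsub>A\<^esub> a \<in> S"
  shows "subalgebra_of K A S"
  unfolding subalgebra_of_def
proof (intro conjI subringI ballI)
  show "\<ominus>\<^bsub>A\<^esub> a \<in> S" if "a \<in> S" for a
    using assms(5)[of "\<ominus>\<^bsub>K\<^esub> \<one>\<^bsub>K\<^esub>" a] assms(1) that by (auto simp: smult_l_minus)
qed (use assms in auto)

lemma subalgebra_carrier: "subalgebra_of K A (carrier A)"
  by (rule subalgebraI) auto

lemma algebra_generated_least:
  "subalgebra_of K A S \<Longrightarrow> Y \<subseteq> S \<Longrightarrow> algebra_generated K A Y \<subseteq> S"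
  unfolding algebra_generated_def by blast

lemma algebra_generated_subset: "Y \<subseteq> algebra_generated K A Y"
  unfolding algebra_generated_def by blast

lemma algebra_generated_mono: "Y \<subseteq> Z \<Longrightarrow> algebra_generated K A Y \<subseteq> algebra_generated K A Z"
  unfolding algebra_generated_def by blast

lemma algebra_generated_subalgebra:
  assumes "Y \<subseteq> carrier A"
  shows "subalgebra_of K A (algebra_generated K A Y)"
proof -
  have mem: "a \<in> algebra_generated K A Y \<longleftrightarrow> (\<forall>S. subalgebra_of K A S \<longrightarrow> Y \<subseteq> S \<longrightarrow> a \<in> S)" for a
    unfolding algebra_generated_def by blast
  note S = subringD[OF subalgebraD(1)]
  show ?thesis
  proof (rule subalgebraI)
    show "algebra_generated K A Y \<subseteq> carrier A"
      using algebra_generated_least[OF subalgebra_carrier assms] .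
  qed (use S subalgebraD(2) in \<open>simp_all add: mem\<close>)
qed

lemma algebra_generated_empty: "algebra_generated K A {} = (\<lambda>k. k \<odot>\<^bsub>A\<^esub> \<one>\<^bsub>A\<^esub>) ` carrier K"
proof
  have "subalgebra_of K A ((\<lambda>k. k \<odot>\<^bsub>A\<^esub> \<one>\<^bsub>A\<^esub>) ` carrier K)"
  proof (rule subalgebraI)
    show "\<one>\<^bsub>A\<^esub> \<in> (\<lambda>k. k \<odot>\<^bsub>A\<^esub> \<one>\<^bsub>A\<^esub>) ` carrier K"
      by (rule image_eqI[of _ _ "\<one>\<^bsub>K\<^esub>"]) simp_all
  qed (auto simp: smult_l_distr[symmetric] smult_assoc1[symmetric] smult_mult_left smult_mult_right image_iff
      intro!: bexI)
  then show "algebra_generated K A {} \<subseteq> (\<lambda>k. k \<odot>\<^bsub>A\<^esub> \<one>\<^bsub>A\<^esub>) ` carrier K"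
    by (rule algebra_generated_least) simp
  show "(\<lambda>k. k \<odot>\<^bsub>A\<^esub> \<one>\<^bsub>A\<^esub>) ` carrier K \<subseteq> algebra_generated K A {}"
    using subalgebraD(2)[OF algebra_generated_subalgebra[of "{}"]]
      subringD(3)[OF subalgebraD(1)[OF algebra_generated_subalgebra[of "{}"]]] by auto
qed

lemma linear_onD:
  assumes "linear_on K A S f"
  shows "a \<in> S \<Longrightarrow> f a \<in> S" "a \<in> S \<Longrightarrow> b \<in> S \<Longrightarrow> f (a \<oplus>\<^bsub>A\<^esub> b) = f a \<oplus>\<^bsub>A\<^esub> f b"
    "c \<in> carrier K \<Longrightarrow> a \<in> S \<Longrightarrow> f (c \<odot>\<^bsub>A\<^esub> a) = c \<odot>\<^bsub>A\<^esub> f a"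
  using assms unfolding linear_on_def by auto

lemma linear_finsum:
  assumes f: "linear_on K A (carrier A) f" and "finite I" "v \<in> I \<rightarrow> carrier A"
  shows "f (\<Oplus>\<^bsub>A\<^esub>i\<in>I. v i) = (\<Oplus>\<^bsub>A\<^esub>i\<in>I. f (v i))"
  using assms(2,3)
proof (induction I)
  case empty
  have "f \<zero>\<^bsub>A\<^esub> = \<zero>\<^bsub>K\<^esub> \<odot>\<^bsub>A\<^esub> f \<zero>\<^bsub>A\<^esub>" using linear_onD(3)[OF f, of "\<zero>\<^bsub>K\<^esub>" "\<zero>\<^bsub>A\<^esub>"] by simp
  then show ?case using linear_onD(1)[OF f] by simp
next
  case (insert i I)
  have v: "v \<in> I \<rightarrow> carrier A" "v i \<in> carrier A" using insert by auto
  have fv: "(\<lambda>i. f (v i)) \<in> I \<rightarrow> carrier A" "f (v i) \<in> carrier A" using v linear_onD(1)[OF f] by auto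
  show ?case using insert(1,2) insert.IH[OF v(1)] v fv linear_onD(2)[OF f v(2)] by simp
qed

lemma smult_finsum_left:
  assumes "finite I" "k \<in> I \<rightarrow> carrier K" "a \<in> carrier A"
  shows "(\<Oplus>\<^bsub>K\<^esub>i\<in>I. k i) \<odot>\<^bsub>A\<^esub> a = (\<Oplus>\<^bsub>A\<^esub>i\<in>I. k i \<odot>\<^bsub>A\<^esub> a)"
  using assms(1,2)
proof (induction I)
  case (insert i I)
  then have "k \<in> I \<rightarrow> carrier K" "k i \<in> carrier K" by auto
  then show ?case using insert assms(3) by (simp add: smult_l_distr Pi_def)
qed (use assms(3) in simp)

end

lemma (in comm_monoid) finprod_swap:
  assumes "finite I" "finite J" "\<And>i j. i \<in> I \<Longrightarrow> j \<in> J \<Longrightarrow> f i j \<in> carrier G"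
  shows "(\<Otimes>i\<in>I. \<Otimes>j\<in>J. f i j) = (\<Otimes>j\<in>J. \<Otimes>i\<in>I. f i j)"
  using assms(1,3)
proof (induction I)
  case (insert i I)
  have "(\<Otimes>i\<in>insert i I. \<Otimes>j\<in>J. f i j) = (\<Otimes>j\<in>J. f i j) \<otimes> (\<Otimes>j\<in>J. \<Otimes>i\<in>I. f i j)"
    using insert by simp
  also have "\<dots> = (\<Otimes>j\<in>J. f i j \<otimes> (\<Otimes>i\<in>I. f i j))"
    using insert by (intro finprod_multf[symmetric]) auto
  also have "\<dots> = (\<Otimes>j\<in>J. \<Otimes>i\<in>insert i I. f i j)"
    using insert by (intro finprod_cong') auto
  finally show ?case .
qed simp

section \<open>Regular functions on the torus and the group of rational characters\<close>

locale split_torus = KF: field K for K :: "('k, 'm) ring_scheme" (structure) + fixes r :: nat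
begin

abbreviation Tor where "Tor \<equiv> torus K r"
abbreviation \<Gamma> where "\<Gamma> \<equiv> character_group K r"

sublocale U: comm_group "units_of K" by (rule KF.units_comm_group)

lemma torus_group: "group Tor"
  unfolding torus_def by (rule product_group) (rule KF.units_group)

sublocale Tor: group Tor by (rule torus_group)

lemma torus_carrier: "carrier Tor = (\<Pi>\<^sub>E i\<in>{..<r}. Units K)"
  by (simp add: torus_def units_of_carrier)

lemma regular_add:
  assumes "regular_function K r f" "regular_function K r g"
  shows "regular_function K r (\<lambda>h. f h \<oplus> g h)"
proof -
  obtain F c where F: "finite F" "c \<in> F \<rightarrow> carrier K"
    "\<forall>h\<in>carrier Tor. f h = (\<Oplus>m\<in>F. c m \<otimes> laurent_monomial K r m h)"
    using assms(1) unfolding regular_function_def by blast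
  obtain G d where G: "finite G" "d \<in> G \<rightarrow> carrier K"
    "\<forall>h\<in>carrier Tor. g h = (\<Oplus>m\<in>G. d m \<otimes> laurent_monomial K r m h)"
    using assms(2) unfolding regular_function_def by blast
  define c' where "c' m = (if m \<in> F then c m else \<zero>)" for m
  define d' where "d' m = (if m \<in> G then d m else \<zero>)" for m
  have cd: "c' m \<in> carrier K" "d' m \<in> carrier K" for m unfolding c'_def d'_def using F G by auto
  have l: "laurent_monomial K r m h \<in> carrier K" if "h \<in> carrier Tor" for m h
  proof -
    have "laurent_monomial K r m h \<in> carrier (units_of K)" unfolding laurent_monomial_def
      using that by (intro U.finprod_closed) (auto simp: torus_carrier units_of_carrier[symmetric])
    then show ?thesis by (simp add: units_of_carrier KF.Units_closed)
  qed
  have "f h \<oplus> g h = (\<Oplus>m\<in>F \<union> G. (c' m \<oplus> d' m) \<otimes> laurent_monomial K r m h)"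
    if h: "h \<in> carrier Tor" for h
  proof -
    have "f h = (\<Oplus>m\<in>F \<union> G. c' m \<otimes> laurent_monomial K r m h)" unfolding F(3)[rule_format, OF h]
      by (rule KF.add.finprod_mono_neutral_cong_left) (use F G cd l[OF h] in \<open>auto simp: c'_def Pi_iff\<close>)
    moreover have "g h = (\<Oplus>m\<in>F \<union> G. d' m \<otimes> laurent_monomial K r m h)" unfolding G(3)[rule_format, OF h]
      by (rule KF.add.finprod_mono_neutral_cong_left) (use F G cd l[OF h] in \<open>auto simp: d'_def Pi_iff\<close>)
    ultimately show ?thesis using cd l[OF h] by (simp add: KF.l_distr KF.finsum_addf)
  qed
  then show ?thesis unfolding regular_function_def using F G cd
    by (intro exI[of _ "F \<union> G"] exI[of _ "\<lambda>m. c' m \<oplus> d' m"]) auto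
qed

lemma laurent_Units: "h \<in> carrier Tor \<Longrightarrow> laurent_monomial K r m h \<in> Units K"
proof -
  assume h: "h \<in> carrier Tor"
  have "laurent_monomial K r m h \<in> carrier (units_of K)" unfolding laurent_monomial_def
    using h by (intro U.finprod_closed) (auto simp: torus_carrier units_of_carrier[symmetric])
  then show ?thesis by (simp add: units_of_carrier)
qed

lemma laurent_closed: "h \<in> carrier Tor \<Longrightarrow> laurent_monomial K r m h \<in> carrier K"
  using laurent_Units KF.Units_closed by blast

lemma regular_smult:
  assumes "regular_function K r f" "k \<in> carrier K"
  shows "regular_function K r (\<lambda>h. k \<otimes> f h)"
proof -
  obtain F c where F: "finite F" "c \<in> F \<rightarrow> carrier K"
    "\<forall>h\<in>carrier Tor. f h = (\<Oplus>m\<in>F. c m \<otimes> laurent_monomial K r m h)"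
    using assms(1) unfolding regular_function_def by blast
  have "k \<otimes> f h = (\<Oplus>m\<in>F. (k \<otimes> c m) \<otimes> laurent_monomial K r m h)"
    if h: "h \<in> carrier Tor" for h
  proof -
    have "k \<otimes> f h = (\<Oplus>m\<in>F. k \<otimes> (c m \<otimes> laurent_monomial K r m h))"
      unfolding F(3)[rule_format, OF h]
      by (rule KF.finsum_rdistr) (use F assms laurent_closed[OF h] in \<open>auto simp: Pi_iff\<close>)
    also have "\<dots> = (\<Oplus>m\<in>F. (k \<otimes> c m) \<otimes> laurent_monomial K r m h)"
      by (rule KF.finsum_cong') (use F assms laurent_closed[OF h] in \<open>auto simp: KF.m_assoc Pi_iff\<close>)
    finally show ?thesis .
  qed
  then show ?thesis unfolding regular_function_def using F assms
    by (intro exI[of _ F] exI[of _ "\<lambda>m. k \<otimes> c m"]) auto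
qed

lemma units_carrier_nth: "g \<in> carrier Tor \<Longrightarrow> i < r \<Longrightarrow> g i \<in> carrier (units_of K)"
  by (auto simp: torus_carrier units_of_carrier)

lemma laurent_add:
  assumes h: "g \<in> carrier Tor"
  shows "laurent_monomial K r (\<lambda>i. m i + m' i) g = laurent_monomial K r m g \<otimes> laurent_monomial K r m' g"
proof -
  note c = units_carrier_nth[OF h]
  have "laurent_monomial K r (\<lambda>i. m i + m' i) g =
      finprod (units_of K) (\<lambda>i. g i [^]\<^bsub>units_of K\<^esub> m i \<otimes>\<^bsub>units_of K\<^esub> g i [^]\<^bsub>units_of K\<^esub> m' i) {..<r}"
    unfolding laurent_monomial_def using c by (intro U.finprod_cong') (auto simp: U.int_pow_mult)
  also have "\<dots> = laurent_monomial K r m g \<otimes>\<^bsub>units_of K\<^esub> laurent_monomial K r m' g"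
    unfolding laurent_monomial_def using c by (intro U.finprod_multf) auto
  finally show ?thesis by (simp add: units_of_mult)
qed

text \<open>Multiplication by a monomial is an injective translation of the exponents.\<close>

lemma regular_mult_monomial:
  assumes "regular_function K r f"
  shows "regular_function K r (\<lambda>h. f h \<otimes> laurent_monomial K r m h)"
proof -
  obtain F c where F: "finite F" "c \<in> F \<rightarrow> carrier K"
    "\<forall>h\<in>carrier Tor. f h = (\<Oplus>m\<in>F. c m \<otimes> laurent_monomial K r m h)"
    using assms(1) unfolding regular_function_def by blast
  have inj: "inj_on (\<lambda>m' i. m' i + m i) F" by (rule inj_onI) (metis (no_types, lifting) add_right_cancel ext)
  define c' where "c' m' = c (\<lambda>i. m' i - m i)" for m'
  have "f h \<otimes> laurent_monomial K r m h =
     (\<Oplus>m'\<in>(\<lambda>m' i. m' i + m i) ` F. c' m' \<otimes> laurent_monomial K r m' h)"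
    if h: "h \<in> carrier Tor" for h
  proof -
    have "f h \<otimes> laurent_monomial K r m h =
      (\<Oplus>m'\<in>F. c m' \<otimes> laurent_monomial K r m' h \<otimes> laurent_monomial K r m h)"
      unfolding F(3)[rule_format, OF h]
      by (rule KF.finsum_ldistr) (use F laurent_closed[OF h] in \<open>auto simp: Pi_iff\<close>)
    also have "\<dots> = (\<Oplus>m'\<in>F. c' (\<lambda>i. m' i + m i) \<otimes> laurent_monomial K r (\<lambda>i. m' i + m i) h)"
      by (rule KF.finsum_cong')
        (use F laurent_closed[OF h] in \<open>auto simp: laurent_add[OF h] KF.m_assoc Pi_iff c'_def\<close>)
    also have "\<dots> = (\<Oplus>m'\<in>(\<lambda>m' i. m' i + m i) ` F. c' m' \<otimes> laurent_monomial K r m' h)"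
      by (rule KF.finsum_reindex[symmetric, OF _ inj]) (use F laurent_closed[OF h] in \<open>auto simp: c'_def Pi_iff\<close>)
    finally show ?thesis .
  qed
  then show ?thesis unfolding regular_function_def using F
    by (intro exI[of _ "(\<lambda>m' i. m' i + m i) ` F"] exI[of _ c']) (auto simp: c'_def)
qed

lemma regular_zero: "regular_function K r (\<lambda>h. \<zero>)"
  unfolding regular_function_def by (intro exI[of _ "{}"]) auto

lemma regular_cong:
  "\<lbrakk>regular_function K r f; \<And>h. h \<in> carrier Tor \<Longrightarrow> g h = f h\<rbrakk> \<Longrightarrow> regular_function K r g"
  unfolding regular_function_def by metis

lemma regular_one: "regular_function K r (\<lambda>h. \<one>)"
proof -
  have "laurent_monomial K r (\<lambda>_. 0) h = \<one>" for h
    unfolding laurent_monomial_def by (simp, simp add: units_of_one)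
  then show ?thesis unfolding regular_function_def
    by (intro exI[of _ "{\<lambda>_. 0}"] exI[of _ "\<lambda>_. \<one>"]) auto
qed

lemma regular_finsum:
  assumes "finite I" "\<And>i. i \<in> I \<Longrightarrow> regular_function K r (f i)"
    "\<And>i h. i \<in> I \<Longrightarrow> h \<in> carrier Tor \<Longrightarrow> f i h \<in> carrier K"
  shows "regular_function K r (\<lambda>h. \<Oplus>i\<in>I. f i h)"
  using assms
proof (induction I)
  case empty
  then show ?case using regular_zero by simp
next
  case (insert i I)
  have "regular_function K r (\<lambda>h. f i h \<oplus> (\<Oplus>i\<in>I. f i h))"
    using insert by (intro regular_add) auto
  then show ?case by (rule regular_cong) (use insert in auto)
qed

lemma regular_mult:
  assumes f: "regular_function K r f" and g: "regular_function K r g"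
    and fc: "\<And>h. h \<in> carrier Tor \<Longrightarrow> f h \<in> carrier K"
  shows "regular_function K r (\<lambda>h. f h \<otimes> g h)"
proof -
  obtain G d where G: "finite G" "d \<in> G \<rightarrow> carrier K"
    "\<forall>h\<in>carrier Tor. g h = (\<Oplus>m\<in>G. d m \<otimes> laurent_monomial K r m h)"
    using g unfolding regular_function_def by blast
  have "regular_function K r (\<lambda>h. \<Oplus>m\<in>G. d m \<otimes> (f h \<otimes> laurent_monomial K r m h))"
    using G fc laurent_closed
    by (intro regular_finsum regular_smult regular_mult_monomial f) auto
  then show ?thesis
  proof (rule regular_cong)
    fix h assume h: "h \<in> carrier Tor"
    have "f h \<otimes> g h = (\<Oplus>m\<in>G. f h \<otimes> (d m \<otimes> laurent_monomial K r m h))"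
      unfolding G(3)[rule_format, OF h]
      by (rule KF.finsum_rdistr) (use G fc h laurent_closed[OF h] in \<open>auto simp: Pi_iff\<close>)
    also have "\<dots> = (\<Oplus>m\<in>G. d m \<otimes> (f h \<otimes> laurent_monomial K r m h))"
      by (rule KF.finsum_cong')
        (use G fc h laurent_closed[OF h] in \<open>auto simp: KF.m_lcomm Pi_iff\<close>)
    finally show "f h \<otimes> g h = (\<Oplus>m\<in>G. d m \<otimes> (f h \<otimes> laurent_monomial K r m h))" .
  qed
qed

lemma regular_function_closed:
  assumes "regular_function K r f" "h \<in> carrier Tor"
  shows "f h \<in> carrier K"
  using assms laurent_closed[OF assms(2)] unfolding regular_function_def
  by (auto intro!: KF.finsum_closed simp: Pi_iff)

lemma character_carrier:
  "\<chi> \<in> carrier \<Gamma> \<longleftrightarrow> \<chi> \<in> hom Tor (units_of K) \<and> \<chi> \<in> extensional (carrier Tor) \<and> regular_function K r \<chi>"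
  by (auto simp: character_group_def)

lemma character_mult: "\<chi> \<otimes>\<^bsub>\<Gamma>\<^esub> \<psi> = (\<lambda>h\<in>carrier Tor. \<chi> h \<otimes> \<psi> h)"
  and character_one: "\<one>\<^bsub>\<Gamma>\<^esub> = (\<lambda>h\<in>carrier Tor. \<one>)"
  by (simp_all add: character_group_def)

lemma character_Units: "\<chi> \<in> carrier \<Gamma> \<Longrightarrow> h \<in> carrier Tor \<Longrightarrow> \<chi> h \<in> Units K"
  and character_hom: "\<chi> \<in> carrier \<Gamma> \<Longrightarrow> h \<in> carrier Tor \<Longrightarrow> h' \<in> carrier Tor \<Longrightarrow>
    \<chi> (h \<otimes>\<^bsub>Tor\<^esub> h') = \<chi> h \<otimes> \<chi> h'"
  unfolding character_carrier hom_def by (auto simp: units_of_carrier units_of_mult)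

lemma characterI:
  assumes "\<And>h. h \<in> carrier Tor \<Longrightarrow> \<chi> h \<in> Units K"
    "\<And>h h'. h \<in> carrier Tor \<Longrightarrow> h' \<in> carrier Tor \<Longrightarrow> \<chi> (h \<otimes>\<^bsub>Tor\<^esub> h') = \<chi> h \<otimes> \<chi> h'"
    "\<chi> \<in> extensional (carrier Tor)" "regular_function K r \<chi>"
  shows "\<chi> \<in> carrier \<Gamma>"
  unfolding character_carrier hom_def using assms by (auto simp: units_of_carrier units_of_mult)

lemma characters_eqI:
  "\<lbrakk>\<chi> \<in> carrier \<Gamma>; \<psi> \<in> carrier \<Gamma>; \<And>h. h \<in> carrier Tor \<Longrightarrow> \<chi> h = \<psi> h\<rbrakk> \<Longrightarrow> \<chi> = \<psi>"
  unfolding character_carrier by (meson extensionalityI)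

text \<open>Inversion on the torus negates exponents. This provides the inverses in the group of
  characters.\<close>

lemma regular_inverse:
  assumes "regular_function K r f"
  shows "regular_function K r (\<lambda>h\<in>carrier Tor. f (inv\<^bsub>Tor\<^esub> h))"
proof -
  obtain F c where F: "finite F" "c \<in> F \<rightarrow> carrier K"
    "\<forall>h\<in>carrier Tor. f h = (\<Oplus>m\<in>F. c m \<otimes> laurent_monomial K r m h)"
    using assms(1) unfolding regular_function_def by blast
  have inj: "inj_on (\<lambda>m i. - m i :: int) F" by (rule inj_onI) (metis (no_types, lifting) minus_minus ext)
  have invh: "(inv\<^bsub>Tor\<^esub> h) i = inv\<^bsub>units_of K\<^esub> (h i)" if "h \<in> carrier Tor" "i < r" for h i
    using that inv_product_group[of h "{..<r}" "\<lambda>_. units_of K"] U.is_group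
    by (simp add: torus_def)
  have neg: "laurent_monomial K r m (inv\<^bsub>Tor\<^esub> h) = laurent_monomial K r (\<lambda>i. - m i) h"
    if h: "h \<in> carrier Tor" for h m
    unfolding laurent_monomial_def
  proof (rule U.finprod_cong')
    have hi: "h i \<in> carrier (units_of K)" if "i \<in> {..<r}" for i
      using h that by (auto simp: torus_carrier units_of_carrier)
    then show "(\<lambda>i. h i [^]\<^bsub>units_of K\<^esub> - m i) \<in> {..<r} \<rightarrow> carrier (units_of K)" by auto
    fix i assume "i \<in> {..<r}"
    then show "(inv\<^bsub>Tor\<^esub> h) i [^]\<^bsub>units_of K\<^esub> m i = h i [^]\<^bsub>units_of K\<^esub> - m i"
      using invh[OF h] hi[of i] by (simp add: U.int_pow_inv U.int_pow_neg)
  qed simp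
  have "f (inv\<^bsub>Tor\<^esub> h) = (\<Oplus>m\<in>(\<lambda>m i. - m i) ` F. c (\<lambda>i. - m i) \<otimes> laurent_monomial K r m h)"
    if h: "h \<in> carrier Tor" for h
  proof -
    have "f (inv\<^bsub>Tor\<^esub> h) = (\<Oplus>m\<in>F. c m \<otimes> laurent_monomial K r m (inv\<^bsub>Tor\<^esub> h))"
      using F(3) h by simp
    also have "\<dots> = (\<Oplus>m\<in>F. c (\<lambda>i. - (- m i)) \<otimes> laurent_monomial K r (\<lambda>i. - m i) h)"
      using neg[OF h] by simp
    also have "\<dots> = (\<Oplus>m\<in>(\<lambda>m i. - m i) ` F. c (\<lambda>i. - m i) \<otimes> laurent_monomial K r m h)"
      by (rule KF.finsum_reindex[symmetric, OF _ inj]) (use F laurent_closed[OF h] in \<open>auto simp: Pi_iff\<close>)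
    finally show ?thesis .
  qed
  then show ?thesis unfolding regular_function_def using F
    by (intro exI[of _ "(\<lambda>m i. - m i) ` F"] exI[of _ "\<lambda>m. c (\<lambda>i. - m i)"]) auto
qed

lemma character_group_comm_group: "comm_group \<Gamma>"
proof (rule comm_groupI)
  fix \<chi> \<psi> assume \<chi>: "\<chi> \<in> carrier \<Gamma>" and \<psi>: "\<psi> \<in> carrier \<Gamma>"
  note c = KF.Units_closed[OF character_Units[OF \<chi>]] KF.Units_closed[OF character_Units[OF \<psi>]]
  show "\<chi> \<otimes>\<^bsub>\<Gamma>\<^esub> \<psi> \<in> carrier \<Gamma>" unfolding character_mult
  proof (rule characterI)
    show "regular_function K r (\<lambda>h\<in>carrier Tor. \<chi> h \<otimes> \<psi> h)"
      by (rule regular_cong[OF regular_mult]) (use \<chi> \<psi> c in \<open>auto simp: character_carrier\<close>)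
  qed (use character_Units[OF \<chi>] character_Units[OF \<psi>] c in
      \<open>auto simp: character_hom[OF \<chi>] character_hom[OF \<psi>] KF.m_ac\<close>)
  show "\<chi> \<otimes>\<^bsub>\<Gamma>\<^esub> \<psi> = \<psi> \<otimes>\<^bsub>\<Gamma>\<^esub> \<chi>"
    unfolding character_mult using c by (intro restrict_ext) (simp add: KF.m_comm)
next
  show "\<one>\<^bsub>\<Gamma>\<^esub> \<in> carrier \<Gamma>" unfolding character_one
    by (rule characterI) (auto intro!: regular_cong[OF regular_one])
next
  fix \<chi> \<psi> \<theta> assume \<chi>: "\<chi> \<in> carrier \<Gamma>" and \<psi>: "\<psi> \<in> carrier \<Gamma>" and \<theta>: "\<theta> \<in> carrier \<Gamma>"
  note c = KF.Units_closed[OF character_Units[OF \<chi>]] KF.Units_closed[OF character_Units[OF \<psi>]]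
    KF.Units_closed[OF character_Units[OF \<theta>]]
  show "\<chi> \<otimes>\<^bsub>\<Gamma>\<^esub> \<psi> \<otimes>\<^bsub>\<Gamma>\<^esub> \<theta> = \<chi> \<otimes>\<^bsub>\<Gamma>\<^esub> (\<psi> \<otimes>\<^bsub>\<Gamma>\<^esub> \<theta>)"
    unfolding character_mult using c by (intro restrict_ext) (simp add: KF.m_assoc)
next
  fix \<chi> assume \<chi>: "\<chi> \<in> carrier \<Gamma>"
  note c = KF.Units_closed[OF character_Units[OF \<chi>]]
  show "\<one>\<^bsub>\<Gamma>\<^esub> \<otimes>\<^bsub>\<Gamma>\<^esub> \<chi> = \<chi>"
    using \<chi> c unfolding character_mult character_one character_carrier
    by (auto intro!: extensionalityI[of _ "carrier Tor"])
  let ?\<psi> = "\<lambda>h\<in>carrier Tor. \<chi> (inv\<^bsub>Tor\<^esub> h)"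
  have "?\<psi> \<in> carrier \<Gamma>"
  proof (rule characterI)
    show "?\<psi> (h \<otimes>\<^bsub>Tor\<^esub> h') = ?\<psi> h \<otimes> ?\<psi> h'" if "h \<in> carrier Tor" "h' \<in> carrier Tor" for h h'
      using that c by (simp add: Tor.inv_mult_group character_hom[OF \<chi>] KF.m_comm)
    show "regular_function K r ?\<psi>" using \<chi> regular_inverse unfolding character_carrier by blast
  qed (use character_Units[OF \<chi>] in auto)
  moreover have "?\<psi> \<otimes>\<^bsub>\<Gamma>\<^esub> \<chi> = \<one>\<^bsub>\<Gamma>\<^esub>"
  proof -
    have "\<chi> \<one>\<^bsub>Tor\<^esub> = \<one>"
      using \<chi> hom_one[OF _ torus_group U.is_group, of \<chi>] unfolding character_carrier by (simp add: units_of_one)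
    then show ?thesis unfolding character_mult character_one
      by (intro restrict_ext) (simp add: character_hom[OF \<chi>, symmetric])
  qed
  ultimately show "\<exists>\<psi>\<in>carrier \<Gamma>. \<psi> \<otimes>\<^bsub>\<Gamma>\<^esub> \<chi> = \<one>\<^bsub>\<Gamma>\<^esub>" by blast
qed

end

section \<open>The grading of a CGL extension\<close>

context graded_algebra
begin

lemma comp_smult: "k \<in> carrier K \<Longrightarrow> a \<in> carrier A \<Longrightarrow> comp (k \<odot> a) = (\<lambda>s. k \<odot> comp a s)"
  by (intro comp_eq family_smult comp_family)

text \<open>The elements all of whose components stay in the generated algebra form a subalgebra,
  and it contains the homogeneous generators.\<close>

lemma algebra_generated_graded:
  assumes Y: "\<And>y. y \<in> Y \<Longrightarrow> \<exists>s\<in>carrier \<Gamma>. y \<in> D s"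
  shows "graded_subset (algebra_generated K A Y)"
proof -
  let ?S = "algebra_generated K A Y"
  have Yc: "Y \<subseteq> carrier A" using Y D_closed by blast
  have S: "subalgebra_of K A ?S" by (rule algebra_generated_subalgebra[OF Yc])
  note SD = subringD[OF subalgebraD(1)[OF S]]
  define T where "T = {a \<in> ?S. \<forall>s\<in>carrier \<Gamma>. comp a s \<in> ?S}"
  have hom: "h \<in> T" if "s \<in> carrier \<Gamma>" "h \<in> D s" "h \<in> ?S" for s h
    using comp_hom[OF that(1,2)] that(3) SD(2) unfolding T_def by auto
  have Tg: "graded_subset T"
    unfolding graded_subset_def
  proof (intro conjI ballI)
    show "T \<subseteq> carrier A" unfolding T_def using SD by auto
    show "\<zero> \<in> T" unfolding T_def using SD comp_zero by auto
    show "a \<oplus> b \<in> T" if "a \<in> T" "b \<in> T" for a b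
      using that SD(1,4) unfolding T_def by (auto simp: comp_add subset_iff)
    show "k \<odot> a \<in> T" if "k \<in> carrier K" "a \<in> T" for k a
      using that SD(1) subalgebraD(2)[OF S] unfolding T_def by (auto simp: comp_smult subset_iff)
    show "comp a s \<in> T" if "a \<in> T" "s \<in> carrier \<Gamma>" for a s
      using that hom comp_mem SD(1) unfolding T_def by blast
  qed
  have Tc: "a \<in> carrier A" if "a \<in> T" for a using that SD(1) unfolding T_def by blast
  have "subalgebra_of K A T"
  proof (rule subalgebraI)
    show "a \<otimes> b \<in> T" if a: "a \<in> T" and b: "b \<in> T" for a b
    proof (rule additive_memI[OF additive_mult_left Tg b])
      fix t g assume t: "t \<in> carrier \<Gamma>" and g: "g \<in> T" "g \<in> D t"
      show "a \<otimes> g \<in> T"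
      proof (rule additive_memI[OF additive_mult_right Tg a])
        fix s f assume s: "s \<in> carrier \<Gamma>" and f: "f \<in> T" "f \<in> D s"
        show "f \<otimes> g \<in> T"
          using hom[OF _ D_mult[OF s t f(2) g(2)]] s t f(1) g(1) SD(5) unfolding T_def by auto
      qed (use Tc g graded_subsetD[OF Tg] in auto)
    qed (use Tc a graded_subsetD[OF Tg] in auto)
  qed (use Tc graded_subsetD[OF Tg] hom[OF _ D_one] SD in auto)
  moreover have "Y \<subseteq> T" using Y hom algebra_generated_subset by blast
  ultimately have "?S \<subseteq> T" by (rule algebra_generated_least)
  then have "?S = T" unfolding T_def by blast
  then show ?thesis using Tg by simp
qed

end

context CGL_extension
begin

abbreviation D where "D \<equiv> eigenspace K A r act"
abbreviation IA where "IA \<equiv> interval_subalgebra K A x"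

sublocale split_torus K r by (intro split_torus.intro field)

lemma act_action: "group_action Tor (carrier A) act"
  and act_automorphism: "g \<in> carrier Tor \<Longrightarrow> algebra_automorphism K A (carrier A) (act g)"
  using rational_action unfolding rational_torus_action_def by auto

lemma act_linear: "g \<in> carrier Tor \<Longrightarrow> linear_on K A (carrier A) (act g)"
  using act_automorphism unfolding algebra_automorphism_def by blast

lemmas act_closed = linear_onD(1)[OF act_linear]
  and act_add = linear_onD(2)[OF act_linear]
  and act_smult = linear_onD(3)[OF act_linear]

lemma act_mult: "\<lbrakk>g \<in> carrier Tor; a \<in> carrier A; b \<in> carrier A\<rbrakk> \<Longrightarrow> act g (a \<otimes>\<^bsub>A\<^esub> b) = act g a \<otimes>\<^bsub>A\<^esub> act g b"
  and act_one: "g \<in> carrier Tor \<Longrightarrow> act g \<one>\<^bsub>A\<^esub> = \<one>\<^bsub>A\<^esub>"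
  using act_automorphism[of g] unfolding algebra_automorphism_def ring_iso_def ring_hom_def by auto

lemma act_zero: "g \<in> carrier Tor \<Longrightarrow> act g \<zero>\<^bsub>A\<^esub> = \<zero>\<^bsub>A\<^esub>"
  using act_smult[of g "\<zero>\<^bsub>K\<^esub>" "\<zero>\<^bsub>A\<^esub>"] act_closed[of g "\<zero>\<^bsub>A\<^esub>"] by simp

lemma act_inj: "\<lbrakk>g \<in> carrier Tor; a \<in> carrier A; act g a = \<zero>\<^bsub>A\<^esub>\<rbrakk> \<Longrightarrow> a = \<zero>\<^bsub>A\<^esub>"
  using group_action.inj_prop[OF act_action, of g] act_zero[of g] by (metis M.zero_closed inj_onD)

lemma act_comp:
  "\<lbrakk>g \<in> carrier Tor; g' \<in> carrier Tor; a \<in> carrier A\<rbrakk> \<Longrightarrow> act (g \<otimes>\<^bsub>Tor\<^esub> g') a = act g (act g' a)"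
  using group_action.composition_rule[OF act_action] by blast

lemma eigenvalue_eq:
  "\<lbrakk>a \<in> carrier A; a \<noteq> \<zero>\<^bsub>A\<^esub>; k \<in> carrier K; f a = k \<odot>\<^bsub>A\<^esub> a\<rbrakk> \<Longrightarrow> eigenvalue K A f a = k"
  unfolding eigenvalue_def by (rule the_equality) (auto intro: smult_cancel)

lemma x_carrier: "k \<in> {1..N} \<Longrightarrow> x k \<in> carrier A"
  and x_nonzero: "k \<in> {1..N} \<Longrightarrow> x k \<noteq> \<zero>\<^bsub>A\<^esub>"
  using eigenvectors unfolding torus_eigenvector_def by auto

text \<open>Inside a rational subspace containing \<open>a\<close>, compare the two sides of the
  eigenvalue equation at a coordinate where \<open>a\<close> does not vanish. This writes
  \<open>\<chi>\<close> as a linear combination of matrix coefficients.\<close>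

lemma eigencharacter_regular:
  assumes a: "a \<in> carrier A" "a \<noteq> \<zero>\<^bsub>A\<^esub>"
    and \<chi>: "\<And>g. g \<in> carrier Tor \<Longrightarrow> \<chi> g \<in> carrier K \<and> act g a = \<chi> g \<odot>\<^bsub>A\<^esub> a"
  shows "regular_function K r \<chi>"
proof -
  obtain V where V: "rational_subspace K A r act V" "a \<in> V"
    using rational_action a(1) unfolding rational_torus_action_def by blast
  obtain d :: nat and v m where v: "v \<in> {..<d} \<rightarrow> carrier A"
    and Vv: "V = {\<Oplus>\<^bsub>A\<^esub>i\<in>{..<d}. c i \<odot>\<^bsub>A\<^esub> v i | c. c \<in> {..<d} \<rightarrow> carrier K}"
    and indep: "\<forall>c\<in>{..<d} \<rightarrow> carrier K. (\<Oplus>\<^bsub>A\<^esub>i\<in>{..<d}. c i \<odot>\<^bsub>A\<^esub> v i) = \<zero>\<^bsub>A\<^esub> \<longrightarrow> (\<forall>i<d. c i = \<zero>\<^bsub>K\<^esub>)"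
    and m: "\<forall>i<d. \<forall>j<d. regular_function K r (m i j)"
    and act_v: "\<forall>g\<in>carrier Tor. \<forall>j<d. act g (v j) = (\<Oplus>\<^bsub>A\<^esub>i\<in>{..<d}. m i j g \<odot>\<^bsub>A\<^esub> v i)"
    using V(1) unfolding rational_subspace_def by (elim exE conjE) (rule that; assumption)
  obtain c where c: "c \<in> {..<d} \<rightarrow> carrier K" "a = (\<Oplus>\<^bsub>A\<^esub>i\<in>{..<d}. c i \<odot>\<^bsub>A\<^esub> v i)"
    using V(2) unfolding Vv by blast
  have cc: "c i \<in> carrier K" "v i \<in> carrier A" if "i < d" for i using c v that by auto
  have "\<exists>i<d. c i \<noteq> \<zero>\<^bsub>K\<^esub>"
  proof (rule ccontr)
    assume "\<not> (\<exists>i<d. c i \<noteq> \<zero>\<^bsub>K\<^esub>)"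
    then have "a = (\<Oplus>\<^bsub>A\<^esub>i\<in>{..<d}. \<zero>\<^bsub>A\<^esub>)" unfolding c(2)
      by (intro M.finsum_cong') (use cc in auto)
    then show False using a by simp
  qed
  then obtain i0 where i0: "i0 < d" "c i0 \<noteq> \<zero>\<^bsub>K\<^esub>" by blast
  then have ci: "c i0 \<in> Units K" using cc Units_K by auto
  \<comment> \<open>\<open>f i g\<close> is the coordinate of \<open>act g a\<close> along
    \<open>v i\<close>.\<close>
  define f where "f i g = (\<Oplus>\<^bsub>K\<^esub>j\<in>{..<d}. c j \<otimes>\<^bsub>K\<^esub> m i j g)" for i g
  have mc: "m i j g \<in> carrier K" if "i < d" "j < d" "g \<in> carrier Tor" for i j g
    using regular_function_closed m that by blast
  have fc: "f i g \<in> carrier K" if "i < d" "g \<in> carrier Tor" for i g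
    unfolding f_def using cc mc that by (intro R.finsum_closed) auto
  have eq: "\<chi> g = inv\<^bsub>K\<^esub> (c i0) \<otimes>\<^bsub>K\<^esub> f i0 g" if g: "g \<in> carrier Tor" for g
  proof -
    have "act g a = (\<Oplus>\<^bsub>A\<^esub>j\<in>{..<d}. act g (c j \<odot>\<^bsub>A\<^esub> v j))"
      unfolding c(2) by (rule linear_finsum[OF act_linear[OF g]]) (use cc in auto)
    also have "\<dots> = (\<Oplus>\<^bsub>A\<^esub>j\<in>{..<d}. \<Oplus>\<^bsub>A\<^esub>i\<in>{..<d}. (c j \<otimes>\<^bsub>K\<^esub> m i j g) \<odot>\<^bsub>A\<^esub> v i)"
    proof (rule M.finsum_cong')
      fix j assume j: "j \<in> {..<d}"
      have "act g (c j \<odot>\<^bsub>A\<^esub> v j) = c j \<odot>\<^bsub>A\<^esub> (\<Oplus>\<^bsub>A\<^esub>i\<in>{..<d}. m i j g \<odot>\<^bsub>A\<^esub> v i)"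
        using act_smult[OF g] act_v g cc j by simp
      also have "\<dots> = (\<Oplus>\<^bsub>A\<^esub>i\<in>{..<d}. c j \<odot>\<^bsub>A\<^esub> (m i j g \<odot>\<^bsub>A\<^esub> v i))"
        by (rule finsum_smult_ldistr) (use cc mc j g in auto)
      also have "\<dots> = (\<Oplus>\<^bsub>A\<^esub>i\<in>{..<d}. (c j \<otimes>\<^bsub>K\<^esub> m i j g) \<odot>\<^bsub>A\<^esub> v i)"
        by (rule M.finsum_cong') (use cc mc j g in \<open>auto simp: smult_assoc1\<close>)
      finally show "act g (c j \<odot>\<^bsub>A\<^esub> v j) = (\<Oplus>\<^bsub>A\<^esub>i\<in>{..<d}. (c j \<otimes>\<^bsub>K\<^esub> m i j g) \<odot>\<^bsub>A\<^esub> v i)" .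
    qed (use cc mc g in \<open>auto intro!: M.finsum_closed\<close>)
    also have "\<dots> = (\<Oplus>\<^bsub>A\<^esub>i\<in>{..<d}. \<Oplus>\<^bsub>A\<^esub>j\<in>{..<d}. (c j \<otimes>\<^bsub>K\<^esub> m i j g) \<odot>\<^bsub>A\<^esub> v i)"
      by (rule M.add.finprod_swap) (use cc mc g in auto)
    also have "\<dots> = (\<Oplus>\<^bsub>A\<^esub>i\<in>{..<d}. f i g \<odot>\<^bsub>A\<^esub> v i)"
      unfolding f_def
      by (rule M.finsum_cong') (use cc mc g in \<open>auto simp: smult_finsum_left intro!: M.finsum_closed R.finsum_closed\<close>)
    finally have 1: "act g a = (\<Oplus>\<^bsub>A\<^esub>i\<in>{..<d}. f i g \<odot>\<^bsub>A\<^esub> v i)" .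
    have \<chi>g: "\<chi> g \<in> carrier K" "act g a = \<chi> g \<odot>\<^bsub>A\<^esub> a" using \<chi> g by auto
    have "\<ominus>\<^bsub>K\<^esub> \<chi> g \<odot>\<^bsub>A\<^esub> a = (\<Oplus>\<^bsub>A\<^esub>i\<in>{..<d}. \<ominus>\<^bsub>K\<^esub> \<chi> g \<odot>\<^bsub>A\<^esub> (c i \<odot>\<^bsub>A\<^esub> v i))"
      unfolding c(2) by (rule finsum_smult_ldistr) (use cc \<chi>g in auto)
    also have "\<dots> = (\<Oplus>\<^bsub>A\<^esub>i\<in>{..<d}. (\<ominus>\<^bsub>K\<^esub> \<chi> g \<otimes>\<^bsub>K\<^esub> c i) \<odot>\<^bsub>A\<^esub> v i)"
      by (rule M.finsum_cong') (use cc \<chi>g in \<open>auto simp: smult_assoc1\<close>)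
    finally have 2: "\<ominus>\<^bsub>K\<^esub> \<chi> g \<odot>\<^bsub>A\<^esub> a = (\<Oplus>\<^bsub>A\<^esub>i\<in>{..<d}. (\<ominus>\<^bsub>K\<^esub> \<chi> g \<otimes>\<^bsub>K\<^esub> c i) \<odot>\<^bsub>A\<^esub> v i)" .
    have "(\<Oplus>\<^bsub>A\<^esub>i\<in>{..<d}. (f i g \<oplus>\<^bsub>K\<^esub> \<ominus>\<^bsub>K\<^esub> \<chi> g \<otimes>\<^bsub>K\<^esub> c i) \<odot>\<^bsub>A\<^esub> v i) =
      (\<Oplus>\<^bsub>A\<^esub>i\<in>{..<d}. f i g \<odot>\<^bsub>A\<^esub> v i \<oplus>\<^bsub>A\<^esub> (\<ominus>\<^bsub>K\<^esub> \<chi> g \<otimes>\<^bsub>K\<^esub> c i) \<odot>\<^bsub>A\<^esub> v i)"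
      by (rule M.finsum_cong') (use cc fc g \<chi>g in \<open>auto simp: smult_l_distr\<close>)
    also have "\<dots> = act g a \<oplus>\<^bsub>A\<^esub> \<ominus>\<^bsub>K\<^esub> \<chi> g \<odot>\<^bsub>A\<^esub> a"
      unfolding 1 2 by (rule M.finsum_addf) (use cc fc g \<chi>g in auto)
    also have "\<dots> = \<zero>\<^bsub>A\<^esub>" using \<chi>g a by (simp add: smult_l_minus M.r_neg)
    finally have sum0: "(\<Oplus>\<^bsub>A\<^esub>i\<in>{..<d}. (f i g \<oplus>\<^bsub>K\<^esub> \<ominus>\<^bsub>K\<^esub> \<chi> g \<otimes>\<^bsub>K\<^esub> c i) \<odot>\<^bsub>A\<^esub> v i) = \<zero>\<^bsub>A\<^esub>" .
    have coeff: "(\<lambda>i. f i g \<oplus>\<^bsub>K\<^esub> \<ominus>\<^bsub>K\<^esub> \<chi> g \<otimes>\<^bsub>K\<^esub> c i) \<in> {..<d} \<rightarrow> carrier K"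
      using cc fc g \<chi>g by auto
    have "f i0 g \<oplus>\<^bsub>K\<^esub> \<ominus>\<^bsub>K\<^esub> \<chi> g \<otimes>\<^bsub>K\<^esub> c i0 = \<zero>\<^bsub>K\<^esub>"
      using bspec[OF indep, of "\<lambda>i. f i g \<oplus>\<^bsub>K\<^esub> \<ominus>\<^bsub>K\<^esub> \<chi> g \<otimes>\<^bsub>K\<^esub> c i"] i0(1) coeff sum0 by blast
    then have "f i0 g = \<chi> g \<otimes>\<^bsub>K\<^esub> c i0"
      using fc[OF i0(1) g] \<chi>g cc[OF i0(1)]
      by (metis R.add.inv_solve_right R.l_minus R.l_zero R.m_closed R.zero_closed R.minus_minus R.add.inv_closed)
    then show ?thesis using \<chi>g cc[OF i0(1)] ci by (simp add: R.m_lcomm R.Units_l_inv)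
  qed
  have "regular_function K r (\<lambda>g. inv\<^bsub>K\<^esub> (c i0) \<otimes>\<^bsub>K\<^esub> f i0 g)"
    unfolding f_def using ci cc m i0 mc by (intro regular_smult regular_finsum) auto
  then show ?thesis by (rule regular_cong) (rule eq)
qed

text \<open>The degree of \<open>x k\<close>. The restriction makes it extensional, as elements of
  \<open>\<Gamma>\<close> have to be.\<close>

definition chr :: "nat \<Rightarrow> (nat \<Rightarrow> 'k) \<Rightarrow> 'k" where
  "chr k = (\<lambda>g\<in>carrier Tor. eigenvalue K A (act g) (x k))"

lemma chr_act:
  assumes k: "k \<in> {1..N}" and g: "g \<in> carrier Tor"
  shows "chr k g \<in> Units K" "act g (x k) = chr k g \<odot>\<^bsub>A\<^esub> x k"
proof -
  obtain c where c: "c \<in> carrier K" "act g (x k) = c \<odot>\<^bsub>A\<^esub> x k"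
    using eigenvectors[OF k] g unfolding torus_eigenvector_def by blast
  have e: "chr k g = c" unfolding chr_def using eigenvalue_eq x_carrier x_nonzero k c g by simp
  then show "act g (x k) = chr k g \<odot>\<^bsub>A\<^esub> x k" using c by simp
  have "c \<noteq> \<zero>\<^bsub>K\<^esub>" using c act_inj[OF g x_carrier[OF k]] x_nonzero[OF k] x_carrier[OF k] by auto
  then show "chr k g \<in> Units K" using e c Units_K by simp
qed

lemma chr_mem:
  assumes k: "k \<in> {1..N}"
  shows "chr k \<in> carrier \<Gamma>" "x k \<in> D (chr k)"
proof -
  note u = chr_act(1)[OF k] and e = chr_act(2)[OF k] and c = R.Units_closed[OF chr_act(1)[OF k]]
  show "x k \<in> D (chr k)" unfolding eigenspace_def using e x_carrier[OF k] by auto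
  show "chr k \<in> carrier \<Gamma>"
  proof (rule characterI)
    fix g g' assume g: "g \<in> carrier Tor" "g' \<in> carrier Tor"
    have "chr k (g \<otimes>\<^bsub>Tor\<^esub> g') \<odot>\<^bsub>A\<^esub> x k = act g (act g' (x k))"
      using e[of "g \<otimes>\<^bsub>Tor\<^esub> g'"] act_comp[OF g x_carrier[OF k]] g by (simp add: Tor.m_closed)
    also have "\<dots> = (chr k g \<otimes>\<^bsub>K\<^esub> chr k g') \<odot>\<^bsub>A\<^esub> x k"
      using e g c act_smult[OF g(1)] x_carrier[OF k] by (simp add: smult_assoc1[symmetric] R.m_comm)
    finally show "chr k (g \<otimes>\<^bsub>Tor\<^esub> g') = chr k g \<otimes>\<^bsub>K\<^esub> chr k g'"
      by (rule smult_cancel[OF c[OF Tor.m_closed[OF g]] R.m_closed[OF c[OF g(1)] c[OF g(2)]]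
          x_carrier[OF k] x_nonzero[OF k]])
  next
    show "regular_function K r (chr k)"
      by (rule eigencharacter_regular[OF x_carrier[OF k] x_nonzero[OF k]]) (use c e in auto)
  qed (use u in \<open>auto simp: chr_def\<close>)
qed

lemma eigenspaceD:
  "a \<in> D \<chi> \<Longrightarrow> a \<in> carrier A" "a \<in> D \<chi> \<Longrightarrow> g \<in> carrier Tor \<Longrightarrow> act g a = \<chi> g \<odot>\<^bsub>A\<^esub> a"
  unfolding eigenspace_def by auto

lemma eigenspaceI:
  "\<lbrakk>a \<in> carrier A; \<And>g. g \<in> carrier Tor \<Longrightarrow> act g a = \<chi> g \<odot>\<^bsub>A\<^esub> a\<rbrakk> \<Longrightarrow> a \<in> D \<chi>"
  unfolding eigenspace_def by auto

lemmas character_closed = R.Units_closed[OF character_Units]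

lemma eigenspace_mult:
  assumes s: "s \<in> carrier \<Gamma>" "t \<in> carrier \<Gamma>" and ab: "a \<in> D s" "b \<in> D t"
  shows "a \<otimes>\<^bsub>A\<^esub> b \<in> D (s \<otimes>\<^bsub>\<Gamma>\<^esub> t)"
proof (rule eigenspaceI)
  note c = eigenspaceD(1)[OF ab(1)] eigenspaceD(1)[OF ab(2)]
  show "a \<otimes>\<^bsub>A\<^esub> b \<in> carrier A" using c by simp
  fix g assume g: "g \<in> carrier Tor"
  show "act g (a \<otimes>\<^bsub>A\<^esub> b) = (s \<otimes>\<^bsub>\<Gamma>\<^esub> t) g \<odot>\<^bsub>A\<^esub> (a \<otimes>\<^bsub>A\<^esub> b)"
    using act_mult[OF g c] eigenspaceD(2)[OF ab(1) g] eigenspaceD(2)[OF ab(2) g] c g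
      character_closed[OF s(1) g] character_closed[OF s(2) g]
    by (simp add: character_mult smult_mult_left smult_mult_right smult_assoc1[symmetric] R.m_comm)
qed

lemma eigenspace_one: "\<one>\<^bsub>A\<^esub> \<in> D \<one>\<^bsub>\<Gamma>\<^esub>"
  by (rule eigenspaceI) (auto simp: character_one act_one)

lemma eigenspace_add:
  assumes s: "s \<in> carrier \<Gamma>" and "a \<in> D s" "b \<in> D s"
  shows "a \<oplus>\<^bsub>A\<^esub> b \<in> D s"
  using assms eigenspaceD act_add character_closed[OF s]
  by (intro eigenspaceI) (auto simp: smult_r_distr)

lemma eigenspace_smult:
  assumes s: "s \<in> carrier \<Gamma>" and "a \<in> D s" "k \<in> carrier K"
  shows "k \<odot>\<^bsub>A\<^esub> a \<in> D s"
  using assms eigenspaceD act_smult character_closed[OF s]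
  by (intro eigenspaceI) (auto simp: smult_assoc1[symmetric] R.m_comm)

lemma eigenspace_zero: "s \<in> carrier \<Gamma> \<Longrightarrow> \<zero>\<^bsub>A\<^esub> \<in> D s"
  by (rule eigenspaceI) (auto simp: act_zero character_closed)

text \<open>To treat a degree \<open>t\<close> other than \<open>s0\<close>, choose \<open>g\<close>
  on which the two characters differ and apply \<open>act g\<close> minus the scalar
  \<open>s0 g\<close> to the relation. The term of degree \<open>s0\<close> disappears and the
  induction hypothesis applies to the rest.\<close>

lemma eigenspaces_independent:
  assumes "finite F" "F \<subseteq> carrier \<Gamma>" "\<And>s. s \<in> F \<Longrightarrow> f s \<in> D s" "(\<Oplus>\<^bsub>A\<^esub>s\<in>F. f s) = \<zero>\<^bsub>A\<^esub>"
  shows "\<forall>s\<in>F. f s = \<zero>\<^bsub>A\<^esub>"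
  using assms
proof (induction F arbitrary: f)
  case (insert s0 F)
  have f: "f s \<in> carrier A" if "s \<in> insert s0 F" for s using insert.prems(2)[OF that] eigenspaceD(1) by blast
  have s0: "s0 \<in> carrier \<Gamma>" and F: "F \<subseteq> carrier \<Gamma>" using insert.prems by auto
  have sum: "f s0 \<oplus>\<^bsub>A\<^esub> (\<Oplus>\<^bsub>A\<^esub>s\<in>F. f s) = \<zero>\<^bsub>A\<^esub>"
    using insert.prems(3) insert.hyps f by simp
  have zero: "f t = \<zero>\<^bsub>A\<^esub>" if t: "t \<in> F" for t
  proof -
    have tc: "t \<in> carrier \<Gamma>" and "t \<noteq> s0" using t F insert.hyps by auto
    then obtain g where g: "g \<in> carrier Tor" "t g \<noteq> s0 g" using characters_eqI s0 by blast
    note sg = character_closed[OF _ g(1)]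
    define f' where "f' s = (s g \<oplus>\<^bsub>K\<^esub> \<ominus>\<^bsub>K\<^esub> s0 g) \<odot>\<^bsub>A\<^esub> f s" for s
    have dc: "s g \<oplus>\<^bsub>K\<^esub> \<ominus>\<^bsub>K\<^esub> s0 g \<in> carrier K" if "s \<in> F" for s using sg F s0 that by blast
    have Sc: "(\<Oplus>\<^bsub>A\<^esub>s\<in>F. f s) \<in> carrier A" using f by (intro M.finsum_closed) auto
    have "(\<Oplus>\<^bsub>A\<^esub>s\<in>F. f' s) = (\<Oplus>\<^bsub>A\<^esub>s\<in>F. act g (f s) \<oplus>\<^bsub>A\<^esub> \<ominus>\<^bsub>K\<^esub> s0 g \<odot>\<^bsub>A\<^esub> f s)"
    proof (rule M.finsum_cong')
      fix s assume s: "s \<in> F"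
      then have "act g (f s) = s g \<odot>\<^bsub>A\<^esub> f s" using eigenspaceD(2) insert.prems(2) g by blast
      then show "f' s = act g (f s) \<oplus>\<^bsub>A\<^esub> \<ominus>\<^bsub>K\<^esub> s0 g \<odot>\<^bsub>A\<^esub> f s"
        unfolding f'_def using sg F s s0 f by (simp add: smult_l_distr subset_iff)
    qed (use f act_closed g sg s0 in auto)
    also have "\<dots> = (\<Oplus>\<^bsub>A\<^esub>s\<in>F. act g (f s)) \<oplus>\<^bsub>A\<^esub> (\<Oplus>\<^bsub>A\<^esub>s\<in>F. \<ominus>\<^bsub>K\<^esub> s0 g \<odot>\<^bsub>A\<^esub> f s)"
      by (rule M.finsum_addf) (use f act_closed g sg s0 in auto)
    also have "(\<Oplus>\<^bsub>A\<^esub>s\<in>F. act g (f s)) = act g (\<Oplus>\<^bsub>A\<^esub>s\<in>F. f s)"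
      by (rule linear_finsum[symmetric, OF act_linear[OF g(1)] insert.hyps(1)]) (use f in auto)
    also have "(\<Oplus>\<^bsub>A\<^esub>s\<in>F. \<ominus>\<^bsub>K\<^esub> s0 g \<odot>\<^bsub>A\<^esub> f s) = \<ominus>\<^bsub>K\<^esub> s0 g \<odot>\<^bsub>A\<^esub> (\<Oplus>\<^bsub>A\<^esub>s\<in>F. f s)"
      by (rule finsum_smult_ldistr[symmetric, OF insert.hyps(1)]) (use f sg s0 in auto)
    \<comment> \<open>By the relation the sum over \<open>F\<close> is the negative of
      \<open>f s0\<close>, an eigenvector for \<open>s0\<close>; on it \<open>act g\<close> and the
      scalar \<open>s0 g\<close> agree.\<close>
    also have "(\<Oplus>\<^bsub>A\<^esub>s\<in>F. f s) = \<ominus>\<^bsub>K\<^esub> \<one>\<^bsub>K\<^esub> \<odot>\<^bsub>A\<^esub> f s0"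
      using sum f[of s0] Sc by (simp add: smult_l_minus) (metis M.a_comm M.minus_equality)
    also have "act g (\<ominus>\<^bsub>K\<^esub> \<one>\<^bsub>K\<^esub> \<odot>\<^bsub>A\<^esub> f s0) = \<ominus>\<^bsub>K\<^esub> \<one>\<^bsub>K\<^esub> \<odot>\<^bsub>A\<^esub> (s0 g \<odot>\<^bsub>A\<^esub> f s0)"
      using act_smult[OF g(1)] eigenspaceD(2)[OF insert.prems(2) g(1)] f by simp
    also have "\<ominus>\<^bsub>K\<^esub> \<one>\<^bsub>K\<^esub> \<odot>\<^bsub>A\<^esub> (s0 g \<odot>\<^bsub>A\<^esub> f s0) \<oplus>\<^bsub>A\<^esub> \<ominus>\<^bsub>K\<^esub> s0 g \<odot>\<^bsub>A\<^esub> (\<ominus>\<^bsub>K\<^esub> \<one>\<^bsub>K\<^esub> \<odot>\<^bsub>A\<^esub> f s0) = \<zero>\<^bsub>A\<^esub>"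
      using f[of s0] sg[OF s0] by (simp add: smult_l_minus smult_r_minus M.l_neg)
    finally have "(\<Oplus>\<^bsub>A\<^esub>s\<in>F. f' s) = \<zero>\<^bsub>A\<^esub>" .
    moreover have "f' s \<in> D s" if "s \<in> F" for s
      unfolding f'_def using eigenspace_smult insert.prems(2) F that dc by blast
    ultimately have "f' t = \<zero>\<^bsub>A\<^esub>" using insert.IH[of f'] F t by blast
    moreover have "t g \<oplus>\<^bsub>K\<^esub> \<ominus>\<^bsub>K\<^esub> s0 g \<in> Units K"
      using dc[OF t] g(2) sg[OF tc] sg[OF s0] R.r_right_minus_eq unfolding Units_K R.minus_eq[symmetric] by simp
    ultimately show ?thesis using smult_zero_iff f t unfolding f'_def by blast
  qed
  then have "(\<Oplus>\<^bsub>A\<^esub>s\<in>F. f s) = \<zero>\<^bsub>A\<^esub>" by (intro M.add.finprod_one_eqI) auto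
  then have "f s0 = \<zero>\<^bsub>A\<^esub>" using sum f[of s0] by simp
  then show ?case using zero by simp
qed simp

text \<open>Products of eigenvectors are eigenvectors, so the homogeneous sums form a subalgebra; it
  contains the variables, and these generate \<open>A\<close>.\<close>

lemma homogeneous_sums_carrier:
  assumes a: "a \<in> carrier A" shows "a \<in> homogeneous_sums A \<Gamma> D"
proof -
  let ?H = "homogeneous_sums A \<Gamma> D"
  have c: "p \<in> carrier A" if "p \<in> ?H" for p
    using that by induction (auto dest: eigenspaceD(1))
  have Hadd: "p \<oplus>\<^bsub>A\<^esub> h \<in> ?H" if "p \<in> ?H" "s \<in> carrier \<Gamma>" "h \<in> D s" for p s h
    by (rule homogeneous_sums.add[where D = D and s = s, OF that])
  have Hzero: "\<zero>\<^bsub>A\<^esub> \<in> ?H" by (rule homogeneous_sums.zero)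
  have hom: "h \<in> ?H" if "s \<in> carrier \<Gamma>" "h \<in> D s" for s h
    using Hadd[OF Hzero that] eigenspaceD(1)[OF that(2)] by simp
  have H_add: "p \<oplus>\<^bsub>A\<^esub> q \<in> ?H" if q: "q \<in> ?H" and p: "p \<in> ?H" for p q
    using q
  proof induction
    case zero
    then show ?case using p c by simp
  next
    case (add q s h)
    then show ?case
      using Hadd[OF add(4,2,3)] c p eigenspaceD(1)[OF add(3)] by (simp add: M.a_assoc)
  qed
  have mult_hom: "p \<otimes>\<^bsub>A\<^esub> h \<in> ?H" if p: "p \<in> ?H" and h: "t \<in> carrier \<Gamma>" "h \<in> D t" for p h t
    using p
  proof induction
    case zero
    then show ?case using eigenspaceD(1)[OF h(2)] Hzero by simp
  next
    case (add q s g)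
    have "q \<otimes>\<^bsub>A\<^esub> h \<oplus>\<^bsub>A\<^esub> g \<otimes>\<^bsub>A\<^esub> h \<in> ?H"
      using Hadd[OF add(4) _ eigenspace_mult[OF add(2) h(1) add(3) h(2)]] add h 
        character_group_comm_group comm_group.axioms(1) comm_monoid.axioms(1) monoid.m_closed by metis
    then show ?case using c[OF add(1)] eigenspaceD(1)[OF h(2)] eigenspaceD(1)[OF add(3)]
      by (simp add: l_distr)
  qed
  have "subalgebra_of K A ?H"
  proof (rule subalgebraI)
    show "\<one>\<^bsub>A\<^esub> \<in> ?H" using hom[OF _ eigenspace_one] character_group_comm_group
      comm_group.axioms(1) comm_monoid.axioms(1) monoid.one_closed by metis
    show "p \<otimes>\<^bsub>A\<^esub> q \<in> ?H" if p: "p \<in> ?H" and q: "q \<in> ?H" for p q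
      using q
    proof induction
      case zero
      then show ?case using p c Hzero by simp
    next
      case (add q s h)
      then show ?case using add mult_hom[OF p add(2,3)] c p eigenspaceD(1)[OF add(3)] H_add
        by (simp add: r_distr)
    qed
    show "k \<odot>\<^bsub>A\<^esub> p \<in> ?H" if k: "k \<in> carrier K" and p: "p \<in> ?H" for k p
      using p
    proof induction
      case zero
      then show ?case using k Hzero by simp
    next
      case (add q s h)
      then show ?case using Hadd[OF add(4,2) eigenspace_smult[OF add(2,3) k]]
        c[OF add(1)] k eigenspaceD(1)[OF add(3)] by (simp add: smult_r_distr)
    qed
  qed (use c H_add in auto)
  moreover have "x ` {1..N} \<subseteq> ?H" using hom chr_mem by blast
  ultimately have "IA 1 N \<subseteq> ?H" unfolding interval_subalgebra_def by (rule algebra_generated_least)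
  then show ?thesis using generated a by blast
qed

sublocale graded_algebra K A \<Gamma> D
proof (intro graded_algebra.intro graded_algebra_axioms.intro assoc_algebra_axioms character_group_comm_group)
  fix a Q assume a: "a \<in> carrier A" and Q0: "Q \<zero>\<^bsub>A\<^esub>"
    and Q: "\<And>p h s. \<lbrakk>p \<in> carrier A; Q p; s \<in> carrier \<Gamma>; h \<in> D s\<rbrakk> \<Longrightarrow> Q (p \<oplus>\<^bsub>A\<^esub> h)"
  have "a \<in> carrier A \<and> Q a" using homogeneous_sums_carrier[OF a]
    by induction (use Q0 Q eigenspaceD(1) in auto)
  then show "Q a" ..
next
  show "a \<in> carrier A" if "s \<in> carrier \<Gamma>" "a \<in> D s" for s a using that(2) by (rule eigenspaceD(1))
next
  show "\<zero>\<^bsub>A\<^esub> \<in> D s" if "s \<in> carrier \<Gamma>" for s using that by (rule eigenspace_zero)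
next
  show "a \<oplus>\<^bsub>A\<^esub> b \<in> D s" if "s \<in> carrier \<Gamma>" "a \<in> D s" "b \<in> D s" for s a b
    using that by (rule eigenspace_add)
next
  show "k \<odot>\<^bsub>A\<^esub> a \<in> D s" if "s \<in> carrier \<Gamma>" "k \<in> carrier K" "a \<in> D s" for s k a
    using that(1,3,2) by (rule eigenspace_smult)
next
  show "\<one>\<^bsub>A\<^esub> \<in> D \<one>\<^bsub>\<Gamma>\<^esub>" by (rule eigenspace_one)
next
  show "a \<otimes>\<^bsub>A\<^esub> b \<in> D (s \<otimes>\<^bsub>\<Gamma>\<^esub> t)" if "s \<in> carrier \<Gamma>" "t \<in> carrier \<Gamma>" "a \<in> D s" "b \<in> D t" for s t a b
    using that by (rule eigenspace_mult)
next
  fix F f assume F: "finite F" "F \<subseteq> carrier \<Gamma>" "\<And>s. s \<in> F \<Longrightarrow> f s \<in> D s" "(\<Oplus>\<^bsub>A\<^esub>s\<in>F. f s) = \<zero>\<^bsub>A\<^esub>"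
  show "\<forall>s\<in>F. f s = \<zero>\<^bsub>A\<^esub>" by (rule eigenspaces_independent[of F f, OF F(1,2) F(3) F(4)])
qed


end

section \<open>Extending multiplicative maps from an Ore domain to the units of its quotient
  ring\<close>

lemma (in comm_group) fraction_mult_eq:
  assumes c: "a \<in> carrier G" "b \<in> carrier G" "s \<in> carrier G" "t \<in> carrier G" "u \<in> carrier G" "v \<in> carrier G"
    and eq: "s \<otimes> u = b \<otimes> v"
  shows "(a \<otimes> u) \<otimes> inv (t \<otimes> v) = (a \<otimes> inv s) \<otimes> (b \<otimes> inv t)"
proof -
  have u: "u = inv s \<otimes> (b \<otimes> v)" using eq c by (metis inv_solve_left m_closed)
  have "(a \<otimes> u) \<otimes> inv (t \<otimes> v) = ((a \<otimes> inv s) \<otimes> (b \<otimes> inv t)) \<otimes> (v \<otimes> inv v)"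
    unfolding u using c by (simp only: inv_mult m_ac m_closed inv_closed)
  then show ?thesis using c by simp
qed

lemma (in comm_group) fraction_cancel:
  assumes c: "a \<in> carrier G" "s \<in> carrier G" "u \<in> carrier G"
  shows "(a \<otimes> u) \<otimes> inv (s \<otimes> u) = a \<otimes> inv s"
proof -
  have "(a \<otimes> u) \<otimes> inv (s \<otimes> u) = (a \<otimes> inv s) \<otimes> (u \<otimes> inv u)"
    using c by (simp only: inv_mult m_ac m_closed inv_closed)
  then show ?thesis using c by simp
qed

text \<open>On a s^-1 the extension is forced to be L(a) L(s)^-1. Fractions are multiplied by
  rewriting s^-1 b as u v^-1 with s u = b v; commutativity of \<open>M\<close> makes the forced
  formula respect this.\<close>

lemma (in right_ore_domain) quotient_extension:
  fixes M :: "('c, 'd) monoid_scheme" and Q :: "('q, 'p) ring_scheme"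
  assumes M: "comm_group M"
    and L_closed: "\<And>a. a \<in> carrier R \<Longrightarrow> a \<noteq> \<zero> \<Longrightarrow> L a \<in> carrier M"
    and L_mult: "\<And>a b. \<lbrakk>a \<in> carrier R; b \<in> carrier R; a \<noteq> \<zero>; b \<noteq> \<zero>\<rbrakk> \<Longrightarrow> L (a \<otimes> b) = L a \<otimes>\<^bsub>M\<^esub> L b"
    and Q: "classical_right_quotient_ring R Q \<phi>"
  obtains L' where "L' \<in> hom (units_of Q) M" "\<And>a. a \<in> carrier R \<Longrightarrow> a \<noteq> \<zero> \<Longrightarrow> L' (\<phi> a) = L a"
proof -
  interpret M: comm_group M by (rule M)
  interpret Q: ring Q using Q unfolding classical_right_quotient_ring_def by blast
  have hom: "\<phi> \<in> ring_hom R Q" and inj: "inj_on \<phi> (carrier R)"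
    and reg: "\<And>s. s \<in> carrier R \<Longrightarrow> s \<noteq> \<zero> \<Longrightarrow> \<phi> s \<in> Units Q"
    and frac: "\<And>q. q \<in> carrier Q \<Longrightarrow> \<exists>a s. a \<in> carrier R \<and> s \<in> carrier R \<and> s \<noteq> \<zero> \<and> q = \<phi> a \<otimes>\<^bsub>Q\<^esub> inv\<^bsub>Q\<^esub> (\<phi> s)"
    using Q regular_element_iff unfolding classical_right_quotient_ring_def by auto
  note \<phi>c = ring_hom_closed[OF hom] and \<phi>m = ring_hom_mult[OF hom] and \<phi>1 = ring_hom_one[OF hom]
  have \<phi>0: "\<phi> \<zero> = \<zero>\<^bsub>Q\<^esub>" using ring_hom_zero[OF hom ring_axioms Q.ring_axioms] .
  have Qnt: "\<zero>\<^bsub>Q\<^esub> \<notin> Units Q"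
  proof
    assume "\<zero>\<^bsub>Q\<^esub> \<in> Units Q"
    then have "\<one>\<^bsub>Q\<^esub> = \<zero>\<^bsub>Q\<^esub>" by (metis Q.Units_inv_closed Q.Units_l_inv Q.r_null)
    then have "\<phi> \<one> = \<phi> \<zero>" using \<phi>0 \<phi>1 by simp
    then show False using inj one_neq_zero by (meson inj_onD one_closed zero_closed)
  qed
  let ?P = "\<lambda>q a s. a \<in> carrier R \<and> s \<in> carrier R \<and> a \<noteq> \<zero> \<and> s \<noteq> \<zero> \<and> q = \<phi> a \<otimes>\<^bsub>Q\<^esub> inv\<^bsub>Q\<^esub> (\<phi> s)"
  have ex: "\<exists>a s. ?P q a s" if q: "q \<in> Units Q" for q
  proof -
    obtain a s where as: "a \<in> carrier R" "s \<in> carrier R" "s \<noteq> \<zero>" "q = \<phi> a \<otimes>\<^bsub>Q\<^esub> inv\<^bsub>Q\<^esub> (\<phi> s)"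
      using frac[OF Q.Units_closed[OF q]] by blast
    have "a \<noteq> \<zero>"
    proof
      assume "a = \<zero>"
      then have "q = \<zero>\<^bsub>Q\<^esub>" using as \<phi>0 reg by simp
      then show False using q Qnt by simp
    qed
    then show ?thesis using as by blast
  qed
  define V where "V a s = L a \<otimes>\<^bsub>M\<^esub> inv\<^bsub>M\<^esub> L s" for a s
  have ore: "\<exists>u v. u \<in> carrier R \<and> v \<in> carrier R \<and> u \<noteq> \<zero> \<and> v \<noteq> \<zero> \<and> s \<otimes> u = t \<otimes> v"
    if "s \<in> carrier R" "t \<in> carrier R" "s \<noteq> \<zero>" "t \<noteq> \<zero>" for s t
  proof -
    obtain u v where uv: "u \<in> carrier R" "v \<in> carrier R" "s \<otimes> u = t \<otimes> v" "s \<otimes> u \<noteq> \<zero>"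
      using right_ore[of s t] \<open>s \<in> carrier R\<close> \<open>t \<in> carrier R\<close> \<open>s \<noteq> \<zero>\<close> \<open>t \<noteq> \<zero>\<close> by blast
    then have "u \<noteq> \<zero>" "v \<noteq> \<zero>" using \<open>s \<in> carrier R\<close> \<open>t \<in> carrier R\<close> by auto
    then show ?thesis using uv by blast
  qed
  \<comment> \<open>Equality of a s^-1 and b t^-1 means that a u = b v whenever s u = t v.\<close>
  have V_unique: "V a s = V b t" if as: "?P q a s" and bt: "?P q b t" for q a s b t
  proof -
    obtain u v where uv: "u \<in> carrier R" "v \<in> carrier R" "u \<noteq> \<zero>" "v \<noteq> \<zero>" "s \<otimes> u = t \<otimes> v"
      using ore[of s t] as bt by blast
    have c: "\<phi> a \<in> carrier Q" "\<phi> b \<in> carrier Q" "\<phi> u \<in> carrier Q" "\<phi> v \<in> carrier Q"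
      "\<phi> s \<in> Units Q" "\<phi> t \<in> Units Q" using \<phi>c reg as bt uv by auto
    note c' = Q.Units_closed[OF c(5)] Q.Units_closed[OF c(6)] Q.Units_inv_closed[OF c(5)] Q.Units_inv_closed[OF c(6)]
    have qc: "q \<in> carrier Q" using as c(1) c'(3) by simp
    have "q \<otimes>\<^bsub>Q\<^esub> \<phi> s = \<phi> a \<otimes>\<^bsub>Q\<^esub> (inv\<^bsub>Q\<^esub> (\<phi> s) \<otimes>\<^bsub>Q\<^esub> \<phi> s)"
      "q \<otimes>\<^bsub>Q\<^esub> \<phi> t = \<phi> b \<otimes>\<^bsub>Q\<^esub> (inv\<^bsub>Q\<^esub> (\<phi> t) \<otimes>\<^bsub>Q\<^esub> \<phi> t)"
      using as bt c c' by (metis Q.m_assoc)+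
    then have qs: "q \<otimes>\<^bsub>Q\<^esub> \<phi> s = \<phi> a" "q \<otimes>\<^bsub>Q\<^esub> \<phi> t = \<phi> b" using c by (simp_all add: Q.Units_l_inv)
    have "\<phi> (a \<otimes> u) = q \<otimes>\<^bsub>Q\<^esub> (\<phi> s \<otimes>\<^bsub>Q\<^esub> \<phi> u)"
      using as uv(1) \<phi>m qs(1) qc c c' by (simp add: Q.m_assoc[symmetric])
    also have "\<phi> s \<otimes>\<^bsub>Q\<^esub> \<phi> u = \<phi> t \<otimes>\<^bsub>Q\<^esub> \<phi> v" using as bt uv \<phi>m by metis
    also have "q \<otimes>\<^bsub>Q\<^esub> (\<phi> t \<otimes>\<^bsub>Q\<^esub> \<phi> v) = \<phi> (b \<otimes> v)"
      using bt uv(2) \<phi>m qs(2) qc c c' by (simp add: Q.m_assoc[symmetric])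
    finally have "\<phi> (a \<otimes> u) = \<phi> (b \<otimes> v)" .
    then have au: "a \<otimes> u = b \<otimes> v" using inj as bt uv by (meson inj_onD m_closed)
    have "L a \<otimes>\<^bsub>M\<^esub> L u = L b \<otimes>\<^bsub>M\<^esub> L v" "L s \<otimes>\<^bsub>M\<^esub> L u = L t \<otimes>\<^bsub>M\<^esub> L v"
      using L_mult as bt uv au by metis+
    moreover have Lc: "L a \<in> carrier M" "L b \<in> carrier M" "L s \<in> carrier M" "L t \<in> carrier M"
      "L u \<in> carrier M" "L v \<in> carrier M" using L_closed as bt uv by auto
    moreover have "V a s = (L a \<otimes>\<^bsub>M\<^esub> L u) \<otimes>\<^bsub>M\<^esub> inv\<^bsub>M\<^esub> (L s \<otimes>\<^bsub>M\<^esub> L u)"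
      "V b t = (L b \<otimes>\<^bsub>M\<^esub> L v) \<otimes>\<^bsub>M\<^esub> inv\<^bsub>M\<^esub> (L t \<otimes>\<^bsub>M\<^esub> L v)"
      unfolding V_def using Lc by (simp_all add: M.fraction_cancel)
    ultimately show ?thesis by simp
  qed
  define L' where "L' q = (SOME w. \<exists>a s. ?P q a s \<and> w = V a s)" for q
  have L'_eq: "L' q = V a s" if as: "?P q a s" for q a s
  proof -
    have "\<exists>b t. ?P q b t \<and> L' q = V b t" unfolding L'_def
      by (rule someI_ex) (use as in blast)
    then obtain b t where bt: "?P q b t" "L' q = V b t" by blast
    then show ?thesis using V_unique[OF as bt(1)] by simp
  qed
  have V_closed: "V a s \<in> carrier M" if "a \<in> carrier R" "s \<in> carrier R" "a \<noteq> \<zero>" "s \<noteq> \<zero>" for a s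
    unfolding V_def using L_closed that by simp
  have "L' \<in> hom (units_of Q) M"
  proof (rule homI; unfold units_of_carrier units_of_mult)
    fix p assume "p \<in> Units Q"
    then obtain a s where "?P p a s" using ex by blast
    then show "L' p \<in> carrier M" using L'_eq V_closed by metis
  next
    fix p q assume p: "p \<in> Units Q" and q: "q \<in> Units Q"
    obtain a s where as: "?P p a s" using ex p by blast
    obtain b t where bt: "?P q b t" using ex q by blast
    obtain u v where uv: "u \<in> carrier R" "v \<in> carrier R" "u \<noteq> \<zero>" "v \<noteq> \<zero>" "s \<otimes> u = b \<otimes> v"
      using ore[of s b] as bt by blast
    have c: "\<phi> a \<in> carrier Q" "\<phi> b \<in> carrier Q" "\<phi> u \<in> carrier Q"
      "\<phi> v \<in> Units Q" "\<phi> s \<in> Units Q" "\<phi> t \<in> Units Q" using \<phi>c reg as bt uv by auto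
    note c' = Q.Units_closed[OF c(4)] Q.Units_closed[OF c(5)] Q.Units_closed[OF c(6)]
      Q.Units_inv_closed[OF c(4)] Q.Units_inv_closed[OF c(5)] Q.Units_inv_closed[OF c(6)]
    have "\<phi> s \<otimes>\<^bsub>Q\<^esub> \<phi> u = \<phi> b \<otimes>\<^bsub>Q\<^esub> \<phi> v" using uv as bt \<phi>m by metis
    then have "inv\<^bsub>Q\<^esub> (\<phi> s) \<otimes>\<^bsub>Q\<^esub> (\<phi> s \<otimes>\<^bsub>Q\<^esub> \<phi> u) \<otimes>\<^bsub>Q\<^esub> inv\<^bsub>Q\<^esub> (\<phi> v) =
      inv\<^bsub>Q\<^esub> (\<phi> s) \<otimes>\<^bsub>Q\<^esub> (\<phi> b \<otimes>\<^bsub>Q\<^esub> \<phi> v) \<otimes>\<^bsub>Q\<^esub> inv\<^bsub>Q\<^esub> (\<phi> v)" by simp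
    then have swap: "\<phi> u \<otimes>\<^bsub>Q\<^esub> inv\<^bsub>Q\<^esub> (\<phi> v) = inv\<^bsub>Q\<^esub> (\<phi> s) \<otimes>\<^bsub>Q\<^esub> \<phi> b"
      using c c' by (simp add: Q.m_assoc[symmetric] Q.Units_l_inv) (simp add: Q.m_assoc Q.Units_r_inv)
    have iv: "inv\<^bsub>Q\<^esub> (\<phi> (t \<otimes> v)) = inv\<^bsub>Q\<^esub> (\<phi> v) \<otimes>\<^bsub>Q\<^esub> inv\<^bsub>Q\<^esub> (\<phi> t)"
      using bt uv \<phi>m[of t v] group.inv_mult_group[OF Q.units_group, of "\<phi> t" "\<phi> v"] c(4,6)
      by (simp add: units_of_carrier units_of_mult Q.units_of_inv Q.Units_m_closed)
    have "p \<otimes>\<^bsub>Q\<^esub> q = \<phi> a \<otimes>\<^bsub>Q\<^esub> (inv\<^bsub>Q\<^esub> (\<phi> s) \<otimes>\<^bsub>Q\<^esub> \<phi> b) \<otimes>\<^bsub>Q\<^esub> inv\<^bsub>Q\<^esub> (\<phi> t)"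
      using as bt c c' by (simp add: Q.m_assoc)
    also have "\<dots> = \<phi> (a \<otimes> u) \<otimes>\<^bsub>Q\<^esub> inv\<^bsub>Q\<^esub> (\<phi> (t \<otimes> v))"
      unfolding swap[symmetric] iv using as uv c c' \<phi>m by (simp add: Q.m_assoc)
    finally have "?P (p \<otimes>\<^bsub>Q\<^esub> q) (a \<otimes> u) (t \<otimes> v)" using as bt uv nonzero_mult by auto
    then have "L' (p \<otimes>\<^bsub>Q\<^esub> q) = V (a \<otimes> u) (t \<otimes> v)" by (rule L'_eq)
    also have "\<dots> = V a s \<otimes>\<^bsub>M\<^esub> V b t"
    proof -
      have Lc: "L a \<in> carrier M" "L b \<in> carrier M" "L s \<in> carrier M" "L t \<in> carrier M"
        "L u \<in> carrier M" "L v \<in> carrier M" using L_closed as bt uv by auto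
      have "L s \<otimes>\<^bsub>M\<^esub> L u = L b \<otimes>\<^bsub>M\<^esub> L v" using L_mult as bt uv by metis
      moreover have "L (a \<otimes> u) = L a \<otimes>\<^bsub>M\<^esub> L u" "L (t \<otimes> v) = L t \<otimes>\<^bsub>M\<^esub> L v"
        using L_mult as bt uv by blast+
      ultimately show ?thesis unfolding V_def using M.fraction_mult_eq Lc by metis
    qed
    also have "\<dots> = L' p \<otimes>\<^bsub>M\<^esub> L' q" using L'_eq as bt by metis
    finally show "L' (p \<otimes>\<^bsub>Q\<^esub> q) = L' p \<otimes>\<^bsub>M\<^esub> L' q" .
  qed
  moreover have "L' (\<phi> a) = L a" if a: "a \<in> carrier R" "a \<noteq> \<zero>" for a
  proof -
    have "?P (\<phi> a) a \<one>" using a one_neq_zero \<phi>1 \<phi>c by simp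
    then have "L' (\<phi> a) = V a \<one>" by (rule L'_eq)
    moreover have "L \<one> \<otimes>\<^bsub>M\<^esub> L \<one> = L \<one>" "L \<one> \<in> carrier M"
      using L_mult[of \<one> \<one>] L_closed[of \<one>] one_neq_zero by simp_all
    then have "L \<one> = \<one>\<^bsub>M\<^esub>" by (metis M.l_cancel_one)
    ultimately show ?thesis unfolding V_def using L_closed a by simp
  qed
  ultimately show ?thesis using that by blast
qed

section \<open>Interval subalgebras as iterated skew polynomial steps\<close>

context CGL_extension
begin

lemma x_image: "1 \<le> j \<Longrightarrow> k \<le> N \<Longrightarrow> x ` {j..k} \<subseteq> carrier A"
  using x_carrier by auto

lemma IA_subalgebra: "1 \<le> j \<Longrightarrow> k \<le> N \<Longrightarrow> subalgebra_of K A (IA j k)"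
  unfolding interval_subalgebra_def by (rule algebra_generated_subalgebra[OF x_image])

lemma IA_subring: "1 \<le> j \<Longrightarrow> k \<le> N \<Longrightarrow> subring (IA j k) A"
  using subalgebraD(1) IA_subalgebra by blast

lemma IA_graded: assumes "1 \<le> j" "k \<le> N" shows "graded_subset (IA j k)"
  unfolding interval_subalgebra_def
proof (rule algebra_generated_graded)
  fix y assume "y \<in> x ` {j..k}"
  then obtain i where i: "i \<in> {j..k}" "y = x i" by blast
  then have "i \<in> {1..N}" using assms by simp
  then show "\<exists>s\<in>carrier \<Gamma>. y \<in> D s" using chr_mem[of i] i(2) by blast
qed

lemma IA_mono: "j' \<le> j \<Longrightarrow> k \<le> k' \<Longrightarrow> IA j k \<subseteq> IA j' k'"
  unfolding interval_subalgebra_def by (rule algebra_generated_mono) auto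

lemma IA_empty: "k < j \<Longrightarrow> IA j k = (\<lambda>k. k \<odot>\<^bsub>A\<^esub> \<one>\<^bsub>A\<^esub>) ` carrier K"
  unfolding interval_subalgebra_def by (simp add: algebra_generated_empty)

lemma x_IA: "i \<in> {j..k} \<Longrightarrow> x i \<in> IA j k"
  unfolding interval_subalgebra_def using algebra_generated_subset by blast

lemma act_additive: "g \<in> carrier Tor \<Longrightarrow> additive (act g)"
  unfolding additive_def using act_add act_closed by blast

text \<open>Torus elements act by scalars on homogeneous elements, so they map every graded subspace
  into itself, and so do their inverses.\<close>

lemma act_graded:
  assumes g: "g \<in> carrier Tor" and T: "graded_subset T" and a: "a \<in> T"
  shows "act g a \<in> T" "\<exists>b\<in>T. act g b = a"
proof -
  have mem: "act g a \<in> T" if g: "g \<in> carrier Tor" for g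
  proof (rule additive_memI[OF act_additive[OF g] T a])
    fix s b assume "s \<in> carrier \<Gamma>" "b \<in> T" "b \<in> D s"
    then show "act g b \<in> T"
      using eigenspaceD(2)[OF _ g] graded_subsetD(4)[OF T] character_closed[OF _ g] by metis
  qed (use graded_subsetD[OF T] in auto)
  then show "act g a \<in> T" using g .
  have ac: "a \<in> carrier A" using graded_subsetD(1)[OF T a] .
  have "act g (act (inv\<^bsub>Tor\<^esub> g) a) = act \<one>\<^bsub>Tor\<^esub> a"
    using act_comp[OF g Tor.inv_closed[OF g] ac] g by simp
  also have "\<dots> = a"
    using group_action.id_eq_one[OF act_action] ac by (metis restrict_apply')
  finally show "\<exists>b\<in>T. act g b = a" using mem[OF Tor.inv_closed[OF g]] by blast
qed

lemma scale_act:
  assumes g: "g \<in> carrier Tor" and a: "a \<in> carrier A"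
  shows "scale (\<lambda>s. s g) a = act g a"
proof (rule additive_eqI[OF scale_additive act_additive[OF g] graded_carrier a])
  fix s b assume s: "s \<in> carrier \<Gamma>" "b \<in> D s"
  show "scale (\<lambda>s. s g) b = act g b"
    using scale_hom[of "\<lambda>s. s g" s b] s g character_closed eigenspaceD(2)[OF s(2) g] by simp
qed (use g character_closed in blast)

lemma delta_eq:
  assumes k: "k \<in> {1..N}" and a: "a \<in> IA 1 (k - 1)"
  shows "x k \<otimes>\<^bsub>A\<^esub> a = act (h k) a \<otimes>\<^bsub>A\<^esub> x k \<oplus>\<^bsub>A\<^esub> \<delta> k a" "\<delta> k a \<in> IA 1 (k - 1)"
  using skew_polynomial[OF k] \<sigma>_eq_h[OF k a] a \<delta>_derivation[OF k]
  unfolding skew_polynomial_over_def skew_derivation_def linear_on_def by auto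

end

context ring
begin

text \<open>Translates the recursive filtration into the coefficient sums of
  \<open>skew_polynomial_over\<close>, whose uniqueness clause then yields
  \<open>free\<close>.\<close>

lemma skew_filtration_finsum:
  assumes T: "subring T R" and x: "x \<in> carrier R"
  shows "f \<in> skew_filtration R T x n \<Longrightarrow> \<exists>c\<in>{..<n} \<rightarrow> T. f = (\<Oplus>i\<in>{..<n}. c i \<otimes> x [^] i)"
proof (induction n arbitrary: f)
  case (Suc n)
  obtain p a where pa: "p \<in> skew_filtration R T x n" "a \<in> T" "f = p \<oplus> a \<otimes> x [^] n"
    using Suc.prems by (auto simp: skew_filtration.simps(2))
  obtain c where c: "c \<in> {..<n} \<rightarrow> T" "p = (\<Oplus>i\<in>{..<n}. c i \<otimes> x [^] i)" using Suc.IH pa by blast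
  have Tc: "t \<in> carrier R" if "t \<in> T" for t using subringD(7)[OF T that] .
  let ?c = "c(n := a)"
  have cc: "c i \<otimes> x [^] i \<in> carrier R" if "i < n" for i using c(1) Tc that x by auto
  have "(\<Oplus>i\<in>{..<Suc n}. ?c i \<otimes> x [^] i) = ?c n \<otimes> x [^] n \<oplus> (\<Oplus>i\<in>{..<n}. ?c i \<otimes> x [^] i)"
    unfolding lessThan_Suc by (rule finsum_insert) (use cc Tc pa x in auto)
  also have "(\<Oplus>i\<in>{..<n}. ?c i \<otimes> x [^] i) = p" unfolding c(2)
    by (rule finsum_cong') (use cc in auto)
  also have "?c n \<otimes> x [^] n \<oplus> p = f"
    using pa Tc x c(2) cc by (simp add: a_comm)
  finally have "f = (\<Oplus>i\<in>{..<Suc n}. ?c i \<otimes> x [^] i)" by simp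
  moreover have "?c \<in> {..<Suc n} \<rightarrow> T" using c pa by (auto simp: less_Suc_eq)
  ultimately show ?case by blast
qed auto

end

context CGL_extension
begin

text \<open>The lower end \<open>j\<close> is arbitrary: \<open>j = 1\<close> gives the chain
  defining the extension, and larger \<open>j\<close> serve the symmetric case. Stability under
  \<open>\<delta> k\<close> is what turns A_[j,k] into a skew polynomial algebra over
  A_[j,k-1].\<close>

lemma chain_step:
  assumes j: "1 \<le> j" "j \<le> k" and k: "k \<le> N"
    and \<delta>: "\<And>a. a \<in> IA j (k - 1) \<Longrightarrow> \<delta> k a \<in> IA j (k - 1)"
  shows "skew_step A (IA j (k - 1)) (x k) (scale (\<lambda>s. s (h k)))"
    and "skew_step.ext A (IA j (k - 1)) (x k) = IA j k"
proof -
  let ?T = "IA j (k - 1)" and ?s = "scale (\<lambda>s. s (h k))"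
  have kN: "k \<in> {1..N}" using assms by auto
  have g: "h k \<in> carrier Tor" using h_torus[OF kN] .
  have T: "graded_subset ?T" "subring ?T A" "subalgebra_of K A ?T"
    using IA_graded IA_subring IA_subalgebra assms by auto
  have sub: "?T \<subseteq> IA 1 (k - 1)" using IA_mono j by auto
  have Tc: "a \<in> carrier A" if "a \<in> ?T" for a using graded_subsetD(1)[OF T(1) that] .
  have sa: "?s a = act (h k) a" if "a \<in> ?T" for a using scale_act g Tc that by blast
  show step: "skew_step A ?T (x k) ?s"
  proof (intro skew_step.intro skew_filtered.intro skew_filtered_axioms.intro skew_step_axioms.intro ring_axioms T(2) x_carrier[OF kN])
    show "?s a \<in> ?T" if "a \<in> ?T" for a
      using act_graded(1)[OF g T(1) that] sa[OF that] by simp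
    show "a = \<zero>\<^bsub>A\<^esub>" if "a \<in> ?T" "?s a = \<zero>\<^bsub>A\<^esub>" for a using that sa act_inj[OF g Tc] by simp
    show "\<exists>b\<in>?T. ?s b = a" if "a \<in> ?T" for a
      using act_graded(2)[OF g T(1) that] sa by auto
    show "\<exists>d\<in>?T. x k \<otimes>\<^bsub>A\<^esub> a = ?s a \<otimes>\<^bsub>A\<^esub> x k \<oplus>\<^bsub>A\<^esub> d" if "a \<in> ?T" for a
      using delta_eq(1)[OF kN] \<delta>[OF that] sa[OF that] sub that by (metis subsetD)
    show "a = \<zero>\<^bsub>A\<^esub>" if a: "a \<in> ?T" "a \<otimes>\<^bsub>A\<^esub> x k [^]\<^bsub>A\<^esub> n \<in> skew_filtration A ?T (x k) n" for a n
    proof -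
      obtain c where c: "c \<in> {..<n} \<rightarrow> ?T" "a \<otimes>\<^bsub>A\<^esub> x k [^]\<^bsub>A\<^esub> n = (\<Oplus>\<^bsub>A\<^esub>i\<in>{..<n}. c i \<otimes>\<^bsub>A\<^esub> x k [^]\<^bsub>A\<^esub> i)"
        using skew_filtration_finsum[OF T(2) x_carrier[OF kN] a(2)] by blast
      \<comment> \<open>Appending the coefficient -a in degree \<open>n\<close> to the expansion in
        lower degrees gives a vanishing left polynomial.\<close>
      let ?c = "c(n := \<ominus>\<^bsub>A\<^esub> a)"
      note xc = x_carrier[OF kN]
      have cc: "c i \<otimes>\<^bsub>A\<^esub> x k [^]\<^bsub>A\<^esub> i \<in> carrier A" if "i < n" for i using c(1) Tc that xc by auto
      have "(\<Oplus>\<^bsub>A\<^esub>i\<in>{..<Suc n}. ?c i \<otimes>\<^bsub>A\<^esub> x k [^]\<^bsub>A\<^esub> i) =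
          ?c n \<otimes>\<^bsub>A\<^esub> x k [^]\<^bsub>A\<^esub> n \<oplus>\<^bsub>A\<^esub> (\<Oplus>\<^bsub>A\<^esub>i\<in>{..<n}. ?c i \<otimes>\<^bsub>A\<^esub> x k [^]\<^bsub>A\<^esub> i)"
        unfolding lessThan_Suc by (rule M.finsum_insert) (use cc Tc a xc in auto)
      also have "(\<Oplus>\<^bsub>A\<^esub>i\<in>{..<n}. ?c i \<otimes>\<^bsub>A\<^esub> x k [^]\<^bsub>A\<^esub> i) = a \<otimes>\<^bsub>A\<^esub> x k [^]\<^bsub>A\<^esub> n" unfolding c(2)
        by (rule M.finsum_cong') (use cc in auto)
      also have "?c n \<otimes>\<^bsub>A\<^esub> x k [^]\<^bsub>A\<^esub> n \<oplus>\<^bsub>A\<^esub> a \<otimes>\<^bsub>A\<^esub> x k [^]\<^bsub>A\<^esub> n = \<zero>\<^bsub>A\<^esub>"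
        using Tc a xc by (simp add: l_minus M.l_neg)
      finally have 0: "(\<Oplus>\<^bsub>A\<^esub>i\<in>{..<Suc n}. ?c i \<otimes>\<^bsub>A\<^esub> x k [^]\<^bsub>A\<^esub> i) = \<zero>\<^bsub>A\<^esub>" .
      have "?c \<in> {..<Suc n} \<rightarrow> IA 1 (k - 1)"
        using c(1) subsetD[OF sub subringD(6)[OF T(2) a(1)]] subsetD[OF sub] by (auto simp: less_Suc_eq Pi_iff)
      then have "\<forall>i<Suc n. ?c i = \<zero>\<^bsub>A\<^esub>"
        using skew_polynomial[OF kN] 0 unfolding skew_polynomial_over_def by blast
      then have "\<ominus>\<^bsub>A\<^esub> a = \<zero>\<^bsub>A\<^esub>" by (metis fun_upd_same lessI)
      then show "a = \<zero>\<^bsub>A\<^esub>" using Tc[OF a(1)] by (metis M.minus_minus M.minus_equality M.l_zero M.zero_closed)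
    qed
  qed
  interpret S: skew_step A ?T "x k" ?s by (rule step)
  note U = IA_subring[OF j(1) k] and US = subringD[OF IA_subring[OF j(1) k]]
  have xk: "x k [^]\<^bsub>A\<^esub> n \<in> IA j k" for n :: nat
    by (induction n) (use US x_IA[of k j k] j in auto)
  have "S.P n \<subseteq> IA j k" for n
  proof (induction n)
    case (Suc n)
    show ?case
    proof
      fix f assume "f \<in> S.P (Suc n)"
      then obtain p a where "p \<in> S.P n" "a \<in> ?T" "f = p \<oplus>\<^bsub>A\<^esub> a \<otimes>\<^bsub>A\<^esub> x k [^]\<^bsub>A\<^esub> n" using S.P_SucE by blast
      moreover have "?T \<subseteq> IA j k" using IA_mono by simp
      ultimately show "f \<in> IA j k" using Suc xk US(4,5) by blast
    qed
  qed (use US in auto)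
  moreover have "algebra_generated K A (x ` {j..k}) \<subseteq> S.ext"
  proof (rule algebra_generated_least)
    note SE = subringD[OF S.subring_ext]
    show "subalgebra_of K A S.ext"
    proof (rule subalgebraI)
      fix c a assume c: "c \<in> carrier K" and a: "a \<in> S.ext"
      have "c \<odot>\<^bsub>A\<^esub> \<one>\<^bsub>A\<^esub> \<in> S.ext"
        using subalgebraD(2)[OF T(3) c subringD(3)[OF T(2)]] S.T_subset_ext by blast
      then have "(c \<odot>\<^bsub>A\<^esub> \<one>\<^bsub>A\<^esub>) \<otimes>\<^bsub>A\<^esub> a \<in> S.ext" using SE a by blast
      then show "c \<odot>\<^bsub>A\<^esub> a \<in> S.ext" using SE(7)[OF a] c by (simp add: smult_mult_left)
    qed (use SE in auto)
    show "x ` {j..k} \<subseteq> S.ext"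
    proof (rule image_subsetI)
      fix i assume i: "i \<in> {j..k}"
      show "x i \<in> S.ext"
      proof (cases "i = k")
        case True
        then show ?thesis using S.x_ext by simp
      next
        case False
        then have "i \<in> {j..k - 1}" using i by auto
        then show ?thesis using x_IA S.T_subset_ext by blast
      qed
    qed
  qed
  then have "IA j k \<subseteq> S.ext" unfolding interval_subalgebra_def .
  ultimately show "S.ext = IA j k" unfolding S.ext_def by blast
qed

lemma chain_step_1:
  assumes k: "k \<in> {1..N}"
  shows "skew_step A (IA 1 (k - 1)) (x k) (scale (\<lambda>s. s (h k)))"
    and "skew_step.ext A (IA 1 (k - 1)) (x k) = IA 1 k"
  using chain_step[of 1 k] delta_eq(2)[OF k] k by auto

text \<open>Solving the commutation rule for \<open>\<delta> k a\<close> exhibits it as a difference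
  of two elements of the same degree.\<close>

lemma delta_hom:
  assumes k: "k \<in> {1..N}" and a: "a \<in> IA 1 (k - 1)" "a \<in> D s" and s: "s \<in> carrier \<Gamma>"
  shows "\<delta> k a \<in> D (s \<otimes>\<^bsub>\<Gamma>\<^esub> chr k)" "\<delta> k a = x k \<otimes>\<^bsub>A\<^esub> a \<ominus>\<^bsub>A\<^esub> s (h k) \<odot>\<^bsub>A\<^esub> (a \<otimes>\<^bsub>A\<^esub> x k)"
proof -
  have g: "h k \<in> carrier Tor" using h_torus[OF k] .
  note c = eigenspaceD(1)[OF a(2)] x_carrier[OF k] character_closed[OF s g]
  have d: "\<delta> k a \<in> carrier A" using delta_eq(2)[OF k a(1)] graded_subsetD(1)[OF IA_graded] k
    by (metis atLeastAtMost_iff diff_le_self le_trans order_refl)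
  have eq: "x k \<otimes>\<^bsub>A\<^esub> a = s (h k) \<odot>\<^bsub>A\<^esub> (a \<otimes>\<^bsub>A\<^esub> x k) \<oplus>\<^bsub>A\<^esub> \<delta> k a"
    using delta_eq(1)[OF k a(1)] eigenspaceD(2)[OF a(2) g] c by (simp add: smult_mult_left)
  show e: "\<delta> k a = x k \<otimes>\<^bsub>A\<^esub> a \<ominus>\<^bsub>A\<^esub> s (h k) \<odot>\<^bsub>A\<^esub> (a \<otimes>\<^bsub>A\<^esub> x k)"
    unfolding eq using c d by (simp add: a_minus_def M.a_comm M.r_neg2 M.r_neg1 M.a_lcomm M.l_neg M.r_neg)
  note \<chi> = chr_mem[OF k]
  have sc: "s \<otimes>\<^bsub>\<Gamma>\<^esub> chr k \<in> carrier \<Gamma>" using s \<chi> by simp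
  have 1: "x k \<otimes>\<^bsub>A\<^esub> a \<in> D (s \<otimes>\<^bsub>\<Gamma>\<^esub> chr k)"
    using D_mult[OF \<chi>(1) s \<chi>(2) a(2)] G.m_comm[OF s \<chi>(1)] by simp
  have 2: "a \<otimes>\<^bsub>A\<^esub> x k \<in> D (s \<otimes>\<^bsub>\<Gamma>\<^esub> chr k)" using D_mult[OF s \<chi>(1) a(2) \<chi>(2)] .
  have "\<delta> k a = x k \<otimes>\<^bsub>A\<^esub> a \<oplus>\<^bsub>A\<^esub> \<ominus>\<^bsub>K\<^esub> s (h k) \<odot>\<^bsub>A\<^esub> (a \<otimes>\<^bsub>A\<^esub> x k)"
    unfolding e using c by (simp add: a_minus_def smult_l_minus)
  then show "\<delta> k a \<in> D (s \<otimes>\<^bsub>\<Gamma>\<^esub> chr k)"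
    using D_add[OF sc 1 D_smult[OF sc _ 2]] c by simp
qed

end

section \<open>Commutators in twists of a CGL extension\<close>

context CGL_extension
begin

lemma delta_power:
  assumes k: "k \<in> {1..N}" and j: "j \<in> {1..k - 1}"
  shows "(\<delta> k ^^ m) (x j) \<in> IA 1 (k - 1)" "(\<delta> k ^^ m) (x j) \<in> D (chr j \<otimes>\<^bsub>\<Gamma>\<^esub> chr k [^]\<^bsub>\<Gamma>\<^esub> m)"
proof (induction m)
  case 0
  have "j \<in> {1..N}" using k j by auto
  then show "(\<delta> k ^^ 0) (x j) \<in> IA 1 (k - 1)" "(\<delta> k ^^ 0) (x j) \<in> D (chr j \<otimes>\<^bsub>\<Gamma>\<^esub> chr k [^]\<^bsub>\<Gamma>\<^esub> (0::nat))"
    using x_IA[OF j] chr_mem[of j] by auto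
next
  case (Suc m)
  have jN: "j \<in> {1..N}" using k j by auto
  note \<chi> = chr_mem(1)[OF jN] chr_mem(1)[OF k]
  show "(\<delta> k ^^ Suc m) (x j) \<in> IA 1 (k - 1)" using delta_eq(2)[OF k Suc(1)] by simp
  have "\<delta> k ((\<delta> k ^^ m) (x j)) \<in> D (chr j \<otimes>\<^bsub>\<Gamma>\<^esub> chr k [^]\<^bsub>\<Gamma>\<^esub> m \<otimes>\<^bsub>\<Gamma>\<^esub> chr k)"
    by (rule delta_hom(1)[OF k Suc(1,2)]) (use \<chi> in simp)
  then show "(\<delta> k ^^ Suc m) (x j) \<in> D (chr j \<otimes>\<^bsub>\<Gamma>\<^esub> chr k [^]\<^bsub>\<Gamma>\<^esub> Suc m)"
    using \<chi> by (simp add: G.m_assoc)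
qed

lemma lambda_eq: "k \<in> {1..N} \<Longrightarrow> CGL_lambda K A x act h k = chr k (h k)"
  unfolding CGL_lambda_def chr_def using h_torus by simp

lemma lambda_power: "k \<in> {1..N} \<Longrightarrow> 0 < n \<Longrightarrow> chr k (h k) [^]\<^bsub>K\<^esub> (n::nat) \<noteq> \<one>\<^bsub>K\<^esub>"
  using not_root_of_unity[of k] lambda_eq[of k] unfolding CGL_lambda_def root_of_unity_def by metis

lemma character_pow:
  "\<chi> \<in> carrier \<Gamma> \<Longrightarrow> g \<in> carrier Tor \<Longrightarrow> (\<chi> [^]\<^bsub>\<Gamma>\<^esub> (n::nat)) g = \<chi> g [^]\<^bsub>K\<^esub> n"
  by (induction n) (auto simp: character_one character_mult)

text \<open>The invariant is that the defect of \<open>Z\<close> is a scalar multiple of one single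
  iterate of \<open>\<delta> k\<close>. Multiplying \<open>Z\<close> by \<open>x k\<close> and
  adding a suitable multiple of this iterate moves the defect on to the next one.\<close>

lemma normal_element_aux:
  assumes k: "k \<in> {1..N}" and j: "j \<in> {1..k - 1}"
  shows "\<exists>Z g. g \<in> carrier K \<and> Z \<in> D (chr j \<otimes>\<^bsub>\<Gamma>\<^esub> chr k [^]\<^bsub>\<Gamma>\<^esub> p) \<and>
    (\<exists>q\<in>skew_filtration A (IA 1 (k - 1)) (x k) p. Z = q \<oplus>\<^bsub>A\<^esub> x j \<otimes>\<^bsub>A\<^esub> x k [^]\<^bsub>A\<^esub> p) \<and>
    x k \<otimes>\<^bsub>A\<^esub> Z = chr j (h k) \<odot>\<^bsub>A\<^esub> (Z \<otimes>\<^bsub>A\<^esub> x k) \<oplus>\<^bsub>A\<^esub> g \<odot>\<^bsub>A\<^esub> (\<delta> k ^^ Suc p) (x j)"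
proof -
  have jN: "j \<in> {1..N}" using k j by auto
  note \<chi> = chr_mem(1)[OF jN] chr_mem(1)[OF k] and xc = x_carrier[OF jN] x_carrier[OF k]
  have g: "h k \<in> carrier Tor" using h_torus k .
  interpret S: skew_step A "IA 1 (k - 1)" "x k" "scale (\<lambda>s. s (h k))" by (rule chain_step_1(1)[OF k])
  let ?a = "\<lambda>m. (\<delta> k ^^ m) (x j)" and ?l = "chr j (h k)" and ?q = "chr k (h k)"
  have l: "?l \<in> Units K" "?l \<in> carrier K" "?q \<in> carrier K"
    using chr_act(1)[OF jN g] chr_act(1)[OF k g] by (auto simp: R.Units_closed)
  note aT = delta_power(1)[OF k j] and aD = delta_power(2)[OF k j]
  have ac: "?a m \<in> carrier A" for m using aT S.Ts(7) by blast
  \<comment> \<open>The iterate has the degree of x_j times the m-th power of that of x_k, so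
    \<open>h k\<close> scales it by l q^m, with l and q the scalars \<open>?l\<close> and
    \<open>?q\<close>.\<close>
  have xa: "x k \<otimes>\<^bsub>A\<^esub> ?a m = (?l \<otimes>\<^bsub>K\<^esub> ?q [^]\<^bsub>K\<^esub> m) \<odot>\<^bsub>A\<^esub> (?a m \<otimes>\<^bsub>A\<^esub> x k) \<oplus>\<^bsub>A\<^esub> ?a (Suc m)" for m
  proof -
    have "act (h k) (?a m) = (?l \<otimes>\<^bsub>K\<^esub> ?q [^]\<^bsub>K\<^esub> m) \<odot>\<^bsub>A\<^esub> ?a m"
      using eigenspaceD(2)[OF aD g] \<chi> g by (simp add: character_mult character_pow)
    then show ?thesis using delta_eq(1)[OF k aT[of m]] ac l xc by (simp add: smult_mult_left)
  qed
  show ?thesis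
  proof (induction p)
    case 0
    have "\<zero>\<^bsub>A\<^esub> \<in> S.P 0" by simp
    moreover have "x k \<otimes>\<^bsub>A\<^esub> x j = ?l \<odot>\<^bsub>A\<^esub> (x j \<otimes>\<^bsub>A\<^esub> x k) \<oplus>\<^bsub>A\<^esub> \<one>\<^bsub>K\<^esub> \<odot>\<^bsub>A\<^esub> ?a (Suc 0)"
      using xa[of 0] l ac[of 1] by simp
    ultimately show ?case using aD[of 0] xc
      by (intro exI[of _ "x j"] exI[of _ "\<one>\<^bsub>K\<^esub>"]) auto
  next
    case (Suc p)
    then obtain Z b t where Z: "b \<in> carrier K" "Z \<in> D (chr j \<otimes>\<^bsub>\<Gamma>\<^esub> chr k [^]\<^bsub>\<Gamma>\<^esub> p)"
      "t \<in> S.P p" "Z = t \<oplus>\<^bsub>A\<^esub> x j \<otimes>\<^bsub>A\<^esub> x k [^]\<^bsub>A\<^esub> p"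
      "x k \<otimes>\<^bsub>A\<^esub> Z = ?l \<odot>\<^bsub>A\<^esub> (Z \<otimes>\<^bsub>A\<^esub> x k) \<oplus>\<^bsub>A\<^esub> b \<odot>\<^bsub>A\<^esub> ?a (Suc p)" by blast
    have Zc: "Z \<in> carrier A" using Z(2) eigenspaceD(1) by blast
    let ?q' = "?q [^]\<^bsub>K\<^esub> Suc p"
    have qc: "?q' \<in> carrier K" using l by simp
    have "\<one>\<^bsub>K\<^esub> \<ominus>\<^bsub>K\<^esub> ?q' \<in> Units K"
      using lambda_power[OF k, of "Suc p"] qc by (auto simp: Units_K)
    then have v: "?l \<otimes>\<^bsub>K\<^esub> (\<one>\<^bsub>K\<^esub> \<ominus>\<^bsub>K\<^esub> ?q') \<in> Units K" using l by (intro R.Units_m_closed)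
    \<comment> \<open>The terms with one factor \<open>x k\<close> on the right combine to a
      multiple of \<open>Z'\<close> exactly if b + b' l q^(p+1) = l b'. This can be solved because q
      is not a root of unity.\<close>
    define b' where "b' = b \<otimes>\<^bsub>K\<^esub> inv\<^bsub>K\<^esub> (?l \<otimes>\<^bsub>K\<^esub> (\<one>\<^bsub>K\<^esub> \<ominus>\<^bsub>K\<^esub> ?q'))"
    have b': "b' \<in> carrier K" unfolding b'_def using Z(1) v by simp
    have "b' \<otimes>\<^bsub>K\<^esub> (?l \<otimes>\<^bsub>K\<^esub> (\<one>\<^bsub>K\<^esub> \<ominus>\<^bsub>K\<^esub> ?q')) = b"
      unfolding b'_def using Z(1) v by (simp add: R.m_assoc R.Units_closed R.Units_l_inv)
    moreover have "b' \<otimes>\<^bsub>K\<^esub> (?l \<otimes>\<^bsub>K\<^esub> (\<one>\<^bsub>K\<^esub> \<ominus>\<^bsub>K\<^esub> ?q')) = b' \<otimes>\<^bsub>K\<^esub> ?l \<ominus>\<^bsub>K\<^esub> b' \<otimes>\<^bsub>K\<^esub> (?l \<otimes>\<^bsub>K\<^esub> ?q')"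
      using b' l qc by (simp add: R.minus_eq R.r_distr R.r_minus)
    ultimately have b_eq: "b \<oplus>\<^bsub>K\<^esub> b' \<otimes>\<^bsub>K\<^esub> (?l \<otimes>\<^bsub>K\<^esub> ?q') = ?l \<otimes>\<^bsub>K\<^esub> b'"
      using b' l qc Z(1) by (metis R.add.inv_solve_right' R.m_closed R.m_comm R.minus_eq)
    define Z' where "Z' = Z \<otimes>\<^bsub>A\<^esub> x k \<oplus>\<^bsub>A\<^esub> b' \<odot>\<^bsub>A\<^esub> ?a (Suc p)"
    have c: "Z \<otimes>\<^bsub>A\<^esub> x k \<in> carrier A" "?a (Suc p) \<in> carrier A" "?a (Suc (Suc p)) \<in> carrier A"
      "?a (Suc p) \<otimes>\<^bsub>A\<^esub> x k \<in> carrier A" "?l \<otimes>\<^bsub>K\<^esub> ?q' \<in> carrier K"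
      using Zc xc ac[of "Suc p"] ac[of "Suc (Suc p)"] l qc by auto
    have "x k \<otimes>\<^bsub>A\<^esub> Z' = (x k \<otimes>\<^bsub>A\<^esub> Z) \<otimes>\<^bsub>A\<^esub> x k \<oplus>\<^bsub>A\<^esub> b' \<odot>\<^bsub>A\<^esub> (x k \<otimes>\<^bsub>A\<^esub> ?a (Suc p))"
      unfolding Z'_def using c Zc xc b' by (simp add: r_distr smult_mult_right m_assoc)
    also have "(x k \<otimes>\<^bsub>A\<^esub> Z) \<otimes>\<^bsub>A\<^esub> x k = ?l \<odot>\<^bsub>A\<^esub> (Z \<otimes>\<^bsub>A\<^esub> x k \<otimes>\<^bsub>A\<^esub> x k) \<oplus>\<^bsub>A\<^esub> b \<odot>\<^bsub>A\<^esub> (?a (Suc p) \<otimes>\<^bsub>A\<^esub> x k)"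
      unfolding Z(5) using c l Z(1) xc by (simp add: l_distr smult_mult_left)
    also have "b' \<odot>\<^bsub>A\<^esub> (x k \<otimes>\<^bsub>A\<^esub> ?a (Suc p)) =
        (b' \<otimes>\<^bsub>K\<^esub> (?l \<otimes>\<^bsub>K\<^esub> ?q')) \<odot>\<^bsub>A\<^esub> (?a (Suc p) \<otimes>\<^bsub>A\<^esub> x k) \<oplus>\<^bsub>A\<^esub> b' \<odot>\<^bsub>A\<^esub> ?a (Suc (Suc p))"
      unfolding xa using c b' l by (simp only: smult_r_distr smult_assoc1 smult_closed)
    also have "(?l \<odot>\<^bsub>A\<^esub> (Z \<otimes>\<^bsub>A\<^esub> x k \<otimes>\<^bsub>A\<^esub> x k) \<oplus>\<^bsub>A\<^esub> b \<odot>\<^bsub>A\<^esub> (?a (Suc p) \<otimes>\<^bsub>A\<^esub> x k)) \<oplus>\<^bsub>A\<^esub>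
        ((b' \<otimes>\<^bsub>K\<^esub> (?l \<otimes>\<^bsub>K\<^esub> ?q')) \<odot>\<^bsub>A\<^esub> (?a (Suc p) \<otimes>\<^bsub>A\<^esub> x k) \<oplus>\<^bsub>A\<^esub> b' \<odot>\<^bsub>A\<^esub> ?a (Suc (Suc p))) =
      (?l \<odot>\<^bsub>A\<^esub> (Z \<otimes>\<^bsub>A\<^esub> x k \<otimes>\<^bsub>A\<^esub> x k) \<oplus>\<^bsub>A\<^esub> (b \<oplus>\<^bsub>K\<^esub> b' \<otimes>\<^bsub>K\<^esub> (?l \<otimes>\<^bsub>K\<^esub> ?q')) \<odot>\<^bsub>A\<^esub> (?a (Suc p) \<otimes>\<^bsub>A\<^esub> x k))
        \<oplus>\<^bsub>A\<^esub> b' \<odot>\<^bsub>A\<^esub> ?a (Suc (Suc p))"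
      using c b' l Z(1) xc by (simp only: smult_l_distr smult_closed R.m_closed M.a_assoc M.a_closed m_closed)
    also have "?l \<odot>\<^bsub>A\<^esub> (Z \<otimes>\<^bsub>A\<^esub> x k \<otimes>\<^bsub>A\<^esub> x k) \<oplus>\<^bsub>A\<^esub> (b \<oplus>\<^bsub>K\<^esub> b' \<otimes>\<^bsub>K\<^esub> (?l \<otimes>\<^bsub>K\<^esub> ?q')) \<odot>\<^bsub>A\<^esub> (?a (Suc p) \<otimes>\<^bsub>A\<^esub> x k) =
        ?l \<odot>\<^bsub>A\<^esub> (Z' \<otimes>\<^bsub>A\<^esub> x k)"
      unfolding b_eq Z'_def using c b' l xc
      by (simp only: l_distr smult_mult_left smult_r_distr smult_assoc1 smult_closed m_closed)
    finally have eq: "x k \<otimes>\<^bsub>A\<^esub> Z' = ?l \<odot>\<^bsub>A\<^esub> (Z' \<otimes>\<^bsub>A\<^esub> x k) \<oplus>\<^bsub>A\<^esub> b' \<odot>\<^bsub>A\<^esub> ?a (Suc (Suc p))" .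
    have \<chi>p: "chr j \<otimes>\<^bsub>\<Gamma>\<^esub> chr k [^]\<^bsub>\<Gamma>\<^esub> p \<in> carrier \<Gamma>" "chr j \<otimes>\<^bsub>\<Gamma>\<^esub> chr k [^]\<^bsub>\<Gamma>\<^esub> Suc p \<in> carrier \<Gamma>"
      using \<chi> by auto
    have "Z \<otimes>\<^bsub>A\<^esub> x k \<in> D (chr j \<otimes>\<^bsub>\<Gamma>\<^esub> chr k [^]\<^bsub>\<Gamma>\<^esub> Suc p)"
      using D_mult[OF \<chi>p(1) \<chi>(2) Z(2) chr_mem(2)[OF k]] \<chi> by (simp add: G.m_assoc)
    then have ZD: "Z' \<in> D (chr j \<otimes>\<^bsub>\<Gamma>\<^esub> chr k [^]\<^bsub>\<Gamma>\<^esub> Suc p)"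
      unfolding Z'_def using D_add[OF \<chi>p(2) _ D_smult[OF \<chi>p(2) b' aD]] by blast
    have bT: "b' \<odot>\<^bsub>A\<^esub> ?a (Suc p) \<in> IA 1 (k - 1)"
      using subalgebraD(2)[OF IA_subalgebra b' aT[of "Suc p"]] k by auto
    have "b' \<odot>\<^bsub>A\<^esub> ?a (Suc p) \<in> S.P (Suc p)"
      using S.P_monom[OF bT, of 0] S.P_mono[of "Suc 0" "Suc p"] S.Ts(7)[OF bT] by simp
    then have tP: "t \<otimes>\<^bsub>A\<^esub> x k \<oplus>\<^bsub>A\<^esub> b' \<odot>\<^bsub>A\<^esub> ?a (Suc p) \<in> S.P (Suc p)"
      using S.P_add S.P_mult_x Z(3) by blast
    have "Z' = (t \<otimes>\<^bsub>A\<^esub> x k \<oplus>\<^bsub>A\<^esub> b' \<odot>\<^bsub>A\<^esub> ?a (Suc p)) \<oplus>\<^bsub>A\<^esub> x j \<otimes>\<^bsub>A\<^esub> x k [^]\<^bsub>A\<^esub> Suc p"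
      unfolding Z'_def Z(4) using S.P_carrier[OF Z(3)] xc c b' by (simp add: l_distr m_assoc M.a_ac)
    then show ?case using b' ZD tP eq by blast
  qed
qed

text \<open>Local nilpotency removes the defect after finitely many steps, and the leading
  coefficient x_j keeps the element nonzero.\<close>

lemma normal_element:
  assumes k: "k \<in> {1..N}" and j: "j \<in> {1..k - 1}"
  obtains z n where "z \<noteq> \<zero>\<^bsub>A\<^esub>" "z \<in> D (chr j \<otimes>\<^bsub>\<Gamma>\<^esub> chr k [^]\<^bsub>\<Gamma>\<^esub> (n::nat))"
    "x k \<otimes>\<^bsub>A\<^esub> z = chr j (h k) \<odot>\<^bsub>A\<^esub> (z \<otimes>\<^bsub>A\<^esub> x k)"
proof -
  have jN: "j \<in> {1..N}" and k2: "k \<in> {2..N}" using k j by auto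
  interpret S: skew_step A "IA 1 (k - 1)" "x k" "scale (\<lambda>s. s (h k))" by (rule chain_step_1(1)[OF k])
  have xj: "x j \<in> IA 1 (k - 1)" by (rule x_IA[OF j])
  obtain n where "(\<delta> k ^^ n) (x j) = \<zero>\<^bsub>A\<^esub>" using locally_nilpotent[OF k2 xj] by blast
  moreover have "\<delta> k \<zero>\<^bsub>A\<^esub> = \<zero>\<^bsub>A\<^esub>"
  proof -
    have "\<zero>\<^bsub>A\<^esub> \<in> IA 1 (k - 1)" by (rule S.Ts(2))
    then show ?thesis
      using \<delta>_derivation[OF k] S.Ts(7) delta_eq(2)[OF k] unfolding skew_derivation_def
      by (metis M.zero_closed R.zero_closed linear_onD(3) smult_l_null)
  qed
  ultimately have 0: "(\<delta> k ^^ Suc n) (x j) = \<zero>\<^bsub>A\<^esub>" by simp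
  obtain Z b q where Z: "b \<in> carrier K" "Z \<in> D (chr j \<otimes>\<^bsub>\<Gamma>\<^esub> chr k [^]\<^bsub>\<Gamma>\<^esub> n)"
    "q \<in> S.P n" "Z = q \<oplus>\<^bsub>A\<^esub> x j \<otimes>\<^bsub>A\<^esub> x k [^]\<^bsub>A\<^esub> n"
    "x k \<otimes>\<^bsub>A\<^esub> Z = chr j (h k) \<odot>\<^bsub>A\<^esub> (Z \<otimes>\<^bsub>A\<^esub> x k) \<oplus>\<^bsub>A\<^esub> b \<odot>\<^bsub>A\<^esub> (\<delta> k ^^ Suc n) (x j)"
    using normal_element_aux[OF k j] by blast
  have "Z \<noteq> \<zero>\<^bsub>A\<^esub>" unfolding Z(4) by (rule S.lead_nonzero[OF Z(3) xj x_nonzero[OF jN]])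
  moreover have "x k \<otimes>\<^bsub>A\<^esub> Z = chr j (h k) \<odot>\<^bsub>A\<^esub> (Z \<otimes>\<^bsub>A\<^esub> x k)"
    using Z(5) 0 Z(1) eigenspaceD(1)[OF Z(2)] x_carrier[OF k] character_closed[OF chr_mem(1)[OF jN] h_torus[OF k]]
    by simp
  ultimately show ?thesis using that Z(2) by blast
qed

end

section \<open>The alternating bicharacter of a cocycle\<close>

context assoc_algebra
begin

lemma U_cancel_right:
  assumes p: "p \<in> Units K" and "a \<in> carrier K" "b \<in> carrier K" "a \<otimes>\<^bsub>K\<^esub> p = b \<otimes>\<^bsub>K\<^esub> p"
  shows "a = b"
  using assms R.Units_l_cancel[OF p, of a b] R.Units_closed[OF p] by (simp add: R.m_comm)

end

context twisted_algebra
begin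

definition commutation :: "'g \<Rightarrow> 'g \<Rightarrow> 'k" where
  "commutation s t = c s t \<otimes>\<^bsub>K\<^esub> inv\<^bsub>K\<^esub> (c t s)"

lemma commutation_Units: "s \<in> carrier \<Gamma> \<Longrightarrow> t \<in> carrier \<Gamma> \<Longrightarrow> commutation s t \<in> Units K"
  unfolding commutation_def by (intro units_mult_closed c_Units R.Units_inv_Units)

lemma commutation_self: "s \<in> carrier \<Gamma> \<Longrightarrow> commutation s s = \<one>\<^bsub>K\<^esub>"
  unfolding commutation_def using c_Units R.Units_r_inv by blast

lemma commutation_eq:
  "s \<in> carrier \<Gamma> \<Longrightarrow> t \<in> carrier \<Gamma> \<Longrightarrow> commutation s t \<otimes>\<^bsub>K\<^esub> c t s = c s t"
  unfolding commutation_def using c_Units[of s t] c_Units[of t s]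
  by (simp add: R.m_assoc R.Units_closed R.Units_l_inv)

text \<open>Three instances of the cocycle identity, at (s, t, u), (t, s, u) and (t, u, s).
  Multiplying by the unit \<open>?p\<close> lets all of them be applied before cancelling.\<close>

lemma commutation_mult_right:
  assumes s: "s \<in> carrier \<Gamma>" and t: "t \<in> carrier \<Gamma>" and u: "u \<in> carrier \<Gamma>"
  shows "commutation s (t \<otimes>\<^bsub>\<Gamma>\<^esub> u) = commutation s t \<otimes>\<^bsub>K\<^esub> commutation s u"
proof -
  note C = c_carrier commutation_Units[THEN R.Units_closed]
  have tu: "t \<otimes>\<^bsub>\<Gamma>\<^esub> u \<in> carrier \<Gamma>" and su: "s \<otimes>\<^bsub>\<Gamma>\<^esub> u \<in> carrier \<Gamma>" and st: "s \<otimes>\<^bsub>\<Gamma>\<^esub> t \<in> carrier \<Gamma>" using s t u by auto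
  let ?X = "commutation s t \<otimes>\<^bsub>K\<^esub> commutation s u"
  have 1: "c s (t \<otimes>\<^bsub>\<Gamma>\<^esub> u) \<otimes>\<^bsub>K\<^esub> c t u = c (s \<otimes>\<^bsub>\<Gamma>\<^esub> t) u \<otimes>\<^bsub>K\<^esub> c s t" by (rule c_cocycle[OF s t u])
  have 2: "c t (s \<otimes>\<^bsub>\<Gamma>\<^esub> u) \<otimes>\<^bsub>K\<^esub> c s u = c (s \<otimes>\<^bsub>\<Gamma>\<^esub> t) u \<otimes>\<^bsub>K\<^esub> c t s"
    using c_cocycle[OF t s u] G.m_comm[OF s t] by simp
  have 3: "c t (s \<otimes>\<^bsub>\<Gamma>\<^esub> u) \<otimes>\<^bsub>K\<^esub> c u s = c (t \<otimes>\<^bsub>\<Gamma>\<^esub> u) s \<otimes>\<^bsub>K\<^esub> c t u"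
    using c_cocycle[OF t u s] G.m_comm[OF s u] by simp
  have e: "c s t = commutation s t \<otimes>\<^bsub>K\<^esub> c t s" "c s u = commutation s u \<otimes>\<^bsub>K\<^esub> c u s"
    using commutation_eq s t u by simp_all
  let ?p = "c t u \<otimes>\<^bsub>K\<^esub> c (s \<otimes>\<^bsub>\<Gamma>\<^esub> t) u \<otimes>\<^bsub>K\<^esub> c t s"
  have "?X \<otimes>\<^bsub>K\<^esub> c (t \<otimes>\<^bsub>\<Gamma>\<^esub> u) s \<otimes>\<^bsub>K\<^esub> ?p =
     (?X \<otimes>\<^bsub>K\<^esub> (c (t \<otimes>\<^bsub>\<Gamma>\<^esub> u) s \<otimes>\<^bsub>K\<^esub> c t u)) \<otimes>\<^bsub>K\<^esub> (c (s \<otimes>\<^bsub>\<Gamma>\<^esub> t) u \<otimes>\<^bsub>K\<^esub> c t s)"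
    using C s t u tu su st by (simp add: R.m_ac)
  also have "\<dots> = (c t (s \<otimes>\<^bsub>\<Gamma>\<^esub> u) \<otimes>\<^bsub>K\<^esub> (commutation s u \<otimes>\<^bsub>K\<^esub> c u s)) \<otimes>\<^bsub>K\<^esub> (c (s \<otimes>\<^bsub>\<Gamma>\<^esub> t) u \<otimes>\<^bsub>K\<^esub> (commutation s t \<otimes>\<^bsub>K\<^esub> c t s))"
    unfolding 3[symmetric] using C s t u tu su st by (simp add: R.m_ac)
  also have "\<dots> = (c (s \<otimes>\<^bsub>\<Gamma>\<^esub> t) u \<otimes>\<^bsub>K\<^esub> c t s) \<otimes>\<^bsub>K\<^esub> (c s (t \<otimes>\<^bsub>\<Gamma>\<^esub> u) \<otimes>\<^bsub>K\<^esub> c t u)"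
    unfolding e[symmetric] 1 2 ..
  also have "\<dots> = c s (t \<otimes>\<^bsub>\<Gamma>\<^esub> u) \<otimes>\<^bsub>K\<^esub> ?p" using C s t u tu su st by (simp add: R.m_ac)
  finally have eq: "?X \<otimes>\<^bsub>K\<^esub> c (t \<otimes>\<^bsub>\<Gamma>\<^esub> u) s \<otimes>\<^bsub>K\<^esub> ?p = c s (t \<otimes>\<^bsub>\<Gamma>\<^esub> u) \<otimes>\<^bsub>K\<^esub> ?p" .
  have p: "?p \<in> Units K" using c_Units s t u st by (intro units_mult_closed) auto
  have "?X \<otimes>\<^bsub>K\<^esub> c (t \<otimes>\<^bsub>\<Gamma>\<^esub> u) s = c s (t \<otimes>\<^bsub>\<Gamma>\<^esub> u)"
    using U_cancel_right[OF p _ _ eq] C s t u tu by simp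
  then have "c s (t \<otimes>\<^bsub>\<Gamma>\<^esub> u) \<otimes>\<^bsub>K\<^esub> inv\<^bsub>K\<^esub> (c (t \<otimes>\<^bsub>\<Gamma>\<^esub> u) s) = ?X \<otimes>\<^bsub>K\<^esub> (c (t \<otimes>\<^bsub>\<Gamma>\<^esub> u) s \<otimes>\<^bsub>K\<^esub> inv\<^bsub>K\<^esub> (c (t \<otimes>\<^bsub>\<Gamma>\<^esub> u) s))"
    using C s t u tu c_Units[OF tu s] by (metis R.m_assoc R.m_closed R.Units_inv_closed)
  then show ?thesis using C s t u c_Units[OF tu s] by (simp add: commutation_def[of s "t \<otimes>\<^bsub>\<Gamma>\<^esub> u"] R.Units_r_inv)
qed

lemma commutation_pow:
  "s \<in> carrier \<Gamma> \<Longrightarrow> commutation s (s [^]\<^bsub>\<Gamma>\<^esub> (n::nat)) = \<one>\<^bsub>K\<^esub>"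
proof (induction n)
  case 0
  then have "commutation s (\<one>\<^bsub>\<Gamma>\<^esub> \<otimes>\<^bsub>\<Gamma>\<^esub> s) = commutation s \<one>\<^bsub>\<Gamma>\<^esub> \<otimes>\<^bsub>K\<^esub> commutation s s"
    by (intro commutation_mult_right) auto
  then show ?case using 0 commutation_self[OF 0] R.Units_closed[OF commutation_Units[OF 0 G.one_closed]] by simp
next
  case (Suc n)
  then show ?case by (simp add: commutation_mult_right commutation_self)
qed

lemma B_mult_hom_commute:
  assumes s: "s \<in> carrier \<Gamma>" and t: "t \<in> carrier \<Gamma>" and ab: "a \<in> D s" "b \<in> D t"
    and k: "k \<in> carrier K" and eq: "a \<otimes> b = k \<odot> (b \<otimes> a)"
  shows "a \<otimes>\<^bsub>B\<^esub> b = (k \<otimes>\<^bsub>K\<^esub> commutation s t) \<odot> (b \<otimes>\<^bsub>B\<^esub> a)"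
proof -
  have c: "a \<in> carrier A" "b \<in> carrier A" "commutation s t \<in> carrier K"
    using D_closed s t ab commutation_Units[THEN R.Units_closed] by blast+
  have "a \<otimes>\<^bsub>B\<^esub> b = (c s t \<otimes>\<^bsub>K\<^esub> k) \<odot> (b \<otimes> a)"
    using B_hom[OF s t ab] eq c k c_carrier[OF s t] by (simp add: smult_assoc1)
  also have "c s t \<otimes>\<^bsub>K\<^esub> k = (k \<otimes>\<^bsub>K\<^esub> commutation s t) \<otimes>\<^bsub>K\<^esub> c t s"
    unfolding commutation_eq[OF s t, symmetric] using c k c_carrier[OF t s] by (simp add: R.m_ac)
  also have "\<dots> \<odot> (b \<otimes> a) = (k \<otimes>\<^bsub>K\<^esub> commutation s t) \<odot> (b \<otimes>\<^bsub>B\<^esub> a)"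
    using B_hom[OF t s ab(2,1)] c k c_carrier[OF t s] by (simp add: smult_assoc1)
  finally show ?thesis .
qed

end

section \<open>Twists of a CGL extension: the Ore condition and commutators\<close>

locale twisted_CGL = CGL_extension K A N x \<sigma> \<delta> r act h
  for K :: "('k, 'm) ring_scheme" and A :: "('k, 'a, 'n) module_scheme" (structure) and N x \<sigma> \<delta> r act h +
  fixes c :: "((nat \<Rightarrow> 'k) \<Rightarrow> 'k) \<Rightarrow> ((nat \<Rightarrow> 'k) \<Rightarrow> 'k) \<Rightarrow> 'k"
  assumes c_cocycles: "c \<in> cocycles (character_group K r) K"
begin

sublocale twisted_algebra K A \<Gamma> D c
  by (intro twisted_algebra.intro twisted_algebra_axioms.intro graded_algebra_axioms c_cocycles)

definition step_scalar :: "nat \<Rightarrow> ((nat \<Rightarrow> 'k) \<Rightarrow> 'k) \<Rightarrow> 'k" where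
  "step_scalar k = twist_scalar (chr k) (\<lambda>s. s (h k))"

lemma twisted_step:
  assumes k: "k \<in> {1..N}"
  shows "skew_step B (IA 1 (k - 1)) (x k) (scale (step_scalar k))"
    and "skew_step.ext B (IA 1 (k - 1)) (x k) = IA 1 k"
proof -
  have T: "graded_subset (IA 1 (k - 1))" using IA_graded k by auto
  obtain w where weq: "w = (\<lambda>s::(nat \<Rightarrow> 'k) \<Rightarrow> 'k. s (h k))" by simp
  have w: "w s \<in> Units K" if "s \<in> carrier \<Gamma>" for s
    unfolding weq using character_Units[OF that h_torus[OF k]] .
  note a = T chr_mem[OF k] w chain_step_1(1)[OF k, folded weq]
  show "skew_step B (IA 1 (k - 1)) (x k) (scale (step_scalar k))"
    unfolding step_scalar_def weq[symmetric] by (rule skew_step_B[OF a])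
  show "skew_step.ext B (IA 1 (k - 1)) (x k) = IA 1 k"
    using ext_B[OF a] chain_step_1(2)[OF k] by simp
qed

lemma one_B_nonzero: "\<one>\<^bsub>B\<^esub> \<noteq> \<zero>"
proof
  assume "\<one>\<^bsub>B\<^esub> = \<zero>"
  then have "inv\<^bsub>K\<^esub> (c \<one>\<^bsub>\<Gamma>\<^esub> \<one>\<^bsub>\<Gamma>\<^esub>) \<odot> \<one> = \<zero>" unfolding B_one .
  then have "\<one> = \<zero>"
    by (rule smult_zero_iff[OF R.Units_inv_Units[OF c_Units[OF G.one_closed G.one_closed]] one_closed])
  then show False using one_not_zero by simp
qed

text \<open>The identities of \<open>A\<close> and of the twist differ by a unit scalar, so both
  span the same copy of K.\<close>

lemma IA_0: "IA 1 0 = (\<lambda>k. k \<odot> \<one>\<^bsub>B\<^esub>) ` carrier K"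
proof -
  let ?c = "c \<one>\<^bsub>\<Gamma>\<^esub> \<one>\<^bsub>\<Gamma>\<^esub>"
  have u: "?c \<in> Units K" "?c \<in> carrier K" "inv\<^bsub>K\<^esub> ?c \<in> carrier K"
    using c_Units[of "\<one>\<^bsub>\<Gamma>\<^esub>" "\<one>\<^bsub>\<Gamma>\<^esub>"] by (auto simp: R.Units_closed)
  have 1: "k \<odot> \<one> = (k \<otimes>\<^bsub>K\<^esub> ?c) \<odot> \<one>\<^bsub>B\<^esub>" if "k \<in> carrier K" for k
    unfolding B_one using u that by (simp add: smult_assoc1[symmetric] R.m_assoc R.Units_r_inv)
  have 2: "k \<odot> \<one>\<^bsub>B\<^esub> = (k \<otimes>\<^bsub>K\<^esub> inv\<^bsub>K\<^esub> ?c) \<odot> \<one>" if "k \<in> carrier K" for k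
    unfolding B_one using u that by (simp add: smult_assoc1)
  have "(\<lambda>k. k \<odot> \<one>) ` carrier K = (\<lambda>k. k \<odot> \<one>\<^bsub>B\<^esub>) ` carrier K"
  proof (intro equalityI image_subsetI)
    fix k assume k: "k \<in> carrier K"
    show "k \<odot> \<one> \<in> (\<lambda>k. k \<odot> \<one>\<^bsub>B\<^esub>) ` carrier K"
      unfolding 1[OF k] using R.m_closed[OF k u(2)] by (rule imageI)
    show "k \<odot> \<one>\<^bsub>B\<^esub> \<in> (\<lambda>k. k \<odot> \<one>) ` carrier K"
      unfolding 2[OF k] using R.m_closed[OF k u(3)] by (rule imageI)
  qed
  then show ?thesis using IA_empty[of 0 1] by simp
qed

lemma scalar_mult_B:
  "\<lbrakk>k \<in> carrier K; a \<in> carrier A\<rbrakk> \<Longrightarrow> (k \<odot> \<one>\<^bsub>B\<^esub>) \<otimes>\<^bsub>B\<^esub> a = k \<odot> a"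
  using B_smult_left[of k "\<one>\<^bsub>B\<^esub>" a] B_one_unit(1)[of a] BR.one_closed by simp

lemma ore_subset_chain: "k \<le> N \<Longrightarrow> ore_subset B (IA 1 k)"
proof (induction k)
  case 0
  have oc: "\<one>\<^bsub>B\<^esub> \<in> carrier A" using BR.one_closed by simp
  have m: "(k \<odot> \<one>\<^bsub>B\<^esub>) \<otimes>\<^bsub>B\<^esub> (l \<odot> \<one>\<^bsub>B\<^esub>) = (k \<otimes>\<^bsub>K\<^esub> l) \<odot> \<one>\<^bsub>B\<^esub>"
    if "k \<in> carrier K" "l \<in> carrier K" for k l
    using scalar_mult_B that oc by (simp add: smult_assoc1)
  have z: "k \<odot> \<one>\<^bsub>B\<^esub> = \<zero> \<longleftrightarrow> k = \<zero>\<^bsub>K\<^esub>" if "k \<in> carrier K" for k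
    using smult_zero_iff[of k "\<one>\<^bsub>B\<^esub>"] oc one_B_nonzero that unfolding Units_K by auto
  show ?case unfolding ore_subset_def IA_0
  proof (intro conjI ballI)
    fix a b assume ab: "a \<in> (\<lambda>k. k \<odot> \<one>\<^bsub>B\<^esub>) ` carrier K" "b \<in> (\<lambda>k. k \<odot> \<one>\<^bsub>B\<^esub>) ` carrier K"
    then obtain k l where kl: "k \<in> carrier K" "l \<in> carrier K" "a = k \<odot> \<one>\<^bsub>B\<^esub>" "b = l \<odot> \<one>\<^bsub>B\<^esub>" by blast
    then show "a \<otimes>\<^bsub>B\<^esub> b = \<zero>\<^bsub>B\<^esub> \<longrightarrow> a = \<zero>\<^bsub>B\<^esub> \<or> b = \<zero>\<^bsub>B\<^esub>"
      using m z KF.integral[of k l] by auto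
  next
    fix a b assume ab: "a \<in> (\<lambda>k. k \<odot> \<one>\<^bsub>B\<^esub>) ` carrier K - {\<zero>\<^bsub>B\<^esub>}" "b \<in> (\<lambda>k. k \<odot> \<one>\<^bsub>B\<^esub>) ` carrier K - {\<zero>\<^bsub>B\<^esub>}"
    then obtain k l where kl: "k \<in> carrier K" "l \<in> carrier K" "a = k \<odot> \<one>\<^bsub>B\<^esub>" "b = l \<odot> \<one>\<^bsub>B\<^esub>" by blast
    then have "k \<noteq> \<zero>\<^bsub>K\<^esub>" "l \<noteq> \<zero>\<^bsub>K\<^esub>" using ab z by auto
    then have "a \<otimes>\<^bsub>B\<^esub> b = b \<otimes>\<^bsub>B\<^esub> a" "a \<otimes>\<^bsub>B\<^esub> b \<noteq> \<zero>\<^bsub>B\<^esub>"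
      using kl m z KF.integral[of k l] by (auto simp: R.m_comm)
    then show "\<exists>u\<in>(\<lambda>k. k \<odot> \<one>\<^bsub>B\<^esub>) ` carrier K. \<exists>v\<in>(\<lambda>k. k \<odot> \<one>\<^bsub>B\<^esub>) ` carrier K.
        a \<otimes>\<^bsub>B\<^esub> u = b \<otimes>\<^bsub>B\<^esub> v \<and> a \<otimes>\<^bsub>B\<^esub> u \<noteq> \<zero>\<^bsub>B\<^esub>" using ab by blast
  qed
next
  case (Suc k)
  have k: "Suc k \<in> {1..N}" using Suc by auto
  show ?case
    using skew_step.ore_subset_ext[OF twisted_step(1)[OF k]] twisted_step(2)[OF k] Suc by simp
qed

lemma right_ore_domain_B: "right_ore_domain B"
proof (intro right_ore_domain.intro right_ore_domain_axioms.intro ring_B)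
  show "\<one>\<^bsub>B\<^esub> \<noteq> \<zero>\<^bsub>B\<^esub>" using one_B_nonzero by simp
qed (use ore_subset_chain[of N] generated in \<open>auto simp: ore_subset_def\<close>)

text \<open>A relation a b = k b a makes \<open>k\<close> the commutator of the images of
  \<open>a\<close> and \<open>b\<close>. The scalars whose images are in the derived subgroup form a
  subgroup, so the generated group lies there too.\<close>

lemma AD_twist_generate:
  assumes S: "S \<subseteq> Units K"
    and comm: "\<And>k. k \<in> S \<Longrightarrow> \<exists>a\<in>carrier A. \<exists>b\<in>carrier A. a \<noteq> \<zero> \<and> b \<noteq> \<zero> \<and> a \<otimes>\<^bsub>B\<^esub> b = k \<odot> (b \<otimes>\<^bsub>B\<^esub> a)"
  shows "generate (units_of K) S \<subseteq> AD K B"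
proof -
  interpret O: right_ore_domain B by (rule right_ore_domain_B)
  let ?Q = O.fraction_ring and ?\<phi> = O.graph_of
  interpret Q: ring ?Q by (rule O.ring_fraction_ring)
  interpret UQ: group "units_of ?Q" by (rule Q.units_group)
  let ?der = "derived (units_of ?Q) (carrier (units_of ?Q))"
  have cl: "classical_right_quotient_ring B ?Q ?\<phi>" by (rule O.classical_right_quotient_ring_fraction_ring)
  then have hom: "?\<phi> \<in> ring_hom B ?Q" unfolding classical_right_quotient_ring_def by blast
  note \<phi>m = ring_hom_mult[OF hom] and \<phi>1 = ring_hom_one[OF hom]
  have oc: "\<one>\<^bsub>B\<^esub> \<in> carrier A" using BR.one_closed by simp
  have m: "?\<phi> ((k \<otimes>\<^bsub>K\<^esub> l) \<odot> \<one>\<^bsub>B\<^esub>) = ?\<phi> (k \<odot> \<one>\<^bsub>B\<^esub>) \<otimes>\<^bsub>?Q\<^esub> ?\<phi> (l \<odot> \<one>\<^bsub>B\<^esub>)"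
    if "k \<in> carrier K" "l \<in> carrier K" for k l
    using \<phi>m[of "k \<odot> \<one>\<^bsub>B\<^esub>" "l \<odot> \<one>\<^bsub>B\<^esub>"] scalar_mult_B[OF that(1), of "l \<odot> \<one>\<^bsub>B\<^esub>"] that oc
    by (simp add: smult_assoc1)
  have u: "?\<phi> a \<in> Units ?Q" if "a \<in> carrier A" "a \<noteq> \<zero>" for a
    using O.graph_of_Units(1)[of a] that by simp
  have ku: "?\<phi> (k \<odot> \<one>\<^bsub>B\<^esub>) \<in> Units ?Q" if "k \<in> Units K" for k
    using u smult_zero_iff[OF that oc] one_B_nonzero that oc R.Units_closed by (metis smult_closed)
  have der: "subgroup ?der (units_of ?Q)" by (rule UQ.derived_is_subgroup) simp
  define H where "H = {k \<in> Units K. ?\<phi> (k \<odot> \<one>\<^bsub>B\<^esub>) \<in> ?der}"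
  have f: "(\<lambda>k. ?\<phi> (k \<odot> \<one>\<^bsub>B\<^esub>)) \<in> hom (units_of K) (units_of ?Q)"
    by (rule homI) (auto simp: units_of_carrier units_of_mult ku m R.Units_closed)
  interpret f: group_hom "units_of K" "units_of ?Q" "\<lambda>k. ?\<phi> (k \<odot> \<one>\<^bsub>B\<^esub>)"
    by (intro group_hom.intro group_hom_axioms.intro f U.is_group UQ.is_group)
  have "subgroup H (units_of K)"
  proof (rule U.subgroupI)
    show "H \<subseteq> carrier (units_of K)" unfolding H_def by (auto simp: units_of_carrier)
    show "H \<noteq> {}" unfolding H_def
      using f.hom_one subgroup.one_closed[OF der] by (auto simp: units_of_one intro!: exI[of _ "\<one>\<^bsub>K\<^esub>"])
    show "inv\<^bsub>units_of K\<^esub> a \<in> H" if "a \<in> H" for a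
      using that f.hom_inv[of a] subgroup.m_inv_closed[OF der] unfolding H_def
      by (auto simp: units_of_carrier R.units_of_inv)
    show "a \<otimes>\<^bsub>units_of K\<^esub> b \<in> H" if "a \<in> H" "b \<in> H" for a b
      using that f.hom_mult[of a b] subgroup.m_closed[OF der] unfolding H_def
      by (auto simp: units_of_carrier units_of_mult)
  qed
  moreover have "S \<subseteq> H"
  proof
    fix k assume k: "k \<in> S"
    then obtain a b where ab: "a \<in> carrier A" "b \<in> carrier A" "a \<noteq> \<zero>" "b \<noteq> \<zero>"
      "a \<otimes>\<^bsub>B\<^esub> b = k \<odot> (b \<otimes>\<^bsub>B\<^esub> a)" using comm by blast
    have kU: "k \<in> Units K" using k S by blast
    let ?a = "?\<phi> a" and ?b = "?\<phi> b" and ?k = "?\<phi> (k \<odot> \<one>\<^bsub>B\<^esub>)"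
    have c: "?a \<in> carrier (units_of ?Q)" "?b \<in> carrier (units_of ?Q)" "?k \<in> carrier (units_of ?Q)"
      using u ab ku[OF kU] by (auto simp: units_of_carrier)
    have "?a \<otimes>\<^bsub>units_of ?Q\<^esub> ?b = ?\<phi> ((k \<odot> \<one>\<^bsub>B\<^esub>) \<otimes>\<^bsub>B\<^esub> (b \<otimes>\<^bsub>B\<^esub> a))"
      using \<phi>m[of a b] ab(1,2) scalar_mult_B[OF R.Units_closed[OF kU] B_closed[OF ab(2,1)]]
      unfolding units_of_mult ab(5)[symmetric] by simp
    also have "\<dots> = ?k \<otimes>\<^bsub>units_of ?Q\<^esub> (?b \<otimes>\<^bsub>units_of ?Q\<^esub> ?a)"
      using \<phi>m[of "k \<odot> \<one>\<^bsub>B\<^esub>" "b \<otimes>\<^bsub>B\<^esub> a"] \<phi>m[of b a] ab(1,2) B_closed oc R.Units_closed[OF kU]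
      by (simp add: units_of_mult)
    finally have "?a \<otimes>\<^bsub>units_of ?Q\<^esub> ?b \<otimes>\<^bsub>units_of ?Q\<^esub> inv\<^bsub>units_of ?Q\<^esub> ?a \<otimes>\<^bsub>units_of ?Q\<^esub> inv\<^bsub>units_of ?Q\<^esub> ?b = ?k"
      using c by (simp add: UQ.m_assoc)
    then have "?k \<in> derived_set (units_of ?Q) (carrier (units_of ?Q))" using c by blast
    then have "?k \<in> ?der" unfolding derived_def by (rule generate.incl)
    then show "k \<in> H" unfolding H_def using kU by blast
  qed
  ultimately have "generate (units_of K) S \<subseteq> H" using U.generate_subgroup_incl by blast
  also have "H \<subseteq> AD K B" unfolding H_def AD_def using cl by auto
  finally show ?thesis .
qed

lemma AD_twist_lower:
  "generate (units_of K) {chr j (h k) \<otimes>\<^bsub>K\<^esub> commutation (chr k) (chr j) | j k. k \<in> {1..N} \<and> j \<in> {1..k - 1}}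
    \<subseteq> AD K B"
proof (rule AD_twist_generate)
  show "{chr j (h k) \<otimes>\<^bsub>K\<^esub> commutation (chr k) (chr j) | j k. k \<in> {1..N} \<and> j \<in> {1..k - 1}} \<subseteq> Units K"
    using chr_act(1) h_torus chr_mem(1) by (auto intro!: units_mult_closed commutation_Units)
  fix m assume "m \<in> {chr j (h k) \<otimes>\<^bsub>K\<^esub> commutation (chr k) (chr j) | j k. k \<in> {1..N} \<and> j \<in> {1..k - 1}}"
  then obtain j k where jk: "k \<in> {1..N}" "j \<in> {1..k - 1}" "m = chr j (h k) \<otimes>\<^bsub>K\<^esub> commutation (chr k) (chr j)"
    by blast
  then have j: "j \<in> {1..N}" by auto
  note \<chi> = chr_mem[OF j] chr_mem[OF jk(1)]
  obtain z n where z: "z \<noteq> \<zero>" "z \<in> D (chr j \<otimes>\<^bsub>\<Gamma>\<^esub> chr k [^]\<^bsub>\<Gamma>\<^esub> (n::nat))"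
    "x k \<otimes> z = chr j (h k) \<odot> (z \<otimes> x k)" using normal_element[OF jk(1,2)] by blast
  let ?s = "chr j \<otimes>\<^bsub>\<Gamma>\<^esub> chr k [^]\<^bsub>\<Gamma>\<^esub> n"
  have s: "?s \<in> carrier \<Gamma>" using \<chi> by simp
  \<comment> \<open>The unknown power of \<open>chr k\<close> in the degree of \<open>z\<close> is
    invisible here, because \<open>commutation\<close> is alternating.\<close>
  have "commutation (chr k) ?s = commutation (chr k) (chr j)"
    using \<chi> commutation_mult_right[of "chr k" "chr j" "chr k [^]\<^bsub>\<Gamma>\<^esub> n"] commutation_pow[of "chr k" n]
      R.Units_closed[OF commutation_Units[of "chr k" "chr j"]] by simp
  then have "x k \<otimes>\<^bsub>B\<^esub> z = m \<odot> (z \<otimes>\<^bsub>B\<^esub> x k)"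
    using B_mult_hom_commute[OF \<chi>(3) s \<chi>(4) z(2) _ z(3)] jk(3)
      character_closed[OF \<chi>(1) h_torus[OF jk(1)]] by simp
  then show "\<exists>a\<in>carrier A. \<exists>b\<in>carrier A. a \<noteq> \<zero> \<and> b \<noteq> \<zero> \<and> a \<otimes>\<^bsub>B\<^esub> b = m \<odot> (b \<otimes>\<^bsub>B\<^esub> a)"
    using x_carrier[OF jk(1)] x_nonzero[OF jk(1)] z(1) eigenspaceD(1)[OF z(2)] by blast
qed

end

section \<open>Diagonal automorphisms of a twist and the upper bound for AD\<close>

context twisted_algebra
begin

lemma B_D_mult: "\<lbrakk>s \<in> carrier \<Gamma>; t \<in> carrier \<Gamma>; a \<in> D s; b \<in> D t\<rbrakk> \<Longrightarrow> a \<otimes>\<^bsub>B\<^esub> b \<in> D (s \<otimes>\<^bsub>\<Gamma>\<^esub> t)"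
  using B_hom[of s t a b] D_smult[OF _ c_carrier D_mult] by simp

lemma one_B_D: "\<one>\<^bsub>B\<^esub> \<in> D \<one>\<^bsub>\<Gamma>\<^esub>"
  unfolding B_one by (rule D_smult[OF G.one_closed _ D_one]) (simp add: c_Units)

lemma commutation_swap:
  assumes "s \<in> carrier \<Gamma>" "t \<in> carrier \<Gamma>"
  shows "commutation s t \<otimes>\<^bsub>K\<^esub> commutation t s = \<one>\<^bsub>K\<^esub>"
proof -
  have c: "c s t \<in> Units K" "c t s \<in> Units K" using c_Units assms by auto
  note c' = c[THEN R.Units_closed] c[THEN R.Units_inv_closed]
  have "commutation s t \<otimes>\<^bsub>K\<^esub> commutation t s =
    (c s t \<otimes>\<^bsub>K\<^esub> inv\<^bsub>K\<^esub> c s t) \<otimes>\<^bsub>K\<^esub> (c t s \<otimes>\<^bsub>K\<^esub> inv\<^bsub>K\<^esub> c t s)"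
    unfolding commutation_def using c' by (simp only: R.m_ac R.m_closed)
  then show ?thesis using c by (simp add: R.Units_r_inv)
qed

context
  fixes u
  assumes u: "u \<in> hom \<Gamma> (units_of K)"
begin

lemma hom_Units: "s \<in> carrier \<Gamma> \<Longrightarrow> u s \<in> Units K"
  and hom_mult': "s \<in> carrier \<Gamma> \<Longrightarrow> t \<in> carrier \<Gamma> \<Longrightarrow> u (s \<otimes>\<^bsub>\<Gamma>\<^esub> t) = u s \<otimes>\<^bsub>K\<^esub> u t"
  using u unfolding hom_def by (auto simp: units_of_carrier units_of_mult)

lemma hom_carrier: "s \<in> carrier \<Gamma> \<Longrightarrow> u s \<in> carrier K"
  using hom_Units R.Units_closed by blast

lemma hom_one': "u \<one>\<^bsub>\<Gamma>\<^esub> = \<one>\<^bsub>K\<^esub>"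
  using hom_one[OF u G.is_group R.units_group] by (simp add: units_of_one)

lemma scale_closed: "a \<in> carrier A \<Longrightarrow> scale u a \<in> carrier A"
  using scale_additive[of u, OF hom_carrier] unfolding additive_def by auto

text \<open>Twisting keeps the degree of a product, so a character of the grading group still acts
  by an automorphism.\<close>

lemma scale_B_mult:
  assumes a: "a \<in> carrier A" and b: "b \<in> carrier A"
  shows "scale u (a \<otimes>\<^bsub>B\<^esub> b) = scale u a \<otimes>\<^bsub>B\<^esub> scale u b"
proof -
  have su: "additive (scale u)" by (rule scale_additive[of u, OF hom_carrier])
  show ?thesis
  proof (rule additive_eqI[OF additive_comp[OF su B_additive_right]
        additive_comp[OF B_additive_right su] graded_carrier b])
    fix t g assume t: "t \<in> carrier \<Gamma>" and g: "g \<in> D t"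
    have gc: "g \<in> carrier A" using D_closed t g by blast
    show "scale u (a \<otimes>\<^bsub>B\<^esub> g) = scale u a \<otimes>\<^bsub>B\<^esub> scale u g"
    proof (rule additive_eqI[OF additive_comp[OF su B_additive_left]
          additive_comp[OF B_additive_left su] graded_carrier a])
      fix s f assume s: "s \<in> carrier \<Gamma>" and f: "f \<in> D s"
      have fc: "f \<in> carrier A" using D_closed s f by blast
      have st: "s \<otimes>\<^bsub>\<Gamma>\<^esub> t \<in> carrier \<Gamma>" using s t by simp
      have "scale u (f \<otimes>\<^bsub>B\<^esub> g) = (u s \<otimes>\<^bsub>K\<^esub> u t) \<odot> (f \<otimes>\<^bsub>B\<^esub> g)"
        using scale_hom[of u, OF hom_carrier st B_D_mult[OF s t f g]] hom_mult'[OF s t] by simp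
      also have "\<dots> = (u s \<odot> f) \<otimes>\<^bsub>B\<^esub> (u t \<odot> g)"
        using hom_carrier s t fc gc B_closed by (simp add: B_smult_left B_smult_right smult_assoc1[symmetric] R.m_comm)
      finally show "scale u (f \<otimes>\<^bsub>B\<^esub> g) = scale u f \<otimes>\<^bsub>B\<^esub> scale u g"
        using scale_hom[of u, OF hom_carrier s f] scale_hom[of u, OF hom_carrier t g] by simp
    qed (use gc scale_closed in auto)
  qed (use a scale_closed in auto)
qed

lemma scale_B_one: "scale u \<one>\<^bsub>B\<^esub> = \<one>\<^bsub>B\<^esub>"
proof -
  have "scale u \<one>\<^bsub>B\<^esub> = u \<one>\<^bsub>\<Gamma>\<^esub> \<odot> \<one>\<^bsub>B\<^esub>"
    by (rule scale_hom[of u, OF hom_carrier G.one_closed one_B_D])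
  then show ?thesis using hom_one' BR.one_closed by simp
qed

lemma scale_B_monomial:
  assumes x: "\<chi> \<in> carrier \<Gamma>" "x \<in> D \<chi>" and a: "a \<in> carrier A"
  shows "scale u (a \<otimes>\<^bsub>B\<^esub> x [^]\<^bsub>B\<^esub> (n::nat)) = (u \<chi> [^]\<^bsub>K\<^esub> n \<odot> scale u a) \<otimes>\<^bsub>B\<^esub> x [^]\<^bsub>B\<^esub> n"
proof -
  have xc: "x \<in> carrier A" using x D_closed by blast
  then have xn: "x [^]\<^bsub>B\<^esub> m \<in> carrier A" for m :: nat using BR.nat_pow_closed[of x m] by simp
  have uc: "u \<chi> \<in> carrier K" using hom_carrier x by blast
  have "scale u (x [^]\<^bsub>B\<^esub> n) = u \<chi> [^]\<^bsub>K\<^esub> n \<odot> x [^]\<^bsub>B\<^esub> n"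
  proof (induction n)
    case 0
    then show ?case using scale_B_one BR.one_closed by simp
  next
    case (Suc n)
    have "scale u (x [^]\<^bsub>B\<^esub> Suc n) = scale u (x [^]\<^bsub>B\<^esub> n) \<otimes>\<^bsub>B\<^esub> scale u x"
      using scale_B_mult[OF xn xc] by simp
    also have "\<dots> = (u \<chi> [^]\<^bsub>K\<^esub> n \<otimes>\<^bsub>K\<^esub> u \<chi>) \<odot> (x [^]\<^bsub>B\<^esub> n \<otimes>\<^bsub>B\<^esub> x)"
      using Suc scale_hom[of u, OF hom_carrier x] uc xc xn B_closed[OF xn xc]
      by (simp add: B_smult_left B_smult_right smult_assoc1[symmetric] R.m_comm)
    finally show ?case by simp
  qed
  then show ?thesis
    using scale_B_mult[OF a xn] scale_closed[OF a] uc xn by (simp add: B_smult_left B_smult_right)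
qed

end

end

context twisted_CGL
begin

lemma step_scalar_eq:
  assumes k: "k \<in> {1..N}" and s: "s \<in> carrier \<Gamma>"
  shows "step_scalar k s = s (h k) \<otimes>\<^bsub>K\<^esub> commutation (chr k) s"
  unfolding step_scalar_def twist_scalar_def commutation_def
  using c_carrier c_Units chr_mem(1)[OF k] s character_closed[OF s h_torus[OF k]]
  by (simp add: R.m_comm)

text \<open>This brings the step automorphisms under the invariance clause of
  \<open>leading_map\<close>.\<close>

lemma step_scalar_hom:
  assumes k: "k \<in> {1..N}" shows "step_scalar k \<in> hom \<Gamma> (units_of K)"
proof (rule homI; unfold units_of_carrier units_of_mult)
  note \<chi> = chr_mem(1)[OF k] and g = h_torus[OF k]
  fix s assume s: "s \<in> carrier \<Gamma>"
  show "step_scalar k s \<in> Units K"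
    unfolding step_scalar_eq[OF k s] by (intro units_mult_closed character_Units s g commutation_Units \<chi>)
  fix t assume t: "t \<in> carrier \<Gamma>"
  have st: "s \<otimes>\<^bsub>\<Gamma>\<^esub> t \<in> carrier \<Gamma>" using s t by simp
  have cc: "commutation (chr k) s \<in> carrier K" "commutation (chr k) t \<in> carrier K"
    "s (h k) \<in> carrier K" "t (h k) \<in> carrier K"
    using commutation_Units[OF \<chi>] character_Units s t g by (auto intro: R.Units_closed)
  show "step_scalar k (s \<otimes>\<^bsub>\<Gamma>\<^esub> t) = step_scalar k s \<otimes>\<^bsub>K\<^esub> step_scalar k t"
    unfolding step_scalar_eq[OF k s] step_scalar_eq[OF k t] step_scalar_eq[OF k st]
      commutation_mult_right[OF \<chi> s t]
    using cc g by (simp add: character_mult R.m_ac)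
qed

text \<open>Besides multiplicativity and the normalization on scalars, the last clause is what makes
  the induction run. The next variable introduces powers of its step automorphism, a diagonal map
  whose values on the earlier degrees lie in \<open>F\<close>, and \<open>L\<close> must not notice
  them.\<close>

definition leading_map ::
  "('c, 'd) monoid_scheme \<Rightarrow> ('k \<Rightarrow> 'c) \<Rightarrow> 'k set \<Rightarrow> nat \<Rightarrow> ('a \<Rightarrow> 'c) \<Rightarrow> bool" where
  "leading_map M \<iota> F k L \<longleftrightarrow> (\<forall>f\<in>IA 1 k - {\<zero>}. L f \<in> carrier M) \<and>
    (\<forall>f\<in>IA 1 k - {\<zero>}. \<forall>g\<in>IA 1 k - {\<zero>}. L (f \<otimes>\<^bsub>B\<^esub> g) = L f \<otimes>\<^bsub>M\<^esub> L g) \<and>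
    (\<forall>l\<in>Units K. L (l \<odot> \<one>\<^bsub>B\<^esub>) = \<iota> l) \<and>
    (\<forall>u\<in>hom \<Gamma> (units_of K). (\<forall>j\<in>{1..k}. u (chr j) \<in> F) \<longrightarrow>
      (\<forall>f\<in>IA 1 k - {\<zero>}. L (scale u f) = L f))"

lemma leading_mapD:
  assumes "leading_map M \<iota> F k L"
  shows "f \<in> IA 1 k - {\<zero>} \<Longrightarrow> L f \<in> carrier M"
    "f \<in> IA 1 k - {\<zero>} \<Longrightarrow> g \<in> IA 1 k - {\<zero>} \<Longrightarrow> L (f \<otimes>\<^bsub>B\<^esub> g) = L f \<otimes>\<^bsub>M\<^esub> L g"
    "l \<in> Units K \<Longrightarrow> L (l \<odot> \<one>\<^bsub>B\<^esub>) = \<iota> l"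
    "u \<in> hom \<Gamma> (units_of K) \<Longrightarrow> \<forall>j\<in>{1..k}. u (chr j) \<in> F \<Longrightarrow> f \<in> IA 1 k - {\<zero>} \<Longrightarrow> L (scale u f) = L f"
  using assms unfolding leading_map_def by blast+

text \<open>Taking the iterated leading coefficient is multiplicative up to the scalars \<open>F\<close>.\<close>

lemma leading_coefficient:
  fixes M :: "('c, 'd) monoid_scheme"
  assumes M: "comm_group M" and \<iota>: "\<iota> \<in> hom (units_of K) M"
    and F: "subgroup F (units_of K)" "\<And>k. k \<in> F \<Longrightarrow> \<iota> k = \<one>\<^bsub>M\<^esub>"
    and lam: "\<And>j k. k \<in> {1..N} \<Longrightarrow> j \<in> {1..k - 1} \<Longrightarrow> step_scalar k (chr j) \<in> F"
    and k: "k \<le> N"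
  shows "\<exists>L. leading_map M \<iota> F k L"
  using k
proof (induction k)
  case 0
  interpret M: comm_group M by (rule M)
  have oc: "\<one>\<^bsub>B\<^esub> \<in> carrier A" using BR.one_closed by simp
  define L where "L f = \<iota> (THE l. l \<in> carrier K \<and> f = l \<odot> \<one>\<^bsub>B\<^esub>)" for f
  have L: "L (l \<odot> \<one>\<^bsub>B\<^esub>) = \<iota> l" if l: "l \<in> Units K" for l
  proof -
    have "(THE m. m \<in> carrier K \<and> l \<odot> \<one>\<^bsub>B\<^esub> = m \<odot> \<one>\<^bsub>B\<^esub>) = l"
      using l oc one_B_nonzero smult_cancel R.Units_closed[OF l] by (intro the_equality) auto
    then show ?thesis unfolding L_def by simp
  qed
  have f: "\<exists>l\<in>Units K. f = l \<odot> \<one>\<^bsub>B\<^esub>" if f0: "f \<in> IA 1 0 - {\<zero>}" for f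
  proof -
    obtain l where l: "l \<in> carrier K" "f = l \<odot> \<one>\<^bsub>B\<^esub>" using f0 unfolding IA_0 by blast
    then have "l \<noteq> \<zero>\<^bsub>K\<^esub>" using f0 oc by auto
    then show ?thesis using l Units_K by blast
  qed
  have \<iota>c: "\<iota> l \<in> carrier M" if "l \<in> Units K" for l
    using \<iota> that unfolding hom_def by (auto simp: units_of_carrier)
  have \<iota>m: "\<iota> (l \<otimes>\<^bsub>K\<^esub> m) = \<iota> l \<otimes>\<^bsub>M\<^esub> \<iota> m" if "l \<in> Units K" "m \<in> Units K" for l m
    using \<iota> that unfolding hom_def by (auto simp: units_of_carrier units_of_mult)
  have mult: "(l \<odot> \<one>\<^bsub>B\<^esub>) \<otimes>\<^bsub>B\<^esub> (m \<odot> \<one>\<^bsub>B\<^esub>) = (l \<otimes>\<^bsub>K\<^esub> m) \<odot> \<one>\<^bsub>B\<^esub>"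
    if "l \<in> Units K" "m \<in> Units K" for l m
    using scalar_mult_B[of l "m \<odot> \<one>\<^bsub>B\<^esub>"] that oc by (simp add: smult_assoc1 R.Units_closed)
  have sc: "scale u (l \<odot> \<one>\<^bsub>B\<^esub>) = l \<odot> \<one>\<^bsub>B\<^esub>" if u: "u \<in> hom \<Gamma> (units_of K)" and l: "l \<in> Units K" for u l
  proof -
    have "scale u (l \<odot> \<one>\<^bsub>B\<^esub>) = u \<one>\<^bsub>\<Gamma>\<^esub> \<odot> (l \<odot> \<one>\<^bsub>B\<^esub>)"
      by (rule scale_hom[of u, OF hom_carrier[OF u] G.one_closed
            D_smult[OF G.one_closed R.Units_closed[OF l] one_B_D]])
    then show ?thesis using hom_one'[OF u] oc R.Units_closed[OF l] by simp
  qed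
  show ?case unfolding leading_map_def
  proof (intro exI[of _ L] conjI ballI impI)
    fix a assume "a \<in> IA 1 0 - {\<zero>}"
    then obtain l where l: "l \<in> Units K" "a = l \<odot> \<one>\<^bsub>B\<^esub>" using f by blast
    show "L a \<in> carrier M" using L l \<iota>c by simp
    fix b assume "b \<in> IA 1 0 - {\<zero>}"
    then obtain m where m: "m \<in> Units K" "b = m \<odot> \<one>\<^bsub>B\<^esub>" using f by blast
    show "L (a \<otimes>\<^bsub>B\<^esub> b) = L a \<otimes>\<^bsub>M\<^esub> L b"
      using l m L \<iota>m mult units_mult_closed by simp
  next
    fix u a assume u: "u \<in> hom \<Gamma> (units_of K)" and a: "a \<in> IA 1 0 - {\<zero>}"
    obtain l where l: "l \<in> Units K" "a = l \<odot> \<one>\<^bsub>B\<^esub>" using f a by blast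
    show "L (scale u a) = L a" using sc[OF u l(1)] l by simp
  qed (use L in auto)
next
  case (Suc n)
  interpret M: comm_group M by (rule M)
  let ?k = "Suc n"
  have k: "?k \<in> {1..N}" using Suc by auto
  have nk: "?k - 1 = n" by simp
  note \<chi> = chr_mem[OF k]
  let ?T = "IA 1 n"
  interpret S: skew_step B ?T "x ?k" "scale (step_scalar ?k)" using twisted_step(1)[OF k] by simp
  have ext: "S.ext = IA 1 ?k" using twisted_step(2)[OF k] by simp
  have T: "graded_subset ?T" using IA_graded Suc by simp
  have ore: "ore_subset B ?T" using ore_subset_chain Suc by simp
  obtain L where L: "leading_map M \<iota> F n L" using Suc.IH Suc.prems by auto
  note Lc = leading_mapD(1)[OF L] and Lm = leading_mapD(2)[OF L] and L\<iota> = leading_mapD(3)[OF L]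
    and Ls = leading_mapD(4)[OF L]
  have oc: "\<one>\<^bsub>B\<^esub> \<in> carrier A" using BR.one_closed by simp
  have scalars: "l \<odot> \<one>\<^bsub>B\<^esub> \<in> ?T - {\<zero>}" if "l \<in> Units K" for l
    using that S.Ts(3) graded_subsetD(4)[OF T] R.Units_closed smult_zero_iff[OF that oc] one_B_nonzero by blast
  have Tc: "a \<in> carrier A" if "a \<in> ?T" for a using graded_subsetD(1)[OF T that] .
  have Lsm: "L (l \<odot> a) = L a" if l: "l \<in> F" and a: "a \<in> ?T - {\<zero>}" for l a
  proof -
    have lU: "l \<in> Units K" using subgroup.mem_carrier[OF F(1) l] by (simp add: units_of_carrier)
    have "L (l \<odot> a) = L ((l \<odot> \<one>\<^bsub>B\<^esub>) \<otimes>\<^bsub>B\<^esub> a)"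
      using scalar_mult_B[OF R.Units_closed[OF lU]] Tc a by simp
    also have "\<dots> = \<one>\<^bsub>M\<^esub> \<otimes>\<^bsub>M\<^esub> L a" using Lm[OF scalars[OF lU] a] L\<iota>[OF lU] F(2)[OF l] by simp
    finally show ?thesis using Lc[OF a] by simp
  qed
  \<comment> \<open>The step automorphism scales the earlier degrees by elements of
    \<open>F\<close>, so the invariance clause can be applied once for each power.\<close>
  have step: "L ((scale (step_scalar ?k) ^^ m) a) = L a" if a: "a \<in> ?T - {\<zero>}" for m a
  proof (induction m)
    case (Suc m)
    have "(scale (step_scalar ?k) ^^ m) a \<in> ?T - {\<zero>}"
      using S.s_pow_closed[of a m] S.s_pow_nonzero[of a m] a by auto
    then show ?case using Ls[OF step_scalar_hom[OF k]] lam[OF k] Suc by simp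
  qed simp
  define L' where "L' f = L (S.lead f)" for f
  have lead: "S.lead f \<in> ?T - {\<zero>}" if "f \<in> IA 1 ?k - {\<zero>}" for f
    using S.lead_mem[of f] that ext by simp
  show ?case unfolding leading_map_def
  proof (intro exI[of _ L'] conjI ballI impI)
    fix f assume f: "f \<in> IA 1 ?k - {\<zero>}"
    show "L' f \<in> carrier M" unfolding L'_def using Lc lead f by blast
    fix g assume g: "g \<in> IA 1 ?k - {\<zero>}"
    obtain m where m: "S.lead (f \<otimes>\<^bsub>B\<^esub> g) = S.lead f \<otimes>\<^bsub>B\<^esub> (scale (step_scalar ?k) ^^ m) (S.lead g)"
      using S.lead_mult_power[OF ore, of f g] f g ext by auto
    have "(scale (step_scalar ?k) ^^ m) (S.lead g) \<in> ?T - {\<zero>}"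
      using S.s_pow_closed[of "S.lead g" m] S.s_pow_nonzero[of "S.lead g" m] lead[OF g] by auto
    then show "L' (f \<otimes>\<^bsub>B\<^esub> g) = L' f \<otimes>\<^bsub>M\<^esub> L' g"
      unfolding L'_def m using Lm[OF lead[OF f]] step[OF lead[OF g]] by simp
  next
    fix l assume l: "l \<in> Units K"
    show "L' (l \<odot> \<one>\<^bsub>B\<^esub>) = \<iota> l"
      unfolding L'_def using S.lead_T[of "l \<odot> \<one>\<^bsub>B\<^esub>"] scalars[OF l] L\<iota>[OF l] by simp
  next
    fix u f assume u: "u \<in> hom \<Gamma> (units_of K)" and uF: "\<forall>j\<in>{1..?k}. u (chr j) \<in> F"
      and f: "f \<in> IA 1 ?k - {\<zero>}"
    have su: "additive (scale u)" by (rule scale_additive[of u, OF hom_carrier[OF u]])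
    have sT: "scale u a \<in> ?T" if "a \<in> ?T" for a by (rule scale_mem[of u, OF hom_carrier[OF u] T that])
    have kU: "u (chr ?k) [^]\<^bsub>K\<^esub> (m::nat) \<in> F" for m
    proof (induction m)
      case 0
      then show ?case using subgroup.one_closed[OF F(1)] by (simp add: units_of_one)
    next
      case (Suc m)
      have "u (chr ?k) \<in> F" using uF k by auto
      then show ?case using subgroup.m_closed[OF F(1) Suc] by (simp add: units_of_mult)
    qed
    have FU: "l \<in> Units K" if "l \<in> F" for l
      using subgroup.mem_carrier[OF F(1) that] by (simp add: units_of_carrier)
    have mono: "scale u (a \<otimes>\<^bsub>B\<^esub> x ?k [^]\<^bsub>B\<^esub> m) = (u (chr ?k) [^]\<^bsub>K\<^esub> m \<odot> scale u a) \<otimes>\<^bsub>B\<^esub> x ?k [^]\<^bsub>B\<^esub> m"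
      if "a \<in> ?T" for a and m :: nat by (rule scale_B_monomial[OF u \<chi> Tc[OF that]])
    have smT: "u (chr ?k) [^]\<^bsub>K\<^esub> m \<odot> scale u a \<in> ?T" if "a \<in> ?T" for a and m :: nat
      using graded_subsetD(4)[OF T R.Units_closed[OF FU[OF kU]] sT[OF that]] .
    \<comment> \<open>Diagonal maps preserve the filtration. Hence the leading coefficient of
      \<open>scale u f\<close> is that of \<open>f\<close>, scaled and multiplied by a power of
      \<open>u (chr ?k)\<close>, and this power lies in \<open>F\<close>.\<close>
    have scale_P: "scale u p \<in> S.P m" if "p \<in> S.P m" for p m
      using that
    proof (induction m arbitrary: p)
      case 0
      then show ?case using additive_zero[OF su] by simp
    next
      case (Suc m)
      obtain q a where qa: "q \<in> S.P m" "a \<in> ?T" "p = q \<oplus>\<^bsub>B\<^esub> a \<otimes>\<^bsub>B\<^esub> x ?k [^]\<^bsub>B\<^esub> m"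
        using S.P_SucE[OF Suc.prems] by metis
      have c: "q \<in> carrier A" "a \<otimes>\<^bsub>B\<^esub> x ?k [^]\<^bsub>B\<^esub> m \<in> carrier A"
        using S.P_carrier[OF qa(1)] S.P_carrier[OF S.P_monom[OF qa(2)]] by auto
      show ?case
        by (rule S.P_SucI[OF Suc.IH[OF qa(1)] smT[OF qa(2), of m]])
          (use su c qa(3) mono[OF qa(2)] in \<open>simp add: additive_def\<close>)
    qed
    obtain m p a where pa: "p \<in> S.P m" "a \<in> ?T" "a \<noteq> \<zero>" "f = p \<oplus>\<^bsub>B\<^esub> a \<otimes>\<^bsub>B\<^esub> x ?k [^]\<^bsub>B\<^esub> m"
      using S.extE[of f] f unfolding ext[symmetric] B_simps by blast
    have c: "p \<in> carrier A" "a \<otimes>\<^bsub>B\<^esub> x ?k [^]\<^bsub>B\<^esub> m \<in> carrier A"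
      using S.P_carrier[OF pa(1)] S.P_carrier[OF S.P_monom[OF pa(2)]] by auto
    let ?b = "u (chr ?k) [^]\<^bsub>K\<^esub> m \<odot> scale u a"
    have sf: "scale u f = scale u p \<oplus>\<^bsub>B\<^esub> ?b \<otimes>\<^bsub>B\<^esub> x ?k [^]\<^bsub>B\<^esub> m"
      using su c pa(4) mono[OF pa(2)] by (simp add: additive_def)
    have sa0: "scale u a \<noteq> \<zero>"
    proof
      assume 0: "scale u a = \<zero>"
      have "a = scale (\<lambda>s. inv\<^bsub>K\<^esub> u s) (scale u a)" using scale_inv(2)[of u, OF hom_Units[OF u] Tc[OF pa(2)]] by simp
      also have "\<dots> = \<zero>" unfolding 0
        by (rule additive_zero[OF scale_additive]) (use hom_Units[OF u] in auto)
      finally show False using pa(3) by simp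
    qed
    have b0: "?b \<noteq> \<zero>" using smult_zero_iff[OF FU[OF kU] Tc[OF sT[OF pa(2)]]] sa0 by blast
    have "S.lead (scale u f) = ?b" unfolding sf
      by (rule S.lead_eq[OF scale_P[OF pa(1)] smT[OF pa(2)]]) (use b0 in simp)
    moreover have "S.lead f = a" unfolding pa(4) by (rule S.lead_eq[OF pa(1,2)]) (use pa(3) in simp)
    moreover have "L ?b = L (scale u a)" using Lsm[OF kU] sT[OF pa(2)] sa0 by simp
    moreover have "L (scale u a) = L a" by (rule Ls[OF u]) (use uF pa in auto)
    ultimately show "L' (scale u f) = L' f" unfolding L'_def by simp
  qed
qed

lemma AD_twist_upper:
  assumes F: "subgroup F (units_of K)"
    and lam: "\<And>j k. k \<in> {1..N} \<Longrightarrow> j \<in> {1..k - 1} \<Longrightarrow> chr j (h k) \<otimes>\<^bsub>K\<^esub> commutation (chr k) (chr j) \<in> F"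
  shows "AD K B \<subseteq> F"
proof
  fix l assume l: "l \<in> AD K B"
  then obtain Q :: "('a \<times> 'a) set ring" and \<phi> where lU: "l \<in> Units K"
    and Q: "classical_right_quotient_ring B Q \<phi>"
    and der: "\<phi> (l \<odot> \<one>\<^bsub>B\<^esub>) \<in> derived (units_of Q) (carrier (units_of Q))"
    unfolding AD_def by auto
  \<comment> \<open>Leading coefficients are read modulo \<open>F\<close>. On scalars this is the
    quotient map, so its kernel there is exactly \<open>F\<close>.\<close>
  let ?M = "units_of K Mod F" and ?\<iota> = "\<lambda>a. F #>\<^bsub>units_of K\<^esub> a"
  have N: "F \<lhd> units_of K" by (rule U.subgroup_imp_normal[OF F])
  have M: "comm_group ?M" by (rule U.abelian_FactGroup[OF F])
  interpret M: comm_group ?M by (rule M)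
  have \<iota>: "?\<iota> \<in> hom (units_of K) ?M" by (rule normal.r_coset_hom_Mod[OF N])
  have \<iota>1: "?\<iota> a = \<one>\<^bsub>?M\<^esub>" if "a \<in> F" for a
    using U.coset_join2[OF subgroup.mem_carrier[OF F that] F that] by simp
  have lam': "step_scalar k (chr j) \<in> F" if "k \<in> {1..N}" "j \<in> {1..k - 1}" for j k
  proof -
    have "j \<in> {1..N}" using that by auto
    then show ?thesis using step_scalar_eq[OF that(1) chr_mem(1)] lam[OF that] by simp
  qed
  have IN: "IA 1 N = carrier A" by (rule generated)
  have "\<exists>L. leading_map ?M ?\<iota> F N L"
    by (rule leading_coefficient[OF M \<iota> F]) (erule \<iota>1, erule (1) lam', rule order_refl)
  then obtain L where L: "leading_map ?M ?\<iota> F N L" ..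
  note L = leading_mapD(1-3)[OF L, unfolded IN]
  interpret O: right_ore_domain B by (rule right_ore_domain_B)
  interpret Q: ring Q using Q unfolding classical_right_quotient_ring_def by blast
  obtain L' where L': "L' \<in> hom (units_of Q) ?M" "\<And>a. a \<in> carrier A \<Longrightarrow> a \<noteq> \<zero> \<Longrightarrow> L' (\<phi> a) = L a"
    using O.quotient_extension[OF M _ _ Q, of L] L(1,2) unfolding B_simps by blast
  interpret L': group_hom "units_of Q" ?M L'
    by (intro group_hom.intro group_hom_axioms.intro L'(1) Q.units_group M.is_group)
  have "L' ` derived (units_of Q) (carrier (units_of Q)) = derived ?M (L' ` carrier (units_of Q))"
    by (rule L'.derived_img[symmetric]) simp
  also have "\<dots> = {\<one>\<^bsub>?M\<^esub>}" by (rule M.derived_eq_singleton) auto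
  finally have "L' (\<phi> (l \<odot> \<one>\<^bsub>B\<^esub>)) = \<one>\<^bsub>?M\<^esub>" using der by blast
  moreover have "l \<odot> \<one>\<^bsub>B\<^esub> \<in> carrier A" "l \<odot> \<one>\<^bsub>B\<^esub> \<noteq> \<zero>"
    using smult_zero_iff[OF lU] one_B_nonzero BR.one_closed R.Units_closed[OF lU] by auto
  ultimately have "F #>\<^bsub>units_of K\<^esub> l = F" using L' L(3)[OF lU] by simp
  then show "l \<in> F" using U.coset_join1[OF _ _ F] lU by (simp add: units_of_carrier)
qed

end

section \<open>Multiplicative independence in a field\<close>

context comm_group
begin

lemma int_pow_finprod:
  "finite I \<Longrightarrow> f \<in> I \<rightarrow> carrier G \<Longrightarrow> finprod G f I [^] (k::int) = finprod G (\<lambda>i. f i [^] k) I"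
  by (induction I rule: finite_induct) (auto simp: int_pow_distrib Pi_def)

lemma finprod_int_pow_const:
  "finite I \<Longrightarrow> g \<in> carrier G \<Longrightarrow> finprod G (\<lambda>j. g [^] (k j :: int)) I = g [^] (\<Sum>j\<in>I. k j)"
  by (induction I rule: finite_induct) (auto simp: int_pow_mult)

lemma subgroup_finprod_closed:
  assumes H: "subgroup H G" and "finite I" "\<And>i. i \<in> I \<Longrightarrow> f i \<in> H"
  shows "finprod G f I \<in> H"
  using assms(2,3)
proof (induction I rule: finite_induct)
  case (insert i I)
  then have "finprod G f (insert i I) = f i \<otimes> finprod G f I"
    using subgroup.mem_carrier[OF H] by (intro finprod_insert) auto
  then show ?case using insert subgroup.m_closed[OF H] by simp
qed (simp add: subgroup.one_closed[OF H])

lemma generate_insert_decomposition: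
  assumes S: "S \<subseteq> carrier G" and g: "g \<in> carrier G" and y: "y \<in> generate G (insert g S)"
  shows "\<exists>a::int. \<exists>z\<in>generate G S. y = g [^] a \<otimes> z"
proof -
  note GS = generate_is_subgroup[OF S] and GC = generate_in_carrier[OF S]
  show ?thesis using y
  proof induction
    case one
    then show ?case using g generate.one[of G S] by (intro exI[of _ 0] bexI[of _ \<one>]) simp_all
  next
    case (incl h)
    show ?case
    proof (cases "h = g")
      case True
      then show ?thesis using g generate.one[of G S] by (intro exI[of _ 1] bexI[of _ \<one>]) simp_all
    next
      case False
      then have "h \<in> generate G S" using incl generate.incl[of h S G] by simp
      then show ?thesis using GC[of h] g by (intro exI[of _ 0] bexI[of _ h]) simp_all
    qed
  next
    case (inv h)
    show ?case
    proof (cases "h = g")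
      case True
      then show ?thesis using g generate.one[of G S]
        by (intro exI[of _ "-1"] bexI[of _ \<one>]) (simp_all add: int_pow_neg)
    next
      case False
      then have "inv h \<in> generate G S" using inv generate.inv[of h S G] by simp
      then show ?thesis using GC[of "inv h"] g by (intro exI[of _ 0] bexI[of _ "inv h"]) simp_all
    qed
  next
    case (eng h1 h2)
    then obtain a b :: int and z w where "z \<in> generate G S" "h1 = g [^] a \<otimes> z" "w \<in> generate G S" "h2 = g [^] b \<otimes> w"
      by blast
    then show ?case using GC g subgroup.m_closed[OF GS]
      by (intro exI[of _ "a + b"] bexI[of _ "z \<otimes> w"]) (auto simp: int_pow_mult m_ac)
  qed
qed

text \<open>Elimination over the integers. If some \<open>f p\<close> involves \<open>g\<close> with
  a nonzero exponent, it serves as a pivot: cross powers with the other \<open>f i\<close> remove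
  \<open>g\<close>, and the result is an independent family with one member fewer over one generator
  fewer.\<close>

lemma int_independent_card:
  fixes f :: "'i \<Rightarrow> 'a"
  assumes "finite S" "S \<subseteq> carrier G" "finite I" "f \<in> I \<rightarrow> generate G S" "int_independent G I f"
  shows "card I \<le> card S"
  using assms
proof (induction S arbitrary: I f rule: finite_induct)
  case empty
  have "I = {}"
  proof (rule ccontr)
    assume "I \<noteq> {}"
    then obtain i where i: "i \<in> I" by blast
    have f: "f j = \<one>" if "j \<in> I" for j using empty that generate_empty by auto
    have "finprod G (\<lambda>j. f j [^] (1::int)) I = \<one>" by (rule finprod_one_eqI) (simp add: f)
    then have "\<forall>j\<in>I. (1::int) = 0"
      using empty.prems(4) unfolding int_independent_def by (elim allE[of _ "\<lambda>_. 1"]) simp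
    then show False using i by simp
  qed
  then show ?case by simp
next
  case (insert g S)
  have S: "S \<subseteq> carrier G" and g: "g \<in> carrier G" using insert by auto
  note GS = generate_is_subgroup[OF S] and GC = generate_in_carrier[OF S]
  have fc: "f i \<in> carrier G" if "i \<in> I" for i
    using insert.prems(3) that generate_in_carrier[OF insert.prems(1)] by auto
  have "\<forall>i\<in>I. \<exists>a::int. \<exists>z\<in>generate G S. f i = g [^] a \<otimes> z"
    using generate_insert_decomposition[OF S g] insert.prems(3) by auto
  then obtain a :: "_ \<Rightarrow> int" and z where az: "\<And>i. i \<in> I \<Longrightarrow> z i \<in> generate G S \<and> f i = g [^] a i \<otimes> z i"
    by metis
  have zc: "z i \<in> carrier G" if "i \<in> I" for i using az that GC by blast
  show ?case
  proof (cases "\<forall>i\<in>I. a i = 0")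
    case True
    then have "f \<in> I \<rightarrow> generate G S" using az zc g by auto
    then have "card I \<le> card S" using insert.IH[OF S insert.prems(2) _ insert.prems(4)] by blast
    then show ?thesis using insert by simp
  next
    case False
    then obtain p where p: "p \<in> I" "a p \<noteq> 0" by blast
    let ?J = "I - {p}"
    define w where "w i = f i [^] a p \<otimes> f p [^] (- a i)" for i
    have wS: "w \<in> ?J \<rightarrow> generate G S"
    proof
      fix i assume "i \<in> ?J"
      then have i: "i \<in> I" by simp
      have "w i = (g [^] (a i * a p) \<otimes> z i [^] a p) \<otimes> (g [^] (a p * - a i) \<otimes> z p [^] (- a i))"
        unfolding w_def using az[OF i] az[OF p(1)] g zc[OF i] zc[OF p(1)]
        by (simp add: int_pow_distrib int_pow_pow del: int_pow_neg)
      also have "\<dots> = (g [^] (a i * a p) \<otimes> g [^] (a p * - a i)) \<otimes> (z i [^] a p \<otimes> z p [^] (- a i))"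
        using g zc[OF i] zc[OF p(1)] by (simp add: m_ac)
      also have "g [^] (a i * a p) \<otimes> g [^] (a p * - a i) = \<one>" using g by (simp add: int_pow_mult[symmetric])
      finally have "w i = z i [^] a p \<otimes> z p [^] (- a i)" using zc[OF i] zc[OF p(1)] by simp
      then show "w i \<in> generate G S"
        using subgroup_int_pow_closed[OF GS] subgroup.m_closed[OF GS] az i p by simp
    qed
    have J: "finite ?J" using insert.prems by simp
    have "int_independent G ?J w" unfolding int_independent_def
    proof (intro allI impI)
      fix n :: "'i \<Rightarrow> int" assume n: "finprod G (\<lambda>i. w i [^] n i) ?J = \<one>"
      \<comment> \<open>The relation among the \<open>f i\<close> that corresponds to the relation
        \<open>n\<close> among the \<open>w i\<close>; the pivot collects the exponents of all the
        corrections.\<close>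
      define m where "m i = (if i = p then - (\<Sum>j\<in>?J. a j * n j) else a p * n i)" for i
      note fp = finprod_int_pow_const[OF J fc[OF p(1)], of "\<lambda>j. - a j * n j"]
      have "finprod G (\<lambda>i. w i [^] n i) ?J = finprod G (\<lambda>i. f i [^] m i \<otimes> f p [^] (- a i * n i)) ?J"
        by (rule finprod_cong') (use fc p(1) in \<open>auto simp: w_def m_def int_pow_distrib int_pow_pow simp del: int_pow_neg\<close>)
      also have "\<dots> = finprod G (\<lambda>i. f i [^] m i) ?J \<otimes> f p [^] (\<Sum>j\<in>?J. - a j * n j)"
        unfolding fp[symmetric] by (rule finprod_multf) (use fc p(1) in auto)
      also have "(\<Sum>j\<in>?J. - a j * n j) = m p" by (simp add: m_def sum_negf)
      also have "finprod G (\<lambda>i. f i [^] m i) ?J \<otimes> f p [^] m p = finprod G (\<lambda>i. f i [^] m i) (insert p ?J)"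
        using J fc p(1) by (subst finprod_insert) (auto simp: m_comm)
      also have "insert p ?J = I" using p by blast
      finally have "\<forall>i\<in>I. m i = 0" using n insert.prems(4) unfolding int_independent_def by metis
      then have "a p * n i = 0" if "i \<in> ?J" for i
        using that unfolding m_def by (auto dest!: bspec[of _ _ i])
      then show "\<forall>i\<in>?J. n i = 0" using p(2) by simp
    qed
    then have "card ?J \<le> card S" using insert.IH[OF S J wS] by blast
    then show ?thesis using insert p by (simp add: card_Diff_singleton)
  qed
qed

text \<open>Otherwise each \<open>e i\<close> would have a nonzero power in the group generated by
  \<open>S\<close>. These powers stay independent, and there are more of them than
  \<open>card S\<close> allows.\<close>

lemma int_independent_outside:
  assumes e: "\<And>i::nat. e i \<in> carrier G" "\<And>n. int_independent G {..<n} e"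
    and S: "finite S" "S \<subseteq> carrier G"
  shows "\<exists>t\<in>carrier G. \<forall>n::int. t [^] n \<in> generate G S \<longrightarrow> n = 0"
proof (rule ccontr)
  assume neg: "\<not> ?thesis"
  have "\<forall>i. \<exists>n::int. e i [^] n \<in> generate G S \<and> n \<noteq> 0" using neg e(1) by blast
  then obtain n :: "nat \<Rightarrow> int" where n: "\<And>i. e i [^] n i \<in> generate G S" "\<And>i. n i \<noteq> 0" by metis
  let ?I = "{..<Suc (card S)}"
  have "int_independent G ?I (\<lambda>i. e i [^] n i)" unfolding int_independent_def
  proof (intro allI impI)
    fix m :: "nat \<Rightarrow> int" assume "finprod G (\<lambda>i. (e i [^] n i) [^] m i) ?I = \<one>"
    then have "finprod G (\<lambda>i. e i [^] (n i * m i)) ?I = \<one>" using e(1) by (simp add: int_pow_pow)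
    then have "\<forall>i\<in>?I. n i * m i = 0"
      using e(2)[of "Suc (card S)"] unfolding int_independent_def by (elim allE[of _ "\<lambda>i. n i * m i"]) simp
    then show "\<forall>i\<in>?I. m i = 0" using n(2) by simp
  qed
  then have "card ?I \<le> card S" by (intro int_independent_card[OF S]) (use n in auto)
  then show False by simp
qed

text \<open>Each new member is chosen so that no nonzero power of it lies in the group generated by
  \<open>S\<close> and the members found before.\<close>

lemma independent_family_modulo:
  assumes e: "\<And>i::nat. e i \<in> carrier G" "\<And>n. int_independent G {..<n} e"
    and "finite I" "finite S" "S \<subseteq> carrier G"
  shows "\<exists>t\<in>I \<rightarrow> carrier G. \<forall>n::'i \<Rightarrow> int.
    finprod G (\<lambda>i. t i [^] n i) I \<in> generate G S \<longrightarrow> (\<forall>i\<in>I. n i = 0)"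
  using assms(3)
proof (induction I rule: finite_induct)
  case empty
  then show ?case by (intro bexI[of _ "\<lambda>_. \<one>"]) auto
next
  case (insert k I)
  then obtain t where t: "t \<in> I \<rightarrow> carrier G"
    "\<And>n::'i \<Rightarrow> int. finprod G (\<lambda>i. t i [^] n i) I \<in> generate G S \<Longrightarrow> \<forall>i\<in>I. n i = 0" by blast
  let ?S = "S \<union> t ` I"
  have S': "finite ?S" "?S \<subseteq> carrier G" using insert t assms by auto
  note GS' = generate_is_subgroup[OF S'(2)] and GS = generate_is_subgroup[OF assms(5)]
  obtain u where u: "u \<in> carrier G" "\<And>n::int. u [^] n \<in> generate G ?S \<Longrightarrow> n = 0"
    using int_independent_outside[OF e S'] by blast
  let ?t = "t(k := u)"
  have "\<forall>i\<in>insert k I. n i = 0"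
    if n: "finprod G (\<lambda>i. ?t i [^] n i) (insert k I) \<in> generate G S" for n :: "'i \<Rightarrow> int"
  proof -
    let ?p = "finprod G (\<lambda>i. t i [^] n i) I"
    have tc: "t i \<in> carrier G" if "i \<in> I" for i using t(1) that by auto
    then have pc: "?p \<in> carrier G" by (intro finprod_closed) auto
    have "finprod G (\<lambda>i. ?t i [^] n i) (insert k I) = u [^] n k \<otimes> finprod G (\<lambda>i. ?t i [^] n i) I"
      using insert(1,2) tc u(1) by (subst finprod_insert) auto
    also have "finprod G (\<lambda>i. ?t i [^] n i) I = ?p"
      by (rule finprod_cong') (use insert(2) tc in auto)
    finally have eq: "u [^] n k \<otimes> ?p \<in> generate G S" using n by simp
    have "?p \<in> generate G ?S"
      by (rule subgroup_finprod_closed[OF GS' insert(1)])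
        (intro subgroup_int_pow_closed[OF GS'] generate.incl, simp)
    have "u [^] n k = (u [^] n k \<otimes> ?p) \<otimes> inv ?p" using u pc by (simp add: m_assoc)
    moreover have "(u [^] n k \<otimes> ?p) \<otimes> inv ?p \<in> generate G ?S"
      using subgroup.m_closed[OF GS'] subgroup.m_inv_closed[OF GS'] \<open>?p \<in> generate G ?S\<close> eq
        mono_generate[of S ?S] by auto
    ultimately have "u [^] n k \<in> generate G ?S" by (rule ssubst)
    then have nk: "n k = 0" by (rule u(2))
    then have "?p \<in> generate G S" using eq pc u by simp
    then show ?thesis using t(2) nk by blast
  qed
  then show ?case using t u by (intro bexI[of _ ?t]) auto
qed

end

section \<open>Infinitely many independent units of a field\<close>

context field
begin

interpretation UG: comm_group "units_of R" by (rule units_comm_group)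

lemma units_of_carrier_iff: "a \<in> carrier (units_of R) \<longleftrightarrow> a \<in> carrier R \<and> a \<noteq> \<zero>"
  using field_Units by (auto simp: units_of_carrier)

text \<open>Look at the last index \<open>i\<close> of a relation. A positive exponent would make
  the inverse of a power of \<open>f i\<close> a quotient of elements invertible modulo
  \<open>f i\<close>; then \<open>f i\<close> divides such an element and hence 1 in
  \<open>S\<close>. Inverting the relation excludes negative exponents.\<close>

lemma euclid_independent:
  assumes S: "subring S R" and f: "\<And>i::nat. f i \<in> S" "\<And>i. f i \<noteq> \<zero>"
    and step: "\<And>i j. j < i \<Longrightarrow> \<exists>w\<in>S. f j \<otimes> w = f i \<ominus> \<one>"
    and nonunit: "\<And>i w. w \<in> S \<Longrightarrow> f i \<otimes> w \<noteq> \<one>"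
  shows "int_independent (units_of R) {..<n} f"
proof -
  note SD = subringD[OF S]
  have fU: "f i \<in> carrier (units_of R)" for i using f SD(7) units_of_carrier_iff by blast
  have main: "m i \<le> 0"
    if m: "finprod (units_of R) (\<lambda>i. f i [^]\<^bsub>units_of R\<^esub> m i) {..<Suc i} = \<one>\<^bsub>units_of R\<^esub>" for m :: "nat \<Rightarrow> int" and i
  proof (rule ccontr)
    assume "\<not> m i \<le> 0"
    then obtain k where k: "m i = int (Suc k)" by (metis gr0_implies_Suc not_le zero_less_imp_eq_int of_nat_0_less_iff)
    \<comment> \<open>\<open>V\<close> consists of the elements of \<open>S\<close> that are
      invertible modulo \<open>f i\<close>; below, \<open>Y\<close> is the group of their quotients
      in the field. All earlier \<open>f j\<close> belong to \<open>V\<close>, because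
      \<open>f i\<close> is 1 plus a multiple of \<open>f j\<close>.\<close>
    define V where "V = {a \<in> S. \<exists>b\<in>S. \<exists>c\<in>S. a \<otimes> b = \<one> \<oplus> f i \<otimes> c}"
    note fi = SD(7)[OF f(1)]
    have Vc: "a \<in> carrier R" if "a \<in> V" for a using that SD(7) unfolding V_def by blast
    have V_mult: "a \<otimes> a' \<in> V" if a: "a \<in> V" and a': "a' \<in> V" for a a'
    proof -
      obtain b c where b: "b \<in> S" "c \<in> S" "a \<otimes> b = \<one> \<oplus> f i \<otimes> c" using a unfolding V_def by blast
      obtain b' c' where b': "b' \<in> S" "c' \<in> S" "a' \<otimes> b' = \<one> \<oplus> f i \<otimes> c'" using a' unfolding V_def by blast
      have cc: "a \<in> carrier R" "b \<in> carrier R" "c \<in> carrier R" "a' \<in> carrier R" "b' \<in> carrier R" "c' \<in> carrier R"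
        using Vc a a' SD(7) b b' by auto
      have "(a \<otimes> a') \<otimes> (b \<otimes> b') = (a \<otimes> b) \<otimes> (a' \<otimes> b')" using cc by (simp add: m_ac)
      also have "\<dots> = \<one> \<oplus> f i \<otimes> (c \<oplus> c' \<oplus> f i \<otimes> (c \<otimes> c'))"
        unfolding b(3) b'(3) using cc fi by (simp add: l_distr r_distr m_ac a_ac)
      finally have "(a \<otimes> a') \<otimes> (b \<otimes> b') = \<one> \<oplus> f i \<otimes> (c \<oplus> c' \<oplus> f i \<otimes> (c \<otimes> c'))" .
      moreover have "b \<otimes> b' \<in> S" "c \<oplus> c' \<oplus> f i \<otimes> (c \<otimes> c') \<in> S" "a \<otimes> a' \<in> S"
        using SD(4,5) b b' f(1) a a' unfolding V_def by auto
      ultimately show ?thesis unfolding V_def by blast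
    qed
    have V_one: "\<one> \<in> V" unfolding V_def using SD(2,3) fi by (intro CollectI conjI bexI[of _ \<one>] bexI[of _ \<zero>]) auto
    have V_f: "f j \<in> V" if "j < i" for j
    proof -
      obtain w where w: "w \<in> S" "f j \<otimes> w = f i \<ominus> \<one>" using step \<open>j < i\<close> by blast
      have c: "w \<in> carrier R" "f j \<in> carrier R" using w SD(7) f(1) by auto
      have "f j \<otimes> (\<ominus> w) = \<ominus> (f i \<ominus> \<one>)" using c w(2) by (simp add: r_minus)
      also have "\<dots> = \<one> \<oplus> f i \<otimes> (\<ominus> \<one>)" using fi by (simp add: a_minus_def r_minus minus_add a_comm)
      finally show ?thesis unfolding V_def using SD(3,6) w(1) f(1) by blast
    qed
    define Y where "Y = {y \<in> carrier (units_of R). \<exists>a\<in>V. \<exists>b\<in>V. y \<otimes> b = a}"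
    have Yc: "y \<in> carrier R" if "y \<in> Y" for y using that units_of_carrier_iff unfolding Y_def by blast
    have Y: "subgroup Y (units_of R)"
    proof (rule UG.subgroupI)
      show "Y \<subseteq> carrier (units_of R)" unfolding Y_def by blast
      have "\<one> \<in> Y" unfolding Y_def units_of_carrier_iff using V_one by (auto intro!: bexI[of _ \<one>])
      then show "Y \<noteq> {}" by blast
      show "inv\<^bsub>units_of R\<^esub> y \<in> Y" if y: "y \<in> Y" for y
      proof -
        obtain a b where ab: "a \<in> V" "b \<in> V" "y \<otimes> b = a" using y unfolding Y_def by blast
        have yc: "y \<in> carrier (units_of R)" using y unfolding Y_def by blast
        then have yU: "y \<in> Units R" "inv\<^bsub>units_of R\<^esub> y \<in> carrier (units_of R)"
          using UG.inv_closed by (simp_all only: units_of_carrier)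
        have "inv y \<otimes> a = b" unfolding ab(3)[symmetric] using yU(1) Vc[OF ab(2)] m_assoc[of "inv y" y b] by (simp add: Units_closed)
        then show ?thesis unfolding Y_def using ab(1,2) yU by (intro CollectI conjI bexI[of _ b] bexI[of _ a]) (simp_all only: units_of_inv)
      qed
      show "y \<otimes>\<^bsub>units_of R\<^esub> z \<in> Y" if y: "y \<in> Y" and z: "z \<in> Y" for y z
      proof -
        obtain a b where ab: "a \<in> V" "b \<in> V" "y \<otimes> b = a" using y unfolding Y_def by blast
        obtain a' b' where ab': "a' \<in> V" "b' \<in> V" "z \<otimes> b' = a'" using z unfolding Y_def by blast
        have "(y \<otimes> z) \<otimes> (b \<otimes> b') = (y \<otimes> b) \<otimes> (z \<otimes> b')"
          using Vc[OF ab(2)] Vc[OF ab'(2)] Yc[OF y] Yc[OF z] by (simp add: m_ac)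
        then have "(y \<otimes> z) \<otimes> (b \<otimes> b') = a \<otimes> a'" unfolding ab(3) ab'(3) .
        moreover have "y \<otimes>\<^bsub>units_of R\<^esub> z \<in> carrier (units_of R)" using y z unfolding Y_def by auto
        ultimately show ?thesis unfolding Y_def using V_mult ab ab' by (auto simp: units_of_mult)
      qed
    qed
    let ?p = "finprod (units_of R) (\<lambda>i. f i [^]\<^bsub>units_of R\<^esub> m i) {..<i}"
    have fY: "f j \<in> Y" if "j < i" for j
      unfolding Y_def using V_f[OF that] V_one fU[of j] SD(7)[OF f(1)]
      by (intro CollectI conjI bexI[of _ "f j"] bexI[of _ \<one>]) auto
    have "?p \<in> Y"
      by (rule UG.subgroup_finprod_closed[OF Y]) (use fY UG.subgroup_int_pow_closed[OF Y] in auto)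
    then obtain a b where ab: "a \<in> V" "b \<in> V" "?p \<otimes> b = a" and pc: "?p \<in> carrier R"
      using Yc unfolding Y_def by blast
    have "f i [^]\<^bsub>units_of R\<^esub> m i \<otimes>\<^bsub>units_of R\<^esub> ?p = \<one>\<^bsub>units_of R\<^esub>"
      using m fU unfolding lessThan_Suc by (subst (asm) UG.finprod_insert) auto
    moreover have "f i [^]\<^bsub>units_of R\<^esub> m i = f i [^] Suc k"
    proof -
      have "f i [^]\<^bsub>units_of R\<^esub> l = f i [^] l" for l :: nat
        by (induction l) (simp_all add: units_of_one units_of_mult)
      then show ?thesis unfolding k by (simp only: int_pow_int)
    qed
    ultimately have fp: "f i [^] Suc k \<otimes> ?p = \<one>" by (simp add: units_of_mult units_of_one)
    obtain b' c where bc: "b' \<in> S" "c \<in> S" "b \<otimes> b' = \<one> \<oplus> f i \<otimes> c" using ab(2) unfolding V_def by blast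
    have cc: "b' \<in> carrier R" "c \<in> carrier R" "a \<in> carrier R" "b \<in> carrier R" "f i [^] k \<in> carrier R"
      using bc SD(7) Vc ab fi by auto
    have "f i [^] Suc k \<otimes> a = b" unfolding ab(3)[symmetric]
      using m_assoc[of "f i [^] Suc k" ?p b] fp cc(4) pc fi by (simp del: nat_pow_Suc)
    then have "f i \<otimes> (f i [^] k \<otimes> a) = b" using cc fi by (simp add: m_ac)
    then have "f i \<otimes> (f i [^] k \<otimes> a \<otimes> b') = \<one> \<oplus> f i \<otimes> c"
      using bc(3) cc fi m_assoc[of "f i" "f i [^] k \<otimes> a" b'] by simp
    then have "f i \<otimes> (f i [^] k \<otimes> a \<otimes> b' \<ominus> c) = \<one>"
      using cc fi by (simp add: a_minus_def r_distr r_minus a_assoc r_neg)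
    moreover have "f i [^] k \<in> S" by (induction k) (use SD f in auto)
    then have "f i [^] k \<otimes> a \<otimes> b' \<ominus> c \<in> S"
      using SD(4-6) ab(1) bc unfolding V_def a_minus_def by auto
    ultimately show False using nonunit by blast
  qed
  have neg: "finprod (units_of R) (\<lambda>i. f i [^]\<^bsub>units_of R\<^esub> - m i) {..<i} = \<one>\<^bsub>units_of R\<^esub>"
    if "finprod (units_of R) (\<lambda>i. f i [^]\<^bsub>units_of R\<^esub> m i) {..<i} = \<one>\<^bsub>units_of R\<^esub>" for m :: "nat \<Rightarrow> int" and i
  proof -
    have "finprod (units_of R) (\<lambda>i. f i [^]\<^bsub>units_of R\<^esub> - m i) {..<i} =
      finprod (units_of R) (\<lambda>i. (f i [^]\<^bsub>units_of R\<^esub> m i) [^]\<^bsub>units_of R\<^esub> (-1::int)) {..<i}"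
      by (rule UG.finprod_cong') (use fU in \<open>auto simp: UG.int_pow_pow\<close>)
    also have "\<dots> = \<one>\<^bsub>units_of R\<^esub> [^]\<^bsub>units_of R\<^esub> (-1::int)"
      unfolding that[symmetric] by (rule UG.int_pow_finprod[symmetric]) (use fU in auto)
    finally show ?thesis by simp
  qed
  have zero: "m i = 0" if "finprod (units_of R) (\<lambda>i. f i [^]\<^bsub>units_of R\<^esub> m i) {..<Suc i} = \<one>\<^bsub>units_of R\<^esub>"
    for m :: "nat \<Rightarrow> int" and i
    using main[OF that] main[OF neg[OF that]] by simp
  show ?thesis unfolding int_independent_def
  proof (intro allI impI)
    fix m :: "nat \<Rightarrow> int" assume "finprod (units_of R) (\<lambda>i. f i [^]\<^bsub>units_of R\<^esub> m i) {..<n} = \<one>\<^bsub>units_of R\<^esub>"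
    then show "\<forall>i\<in>{..<n}. m i = 0"
    proof (induction n)
      case (Suc n)
      have mn: "m n = 0" by (rule zero[OF Suc.prems])
      have "finprod (units_of R) (\<lambda>i. f i [^]\<^bsub>units_of R\<^esub> m i) {..<n} = \<one>\<^bsub>units_of R\<^esub>"
        using Suc.prems fU mn unfolding lessThan_Suc by (subst (asm) UG.finprod_insert) auto
      then show ?case using Suc.IH mn by (auto simp: less_Suc_eq)
    qed simp
  qed
qed

text \<open>Sylvester's sequence with a free starting value. Every term is 1 plus a multiple of each
  earlier term, the situation of Euclid's argument.\<close>

primrec sylvester :: "'a \<Rightarrow> nat \<Rightarrow> 'a" where
  "sylvester a 0 = a"
| "sylvester a (Suc n) = sylvester a n \<otimes> (sylvester a n \<ominus> \<one>) \<oplus> \<one>"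

lemma sylvester_mem: "subring S R \<Longrightarrow> a \<in> S \<Longrightarrow> sylvester a n \<in> S"
  using subringD[of S] by (induction n) (auto simp: a_minus_def)

lemma sylvester_step:
  assumes S: "subring S R" and a: "a \<in> S"
  shows "j < i \<Longrightarrow> \<exists>w\<in>S. sylvester a j \<otimes> w = sylvester a i \<ominus> \<one>"
proof (induction i)
  case (Suc i)
  note SD = subringD[OF S] and mem = sylvester_mem[OF S a]
  have c: "sylvester a l \<in> carrier R" for l using mem SD(7) by blast
  have e: "sylvester a (Suc i) \<ominus> \<one> = sylvester a i \<otimes> (sylvester a i \<ominus> \<one>)"
    using c[of i] by (simp add: a_minus_def a_assoc r_neg)
  show ?case
  proof (cases "j = i")
    case True
    then show ?thesis unfolding e using SD mem by (auto simp: a_minus_def)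
  next
    case False
    then obtain w where w: "w \<in> S" "sylvester a j \<otimes> w = sylvester a i \<ominus> \<one>" using Suc by auto
    then have "sylvester a j \<otimes> (w \<otimes> sylvester a i) = sylvester a (Suc i) \<ominus> \<one>"
      unfolding e using c SD(7)[OF w(1)] by (metis m_assoc m_comm minus_closed one_closed)
    then show ?thesis using SD(5) w mem by blast
  qed
qed simp


lemma nat_pow_nonzero: "a \<in> carrier R \<Longrightarrow> a \<noteq> \<zero> \<Longrightarrow> a [^] (n::nat) \<noteq> \<zero>"
  by (induction n) (auto simp: integral_iff)

abbreviation prime_ring :: "'a set" where "prime_ring \<equiv> range (\<lambda>z::int. [z] \<cdot> \<one>)"

lemma int_mult_one: "[a] \<cdot> \<one> \<otimes> [b] \<cdot> \<one> = [(a * b)] \<cdot> \<one>" for a b :: int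
  by (simp add: add_pow_ldistr_int add.int_pow_pow mult.commute)

lemma subring_prime_ring: "subring prime_ring R"
proof (rule subringI)
  show "prime_ring \<subseteq> carrier R" by auto
  show "\<one> \<in> prime_ring" by (intro image_eqI[of _ _ 1]) auto
  show "\<ominus> a \<in> prime_ring" if "a \<in> prime_ring" for a
    using that by (auto simp flip: add.int_pow_neg)
  show "a \<otimes> b \<in> prime_ring" if "a \<in> prime_ring" "b \<in> prime_ring" for a b
    using that by (auto simp: int_mult_one)
  show "a \<oplus> b \<in> prime_ring" if "a \<in> prime_ring" "b \<in> prime_ring" for a b
    using that by (auto simp flip: add.int_pow_mult)
qed

text \<open>Started at 2, the sequence consists of integers that are at least 2, none of which is
  invertible in the prime ring.\<close>

lemma infinite_independent_char_0:
  assumes char: "\<And>z::int. [z] \<cdot> \<one> = \<zero> \<Longrightarrow> z = 0"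
  shows "\<exists>f. (\<forall>i::nat. f i \<in> carrier (units_of R)) \<and> (\<forall>n. int_independent (units_of R) {..<n} f)"
proof -
  let ?f = "sylvester ([(2::int)] \<cdot> \<one>)"
  have E: "\<exists>E::int. E \<ge> 2 \<and> ?f i = [E] \<cdot> \<one>" for i
  proof (induction i)
    case (Suc i)
    then obtain E :: int where E: "E \<ge> 2" "?f i = [E] \<cdot> \<one>" by blast
    have one: "\<one> = [(1::int)] \<cdot> \<one>" by simp
    have "?f (Suc i) = [E] \<cdot> \<one> \<otimes> ([E] \<cdot> \<one> \<ominus> [(1::int)] \<cdot> \<one>) \<oplus> [(1::int)] \<cdot> \<one>" using E(2) by simp
    also have "[E] \<cdot> \<one> \<ominus> [(1::int)] \<cdot> \<one> = [(E - 1)] \<cdot> \<one>"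
      by (simp add: a_minus_def add.int_pow_diff del: add.int_pow_1)
    also have "[E] \<cdot> \<one> \<otimes> [(E - 1)] \<cdot> \<one> \<oplus> [(1::int)] \<cdot> \<one> = [(E * (E - 1) + 1)] \<cdot> \<one>"
      by (simp only: int_mult_one add.int_pow_mult one_closed)
    finally have "?f (Suc i) = [(E * (E - 1) + 1)] \<cdot> \<one>" .
    moreover have "E * (E - 1) + 1 \<ge> 2" using mult_mono[of 2 E 1 "E - 1"] E(1) by simp
    ultimately show ?case by blast
  qed auto
  have nz: "?f i \<noteq> \<zero>" for i using E[of i] char by fastforce
  have mem: "?f i \<in> prime_ring" for i using E[of i] by blast
  have nonunit: "?f i \<otimes> w \<noteq> \<one>" if w: "w \<in> prime_ring" for i w
  proof
    assume eq: "?f i \<otimes> w = \<one>"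
    obtain E z :: int where E: "E \<ge> 2" "?f i = [E] \<cdot> \<one>" and z: "w = [z] \<cdot> \<one>" using E[of i] w by auto
    have "[(E * z - 1)] \<cdot> \<one> = [(E * z)] \<cdot> \<one> \<ominus> \<one>" by (simp add: a_minus_def add.int_pow_diff)
    also have "\<dots> = \<zero>" using eq unfolding E(2) z by (simp add: int_mult_one r_right_minus_eq)
    finally have "E * z = 1" using char[of "E * z - 1"] by simp
    then show False using E(1) zmult_eq_1_iff[of E z] by auto
  qed
  have "\<And>n. int_independent (units_of R) {..<n} ?f"
    using subring_prime_ring mem nz sylvester_step[OF subring_prime_ring mem[of 0, unfolded sylvester.simps]] nonunit
    by (rule euclid_independent)
  moreover have "\<And>i. ?f i \<in> carrier (units_of R)"
    using mem nz subringD(7)[OF subring_prime_ring] units_of_carrier_iff by blast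
  ultimately show ?thesis by blast
qed

text \<open>Here \<open>q\<close> turns out to be transcendental over the finite prime ring, so the
  sequence started at \<open>q\<close> lives in a polynomial ring. Its terms have positive degree
  and are therefore not invertible there.\<close>

lemma infinite_independent_char_p:
  assumes p: "p \<noteq> 0" "[(p::int)] \<cdot> \<one> = \<zero>"
    and q: "q \<in> carrier R" "\<not> root_of_unity R q" and q0: "q \<noteq> \<zero>"
  shows "\<exists>f. (\<forall>i::nat. f i \<in> carrier (units_of R)) \<and> (\<forall>n. int_independent (units_of R) {..<n} f)"
proof -
  let ?T = prime_ring
  note TD = subringD[OF subring_prime_ring]
  interpret F: skew_filtered R ?T q by (intro skew_filtered.intro skew_filtered_axioms.intro ring_axioms subring_prime_ring q(1))
  have finT: "finite ?T"
  proof (rule finite_subset)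
    have "[z] \<cdot> \<one> = [(z mod \<bar>p\<bar>)] \<cdot> \<one>" for z :: int
    proof -
      have pa: "[(\<bar>p\<bar>)] \<cdot> \<one> = \<zero>" using p(2) by (auto simp: abs_if add.int_pow_neg)
      have "[z] \<cdot> \<one> = [(\<bar>p\<bar> * (z div \<bar>p\<bar>) + z mod \<bar>p\<bar>)] \<cdot> \<one>" by simp
      also have "\<dots> = [(\<bar>p\<bar> * (z div \<bar>p\<bar>))] \<cdot> \<one> \<oplus> [(z mod \<bar>p\<bar>)] \<cdot> \<one>" by (simp only: add.int_pow_mult one_closed)
      also have "[(\<bar>p\<bar> * (z div \<bar>p\<bar>))] \<cdot> \<one> = \<zero>" using pa by (simp flip: int_mult_one)
      finally show ?thesis by simp
    qed
    then have "[z] \<cdot> \<one> \<in> (\<lambda>z. [z] \<cdot> \<one>) ` {0..<\<bar>p\<bar>}" for z :: int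
      using p(1) by (intro image_eqI[of _ _ "z mod \<bar>p\<bar>"]) auto
    then show "?T \<subseteq> (\<lambda>z. [z] \<cdot> \<one>) ` {0..<\<bar>p\<bar>}" by blast
  qed simp
  \<comment> \<open>A finite integral domain is a field: multiplication by \<open>a\<close> is
    injective, hence onto.\<close>
  have inv: "\<exists>b\<in>?T. b \<otimes> a = \<one>" if a: "a \<in> ?T" "a \<noteq> \<zero>" for a
  proof -
    have "inj_on (\<lambda>b. b \<otimes> a) ?T" by (rule inj_onI) (use a TD(7) m_rcancel in blast)
    moreover have "(\<lambda>b. b \<otimes> a) ` ?T \<subseteq> ?T" using TD(5) a(1) by blast
    ultimately have "(\<lambda>b. b \<otimes> a) ` ?T = ?T" using finT by (metis endo_inj_surj)
    then show ?thesis using TD(3) by (metis imageE)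
  qed
  have finP: "finite (F.P n)" for n
  proof (induction n)
    case (Suc n)
    have "F.P (Suc n) = (\<lambda>(u, a). u \<oplus> a \<otimes> q [^] n) ` (F.P n \<times> ?T)"
      unfolding skew_filtration.simps(2) by auto
    then show ?case using Suc finT by simp
  qed simp
  \<comment> \<open>If the top coefficient were nonzero it could be normalized to 1. Then all higher
    powers of \<open>q\<close> would stay in the finite set \<open>F.P n\<close>, two of them would
    coincide, and \<open>q\<close> would be a root of unity.\<close>
  have free: "a = \<zero>" if a: "a \<in> ?T" "a \<otimes> q [^] n \<in> F.P n" for a n
  proof (rule ccontr)
    assume "a \<noteq> \<zero>"
    then obtain b where b: "b \<in> ?T" "b \<otimes> a = \<one>" using inv a by blast
    have "b \<otimes> (a \<otimes> q [^] n) = q [^] n"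
      using b TD(7)[OF a(1)] TD(7)[OF b(1)] q(1) by (simp add: m_assoc[symmetric])
    then have qn: "q [^] n \<in> F.P n" using F.P_smult[OF a(2) b(1)] by simp
    have pow: "q [^] (n + m) \<in> F.P n" for m
    proof (induction m)
      case (Suc m)
      obtain u c where u: "u \<in> F.P n" "c \<in> ?T" "q [^] (n + m) \<otimes> q = u \<oplus> c \<otimes> q [^] n"
        using F.P_SucE[OF F.P_mult_x[OF Suc]] .
      then have "q [^] (n + m) \<otimes> q \<in> F.P n" using F.P_add F.P_smult qn by simp
      then show ?case by simp
    qed (use qn in simp)
    have "\<not> inj (\<lambda>m. q [^] (n + m))"
    proof
      assume "inj (\<lambda>m. q [^] (n + m))"
      then have "infinite (range (\<lambda>m. q [^] (n + m)))" by (rule range_inj_infinite)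
      moreover have "range (\<lambda>m. q [^] (n + m)) \<subseteq> F.P n" using pow by blast
      ultimately show False using finP finite_subset by blast
    qed
    then obtain i j where ij: "q [^] (n + i) = q [^] (n + j)" "i < j"
      unfolding inj_on_def by (metis linorder_neqE_nat)
    have "n + i + (j - i) = n + j" using ij(2) by simp
    then have "q [^] (n + i) \<otimes> q [^] (j - i) = q [^] (n + i) \<otimes> \<one>"
      unfolding nat_pow_mult[OF q(1)] using ij(1) q(1) by simp
    then have "q [^] (j - i) = \<one>"
      using q0 q(1) m_lcancel[of "q [^] (n + i)" "q [^] (j - i)" \<one>] nat_pow_nonzero[of q "n + i"] by simp
    then show False using q(2) ij(2) zero_less_diff unfolding root_of_unity_def by blast
  qed
  interpret S: skew_step R ?T q id
  proof unfold_locales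
    show "\<exists>d\<in>?T. q \<otimes> a = id a \<otimes> q \<oplus> d" if "a \<in> ?T" for a
      using TD(2) TD(7)[OF that] q(1) by (intro bexI[of _ \<zero>]) (simp_all add: m_comm)
  qed (use free in auto)
  let ?f = "sylvester q"
  have one: "\<one> \<in> F.P (Suc d)" for d
    by (rule F.P_mono[of 1], simp, unfold One_nat_def, rule F.P_SucI[OF F.P_zero[of 0] TD(3)]) (use q in auto)
  \<comment> \<open>All terms have positive degree: the degree doubles each time, since subtracting
    and adding 1 only affects lower coefficients.\<close>
  have lead: "\<exists>d u a. d > 0 \<and> u \<in> F.P d \<and> a \<in> ?T \<and> a \<noteq> \<zero> \<and> ?f i = u \<oplus> a \<otimes> q [^] d" for i
  proof (induction i)
    case 0
    have "?f 0 = \<zero> \<oplus> \<one> \<otimes> q [^] (1::nat)" using q by simp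
    then show ?case using F.P_zero[of 1] TD(3) one_not_zero by (metis zero_less_one)
  next
    case (Suc i)
    then obtain d u a where d: "d > 0" "u \<in> F.P d" "a \<in> ?T" "a \<noteq> \<zero>" "?f i = u \<oplus> a \<otimes> q [^] d" by blast
    then obtain d' where d': "d = Suc d'" by (cases d) auto
    have c: "u \<in> carrier R" "a \<in> carrier R" "q [^] d \<in> carrier R" using d F.P_carrier TD(7) q by auto
    have "?f i \<ominus> \<one> = (u \<ominus> \<one>) \<oplus> a \<otimes> q [^] d" unfolding d(5) using c by (simp add: a_minus_def a_ac)
    moreover have "u \<ominus> \<one> \<in> F.P d" using F.P_diff d(2) one[of d'] d' by simp
    ultimately obtain v where v: "v \<in> F.P (d + d)" "?f i \<otimes> (?f i \<ominus> \<one>) = v \<oplus> (a \<otimes> a) \<otimes> q [^] (d + d)"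
      using S.lead_mult[OF d(2) _ d(3) d(3), of "u \<ominus> \<one>" d] d(5) by (auto simp: id_funpow)
    have vc: "v \<in> carrier R" using v F.P_carrier by blast
    have "?f (Suc i) = (v \<oplus> \<one>) \<oplus> (a \<otimes> a) \<otimes> q [^] (d + d)"
      unfolding sylvester.simps v(2) using vc c q by (simp add: a_ac)
    moreover have "v \<oplus> \<one> \<in> F.P (d + d)" using F.P_add[OF v(1)] one[of "d' + d"] d' by simp
    moreover have "a \<otimes> a \<in> ?T" "a \<otimes> a \<noteq> \<zero>" using TD(5) d c integral_iff by auto
    ultimately show ?case using d(1) by (metis add_gr_0)
  qed
  have nz: "?f i \<noteq> \<zero>" for i using lead[of i] S.lead_nonzero by metis
  note sub = S.subring_ext
  have qS: "q \<in> S.ext" by (rule S.x_ext)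
  have nonunit: "?f i \<otimes> w \<noteq> \<one>" if w: "w \<in> S.ext" for i w
  proof
    assume eq: "?f i \<otimes> w = \<one>"
    obtain d u a where d: "d > 0" "u \<in> F.P d" "a \<in> ?T" "a \<noteq> \<zero>" "?f i = u \<oplus> a \<otimes> q [^] d" using lead[of i] by blast
    have fc: "?f i \<in> carrier R" using sylvester_mem[OF sub qS] subringD(7)[OF sub] by blast
    have "w \<noteq> \<zero>" using eq fc by auto
    then obtain m v b where m: "v \<in> F.P m" "b \<in> ?T" "b \<noteq> \<zero>" "w = v \<oplus> b \<otimes> q [^] m"
      using S.extE[OF w] by metis
    obtain z where z: "z \<in> F.P (d + m)" "?f i \<otimes> w = z \<oplus> (a \<otimes> b) \<otimes> q [^] (d + m)"
      using S.lead_mult[OF d(2) m(1) d(3) m(2)] d(5) m(4) by (auto simp: id_funpow)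
    have ab: "a \<otimes> b \<in> ?T" "a \<otimes> b \<noteq> \<zero>" using TD(5,7) d m integral_iff by auto
    have "z \<oplus> (a \<otimes> b) \<otimes> q [^] (d + m) = \<zero> \<oplus> \<one> \<otimes> q [^] (0::nat)" using eq z(2) by simp
    then have "d + m = 0" using S.lead_unique[OF z(1) F.P_zero[of 0] ab(1) TD(3) ab(2)] by simp
    then show False using d(1) by simp
  qed
  have mem: "?f i \<in> S.ext" for i by (rule sylvester_mem[OF sub qS])
  have "\<And>n. int_independent (units_of R) {..<n} ?f"
    using sub mem nz sylvester_step[OF sub qS] nonunit by (rule euclid_independent)
  moreover have "\<And>i. ?f i \<in> carrier (units_of R)"
    using mem nz subringD(7)[OF sub] units_of_carrier_iff by blast
  ultimately show ?thesis by blast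
qed

lemma units_independent_family_modulo:
  assumes q: "q \<in> carrier R" "\<not> root_of_unity R q" "q \<noteq> \<zero>"
    and "finite I" "finite S" "S \<subseteq> carrier (units_of R)"
  shows "\<exists>t\<in>I \<rightarrow> carrier (units_of R). \<forall>n::'i \<Rightarrow> int.
    finprod (units_of R) (\<lambda>i. t i [^]\<^bsub>units_of R\<^esub> n i) I \<in> generate (units_of R) S \<longrightarrow> (\<forall>i\<in>I. n i = 0)"
proof -
  obtain f where "\<And>i::nat. f i \<in> carrier (units_of R)" "\<And>n. int_independent (units_of R) {..<n} f"
    using infinite_independent_char_0 infinite_independent_char_p[OF _ _ q] by blast
  then show ?thesis using assms(4-6) by (rule UG.independent_family_modulo)
qed

end

section \<open>Generic cocycles\<close>

context split_torus
begin

lemma laurent_mult: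
  assumes h: "g \<in> carrier Tor" "g' \<in> carrier Tor"
  shows "laurent_monomial K r m (g \<otimes>\<^bsub>Tor\<^esub> g') = laurent_monomial K r m g \<otimes> laurent_monomial K r m g'"
proof -
  note c = units_carrier_nth[OF h(1)] units_carrier_nth[OF h(2)]
  have "laurent_monomial K r m (g \<otimes>\<^bsub>Tor\<^esub> g') =
      finprod (units_of K) (\<lambda>i. g i [^]\<^bsub>units_of K\<^esub> m i \<otimes>\<^bsub>units_of K\<^esub> g' i [^]\<^bsub>units_of K\<^esub> m i) {..<r}"
    unfolding laurent_monomial_def using c
    by (intro U.finprod_cong') (auto simp: torus_def U.int_pow_distrib)
  also have "\<dots> = laurent_monomial K r m g \<otimes>\<^bsub>units_of K\<^esub> laurent_monomial K r m g'"
    unfolding laurent_monomial_def using c by (intro U.finprod_multf) auto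
  finally show ?thesis by (simp add: units_of_mult)
qed

lemma finsum_minus:
  assumes "finite I" "f \<in> I \<rightarrow> carrier K" "g \<in> I \<rightarrow> carrier K"
  shows "(\<Oplus>i\<in>I. f i \<ominus> g i) = (\<Oplus>i\<in>I. f i) \<ominus> (\<Oplus>i\<in>I. g i)"
  using assms
proof (induction I rule: finite_induct)
  case (insert i I)
  then have "(\<Oplus>i\<in>I. f i) \<in> carrier K" "(\<Oplus>i\<in>I. g i) \<in> carrier K" "f i \<in> carrier K" "g i \<in> carrier K"
    by (auto intro!: KF.finsum_closed)
  moreover have "(\<lambda>i. f i \<ominus> g i) \<in> I \<rightarrow> carrier K" using insert by (auto simp: Pi_iff)
  ultimately show ?case using insert
    by (simp add: Pi_iff) (simp add: a_minus_def KF.minus_add KF.a_ac)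
qed (simp add: a_minus_def)

text \<open>Dedekind's argument: a relation \<open>\<chi> = \<Sum> c\<^sub>m m\<close> with \<open>\<chi> \<noteq> m\<^sub>0\<close> can be shortened by
  subtracting \<open>m\<^sub>0(g)\<close> times the relation from its translate by \<open>g\<close>.\<close>

lemma character_laurent:
  assumes \<chi>: "\<chi> \<in> carrier \<Gamma>"
  shows "\<exists>m. \<forall>g\<in>carrier Tor. \<chi> g = laurent_monomial K r m g"
proof -
  let ?l = "laurent_monomial K r"
  note \<chi>c = KF.Units_closed[OF character_Units[OF \<chi>]]
  have "\<exists>m\<in>F. \<forall>g\<in>carrier Tor. \<chi> g = ?l m g"
    if "finite F" "c \<in> F \<rightarrow> carrier K" "\<forall>g\<in>carrier Tor. \<chi> g = (\<Oplus>m\<in>F. c m \<otimes> ?l m g)" for F c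
    using that
  proof (induction F arbitrary: c rule: finite_induct)
    case empty
    then have "\<chi> \<one>\<^bsub>Tor\<^esub> = \<zero>" by simp
    then show ?case using character_Units[OF \<chi>, of "\<one>\<^bsub>Tor\<^esub>"] KF.field_Units by simp
  next
    case (insert n F)
    show ?case
    proof (cases "\<forall>g\<in>carrier Tor. \<chi> g = ?l n g")
      case False
      then obtain g where g: "g \<in> carrier Tor" "\<chi> g \<noteq> ?l n g" by blast
      define u where "u = \<chi> g \<ominus> ?l n g"
      have u: "u \<in> Units K" using g \<chi>c laurent_closed[OF g(1)] unfolding KF.field_Units u_def by simp
      \<comment> \<open>Dividing by \<open>u\<close> restores coefficient 1 at
        \<open>\<chi>\<close>, so that the shortened relation has the form required by the induction
        hypothesis.\<close>
      define c' where "c' m = inv u \<otimes> (c m \<otimes> (?l m g \<ominus> ?l n g))" for m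
      have uc: "u \<in> carrier K" "inv u \<in> carrier K" using u by auto
      have cc: "c n \<in> carrier K" "\<And>m. m \<in> F \<Longrightarrow> c m \<in> carrier K" using insert.prems by auto
      have c': "c' \<in> F \<rightarrow> carrier K" using cc uc laurent_closed[OF g(1)] unfolding c'_def by auto
      have "\<chi> k = (\<Oplus>m\<in>F. c' m \<otimes> ?l m k)" if k: "k \<in> carrier Tor" for k
      proof -
        note lc = laurent_closed[OF g(1)] laurent_closed[OF k]
        let ?s = "\<Oplus>m\<in>F. c m \<otimes> ?l m k" and ?t = "\<Oplus>m\<in>F. c m \<otimes> ?l m g \<otimes> ?l m k"
        have st: "?s \<in> carrier K" "?t \<in> carrier K" using cc lc by (auto intro!: KF.finsum_closed)
        have 1: "\<chi> k = c n \<otimes> ?l n k \<oplus> ?s"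
          using insert.prems(2) k insert.hyps cc lc by (simp add: Pi_iff)
        have "\<chi> g \<otimes> \<chi> k = \<chi> (g \<otimes>\<^bsub>Tor\<^esub> k)" using character_hom[OF \<chi> g(1) k] by simp
        also have "\<dots> = (\<Oplus>m\<in>insert n F. c m \<otimes> ?l m (g \<otimes>\<^bsub>Tor\<^esub> k))"
          using insert.prems(2) g(1) k by simp
        also have "\<dots> = (\<Oplus>m\<in>insert n F. c m \<otimes> ?l m g \<otimes> ?l m k)"
          using cc lc by (intro KF.finsum_cong') (auto simp: laurent_mult[OF g(1) k] KF.m_assoc)
        also have "\<dots> = c n \<otimes> ?l n g \<otimes> ?l n k \<oplus> ?t"
          using insert.hyps cc lc by (simp add: Pi_iff)
        finally have 2: "\<chi> g \<otimes> \<chi> k = c n \<otimes> ?l n g \<otimes> ?l n k \<oplus> ?t" .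
        have "u \<otimes> \<chi> k = \<chi> g \<otimes> \<chi> k \<ominus> ?l n g \<otimes> \<chi> k"
          unfolding u_def a_minus_def using \<chi>c g(1) k lc by (simp add: KF.l_distr KF.l_minus)
        also have "\<dots> = ?t \<ominus> ?l n g \<otimes> ?s"
        proof -
          let ?x = "c n \<otimes> ?l n g \<otimes> ?l n k"
          have x: "?x \<in> carrier K" "?l n g \<otimes> ?s \<in> carrier K" using cc lc st by auto
          have "?l n g \<otimes> \<chi> k = ?x \<oplus> ?l n g \<otimes> ?s"
            unfolding 1 using cc lc st by (simp add: KF.r_distr KF.m_ac)
          then show ?thesis unfolding 2 using x st
            by (simp add: a_minus_def KF.minus_add KF.a_ac KF.r_neg2 KF.r_neg1)
        qed
        also have "?l n g \<otimes> ?s = (\<Oplus>m\<in>F. ?l n g \<otimes> (c m \<otimes> ?l m k))"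
          using insert.hyps cc lc by (intro KF.finsum_rdistr) auto
        also have "?t \<ominus> \<dots> = (\<Oplus>m\<in>F. c m \<otimes> ?l m g \<otimes> ?l m k \<ominus> ?l n g \<otimes> (c m \<otimes> ?l m k))"
          by (rule finsum_minus[symmetric]) (use insert.hyps(1) cc lc in auto)
        also have "\<dots> = (\<Oplus>m\<in>F. u \<otimes> (c' m \<otimes> ?l m k))"
        proof (rule KF.finsum_cong')
          fix m assume m: "m \<in> F"
          have "u \<otimes> (c' m \<otimes> ?l m k) = (u \<otimes> inv u) \<otimes> (c m \<otimes> (?l m g \<ominus> ?l n g) \<otimes> ?l m k)"
            unfolding c'_def using uc cc(2)[OF m] lc by (simp add: KF.m_assoc)
          also have "\<dots> = c m \<otimes> ?l m g \<otimes> ?l m k \<ominus> ?l n g \<otimes> (c m \<otimes> ?l m k)"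
            using u cc(2)[OF m] lc by (simp add: a_minus_def KF.l_distr KF.r_distr KF.l_minus KF.r_minus KF.m_ac)
          finally show "c m \<otimes> ?l m g \<otimes> ?l m k \<ominus> ?l n g \<otimes> (c m \<otimes> ?l m k) = u \<otimes> (c' m \<otimes> ?l m k)" ..
        qed (use uc c' lc in \<open>auto simp: Pi_iff\<close>)
        also have "\<dots> = u \<otimes> (\<Oplus>m\<in>F. c' m \<otimes> ?l m k)"
          using insert.hyps c' lc uc by (intro KF.finsum_rdistr[symmetric]) auto
        finally show ?thesis
          using uc u \<chi>c k c' lc KF.Units_l_cancel[OF u] by (simp add: Pi_iff)
      qed
      then show ?thesis using insert.IH[OF c'] by blast
    qed blast
  qed
  note shorten = this
  obtain F c where "finite F" "c \<in> F \<rightarrow> carrier K" "\<forall>g\<in>carrier Tor. \<chi> g = (\<Oplus>m\<in>F. c m \<otimes> ?l m g)"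
    using \<chi> unfolding character_carrier regular_function_def by (elim conjE exE)
  from shorten[OF this] show ?thesis by (elim bexE) (rule exI)
qed

text \<open>Evaluate at the torus element with \<open>q\<close> in coordinate \<open>a\<close> and 1
  elsewhere. Over a finite field different exponents can define the same function, which is why an
  element that is not a root of unity is required.\<close>

lemma laurent_exponents_unique:
  assumes q: "q \<in> Units K" "\<not> root_of_unity K q"
    and eq: "\<forall>g\<in>carrier Tor. laurent_monomial K r m g = laurent_monomial K r m' g" and a: "a < r"
  shows "m a = m' a"
proof -
  let ?g = "\<lambda>i\<in>{..<r}. if i = a then q else \<one>"
  have qU: "q \<in> carrier (units_of K)" using q(1) by (simp add: units_of_carrier)
  have g: "?g \<in> carrier Tor" using q(1) by (auto simp: torus_carrier)
  have l: "laurent_monomial K r m ?g = q [^]\<^bsub>units_of K\<^esub> m a" for m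
  proof -
    have "laurent_monomial K r m ?g =
        finprod (units_of K) (\<lambda>i. if i = a then q [^]\<^bsub>units_of K\<^esub> m i else \<one>\<^bsub>units_of K\<^esub>) {..<r}"
      unfolding laurent_monomial_def using qU
      by (intro U.finprod_cong') (auto simp flip: units_of_one[of K])
    also have "\<dots> = q [^]\<^bsub>units_of K\<^esub> m a" using a qU U.finprod_singleton_swap[of a "{..<r}" "\<lambda>i. q [^]\<^bsub>units_of K\<^esub> m i"] by (simp add: Pi_iff)
    finally show ?thesis .
  qed
  have pow: "q [^]\<^bsub>units_of K\<^esub> n = q [^] n" for n :: nat
    by (induction n) (simp_all add: units_of_one units_of_mult)
  have "q [^]\<^bsub>units_of K\<^esub> (m a - m' a) = \<one>\<^bsub>units_of K\<^esub>"
    using bspec[OF eq g] U.r_inv[of "q [^]\<^bsub>units_of K\<^esub> m' a"] qU unfolding l by (simp add: U.int_pow_diff)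
  then have "q [^]\<^bsub>units_of K\<^esub> nat \<bar>m a - m' a\<bar> = \<one>\<^bsub>units_of K\<^esub>"
  proof -
    let ?k = "m a - m' a"
    assume *: "q [^]\<^bsub>units_of K\<^esub> ?k = \<one>\<^bsub>units_of K\<^esub>"
    have "q [^]\<^bsub>units_of K\<^esub> nat \<bar>k\<bar> = \<one>\<^bsub>units_of K\<^esub>"
      if k: "q [^]\<^bsub>units_of K\<^esub> k = \<one>\<^bsub>units_of K\<^esub>" for k :: int
    proof (cases "k < 0")
      case True
      have "q [^]\<^bsub>units_of K\<^esub> (- k) = \<one>\<^bsub>units_of K\<^esub>" by (simp only: U.int_pow_neg[OF qU] k U.inv_one)
      then show ?thesis using int_pow_int[of "units_of K" q "nat (- k)"] True by (simp del: U.int_pow_neg)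
    next
      case False
      then show ?thesis using int_pow_int[of "units_of K" q "nat k"] k by simp
    qed
    from this[OF *] show ?thesis .
  qed
  then have "root_of_unity K q" if "0 < nat \<bar>m a - m' a\<bar>"
    unfolding pow units_of_one root_of_unity_def by (intro exI[of _ "nat \<bar>m a - m' a\<bar>"] conjI that)
  then show ?thesis using q(2) by (cases "m a = m' a") auto
qed

text \<open>Multiplying monomials adds exponents, and uniqueness turns this into additivity of
  \<open>d\<close>. A character with zero exponents is the constant monomial.\<close>

lemma character_exponents:
  assumes q: "q \<in> Units K" "\<not> root_of_unity K q"
  shows "\<exists>d :: ((nat \<Rightarrow> 'k) \<Rightarrow> 'k) \<Rightarrow> nat \<Rightarrow> int.
    (\<forall>s\<in>carrier \<Gamma>. \<forall>t\<in>carrier \<Gamma>. \<forall>a<r. d (s \<otimes>\<^bsub>\<Gamma>\<^esub> t) a = d s a + d t a) \<and>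
    (\<forall>s\<in>carrier \<Gamma>. (\<forall>a<r. d s a = 0) \<longrightarrow> s = \<one>\<^bsub>\<Gamma>\<^esub>)"
proof -
  interpret \<Gamma>: comm_group \<Gamma> by (rule character_group_comm_group)
  have "\<forall>s\<in>carrier \<Gamma>. \<exists>m. \<forall>g\<in>carrier Tor. s g = laurent_monomial K r m g"
    using character_laurent by (rule ballI)
  from bchoice[OF this] obtain d
    where d': "\<forall>s\<in>carrier \<Gamma>. \<forall>g\<in>carrier Tor. s g = laurent_monomial K r (d s) g" ..
  have d: "\<And>s g. s \<in> carrier \<Gamma> \<Longrightarrow> g \<in> carrier Tor \<Longrightarrow> s g = laurent_monomial K r (d s) g"
    by (rule bspec[OF bspec[OF d']])
  have add: "d (s \<otimes>\<^bsub>\<Gamma>\<^esub> t) a = d s a + d t a" if "s \<in> carrier \<Gamma>" "t \<in> carrier \<Gamma>" "a < r" for s t a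
  proof -
    have "laurent_monomial K r (d (s \<otimes>\<^bsub>\<Gamma>\<^esub> t)) g = laurent_monomial K r (\<lambda>i. d s i + d t i) g"
      if g: "g \<in> carrier Tor" for g
    proof -
      have "laurent_monomial K r (d (s \<otimes>\<^bsub>\<Gamma>\<^esub> t)) g = (s \<otimes>\<^bsub>\<Gamma>\<^esub> t) g"
        using d g \<open>s \<in> carrier \<Gamma>\<close> \<open>t \<in> carrier \<Gamma>\<close> by simp
      also have "\<dots> = s g \<otimes> t g" using g by (simp add: character_mult)
      also have "\<dots> = laurent_monomial K r (\<lambda>i. d s i + d t i) g"
        unfolding laurent_add[OF g] using d g \<open>s \<in> carrier \<Gamma>\<close> \<open>t \<in> carrier \<Gamma>\<close> by simp
      finally show ?thesis .
    qed
    then show ?thesis using laurent_exponents_unique[OF q _ \<open>a < r\<close>] by blast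
  qed
  have one: "s = \<one>\<^bsub>\<Gamma>\<^esub>" if s: "s \<in> carrier \<Gamma>" "\<forall>a<r. d s a = 0" for s
  proof (rule characters_eqI[OF s(1) \<Gamma>.one_closed])
    fix g assume g: "g \<in> carrier Tor"
    have "s g = laurent_monomial K r (d s) g" using d s g by simp
    also have "\<dots> = \<one>\<^bsub>units_of K\<^esub>" unfolding laurent_monomial_def
      by (rule U.finprod_one_eqI) (use s(2) in simp)
    finally show "s g = \<one>\<^bsub>\<Gamma>\<^esub> g" using g by (simp add: character_one units_of_one)
  qed
  show ?thesis using add one by blast
qed

end

text \<open>Moves the antisymmetrization from the values to the coefficients; what remains is
  bilinear in the exponents.\<close>

lemma antisymmetric_sum:
  fixes n g :: "'i \<Rightarrow> 'i \<Rightarrow> int"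
  shows "(\<Sum>i\<in>V. \<Sum>j\<in>V. n i j * (g i j - g j i)) = (\<Sum>i\<in>V. \<Sum>j\<in>V. (n i j - n j i) * g i j)"
proof -
  have "(\<Sum>i\<in>V. \<Sum>j\<in>V. n i j * g j i) = (\<Sum>i\<in>V. \<Sum>j\<in>V. n j i * g i j)" by (rule sum.swap)
  then show ?thesis by (simp add: right_diff_distrib left_diff_distrib sum_subtractf)
qed

context split_torus
begin

text \<open>A bicharacter on \<open>X(H) = \<int>\<^sup>r\<close> with generic values \<open>t a b\<close>. Nondegeneracy of the
  exponents follows by using independence of \<open>v\<close> once in each of the two variables.\<close>

lemma generic_cocycle:
  fixes V :: "nat set"
  assumes q: "q \<in> Units K" "\<not> root_of_unity K q"
    and S: "finite S" "S \<subseteq> carrier (units_of K)"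
    and V: "finite V" "\<And>i. i \<in> V \<Longrightarrow> v i \<in> carrier \<Gamma>" "int_independent \<Gamma> V v"
  shows "\<exists>c\<in>cocycles \<Gamma> K. \<forall>n :: nat \<times> nat \<Rightarrow> int.
    finprod (units_of K) (\<lambda>(i, j). (c (v i) (v j) \<otimes> inv c (v j) (v i)) [^]\<^bsub>units_of K\<^esub> n (i, j))
      {(i, j) \<in> V \<times> V. i < j} \<in> generate (units_of K) S \<longrightarrow>
    (\<forall>i\<in>V. \<forall>j\<in>V. i < j \<longrightarrow> n (i, j) = 0)"
proof -
  interpret \<Gamma>: comm_group \<Gamma> by (rule character_group_comm_group)
  obtain d :: "((nat \<Rightarrow> 'k) \<Rightarrow> 'k) \<Rightarrow> nat \<Rightarrow> int" where D:
    "\<forall>s\<in>carrier \<Gamma>. \<forall>t\<in>carrier \<Gamma>. \<forall>a<r. d (s \<otimes>\<^bsub>\<Gamma>\<^esub> t) a = d s a + d t a"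
    "\<forall>s\<in>carrier \<Gamma>. (\<forall>a<r. d s a = 0) \<longrightarrow> s = \<one>\<^bsub>\<Gamma>\<^esub>"
    using character_exponents[OF q] by (elim exE conjE)
  have d: "\<And>s t a. s \<in> carrier \<Gamma> \<Longrightarrow> t \<in> carrier \<Gamma> \<Longrightarrow> a < r \<Longrightarrow> d (s \<otimes>\<^bsub>\<Gamma>\<^esub> t) a = d s a + d t a"
    and d_one: "\<And>s. s \<in> carrier \<Gamma> \<Longrightarrow> (\<And>a. a < r \<Longrightarrow> d s a = 0) \<Longrightarrow> s = \<one>\<^bsub>\<Gamma>\<^esub>"
    using D by blast+
  let ?I = "{(a, b). a < b \<and> b < r}"
  have I: "finite ?I" by (rule finite_subset[of _ "{..<r} \<times> {..<r}"]) auto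
  obtain t where t: "t \<in> ?I \<rightarrow> carrier (units_of K)" "\<And>n. finprod (units_of K) (\<lambda>i. t i [^]\<^bsub>units_of K\<^esub> (n i :: int)) ?I \<in> generate (units_of K) S
      \<Longrightarrow> \<forall>i\<in>?I. n i = 0"
  proof -
    have "q \<in> carrier K" "q \<noteq> \<zero>" using q(1) KF.field_Units by auto
    from KF.units_independent_family_modulo[OF this(1) q(2) this(2) I S] show ?thesis
      using that by (elim bexE) blast
  qed
  have tI: "t i \<in> carrier (units_of K)" if "i \<in> ?I" for i using t(1) that by blast
  define P where "P f = finprod (units_of K) (\<lambda>i. t i [^]\<^bsub>units_of K\<^esub> (f i :: int)) ?I" for f
  have Pc: "P f \<in> carrier (units_of K)" for f unfolding P_def using tI by (intro U.finprod_closed) auto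
  have P_add: "P f \<otimes>\<^bsub>units_of K\<^esub> P g = P (\<lambda>i. f i + g i)" for f g
  proof -
    have "P f \<otimes>\<^bsub>units_of K\<^esub> P g =
        finprod (units_of K) (\<lambda>i. t i [^]\<^bsub>units_of K\<^esub> f i \<otimes>\<^bsub>units_of K\<^esub> t i [^]\<^bsub>units_of K\<^esub> g i) ?I"
      unfolding P_def by (rule U.finprod_multf[symmetric]) (intro Pi_I U.int_pow_closed tI, assumption)+
    also have "\<dots> = P (\<lambda>i. f i + g i)"
      unfolding P_def by (rule U.finprod_cong'[OF refl]) (intro Pi_I U.int_pow_closed tI, assumption, simp only: U.int_pow_mult[OF tI])
    finally show ?thesis .
  qed
  have P_pow: "P f [^]\<^bsub>units_of K\<^esub> (k::int) = P (\<lambda>i. f i * k)" for f k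
    unfolding P_def using tI I by (subst U.int_pow_finprod) (auto simp: U.int_pow_pow intro!: U.finprod_cong')
  have P_cong: "P f = P g" if "\<And>i. i \<in> ?I \<Longrightarrow> f i = g i" for f g
    unfolding P_def using tI that by (intro U.finprod_cong') auto
  \<comment> \<open>Bilinear in the exponent vectors and therefore a cocycle. Only pairs a < b carry
    a parameter, so in c(s, u) / c(u, s) the parameter \<open>t (a, b)\<close> has as exponent the 2
    by 2 minor of the two vectors in columns a and b.\<close>
  define c where "c s u = P (\<lambda>(a, b). d s a * d u b)" for s u
  have cU: "c s u \<in> Units K" for s u using Pc unfolding c_def units_of_carrier by blast
  have c: "c \<in> cocycles \<Gamma> K" unfolding cocycles_def
  proof (intro CollectI conjI ballI cU)
    fix s u w assume "s \<in> carrier \<Gamma>" "u \<in> carrier \<Gamma>" "w \<in> carrier \<Gamma>"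
    then have "c s (u \<otimes>\<^bsub>\<Gamma>\<^esub> w) \<otimes>\<^bsub>units_of K\<^esub> c u w = c (s \<otimes>\<^bsub>\<Gamma>\<^esub> u) w \<otimes>\<^bsub>units_of K\<^esub> c s u"
      unfolding c_def P_add by (intro P_cong) (auto simp: d algebra_simps)
    then show "c s (u \<otimes>\<^bsub>\<Gamma>\<^esub> w) \<otimes> c u w = c (s \<otimes>\<^bsub>\<Gamma>\<^esub> u) w \<otimes> c s u" by (simp add: units_of_mult)
  qed
  have comm: "c s u \<otimes> inv c u s = P (\<lambda>(a, b). d s a * d u b - d u a * d s b)" for s u
  proof -
    have "inv c u s = c u s [^]\<^bsub>units_of K\<^esub> (-1::int)"
      using KF.units_of_inv[OF cU] U.int_pow_neg[of "c u s" 1] Pc cU by (simp add: units_of_carrier)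
    then have "c s u \<otimes> inv c u s = c s u \<otimes>\<^bsub>units_of K\<^esub> c u s [^]\<^bsub>units_of K\<^esub> (-1::int)"
      by (simp add: units_of_mult)
    also have "\<dots> = P (\<lambda>(a, b). d s a * d u b - d u a * d s b)"
      unfolding c_def P_pow P_add by (rule P_cong) auto
    finally show ?thesis .
  qed
  have d_hom: "d (finprod \<Gamma> (\<lambda>i. v i [^]\<^bsub>\<Gamma>\<^esub> (m i :: int)) W) a = (\<Sum>i\<in>W. m i * d (v i) a)"
    if a: "a < r" and W: "W \<subseteq> V" for m W a
  proof -
    have hom: "(\<lambda>s. d s a) \<in> hom \<Gamma> integer_group" using d a by (auto simp: hom_def)
    have pow: "d (s [^]\<^bsub>\<Gamma>\<^esub> k) a = k * d s a" if "s \<in> carrier \<Gamma>" for s and k :: int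
      using group_hom.hom_int_pow[OF group_hom.intro[OF \<Gamma>.is_group group_integer_group group_hom_axioms.intro[OF hom]], of s k] that by simp
    have "finite W" using W V(1) finite_subset by blast
    then show ?thesis using W
    proof (induction W rule: finite_induct)
      case empty
      then show ?case using d[of "\<one>\<^bsub>\<Gamma>\<^esub>" "\<one>\<^bsub>\<Gamma>\<^esub>" a] a by simp
    next
      case (insert i W)
      then have vc: "\<And>j. j \<in> insert i W \<Longrightarrow> v j \<in> carrier \<Gamma>" using V(2) by blast
      have "finprod \<Gamma> (\<lambda>i. v i [^]\<^bsub>\<Gamma>\<^esub> m i) (insert i W) = v i [^]\<^bsub>\<Gamma>\<^esub> m i \<otimes>\<^bsub>\<Gamma>\<^esub> finprod \<Gamma> (\<lambda>i. v i [^]\<^bsub>\<Gamma>\<^esub> m i) W"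
        using insert.hyps vc by (intro \<Gamma>.finprod_insert) auto
      moreover have "finprod \<Gamma> (\<lambda>i. v i [^]\<^bsub>\<Gamma>\<^esub> m i) W \<in> carrier \<Gamma>" using vc by (intro \<Gamma>.finprod_closed) auto
      ultimately show ?case using insert vc a pow[of "v i" "m i"] by (simp add: d)
    qed
  qed
  \<comment> \<open>Independence of the characters \<open>v i\<close>, expressed through exponents;
    this uses that \<open>d\<close> has trivial kernel.\<close>
  have indep: "\<forall>i\<in>V. m i = 0" if m: "\<And>a. a < r \<Longrightarrow> (\<Sum>i\<in>V. m i * d (v i) a) = 0" for m
  proof -
    have "finprod \<Gamma> (\<lambda>i. v i [^]\<^bsub>\<Gamma>\<^esub> m i) V = \<one>\<^bsub>\<Gamma>\<^esub>"
      by (rule d_one) (use V(2) m d_hom in \<open>auto intro!: \<Gamma>.finprod_closed\<close>)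
    then show ?thesis using V(3) unfolding int_independent_def by blast
  qed
  let ?J = "{(i, j) \<in> V \<times> V. i < j}"
  have J: "finite ?J" by (rule finite_subset[of _ "V \<times> V"]) (use V(1) in auto)
  have "\<forall>i\<in>V. \<forall>j\<in>V. i < j \<longrightarrow> n (i, j) = 0"
    if n: "finprod (units_of K) (\<lambda>(i, j). (c (v i) (v j) \<otimes> inv c (v j) (v i)) [^]\<^bsub>units_of K\<^esub> n (i, j))
      ?J \<in> generate (units_of K) S" for n :: "nat \<times> nat \<Rightarrow> int"
  proof -
    define g where "g a b i j = d (v i) a * d (v j) b" for a b i j
    have "finprod (units_of K) (\<lambda>(i, j). (c (v i) (v j) \<otimes> inv c (v j) (v i)) [^]\<^bsub>units_of K\<^esub> n (i, j)) W =
      P (\<lambda>(a, b). \<Sum>(i, j)\<in>W. n (i, j) * (g a b i j - g a b j i))" if "finite W" for W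
      using that
    proof (induction W rule: finite_induct)
      case empty
      have "P (\<lambda>i. 0) = \<one>\<^bsub>units_of K\<^esub>" unfolding P_def by (rule U.finprod_one_eqI) simp
      then show ?case by (simp add: case_prod_unfold)
    next
      case (insert w W)
      then show ?case using Pc unfolding comm P_pow
        by (subst U.finprod_insert) (auto simp: P_add P_pow g_def split: prod.splits intro!: P_cong)
    qed
    from this[OF J] n have "P (\<lambda>(a, b). \<Sum>(i, j)\<in>?J. n (i, j) * (g a b i j - g a b j i)) \<in> generate (units_of K) S"
      by (simp only:)
    note t(2)[OF this[unfolded P_def]]
    then have zero: "(\<Sum>(i, j)\<in>?J. n (i, j) * (g a b i j - g a b j i)) = 0" if "a < b" "b < r" for a b
      using that by (drule_tac x = "(a, b)" in bspec) (simp_all only: prod.case mem_Collect_eq simp_thms)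
    \<comment> \<open>Extension by zero from i < j to all pairs, in preparation for
      \<open>antisymmetric_sum\<close>.\<close>
    define n' where "n' i j = (if i < j then n (i, j) else 0)" for i j
    have "(\<Sum>(i, j)\<in>?J. n (i, j) * (g a b i j - g a b j i)) =
      (\<Sum>i\<in>V. \<Sum>j\<in>V. n' i j * (g a b i j - g a b j i))" for a b
      unfolding sum.cartesian_product
      by (rule sum.mono_neutral_cong_left) (use V(1) in \<open>auto simp: n'_def\<close>)
    note this[unfolded antisymmetric_sum]
    then have lt: "(\<Sum>i\<in>V. \<Sum>j\<in>V. (n' i j - n' j i) * g a b i j) = 0" if "a < b" "b < r" for a b
      using zero that by simp
    have all: "(\<Sum>i\<in>V. \<Sum>j\<in>V. (n' i j - n' j i) * g a b i j) = 0" if ab: "a < r" "b < r" for a b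
    proof -
      \<comment> \<open>Exchanging a and b changes the sign, so vanishing for a < b gives vanishing
        for a > b, and on the diagonal an integer equals its own negative.\<close>
      have swap: "(\<Sum>i\<in>V. \<Sum>j\<in>V. (n' i j - n' j i) * g a b i j) = - (\<Sum>i\<in>V. \<Sum>j\<in>V. (n' i j - n' j i) * g b a i j)" for a b
        by (subst sum.swap) (simp add: g_def sum_negf[symmetric] algebra_simps)
      show ?thesis using lt[of a b] lt[of b a] swap[of a b] swap[of a a] ab by (cases a b rule: linorder_cases) auto
    qed
    have "n' i j - n' j i = 0" if "i \<in> V" "j \<in> V" for i j
    proof -
      have "(\<Sum>i\<in>V. (\<Sum>j\<in>V. (n' i j - n' j i) * d (v j) b) * d (v i) a) = 0" if "a < r" "b < r" for a b
        using all[OF that] by (simp add: g_def sum_distrib_left sum_distrib_right algebra_simps)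
      then have "(\<Sum>j\<in>V. (n' i j - n' j i) * d (v j) b) = 0" if "b < r" for b
        using indep[of "\<lambda>i. \<Sum>j\<in>V. (n' i j - n' j i) * d (v j) b"] that \<open>i \<in> V\<close> by simp
      then show ?thesis using indep[of "\<lambda>j. n' i j - n' j i"] \<open>j \<in> V\<close> by simp
    qed
    then have *: "n' i j = n' j i" if "i \<in> V" "j \<in> V" for i j using that by simp
    show ?thesis
    proof (intro ballI impI)
      fix i j assume "i \<in> V" "j \<in> V" "i < j"
      then show "n (i, j) = 0" using *[of i j] by (simp add: n'_def)
    qed
  qed
  then show ?thesis using c by blast
qed

end

section \<open>Degrees of homogeneous elements\<close>

lemma (in group) generate_hom_mem:
  assumes f: "f \<in> hom G H" and F: "subgroup F H" and H: "group H" and S: "S \<subseteq> carrier G" "\<And>s. s \<in> S \<Longrightarrow> f s \<in> F"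
    and y: "y \<in> generate G S"
  shows "f y \<in> F"
  using y
proof induction
  case one
  then show ?case using hom_one[OF f is_group H] subgroup.one_closed[OF F] by simp
next
  case (inv s)
  then show ?case using group_hom.hom_inv[OF group_hom.intro[OF is_group H group_hom_axioms.intro[OF f]], of s]
      S subgroup.m_inv_closed[OF F] by auto
next
  case (eng s t)
  then show ?case using hom_mult[OF f] generate_in_carrier[OF S(1)] subgroup.m_closed[OF F] by simp
qed (use S in auto)

lemma (in group) generate_hom_eq:
  assumes f: "f \<in> hom G H" and g: "g \<in> hom G H" and H: "group H"
    and S: "S \<subseteq> carrier G" "\<And>s. s \<in> S \<Longrightarrow> f s = g s" and y: "y \<in> generate G S"
  shows "f y = g y"
  using y
proof induction
  case one
  then show ?case using hom_one[OF f is_group H] hom_one[OF g is_group H] by simp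
next
  case (inv s)
  then show ?case using group_hom.hom_inv[OF group_hom.intro[OF is_group H group_hom_axioms.intro[OF f]], of s]
      group_hom.hom_inv[OF group_hom.intro[OF is_group H group_hom_axioms.intro[OF g]], of s] S by auto
next
  case (eng s t)
  then show ?case using hom_mult[OF f] hom_mult[OF g] generate_in_carrier[OF S(1)] by simp
qed (use S in auto)

lemma int_lattice_comm_group: "comm_group (int_lattice N)"
  unfolding int_lattice_def
  by (rule group.group_comm_groupI) (auto simp: fun_eq_iff)

lemma basis_vector_carrier: "basis_vector N i \<in> carrier (int_lattice N)"
  by (simp add: int_lattice_def basis_vector_def)

text \<open>Induction on a bound \<open>k\<close> beyond which all coordinates vanish; the last
  coordinate is cleared with a multiple of its basis vector.\<close>

lemma int_lattice_generated:
  assumes s: "s \<in> carrier (int_lattice N)"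
  shows "s \<in> generate (int_lattice N) (basis_vector N ` {1..N})"
proof -
  let ?L = "int_lattice N"
  interpret L: comm_group ?L by (rule int_lattice_comm_group)
  let ?S = "basis_vector N ` {1..N}"
  have S: "?S \<subseteq> carrier ?L" using basis_vector_carrier by blast
  have "s \<in> generate ?L ?S" if "s \<in> carrier ?L" "\<And>i. k < i \<Longrightarrow> i \<le> N \<Longrightarrow> s i = 0" "k \<le> N" for s k
    using that
  proof (induction k arbitrary: s)
    case 0
    then have "s = \<one>\<^bsub>?L\<^esub>" unfolding int_lattice_def
      by (intro ext) (auto simp: PiE_iff extensional_def)
    then show ?case by (simp add: generate.one)
  next
    case (Suc k)
    let ?e = "basis_vector N (Suc k)"
    let ?t = "s \<otimes>\<^bsub>?L\<^esub> ?e [^]\<^bsub>?L\<^esub> (- s (Suc k))"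
    have pow: "(?e [^]\<^bsub>?L\<^esub> m) i = m * ?e i" if "i \<in> {1..N}" for i and m :: int
    proof -
      have hom: "(\<lambda>s. s i) \<in> hom ?L integer_group" using that by (auto simp: hom_def int_lattice_def)
      show ?thesis
        using group_hom.hom_int_pow[OF group_hom.intro[OF L.is_group group_integer_group group_hom_axioms.intro[OF hom]]
            basis_vector_carrier, of "Suc k" m] by simp
    qed
    have t: "?t \<in> carrier ?L" using Suc.prems(1) basis_vector_carrier by simp
    have "?t \<in> generate ?L ?S"
    proof (rule Suc.IH[OF t])
      fix i assume i: "k < i" "i \<le> N"
      then have "?t i = s i + (?e [^]\<^bsub>?L\<^esub> (- s (Suc k))) i" by (simp add: int_lattice_def)
      also have "\<dots> = 0" using i Suc.prems(2)[of i] by (subst pow) (auto simp: basis_vector_def)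
      finally show "?t i = 0" .
    qed (use Suc.prems in simp)
    moreover have "?e [^]\<^bsub>?L\<^esub> s (Suc k) \<in> generate ?L ?S"
      using Suc.prems(3) by (intro L.subgroup_int_pow_closed[OF L.generate_is_subgroup[OF S]] generate.incl) auto
    ultimately have "?t \<otimes>\<^bsub>?L\<^esub> ?e [^]\<^bsub>?L\<^esub> s (Suc k) \<in> generate ?L ?S" by (rule generate.eng)
    moreover have "?t \<otimes>\<^bsub>?L\<^esub> ?e [^]\<^bsub>?L\<^esub> s (Suc k) = s"
      using Suc.prems(1) basis_vector_carrier[of N "Suc k"] by (simp add: L.m_assoc L.int_pow_neg L.l_inv)
    ultimately show ?case by simp
  qed
  from this[OF s, of N] show ?thesis by simp
qed

text \<open>\<open>\<beta>\<close> is the bicharacter \<chi>' of the theorem. The lattice and the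
  character group are both written multiplicatively.\<close>

locale CGL_lattice = CGL_extension K A N x \<sigma> \<delta> r act h
  for K :: "('k, 'm) ring_scheme" and A :: "('k, 'a, 'n) module_scheme" (structure) and N x \<sigma> \<delta> r act h +
  fixes \<pi> :: "(nat \<Rightarrow> int) \<Rightarrow> (nat \<Rightarrow> 'k) \<Rightarrow> 'k" and \<beta> :: "(nat \<Rightarrow> int) \<Rightarrow> (nat \<Rightarrow> int) \<Rightarrow> 'k"
  assumes \<pi>_hom: "\<pi> \<in> hom (int_lattice N) (character_group K r)"
    and \<pi>_degree: "\<And>i. i \<in> {1..N} \<Longrightarrow>
      \<pi> (basis_vector N i) = hom_degree (character_group K r) (eigenspace K A r act) (x i)"
    and \<beta>_bicharacter: "alternating_bicharacter (int_lattice N) K \<beta>"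
    and \<beta>_lambda2: "\<And>i j. \<lbrakk>i \<in> {1..N}; j \<in> {1..N}\<rbrakk> \<Longrightarrow>
      \<beta> (basis_vector N i) (basis_vector N j) = CGL_lambda2 K A x \<sigma> i j"
begin

abbreviation L where "L \<equiv> int_lattice N"
abbreviation e where "e \<equiv> basis_vector N"
abbreviation U where "U \<equiv> units_of K"

sublocale L: comm_group L by (rule int_lattice_comm_group)

definition span :: "nat \<Rightarrow> nat \<Rightarrow> (nat \<Rightarrow> int) set" where
  "span j k = generate L (e ` {j..k})"

lemmas e_carrier = basis_vector_carrier[of N]

lemma span_subgroup: "subgroup (span j k) L"
  unfolding span_def by (rule L.generate_is_subgroup) (use e_carrier in blast)

lemma span_carrier: "s \<in> span j k \<Longrightarrow> s \<in> carrier L"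
  using subgroup.mem_carrier[OF span_subgroup] .

lemma span_mono: "j' \<le> j \<Longrightarrow> k \<le> k' \<Longrightarrow> span j k \<subseteq> span j' k'"
  unfolding span_def by (rule L.mono_generate) auto

lemma e_span: "i \<in> {j..k} \<Longrightarrow> e i \<in> span j k"
  unfolding span_def by (rule generate.incl) blast

lemma span_all: "span 1 N = carrier L"
  using int_lattice_generated[of _ N] span_carrier unfolding span_def by blast

lemma \<beta>_hom_right: "s \<in> carrier L \<Longrightarrow> \<beta> s \<in> hom L U"
  and \<beta>_hom_left: "t \<in> carrier L \<Longrightarrow> (\<lambda>s. \<beta> s t) \<in> hom L U"
  and \<beta>_self: "s \<in> carrier L \<Longrightarrow> \<beta> s s = \<one>\<^bsub>K\<^esub>"
  using \<beta>_bicharacter unfolding alternating_bicharacter_def by auto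

lemma \<beta>_closed: "\<lbrakk>s \<in> carrier L; t \<in> carrier L\<rbrakk> \<Longrightarrow> \<beta> s t \<in> carrier U"
  using \<beta>_hom_right by (auto simp: hom_def)

lemma \<beta>_right: "\<lbrakk>s \<in> carrier L; t \<in> carrier L; u \<in> carrier L\<rbrakk> \<Longrightarrow> \<beta> s (t \<otimes>\<^bsub>L\<^esub> u) = \<beta> s t \<otimes>\<^bsub>U\<^esub> \<beta> s u"
  using \<beta>_hom_right by (auto simp: hom_def)

lemma \<beta>_left: "\<lbrakk>s \<in> carrier L; t \<in> carrier L; u \<in> carrier L\<rbrakk> \<Longrightarrow> \<beta> (s \<otimes>\<^bsub>L\<^esub> t) u = \<beta> s u \<otimes>\<^bsub>U\<^esub> \<beta> t u"
  using \<beta>_hom_left[of u] by (auto simp: hom_def)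

lemma \<beta>_swap:
  assumes s: "s \<in> carrier L" and t: "t \<in> carrier L"
  shows "\<beta> t s = inv\<^bsub>U\<^esub> \<beta> s t"
proof -
  note c = \<beta>_closed[OF s s] \<beta>_closed[OF s t] \<beta>_closed[OF t s] \<beta>_closed[OF t t]
  have "\<beta> (s \<otimes>\<^bsub>L\<^esub> t) (s \<otimes>\<^bsub>L\<^esub> t) = \<one>\<^bsub>U\<^esub>" using \<beta>_self s t by (simp add: units_of_one)
  then have "(\<beta> s s \<otimes>\<^bsub>U\<^esub> \<beta> t s) \<otimes>\<^bsub>U\<^esub> (\<beta> s t \<otimes>\<^bsub>U\<^esub> \<beta> t t) = \<one>\<^bsub>U\<^esub>"
    using s t by (simp add: \<beta>_right \<beta>_left)
  then have "\<beta> t s \<otimes>\<^bsub>U\<^esub> \<beta> s t = \<one>\<^bsub>U\<^esub>"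
    using c \<beta>_self[OF s] \<beta>_self[OF t] unfolding units_of_one[of K, symmetric] by simp
  then show ?thesis using c by (simp add: U.inv_equality[symmetric])
qed

lemma \<beta>_right_inv: "\<lbrakk>s \<in> carrier L; t \<in> carrier L\<rbrakk> \<Longrightarrow> \<beta> s (inv\<^bsub>L\<^esub> t) = inv\<^bsub>U\<^esub> \<beta> s t"
  using group_hom.hom_inv[OF group_hom.intro[OF L.is_group U.is_group group_hom_axioms.intro[OF \<beta>_hom_right]]] .

lemma \<beta>_right_pow:
  assumes "s \<in> carrier L" "t \<in> carrier L" shows "\<beta> s (t [^]\<^bsub>L\<^esub> (n::nat)) = \<beta> s t [^]\<^bsub>K\<^esub> n"
proof (induction n)
  case 0
  then show ?case using hom_one[OF \<beta>_hom_right[OF assms(1)] L.is_group U.is_group] by (simp add: units_of_one)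
next
  case (Suc n)
  then show ?case using assms by (simp add: \<beta>_right units_of_mult)
qed

lemma \<pi>_e: "i \<in> {1..N} \<Longrightarrow> \<pi> (e i) = chr i"
proof -
  assume i: "i \<in> {1..N}"
  show ?thesis unfolding \<pi>_degree[OF i] hom_degree_def
    by (rule the_equality) (use chr_mem[OF i] hom_degree_unique x_nonzero[OF i] in blast)+
qed

lemma \<pi>_closed: "s \<in> carrier L \<Longrightarrow> \<pi> s \<in> carrier \<Gamma>"
  and \<pi>_mult: "s \<in> carrier L \<Longrightarrow> t \<in> carrier L \<Longrightarrow> \<pi> (s \<otimes>\<^bsub>L\<^esub> t) = \<pi> s \<otimes>\<^bsub>\<Gamma>\<^esub> \<pi> t"
  using \<pi>_hom by (auto simp: hom_def)

lemma \<pi>_one: "\<pi> \<one>\<^bsub>L\<^esub> = \<one>\<^bsub>\<Gamma>\<^esub>"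
  using hom_one[OF \<pi>_hom L.is_group G.is_group] .

lemma \<pi>_inv: "s \<in> carrier L \<Longrightarrow> \<pi> (inv\<^bsub>L\<^esub> s) = inv\<^bsub>\<Gamma>\<^esub> \<pi> s"
  using group_hom.hom_inv[OF group_hom.intro[OF L.is_group G.is_group group_hom_axioms.intro[OF \<pi>_hom]]] .

lemma \<pi>_pow: "s \<in> carrier L \<Longrightarrow> \<pi> (s [^]\<^bsub>L\<^esub> (n::nat)) = \<pi> s [^]\<^bsub>\<Gamma>\<^esub> n"
  by (induction n) (simp_all add: \<pi>_one \<pi>_mult)

lemma evaluation_hom: "g \<in> carrier Tor \<Longrightarrow> (\<lambda>s. \<pi> s g) \<in> hom L U"
  by (rule homI) (simp_all add: units_of_carrier units_of_mult character_mult \<pi>_mult character_Units[OF \<pi>_closed])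

lemma \<beta>_e: 
  assumes i: "i \<in> {1..N}" and j: "j \<in> {1..i - 1}"
  shows "\<beta> (e i) (e j) = chr j (h i)"
proof -
  have j': "j \<in> {1..N}" "j < i" using i j by auto
  have "x j \<in> IA 1 (i - 1)" using x_IA j by blast
  then have "\<sigma> i (x j) = chr j (h i) \<odot> x j" using \<sigma>_eq_h[OF i] chr_act(2)[OF j'(1) h_torus[OF i]] by simp
  then have "eigenvalue K A (\<sigma> i) (x j) = chr j (h i)"
    using eigenvalue_eq x_carrier x_nonzero j' R.Units_closed[OF chr_act(1)[OF j'(1) h_torus[OF i]]] by blast
  then show ?thesis using \<beta>_lambda2[OF i j'(1)] j' by (simp add: CGL_lambda2_def)
qed

text \<open>Two homomorphisms that agree on the basis vectors below \<open>k\<close>. At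
  \<open>e k\<close> they differ: evaluation gives \<lambda>_k whereas
  \<open>\<beta> (e k) (e k)\<close> is 1. This discrepancy is where the generators \<lambda>_k come
  from.\<close>

lemma h_evaluation:
  assumes k: "k \<in> {1..N}" and s: "s \<in> span j (k - 1)" and j: "1 \<le> j"
  shows "\<pi> s (h k) = \<beta> (e k) s"
proof (rule L.generate_hom_eq[OF evaluation_hom[OF h_torus[OF k]] \<beta>_hom_right[OF e_carrier] U.is_group])
  show "s \<in> generate L (e ` {j..k - 1})" using s unfolding span_def .
  fix t assume "t \<in> e ` {j..k - 1}"
  then obtain i where i: "t = e i" "i \<in> {j..k - 1}" by blast
  then have "i \<in> {1..N}" "i \<in> {1..k - 1}" using j k by auto
  then show "\<pi> t (h k) = \<beta> (e k) t" using \<beta>_e[OF k] \<pi>_e i(1) by simp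
qed (use e_carrier in blast)

lemma act_pow:
  assumes k: "k \<in> {1..N}" and g: "g \<in> carrier Tor"
  shows "act g (x k [^] (n::nat)) = chr k g [^]\<^bsub>K\<^esub> n \<odot> x k [^] n"
proof (induction n)
  case 0
  then show ?case using g by (simp add: act_one)
next
  case (Suc n)
  note c = R.Units_closed[OF chr_act(1)[OF k g]] x_carrier[OF k]
  show ?case using Suc c g by (simp add: act_mult chr_act(2)[OF k g] smult_mult_left smult_mult_right smult_assoc1 R.m_comm)
qed

text \<open>The torus preserves the filtration and scales \<open>x l [^] n\<close> by a character.
  Comparing the coefficients of \<open>x l [^] n\<close> in the eigenvector equation of the whole
  element gives the equation for \<open>a\<close>.\<close>

lemma homogeneous_lead:
  assumes j: "1 \<le> j" "j \<le> l" "l \<le> N"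
    and step: "skew_step A (IA j (l - 1)) (x l) u"
    and p: "p \<in> skew_filtration A (IA j (l - 1)) (x l) n" and a: "a \<in> IA j (l - 1)"
    and f: "p \<oplus> a \<otimes> x l [^] n \<in> D (t \<otimes>\<^bsub>\<Gamma>\<^esub> chr l [^]\<^bsub>\<Gamma>\<^esub> n)" and t: "t \<in> carrier \<Gamma>"
  shows "a \<in> D t"
proof (rule eigenspaceI)
  interpret S: skew_step A "IA j (l - 1)" "x l" u by (rule step)
  have l: "l \<in> {1..N}" using j by auto
  note sub = subalgebraD(2)[OF IA_subalgebra[of j "l - 1"]] and gr = IA_graded[of j "l - 1"]
  have sub: "k \<odot> b \<in> IA j (l - 1)" if "k \<in> carrier K" "b \<in> IA j (l - 1)" for k b
    using subalgebraD(2)[OF IA_subalgebra[of j "l - 1"]] that j by simp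
  have gr: "graded_subset (IA j (l - 1))" using IA_graded j by simp
  show ac: "a \<in> carrier A" using S.Ts(7)[OF a] .
  fix g assume g: "g \<in> carrier Tor"
  let ?c = "chr l g"
  have u: "?c [^]\<^bsub>K\<^esub> i \<in> Units K" for i :: nat using chr_act(1)[OF l g] by (rule R.Units_pow_closed)
  have uc: "?c [^]\<^bsub>K\<^esub> i \<in> carrier K" for i :: nat using u by (rule R.Units_closed)
  have tc: "t g \<in> carrier K" using character_closed[OF t g] .
  have xc: "x l [^] i \<in> carrier A" for i :: nat using x_carrier[OF l] by simp
  have step: "act g (q \<oplus> b \<otimes> x l [^] i) = act g q \<oplus> (?c [^]\<^bsub>K\<^esub> i \<odot> act g b) \<otimes> x l [^] i"
    if "q \<in> carrier A" "b \<in> carrier A" for q b and i :: nat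
    using that g xc uc act_closed[OF g that(2)]
    by (simp add: act_add act_mult act_pow[OF l g] smult_mult_left smult_mult_right)
  have P: "act g q \<in> S.P i" if "q \<in> S.P i" for q i
    using that
  proof (induction i arbitrary: q)
    case 0
    then show ?case using act_zero[OF g] by simp
  next
    case (Suc i)
    obtain q' b where q: "q' \<in> S.P i" "b \<in> IA j (l - 1)" "q = q' \<oplus> b \<otimes> x l [^] i"
      using S.P_SucE[OF Suc.prems] .
    show ?case
      by (rule S.P_SucI[OF Suc.IH[OF q(1)] sub[OF uc act_graded(1)[OF g gr q(2)]]])
        (unfold q(3), rule step[OF S.P_carrier[OF q(1)] S.Ts(7)[OF q(2)]])
  qed
  let ?k = "t g \<otimes>\<^bsub>K\<^esub> ?c [^]\<^bsub>K\<^esub> n"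
  have kc: "?k \<in> carrier K" using tc uc by simp
  have pc: "p \<in> carrier A" using S.P_carrier[OF p] .
  have "(?k \<odot> \<one>) \<otimes> p \<in> S.P n" by (rule S.P_smult[OF p sub[OF kc S.Ts(3)]])
  then have kp: "?k \<odot> p \<in> S.P n" using kc pc by (simp add: smult_mult_left)
  have "act g p \<oplus> (?c [^]\<^bsub>K\<^esub> n \<odot> act g a) \<otimes> x l [^] n =
    (t \<otimes>\<^bsub>\<Gamma>\<^esub> chr l [^]\<^bsub>\<Gamma>\<^esub> n) g \<odot> (p \<oplus> a \<otimes> x l [^] n)"
    unfolding step[OF pc ac, symmetric] using eigenspaceD(2)[OF f g] .
  also have "(t \<otimes>\<^bsub>\<Gamma>\<^esub> chr l [^]\<^bsub>\<Gamma>\<^esub> n) g = ?k"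
    using g chr_mem(1)[OF l] by (simp add: character_mult character_pow)
  also have "?k \<odot> (p \<oplus> a \<otimes> x l [^] n) = ?k \<odot> p \<oplus> (?k \<odot> a) \<otimes> x l [^] n"
    using kc pc ac xc by (simp add: smult_r_distr smult_mult_left)
  finally have "?c [^]\<^bsub>K\<^esub> n \<odot> act g a = ?k \<odot> a"
    by (rule S.coeff_unique[OF P[OF p] kp sub[OF uc act_graded(1)[OF g gr a]] sub[OF kc a]])
  then have eq: "?c [^]\<^bsub>K\<^esub> n \<odot> act g a = ?c [^]\<^bsub>K\<^esub> n \<odot> (t g \<odot> a)"
    using tc uc ac by (simp add: smult_assoc1[symmetric] R.m_comm)
  have "inv\<^bsub>K\<^esub> (?c [^]\<^bsub>K\<^esub> n) \<odot> (?c [^]\<^bsub>K\<^esub> n \<odot> b) = b" if "b \<in> carrier A" for b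
    using that u[of n] uc[of n] by (simp add: smult_assoc1[symmetric])
  note cancel = this
  have "act g a = inv\<^bsub>K\<^esub> (?c [^]\<^bsub>K\<^esub> n) \<odot> (?c [^]\<^bsub>K\<^esub> n \<odot> act g a)"
    by (rule cancel[OF act_closed[OF g ac], symmetric])
  also have "\<dots> = t g \<odot> a" unfolding eq by (rule cancel) (use tc ac in simp)
  finally show "act g a = t g \<odot> a" .
qed

text \<open>A homogeneous element which commutes up to scalars with the variables behaves like its
  iterated leading monomial \<open>x\<^sup>m\<close>.\<close>

lemma leading_exponent:
  assumes j: "1 \<le> j"
    and stable: "\<And>k a. k \<in> {j..l} \<Longrightarrow> a \<in> IA j (k - 1) \<Longrightarrow> \<delta> k a \<in> IA j (k - 1)"
    and l: "j - 1 \<le> l" "l \<le> N"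
    and w: "w \<in> IA j l" "w \<noteq> \<zero>" "w \<in> D s" "s \<in> carrier \<Gamma>"
  shows "\<exists>m\<in>span j l. s = \<pi> m \<and> (\<forall>i\<in>{j..l}. \<forall>\<mu>\<in>carrier K.
    x i \<otimes> w = \<mu> \<odot> (w \<otimes> x i) \<longrightarrow> \<mu> = \<beta> (e i) m)"
  using l(1,2) stable w
proof (induction l arbitrary: w s rule: dec_induct)
  case base
  then have "w \<in> (\<lambda>k. k \<odot> \<one>) ` carrier K" using IA_empty[of "j - 1" j] j by simp
  then obtain k where "k \<in> carrier K" "w = k \<odot> \<one>" by blast
  then have "w \<in> D \<one>\<^bsub>\<Gamma>\<^esub>" using D_smult D_one by simp
  then have "s = \<pi> \<one>\<^bsub>L\<^esub>" using hom_degree_unique base \<pi>_one G.one_closed by metis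
  then show ?case using subgroup.one_closed[OF span_subgroup] j by (intro bexI[of _ "\<one>\<^bsub>L\<^esub>"]) auto
next
  case (step k)
  let ?l = "Suc k"
  let ?T = "IA j k"
  have l: "?l \<in> {1..N}" "j \<le> ?l" using step.hyps step.prems(1) j by auto
  obtain u where u: "u = (\<lambda>s. s (h ?l) :: 'k)" by simp
  note cs = chain_step[OF j l(2), folded u]
  have st: "skew_step A ?T (x ?l) (scale u)" and ext: "skew_step.ext A ?T (x ?l) = IA j ?l"
    using cs[OF step.prems(1)] step.prems(2)[of ?l] l(2) by simp_all
  interpret S: skew_step A ?T "x ?l" "scale u" by (rule st)
  obtain n p a where f: "p \<in> S.P n" "a \<in> ?T" "a \<noteq> \<zero>" "w = p \<oplus> a \<otimes> x ?l [^] n"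
    using S.extE[unfolded ext, OF step.prems(3,4)] .
  note \<chi> = chr_mem[OF l(1)] and g = h_torus[OF l(1)]
  define t where "t = s \<otimes>\<^bsub>\<Gamma>\<^esub> inv\<^bsub>\<Gamma>\<^esub> (chr ?l [^]\<^bsub>\<Gamma>\<^esub> n)"
  have \<chi>n: "chr ?l [^]\<^bsub>\<Gamma>\<^esub> n \<in> carrier \<Gamma>" using \<chi> by simp
  have t: "t \<in> carrier \<Gamma>" using \<chi>n step.prems(6) unfolding t_def by simp
  have s: "s = t \<otimes>\<^bsub>\<Gamma>\<^esub> chr ?l [^]\<^bsub>\<Gamma>\<^esub> n"
    unfolding t_def using \<chi>n step.prems(6) by (simp add: G.m_assoc G.l_inv)
  have aD: "a \<in> D t"
    using homogeneous_lead[of j ?l "scale u" p n a t] j l st f t step.prems(1,5) s by simp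
  have "\<exists>m\<in>span j k. t = \<pi> m \<and> (\<forall>i\<in>{j..k}. \<forall>\<mu>\<in>carrier K.
      x i \<otimes> a = \<mu> \<odot> (a \<otimes> x i) \<longrightarrow> \<mu> = \<beta> (e i) m)"
    by (rule step.IH[OF _ _ f(2,3) aD t]) (use step.prems(1,2) in auto)
  then obtain m where m: "m \<in> span j k" "t = \<pi> m" "\<And>i \<mu>. \<lbrakk>i \<in> {j..k}; \<mu> \<in> carrier K;
      x i \<otimes> a = \<mu> \<odot> (a \<otimes> x i)\<rbrakk> \<Longrightarrow> \<mu> = \<beta> (e i) m" by blast
  have mc: "m \<in> carrier L" using span_carrier[OF m(1)] .
  let ?m = "m \<otimes>\<^bsub>L\<^esub> e ?l [^]\<^bsub>L\<^esub> n"
  have mm: "?m \<in> span j ?l"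
  proof (rule subgroup.m_closed[OF span_subgroup])
    show "m \<in> span j ?l" using span_mono[of j j k ?l] m(1) by auto
    show "e ?l [^]\<^bsub>L\<^esub> n \<in> span j ?l"
      using e_span[of ?l j ?l] l(2) subgroup.m_closed[OF span_subgroup]
      by (induction n) (simp_all add: subgroup.one_closed[OF span_subgroup])
  qed
  have \<pi>m: "s = \<pi> ?m" using s m(2) mc e_carrier \<pi>_e[OF l(1)] by (simp add: \<pi>_mult \<pi>_pow)
  have uK: "u \<theta> \<in> carrier K" if "\<theta> \<in> carrier \<Gamma>" for \<theta> using character_closed[OF that g] unfolding u .
  have sub: "b \<odot> y \<in> ?T" if "b \<in> carrier K" "y \<in> ?T" for b y
    using subalgebraD(2)[OF IA_subalgebra[of j k]] that j step.prems(1) by simp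
  have ac: "a \<in> carrier A" "p \<in> carrier A" "x ?l [^] n \<in> carrier A" "x ?l \<in> carrier A"
    using S.Ts(7)[OF f(2)] S.P_carrier[OF f(1)] x_carrier[OF l(1)] by auto
  have scP: "\<mu> \<odot> q \<in> S.P i" if "\<mu> \<in> carrier K" "q \<in> S.P i" for \<mu> q i
    using S.P_smult[OF that(2) sub[OF that(1) S.Ts(3)]] that S.P_carrier[OF that(2)] by (simp add: smult_mult_left)
  have "\<mu> = \<beta> (e i) ?m"
    if i: "i \<in> {j..?l}" and \<mu>: "\<mu> \<in> carrier K" and eq: "x i \<otimes> w = \<mu> \<odot> (w \<otimes> x i)" for i \<mu>
  proof (cases "i = ?l")
    case True
    \<comment> \<open>Compare coefficients in degree \<open>Suc n\<close>: the left side has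
      \<open>scale u a\<close>, that is \<open>u t\<close> times \<open>a\<close>. The power of
      \<open>e ?l\<close> in \<open>?m\<close> is invisible to
      \<open>\<beta> (e ?l)\<close>.\<close>
    obtain q where q: "q \<in> S.P (Suc n)" "x ?l \<otimes> w = q \<oplus> scale u a \<otimes> x ?l [^] Suc n"
      using S.lead_mult[OF S.P_zero[of 1] f(1) S.Ts(3) f(2)] f(4) ac S.s_closed[OF f(2)] S.Ts(7)
      by auto
    have w2: "w \<otimes> x ?l = p \<otimes> x ?l \<oplus> a \<otimes> x ?l [^] Suc n"
      unfolding f(4) using ac by (simp add: l_distr m_assoc)
    have "q \<oplus> scale u a \<otimes> x ?l [^] Suc n =
      \<mu> \<odot> (p \<otimes> x ?l) \<oplus> (\<mu> \<odot> a) \<otimes> x ?l [^] Suc n"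
      using eq[unfolded True q(2) w2] \<mu> ac by (simp add: smult_r_distr smult_mult_left)
    then have "scale u a = \<mu> \<odot> a"
      by (rule S.coeff_unique[OF q(1) scP[OF \<mu> S.P_mult_x[OF f(1)]] S.s_closed[OF f(2)] sub[OF \<mu> f(2)]])
    then have "u t \<odot> a = \<mu> \<odot> a" using scale_hom[of u, OF uK t aD] by simp
    then have "\<mu> = u t" using smult_cancel[OF uK[OF t] \<mu> ac(1) f(3)] by simp
    also have "\<dots> = \<beta> (e ?l) m" unfolding u m(2) using h_evaluation[OF l(1) _ j] m(1) by simp
    also have "\<dots> = \<beta> (e ?l) ?m"
      using \<beta>_closed[OF e_carrier mc] mc e_carrier \<beta>_self[OF e_carrier]
      by (simp add: \<beta>_right \<beta>_right_pow units_of_mult units_of_carrier R.Units_closed)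
    finally show ?thesis using True by simp
  next
    case False
    then have i': "i \<in> {j..k}" "i \<in> {1..N}" "i \<in> {1..?l - 1}" using i j step.prems(1) by auto
    note xi = x_IA[OF i'(1)] and \<chi>i = chr_mem[OF i'(2)]
    have xic: "x i \<in> carrier A" using x_carrier[OF i'(2)] .
    have ui: "u (chr i) \<in> carrier K" using uK[OF \<chi>i(1)] .
    have sp: "(scale u ^^ b) (x i) = u (chr i) [^]\<^bsub>K\<^esub> b \<odot> x i" for b
    proof (induction b)
      case (Suc b)
      have "u (chr i) [^]\<^bsub>K\<^esub> b \<odot> x i \<in> D (chr i)" using D_smult[OF \<chi>i(1) _ \<chi>i(2)] ui by simp
      then show ?case using Suc ui xic scale_hom[of u, OF uK \<chi>i(1)] by (simp add: smult_assoc1[symmetric] R.m_comm)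
    qed (use xic in simp)
    let ?b = "u (chr i) [^]\<^bsub>K\<^esub> n"
    have bc: "?b \<in> carrier K" using ui by simp
    \<comment> \<open>Compare coefficients in degree \<open>n\<close>: on the right side, moving
      \<open>x i\<close> past \<open>x ?l [^] n\<close> produces the factor \<open>?b\<close>. It is
      cancelled by the value of \<open>\<beta> (e i)\<close> at the power of \<open>e ?l\<close> in
      \<open>?m\<close>.\<close>
    obtain q where q: "q \<in> S.P n" "w \<otimes> x i = q \<oplus> (a \<otimes> (?b \<odot> x i)) \<otimes> x ?l [^] n"
      using S.lead_mult[OF f(1) S.P_zero[of 0] f(2) xi] f(4) xic sp[of n] by auto
    have "x i \<otimes> p \<oplus> (x i \<otimes> a) \<otimes> x ?l [^] n =
      \<mu> \<odot> q \<oplus> (\<mu> \<odot> (a \<otimes> (?b \<odot> x i))) \<otimes> x ?l [^] n"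
      using eq[unfolded q(2)] \<mu> ac xic bc S.P_carrier[OF q(1)] unfolding f(4)
      by (simp add: r_distr m_assoc smult_r_distr smult_mult_left)
    then have "x i \<otimes> a = \<mu> \<odot> (a \<otimes> (?b \<odot> x i))"
      by (rule S.coeff_unique[OF S.P_smult[OF f(1) xi] scP[OF \<mu> q(1)] S.Ts(5)[OF xi f(2)]
            sub[OF \<mu> S.Ts(5)[OF f(2) sub[OF bc xi]]]])
    then have "x i \<otimes> a = (\<mu> \<otimes>\<^bsub>K\<^esub> ?b) \<odot> (a \<otimes> x i)"
      using \<mu> bc ac xic by (simp add: smult_mult_right smult_assoc1)
    then have mb: "\<mu> \<otimes>\<^bsub>K\<^esub> ?b = \<beta> (e i) m" using m(3)[OF i'(1)] \<mu> bc by simp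
    have bX: "?b = \<beta> (e ?l) (e i [^]\<^bsub>L\<^esub> n)" unfolding u using \<beta>_e[OF l(1) i'(3)] \<beta>_right_pow e_carrier by simp
    have Xl: "\<beta> (e i) (e ?l [^]\<^bsub>L\<^esub> n) \<otimes>\<^bsub>K\<^esub> ?b = \<one>\<^bsub>K\<^esub>"
    proof -
      have U: "\<beta> (e i) (e ?l) \<in> Units K" "\<beta> (e ?l) (e i) \<in> Units K" using \<beta>_closed e_carrier by (auto simp: units_of_carrier)
      have "\<beta> (e i) (e ?l) \<otimes>\<^bsub>K\<^esub> \<beta> (e ?l) (e i) = \<one>\<^bsub>K\<^esub>"
        unfolding \<beta>_swap[OF e_carrier e_carrier, of "Suc k" i] R.units_of_inv[OF U(1)] using U by simp
      then show ?thesis unfolding bX using U e_carrier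
        by (simp add: \<beta>_right_pow R.nat_pow_distrib[symmetric] R.Units_closed)
    qed
    have "\<mu> = \<mu> \<otimes>\<^bsub>K\<^esub> (\<beta> (e i) (e ?l [^]\<^bsub>L\<^esub> n) \<otimes>\<^bsub>K\<^esub> ?b)" unfolding Xl using \<mu> by simp
    also have "\<dots> = (\<mu> \<otimes>\<^bsub>K\<^esub> ?b) \<otimes>\<^bsub>K\<^esub> \<beta> (e i) (e ?l [^]\<^bsub>L\<^esub> n)"
      using \<mu> bc \<beta>_closed[of "e i" "e ?l [^]\<^bsub>L\<^esub> n"] e_carrier by (simp add: R.m_ac units_of_carrier R.Units_closed)
    also have "\<dots> = \<beta> (e i) ?m" unfolding mb using mc e_carrier by (simp add: \<beta>_right units_of_mult)
    finally show ?thesis .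
  qed
  then show ?case using mm \<pi>m by blast
qed

end

section \<open>Kernel vectors\<close>

lemma (in comm_group) generate_union_decomposition:
  assumes "finite J" "f \<in> J \<rightarrow> carrier G" "S \<subseteq> carrier G" "y \<in> generate G (S \<union> f ` J)"
  shows "\<exists>z\<in>generate G S. \<exists>n :: 'i \<Rightarrow> int. y = z \<otimes> finprod G (\<lambda>i. f i [^] n i) J"
  using assms
proof (induction J arbitrary: y rule: finite_induct)
  case empty
  then show ?case using generate_in_carrier[OF empty(2)] by (intro bexI[of _ y]) auto
next
  case (insert j J)
  have SJ: "S \<union> f ` J \<subseteq> carrier G" and j: "f j \<in> carrier G" using insert.prems by auto
  have "y \<in> generate G (insert (f j) (S \<union> f ` J))" using insert.prems(3) by simp
  then obtain a :: int and w where w: "w \<in> generate G (S \<union> f ` J)" "y = f j [^] a \<otimes> w"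
    using generate_insert_decomposition[OF SJ j] by blast
  obtain z and n :: "'i \<Rightarrow> int" where z: "z \<in> generate G S" "w = z \<otimes> finprod G (\<lambda>i. f i [^] n i) J"
    using insert.IH[OF _ insert.prems(2) w(1)] insert.prems(1) by auto
  let ?n = "n(j := a)"
  have p: "finprod G (\<lambda>i. f i [^] ?n i) (insert j J) = f j [^] a \<otimes> finprod G (\<lambda>i. f i [^] n i) J"
  proof -
    have "finprod G (\<lambda>i. f i [^] ?n i) J = finprod G (\<lambda>i. f i [^] n i) J"
      using insert by (intro finprod_cong') (auto simp: Pi_iff)
    moreover have "finprod G (\<lambda>i. f i [^] ?n i) (insert j J) = f j [^] a \<otimes> finprod G (\<lambda>i. f i [^] ?n i) J"
      using insert by (subst finprod_insert) (auto simp: Pi_iff)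
    ultimately show ?thesis by simp
  qed
  have "finprod G (\<lambda>i. f i [^] n i) J \<in> carrier G" using insert by (intro finprod_closed) (auto simp: Pi_iff)
  then have "y = z \<otimes> finprod G (\<lambda>i. f i [^] ?n i) (insert j J)"
    unfolding p w(2) z(2) using j generate_in_carrier[OF insert.prems(2) z(1)] by (simp add: m_ac)
  then show ?case using z(1) by blast
qed

context CGL_lattice
begin

abbreviation VA where "VA \<equiv> CGL_V K A N x \<delta>"
abbreviation NA where "NA \<equiv> CGL_N K A N x \<delta>"

lemma VA_NA: "VA \<union> NA = {1..N}" "k \<in> NA \<Longrightarrow> k \<in> {1..N}" "k \<in> VA \<Longrightarrow> k \<in> {1..N}" "k \<in> {1..N} \<Longrightarrow> k \<notin> NA \<Longrightarrow> k \<in> VA"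
  unfolding CGL_N_def CGL_V_def by auto

text \<open>\<open>\<delta> k a\<close> vanishes exactly if \<open>x k\<close> moves past
  \<open>a\<close> by the automorphism alone, and the elements with this property form a subalgebra.
  So it is enough to look at the variables.\<close>

lemma delta_vanishes:
  assumes kN: "k \<in> {1..N}" and j: "1 \<le> j"
    and zero: "\<And>i. i \<in> {j..k - 1} \<Longrightarrow> \<delta> k (x i) = \<zero>" and a: "a \<in> IA j (k - 1)"
  shows "\<delta> k a = \<zero>"
proof -
  note g = h_torus[OF kN] and xk = x_carrier[OF kN]
  let ?S = "{a \<in> carrier A. x k \<otimes> a = act (h k) a \<otimes> x k}"
  have "subalgebra_of K A ?S"
  proof (rule subalgebraI)
    fix a b assume "a \<in> ?S" "b \<in> ?S"
    then have ab: "a \<in> carrier A" "b \<in> carrier A" "x k \<otimes> a = act (h k) a \<otimes> x k"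
      "x k \<otimes> b = act (h k) b \<otimes> x k" by auto
    note c = act_closed[OF g ab(1)] act_closed[OF g ab(2)]
    show "a \<oplus> b \<in> ?S" using ab c xk g by (simp add: act_add r_distr l_distr)
    have "x k \<otimes> (a \<otimes> b) = (x k \<otimes> a) \<otimes> b" using ab(1,2) xk by (simp add: m_assoc)
    also have "\<dots> = act (h k) a \<otimes> (x k \<otimes> b)" unfolding ab(3) using ab(1,2) c xk by (simp add: m_assoc)
    also have "\<dots> = act (h k) (a \<otimes> b) \<otimes> x k" unfolding ab(4) using ab(1,2) c xk g by (simp add: act_mult m_assoc)
    finally show "a \<otimes> b \<in> ?S" using ab(1,2) by simp
  next
    fix \<mu> a assume \<mu>: "\<mu> \<in> carrier K" and "a \<in> ?S"
    then show "\<mu> \<odot> a \<in> ?S" using xk act_closed[OF g, of a] g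
      by (simp add: act_smult smult_mult_left smult_mult_right)
  qed (use xk g act_one in auto)
  moreover have "x ` {j..k - 1} \<subseteq> ?S"
  proof
    fix y assume "y \<in> x ` {j..k - 1}"
    then obtain i where i: "y = x i" "i \<in> {j..k - 1}" by blast
    have iN: "i \<in> {1..N}" "i \<in> {1..k - 1}" using i kN j by auto
    have "\<delta> k (x i) = \<zero>" using zero i by blast
    then show "y \<in> ?S" using delta_eq(1)[OF kN x_IA[OF iN(2)]] x_carrier[OF iN(1)] act_closed[OF g x_carrier[OF iN(1)]] xk
      by (simp add: i(1))
  qed
  ultimately have S: "IA j (k - 1) \<subseteq> ?S" unfolding interval_subalgebra_def by (rule algebra_generated_least)
  have a1: "a \<in> IA 1 (k - 1)" using a IA_mono[of 1 j "k - 1" "k - 1"] j by blast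
  have ac: "a \<in> carrier A" "x k \<otimes> a = act (h k) a \<otimes> x k" using S a by auto
  have dc: "\<delta> k a \<in> carrier A"
    using delta_eq(2)[OF kN a1] graded_subsetD(1)[OF IA_graded[of 1 "k - 1"]] kN by auto
  have "act (h k) a \<otimes> x k \<oplus> \<delta> k a = act (h k) a \<otimes> x k"
    using delta_eq(1)[OF kN a1] ac(2) by simp
  then show "\<delta> k a = \<zero>" using act_closed[OF g ac(1)] xk dc by simp
qed

lemma delta_nonzero:
  assumes k: "k \<in> NA"
  shows "\<exists>j\<in>{1..k - 1}. \<delta> k (x j) \<noteq> \<zero>"
  using delta_vanishes[OF VA_NA(2)[OF k] order_refl] k unfolding CGL_N_def CGL_V_def by blast

text \<open>The condition on the vectors chosen in part (a).\<close>

definition kernel_vector :: "nat \<Rightarrow> (nat \<Rightarrow> int) \<Rightarrow> bool" where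
  "kernel_vector k b \<longleftrightarrow> b \<in> kernel L \<Gamma> \<pi> \<and> b \<otimes>\<^bsub>L\<^esub> inv\<^bsub>L\<^esub> e k \<in> span 1 (k - 1)"

lemma kernel_vectorD:
  assumes "kernel_vector k b"
  shows "b \<in> carrier L" "\<pi> b = \<one>\<^bsub>\<Gamma>\<^esub>" "\<exists>m\<in>span 1 (k - 1). b = e k \<otimes>\<^bsub>L\<^esub> m"
proof -
  show b: "b \<in> carrier L" and "\<pi> b = \<one>\<^bsub>\<Gamma>\<^esub>" using assms unfolding kernel_vector_def kernel_def by auto
  have "b = e k \<otimes>\<^bsub>L\<^esub> (b \<otimes>\<^bsub>L\<^esub> inv\<^bsub>L\<^esub> e k)" using b e_carrier[of k] by (simp add: L.m_lcomm)
  then show "\<exists>m\<in>span 1 (k - 1). b = e k \<otimes>\<^bsub>L\<^esub> m" using assms unfolding kernel_vector_def by blast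
qed

lemma kernel_vectorI:
  assumes "m \<in> span 1 (k - 1)" "\<pi> (e k \<otimes>\<^bsub>L\<^esub> m) = \<one>\<^bsub>\<Gamma>\<^esub>"
  shows "kernel_vector k (e k \<otimes>\<^bsub>L\<^esub> m)"
proof -
  have m: "m \<in> carrier L" using span_carrier[OF assms(1)] .
  have "(e k \<otimes>\<^bsub>L\<^esub> m) \<otimes>\<^bsub>L\<^esub> inv\<^bsub>L\<^esub> e k = m"
    using m e_carrier[of k] by (simp add: L.m_comm[of "e k" m] L.m_assoc)
  then show ?thesis using assms m e_carrier unfolding kernel_vector_def kernel_def by simp
qed

text \<open>\<open>\<delta> k (x i)\<close> has the same degree as x_i x_k, so its leading exponent
  \<open>m\<close> and e_i + e_k have equal images under \<open>\<pi>\<close>. The lower end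
  \<open>j\<close> is free so that in the symmetric case \<open>m\<close> can be confined to indices
  above the chosen variable.\<close>

lemma delta_exponent:
  assumes k: "k \<in> {1..N}" and i: "i \<in> {1..k - 1}" and j: "1 \<le> j" "j - 1 \<le> k - 1"
    and stable: "\<And>l a. l \<in> {j..k - 1} \<Longrightarrow> a \<in> IA j (l - 1) \<Longrightarrow> \<delta> l a \<in> IA j (l - 1)"
    and w: "\<delta> k (x i) \<in> IA j (k - 1)" "\<delta> k (x i) \<noteq> \<zero>"
  shows "\<exists>m\<in>span j (k - 1). \<pi> (e k \<otimes>\<^bsub>L\<^esub> (e i \<otimes>\<^bsub>L\<^esub> inv\<^bsub>L\<^esub> m)) = \<one>\<^bsub>\<Gamma>\<^esub> \<and>
    (\<forall>l\<in>{j..k - 1}. \<forall>\<mu>\<in>carrier K.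
      x l \<otimes> \<delta> k (x i) = \<mu> \<odot> (\<delta> k (x i) \<otimes> x l) \<longrightarrow> \<mu> = \<beta> (e l) m)"
proof -
  have i': "i \<in> {1..N}" using i k by auto
  note \<chi> = chr_mem[OF i'] chr_mem(1)[OF k]
  have s: "chr i \<otimes>\<^bsub>\<Gamma>\<^esub> chr k \<in> carrier \<Gamma>" using \<chi> by simp
  have kN: "k - 1 \<le> N" using k by auto
  have "\<delta> k (x i) \<in> D (chr i \<otimes>\<^bsub>\<Gamma>\<^esub> chr k)" using delta_hom(1)[OF k x_IA[OF i] \<chi>(2,1)] .
  from leading_exponent[OF j(1) stable j(2) kN w this s]
  obtain m where m: "m \<in> span j (k - 1)" "chr i \<otimes>\<^bsub>\<Gamma>\<^esub> chr k = \<pi> m"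
    "\<forall>l\<in>{j..k - 1}. \<forall>\<mu>\<in>carrier K. x l \<otimes> \<delta> k (x i) = \<mu> \<odot> (\<delta> k (x i) \<otimes> x l) \<longrightarrow> \<mu> = \<beta> (e l) m"
    by blast
  have mc: "m \<in> carrier L" using span_carrier[OF m(1)] .
  have "\<pi> (e k \<otimes>\<^bsub>L\<^esub> (e i \<otimes>\<^bsub>L\<^esub> inv\<^bsub>L\<^esub> m)) = chr k \<otimes>\<^bsub>\<Gamma>\<^esub> (chr i \<otimes>\<^bsub>\<Gamma>\<^esub> inv\<^bsub>\<Gamma>\<^esub> (chr i \<otimes>\<^bsub>\<Gamma>\<^esub> chr k))"
    using mc e_carrier by (simp add: \<pi>_mult \<pi>_inv \<pi>_e[OF k] \<pi>_e[OF i'] m(2))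
  also have "\<dots> = (chr i \<otimes>\<^bsub>\<Gamma>\<^esub> chr k) \<otimes>\<^bsub>\<Gamma>\<^esub> inv\<^bsub>\<Gamma>\<^esub> (chr i \<otimes>\<^bsub>\<Gamma>\<^esub> chr k)"
    using \<chi> s by (simp only: G.m_assoc[symmetric] G.inv_closed G.m_comm[of "chr k" "chr i"])
  also have "\<dots> = \<one>\<^bsub>\<Gamma>\<^esub>" using s by (rule G.r_inv)
  finally show ?thesis using m by blast
qed

lemma kernel_vector_exists:
  assumes k: "k \<in> NA"
  shows "\<exists>b. kernel_vector k b"
proof -
  have kN: "k \<in> {1..N}" using VA_NA(2)[OF k] .
  obtain j where j: "j \<in> {1..k - 1}" "\<delta> k (x j) \<noteq> \<zero>" using delta_nonzero[OF k] by blast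
  have "\<exists>m\<in>span 1 (k - 1). \<pi> (e k \<otimes>\<^bsub>L\<^esub> (e j \<otimes>\<^bsub>L\<^esub> inv\<^bsub>L\<^esub> m)) = \<one>\<^bsub>\<Gamma>\<^esub>"
  proof -
    have "\<delta> l a \<in> IA 1 (l - 1)" if "l \<in> {1..k - 1}" "a \<in> IA 1 (l - 1)" for l a
      using delta_eq(2)[OF _ that(2)] that(1) kN by auto
    from delta_exponent[OF kN j(1) order_refl _ this delta_eq(2)[OF kN x_IA[OF j(1)]] j(2)]
    show ?thesis by auto
  qed
  then obtain m where m: "m \<in> span 1 (k - 1)" "\<pi> (e k \<otimes>\<^bsub>L\<^esub> (e j \<otimes>\<^bsub>L\<^esub> inv\<^bsub>L\<^esub> m)) = \<one>\<^bsub>\<Gamma>\<^esub>" by blast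
  have "e j \<otimes>\<^bsub>L\<^esub> inv\<^bsub>L\<^esub> m \<in> span 1 (k - 1)"
    using m(1) e_span[OF j(1)] subgroup.m_closed[OF span_subgroup] subgroup.m_inv_closed[OF span_subgroup] by blast
  then show ?thesis using kernel_vectorI[OF _ m(2)] by blast
qed

text \<open>Write b as e_k plus m with m below k. Then \<open>\<beta> (e k) b\<close> equals
  \<open>\<beta> (e k) m\<close>, which is the value of \<open>\<pi> m\<close> at
  \<open>h k\<close>. Since \<open>\<pi> b\<close> is trivial, this value is the inverse of
  \<lambda>_k.\<close>

lemma kernel_vector_self:
  assumes k: "k \<in> {1..N}" and b: "kernel_vector k b"
  shows "\<beta> b (e k) = chr k (h k)"
proof -
  obtain m where m: "m \<in> span 1 (k - 1)" "b = e k \<otimes>\<^bsub>L\<^esub> m" using kernel_vectorD(3)[OF b] by blast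
  note bD = kernel_vectorD(1,2)[OF b] and mc = span_carrier[OF m(1)]
  have u: "chr k (h k) \<in> carrier U" using chr_act(1)[OF k h_torus[OF k]] by (simp add: units_of_carrier)
  have "\<beta> (e k) b = \<pi> m (h k)"
    using \<beta>_closed[OF e_carrier mc] mc e_carrier h_evaluation[OF k m(1)] \<beta>_self[OF e_carrier]
    unfolding m(2) units_of_one[of K, symmetric] by (simp add: \<beta>_right)
  moreover have "chr k (h k) \<otimes>\<^bsub>U\<^esub> \<pi> m (h k) = \<one>\<^bsub>U\<^esub>"
  proof -
    have "chr k (h k) \<otimes>\<^bsub>K\<^esub> \<pi> m (h k) = \<pi> b (h k)"
      unfolding m(2) using mc e_carrier h_torus[OF k] by (simp add: \<pi>_mult \<pi>_e[OF k] character_mult)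
    also have "\<dots> = \<one>\<^bsub>K\<^esub>" unfolding bD(2) character_one using h_torus[OF k] by simp
    finally show ?thesis by (simp add: units_of_mult units_of_one)
  qed
  ultimately have "chr k (h k) \<otimes>\<^bsub>U\<^esub> \<beta> (e k) b = \<one>\<^bsub>U\<^esub>" by simp
  then show ?thesis unfolding \<beta>_swap[OF e_carrier bD(1)]
    using U.inv_equality u \<beta>_closed[OF e_carrier bD(1)] by blast
qed

text \<open>Evaluate the trivial character \<open>\<pi> b\<close> at \<open>h i\<close>.\<close>

lemma \<beta>_kernel_above:
  assumes i: "i \<in> {1..N}" and b: "b \<in> span 1 (i - 1)" "\<pi> b = \<one>\<^bsub>\<Gamma>\<^esub>"
  shows "\<beta> b (e i) = \<one>\<^bsub>U\<^esub>"
proof -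
  have "\<beta> (e i) b = \<one>\<^bsub>U\<^esub>"
    using h_evaluation[OF i b(1)] h_torus[OF i] unfolding b(2) character_one by (simp add: units_of_one)
  then show ?thesis unfolding \<beta>_swap[OF e_carrier span_carrier[OF b(1)]] by simp
qed

lemma kernel_vector_span: "kernel_vector k b \<Longrightarrow> 1 \<le> k \<Longrightarrow> b \<in> span 1 k"
  using kernel_vectorD(3)[of k b] span_mono[of 1 1 "k - 1" k] e_span[of k 1 k] subgroup.m_closed[OF span_subgroup] by auto

lemma \<beta>_span_mem:
  assumes "subgroup F U" "b \<in> carrier L" "\<And>l. l \<in> {j..k} \<Longrightarrow> \<beta> b (e l) \<in> F" "m \<in> span j k"
  shows "\<beta> b m \<in> F"
  by (rule L.generate_hom_mem[OF \<beta>_hom_right[OF assms(2)] assms(1) U.is_group _ _ assms(4)[unfolded span_def]])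
    (use assms(3) e_carrier in auto)

text \<open>Induction on \<open>k\<close> and, for fixed \<open>k\<close>, on \<open>i\<close>. An
  index \<open>i\<close> of \<open>NA\<close> below \<open>k\<close> is traded for the vector
  \<open>b i\<close>: the value at \<open>b i\<close> is the inverse of
  \<open>\<beta> (b i) (b k)\<close>, known from the outer hypothesis, and the difference only
  involves indices below \<open>i\<close>.\<close>

lemma kernel_vector_\<beta>_mem:
  assumes b: "\<And>k. k \<in> NA \<Longrightarrow> kernel_vector k (b k)"
    and F: "subgroup F U" "\<And>k. k \<in> NA \<Longrightarrow> chr k (h k) \<in> F"
      "\<And>k i. \<lbrakk>k \<in> NA; i \<in> VA; i < k\<rbrakk> \<Longrightarrow> \<beta> (b k) (e i) \<in> F"
  shows "\<lbrakk>k \<in> NA; i \<in> {1..N}\<rbrakk> \<Longrightarrow> \<beta> (b k) (e i) \<in> F"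
proof (induction k arbitrary: i rule: less_induct)
  case (less k)
  note outer = less.IH
  have k: "k \<in> {1..N}" using VA_NA(2) less.prems by blast
  note bk = b[OF less.prems(1)]
  note bkc = kernel_vectorD(1)[OF bk]
  show ?case using less.prems(2)
  proof (induction i rule: less_induct)
    case (less i)
    consider "k < i" | "i = k" | "i < k" "i \<in> VA" | "i < k" "i \<in> NA" using VA_NA(4)[of i] less.prems by fastforce
    then show ?case
    proof cases
      case 1
      then have "k \<le> i - 1" "1 \<le> k" using k by auto
      then have "b k \<in> span 1 (i - 1)" using kernel_vector_span[OF bk] span_mono[OF order_refl] by blast
      then show ?thesis using \<beta>_kernel_above[OF less.prems _ kernel_vectorD(2)[OF bk]] subgroup.one_closed[OF F(1)] by simp
    next
      case 2
      then show ?thesis using kernel_vector_self[OF k bk] F(2) \<open>k \<in> NA\<close> by simp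
    next
      case 3
      then show ?thesis using F(3) \<open>k \<in> NA\<close> by blast
    next
      case 4
      note bi = b[OF 4(2)]
      note bic = kernel_vectorD(1)[OF bi]
      obtain m where m: "m \<in> span 1 (i - 1)" "b i = e i \<otimes>\<^bsub>L\<^esub> m" using kernel_vectorD(3)[OF bi] by blast
      have mc: "m \<in> carrier L" using span_carrier[OF m(1)] .
      have 1: "\<beta> (b k) m \<in> F"
        by (rule \<beta>_span_mem[OF F(1) bkc _ m(1)]) (use less.IH less.prems in auto)
      have "\<beta> (b i) (b k) \<in> F"
        by (rule \<beta>_span_mem[OF F(1) bic _ kernel_vector_span[OF bk]]) (use outer[OF 4] k in auto)
      then have 2: "\<beta> (b k) (b i) \<in> F" unfolding \<beta>_swap[OF bic bkc] by (rule subgroup.m_inv_closed[OF F(1)])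
      have "e i = b i \<otimes>\<^bsub>L\<^esub> inv\<^bsub>L\<^esub> m" unfolding m(2) using mc e_carrier by (simp add: L.m_assoc)
      then have "\<beta> (b k) (e i) = \<beta> (b k) (b i) \<otimes>\<^bsub>U\<^esub> inv\<^bsub>U\<^esub> \<beta> (b k) m"
        using bkc bic mc by (simp add: \<beta>_right \<beta>_right_inv)
      then show ?thesis using 1 2 subgroup.m_closed[OF F(1)] subgroup.m_inv_closed[OF F(1)] by simp
    qed
  qed
qed

text \<open>Triangularity: \<open>b i\<close> is \<open>e i\<close> plus a combination of smaller
  basis vectors, so the missing \<open>e i\<close> are recovered in increasing order.\<close>

lemma kernel_vectors_generate:
  assumes b: "\<And>k. k \<in> NA \<Longrightarrow> kernel_vector k (b k)"
  shows "generate L (e ` VA \<union> b ` NA) = carrier L"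
proof -
  let ?S = "e ` VA \<union> b ` NA"
  have S: "?S \<subseteq> carrier L" using e_carrier kernel_vectorD(1)[OF b] by blast
  note H = L.generate_is_subgroup[OF S]
  have e: "i \<in> {1..N} \<Longrightarrow> e i \<in> generate L ?S" for i
  proof (induction i rule: less_induct)
    case (less i)
    show ?case
    proof (cases "i \<in> NA")
      case False
      then show ?thesis using VA_NA(4) less.prems by (intro generate.incl) blast
    next
      case True
      obtain m where m: "m \<in> span 1 (i - 1)" "b i = e i \<otimes>\<^bsub>L\<^esub> m" using kernel_vectorD(3)[OF b[OF True]] by blast
      have "span 1 (i - 1) \<subseteq> generate L ?S" unfolding span_def
        by (rule L.generate_subgroup_incl[OF _ H]) (use less in auto)
      then have "m \<in> generate L ?S" using m(1) by blast
      moreover have "b i \<in> generate L ?S" using True by (intro generate.incl) blast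
      moreover have "e i = b i \<otimes>\<^bsub>L\<^esub> inv\<^bsub>L\<^esub> m" unfolding m(2) using span_carrier[OF m(1)] e_carrier by (simp add: L.m_assoc)
      ultimately show ?thesis using subgroup.m_closed[OF H] subgroup.m_inv_closed[OF H] by simp
    qed
  qed
  have "span 1 N \<subseteq> generate L ?S" unfolding span_def
    by (rule L.generate_subgroup_incl[OF _ H]) (use e in auto)
  then show ?thesis using subgroup.subset[OF H] unfolding span_all by blast
qed

end

section \<open>The bicharacter of a twist on the lattice\<close>

locale twisted_lattice = CGL_lattice K A N x \<sigma> \<delta> r act h \<pi> \<beta>
  for K :: "('k, 'm) ring_scheme" and A :: "('k, 'a, 'n) module_scheme" (structure) and N x \<sigma> \<delta> r act h \<pi> \<beta> +
  fixes c :: "((nat \<Rightarrow> 'k) \<Rightarrow> 'k) \<Rightarrow> ((nat \<Rightarrow> 'k) \<Rightarrow> 'k) \<Rightarrow> 'k"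
  assumes lattice_cocycle: "c \<in> cocycles (character_group K r) K"
begin

sublocale twisted_CGL K A N x \<sigma> \<delta> r act h c
  by (intro twisted_CGL.intro CGL_extension_axioms twisted_CGL_axioms.intro lattice_cocycle)

text \<open>The commutation scalars of the variables in the twist, extended to an alternating
  bicharacter. It allows other generators of the lattice to replace the basis vectors.\<close>

definition \<gamma> :: "(nat \<Rightarrow> int) \<Rightarrow> (nat \<Rightarrow> int) \<Rightarrow> 'k" where
  "\<gamma> s t = \<beta> s t \<otimes>\<^bsub>U\<^esub> commutation (\<pi> s) (\<pi> t)"

lemma commutation_closed: "s \<in> carrier L \<Longrightarrow> t \<in> carrier L \<Longrightarrow> commutation (\<pi> s) (\<pi> t) \<in> carrier U"
  using commutation_Units[OF \<pi>_closed \<pi>_closed] by (simp add: units_of_carrier)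

lemma \<gamma>_closed: "s \<in> carrier L \<Longrightarrow> t \<in> carrier L \<Longrightarrow> \<gamma> s t \<in> carrier U"
  unfolding \<gamma>_def using \<beta>_closed commutation_closed by simp

lemma \<gamma>_hom_right: "s \<in> carrier L \<Longrightarrow> \<gamma> s \<in> hom L U"
proof (rule homI)
  fix t u assume s: "s \<in> carrier L" and t: "t \<in> carrier L" and u: "u \<in> carrier L"
  note c = \<beta>_closed[OF s t] \<beta>_closed[OF s u] commutation_closed[OF s t] commutation_closed[OF s u]
  have "commutation (\<pi> s) (\<pi> (t \<otimes>\<^bsub>L\<^esub> u)) = commutation (\<pi> s) (\<pi> t) \<otimes>\<^bsub>U\<^esub> commutation (\<pi> s) (\<pi> u)"
    unfolding \<pi>_mult[OF t u] using commutation_mult_right[OF \<pi>_closed[OF s] \<pi>_closed[OF t] \<pi>_closed[OF u]]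
    by (simp add: units_of_mult)
  then show "\<gamma> s (t \<otimes>\<^bsub>L\<^esub> u) = \<gamma> s t \<otimes>\<^bsub>U\<^esub> \<gamma> s u"
    unfolding \<gamma>_def \<beta>_right[OF s t u] using c by (simp add: U.m_ac)
qed (rule \<gamma>_closed)

lemma \<gamma>_swap:
  assumes s: "s \<in> carrier L" and t: "t \<in> carrier L"
  shows "\<gamma> t s = inv\<^bsub>U\<^esub> \<gamma> s t"
proof -
  note c = \<beta>_closed[OF s t] commutation_closed[OF s t] commutation_closed[OF t s]
  have "commutation (\<pi> t) (\<pi> s) \<otimes>\<^bsub>U\<^esub> commutation (\<pi> s) (\<pi> t) = \<one>\<^bsub>U\<^esub>"
    using commutation_swap[OF \<pi>_closed[OF t] \<pi>_closed[OF s]] by (simp add: units_of_mult units_of_one)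
  then have "commutation (\<pi> t) (\<pi> s) = inv\<^bsub>U\<^esub> commutation (\<pi> s) (\<pi> t)"
    using U.inv_equality c by simp
  then show ?thesis unfolding \<gamma>_def \<beta>_swap[OF s t] using c by (simp add: U.inv_mult)
qed

lemma \<gamma>_self: "s \<in> carrier L \<Longrightarrow> \<gamma> s s = \<one>\<^bsub>U\<^esub>"
  unfolding \<gamma>_def by (simp add: \<beta>_self commutation_self[OF \<pi>_closed] units_of_mult units_of_one)

lemma \<gamma>_mem:
  assumes F: "subgroup F U" and S: "generate L S = carrier L" "S \<subseteq> carrier L"
    and gen: "\<And>s t. s \<in> S \<Longrightarrow> t \<in> S \<Longrightarrow> \<gamma> s t \<in> F" and st: "s \<in> carrier L" "t \<in> carrier L"
  shows "\<gamma> s t \<in> F"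
proof -
  have 1: "\<gamma> u t \<in> F" if u: "u \<in> S" and t: "t \<in> carrier L" for u t
    by (rule L.generate_hom_mem[OF \<gamma>_hom_right F U.is_group S(2)]) (use u t gen S in auto)
  have "\<gamma> t s \<in> F"
  proof (rule L.generate_hom_mem[OF \<gamma>_hom_right[OF st(2)] F U.is_group S(2)])
    show "\<gamma> t u \<in> F" if "u \<in> S" for u
      using 1[OF that st(2)] subgroup.m_inv_closed[OF F] \<gamma>_swap[of u t] that S(2) st(2) by auto
  qed (use st S in auto)
  then show ?thesis using \<gamma>_swap[OF st(2,1)] subgroup.m_inv_closed[OF F] by simp
qed

lemma \<gamma>_e:
  assumes i: "i \<in> {1..N}" and j: "j \<in> {1..i - 1}"
  shows "\<gamma> (e i) (e j) = chr j (h i) \<otimes>\<^bsub>K\<^esub> commutation (chr i) (chr j)"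
proof -
  have "j \<in> {1..N}" using i j by auto
  then show ?thesis unfolding \<gamma>_def \<beta>_e[OF i j] \<pi>_e[OF i] by (simp only: \<pi>_e units_of_mult)
qed

text \<open>Values of a bicharacter are products of its values at basis vectors and their inverses,
  and at basis vectors \<open>\<gamma>\<close> gives the scalars of
  \<open>AD_twist_lower\<close>.\<close>

lemma twist_lower:
  assumes Y: "\<And>y. y \<in> Y \<Longrightarrow> \<exists>s\<in>carrier L. \<exists>t\<in>carrier L. y = \<gamma> s t"
  shows "generate U Y \<subseteq> AD K (twist \<Gamma> K A D c)"
proof -
  let ?S = "{chr j (h k) \<otimes>\<^bsub>K\<^esub> commutation (chr k) (chr j) | j k. k \<in> {1..N} \<and> j \<in> {1..k - 1}}"
  have S: "?S \<subseteq> carrier U"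
  proof
    fix y assume "y \<in> ?S"
    then obtain j k where jk: "k \<in> {1..N}" "j \<in> {1..k - 1}" "y = chr j (h k) \<otimes>\<^bsub>K\<^esub> commutation (chr k) (chr j)" by blast
    then show "y \<in> carrier U" using \<gamma>_e[OF jk(1,2)] \<gamma>_closed[OF e_carrier e_carrier] by metis
  qed
  let ?F = "generate U ?S"
  note F = U.generate_is_subgroup[OF S]
  have lt: "\<gamma> (e i) (e j) \<in> ?F" if "i \<in> {1..N}" "j \<in> {1..i - 1}" for i j
    unfolding \<gamma>_e[OF that] using that by (intro generate.incl) blast
  have "\<gamma> (e i) (e j) \<in> ?F" if ij: "i \<in> {1..N}" "j \<in> {1..N}" for i j
  proof (cases i j rule: linorder_cases)
    case less
    then have "\<gamma> (e j) (e i) \<in> ?F" using lt[of j i] ij by auto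
    then show ?thesis unfolding \<gamma>_swap[of "e j" "e i", OF e_carrier e_carrier] by (rule subgroup.m_inv_closed[OF F])
  next
    case equal
    then show ?thesis using \<gamma>_self[OF e_carrier] subgroup.one_closed[OF F] by simp
  next
    case greater
    then show ?thesis using lt[of i j] ij by auto
  qed
  note gen = this
  have mem: "\<gamma> s t \<in> ?F" if st: "s \<in> carrier L" "t \<in> carrier L" for s t
  proof (rule \<gamma>_mem[OF F span_all[unfolded span_def] _ _ st])
    show "e ` {1..N} \<subseteq> carrier L" using e_carrier by blast
    fix s t assume "s \<in> e ` {1..N}" "t \<in> e ` {1..N}"
    then show "\<gamma> s t \<in> ?F" by (elim imageE) (simp only: gen)
  qed
  have "Y \<subseteq> ?F"
  proof
    fix y assume "y \<in> Y"
    from Y[OF this] obtain s t where st: "s \<in> carrier L" "t \<in> carrier L" "y = \<gamma> s t" by (elim bexE)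
    show "y \<in> ?F" unfolding st(3) by (rule mem[OF st(1,2)])
  qed
  then have "generate U Y \<subseteq> ?F" by (rule U.generate_subgroup_incl[OF _ F])
  also have "\<dots> \<subseteq> AD K (twist \<Gamma> K A D c)" using AD_twist_lower unfolding B_def .
  finally show ?thesis .
qed

text \<open>The scalars may be tested on any generating set of the lattice. This freedom is used
  with the kernel vectors, on which the twist has no effect.\<close>

lemma twist_upper:
  assumes F: "subgroup F U" and S: "generate L S = carrier L" "S \<subseteq> carrier L"
    and gen: "\<And>s t. s \<in> S \<Longrightarrow> t \<in> S \<Longrightarrow> \<gamma> s t \<in> F"
  shows "AD K (twist \<Gamma> K A D c) \<subseteq> F"
  unfolding B_def[symmetric]
proof (rule AD_twist_upper[OF F])
  fix j k assume "k \<in> {1..N}" "j \<in> {1..k - 1}"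
  from \<gamma>_e[OF this] show "chr j (h k) \<otimes>\<^bsub>K\<^esub> commutation (chr k) (chr j) \<in> F"
    using \<gamma>_mem[OF F S gen e_carrier e_carrier, of k j] by simp
qed

lemma \<gamma>_kernel:
  assumes "s \<in> carrier L" "t \<in> carrier L" "\<pi> s = \<one>\<^bsub>\<Gamma>\<^esub>"
  shows "\<gamma> s t = \<beta> s t"
proof -
  let ?u = "commutation \<one>\<^bsub>\<Gamma>\<^esub> (\<pi> t)"
  note c = commutation_closed[OF assms(2,1)] commutation_closed[OF assms(1,2)]
  have "commutation (\<pi> t) \<one>\<^bsub>\<Gamma>\<^esub> \<otimes>\<^bsub>U\<^esub> commutation (\<pi> t) \<one>\<^bsub>\<Gamma>\<^esub> = commutation (\<pi> t) \<one>\<^bsub>\<Gamma>\<^esub>"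
    using commutation_mult_right[OF \<pi>_closed[OF assms(2)] G.one_closed G.one_closed] by (simp add: units_of_mult)
  then have "commutation (\<pi> t) \<one>\<^bsub>\<Gamma>\<^esub> = \<one>\<^bsub>U\<^esub>" using c unfolding assms(3) by simp
  then have "commutation \<one>\<^bsub>\<Gamma>\<^esub> (\<pi> t) = \<one>\<^bsub>U\<^esub>"
    using commutation_swap[OF G.one_closed \<pi>_closed[OF assms(2)]] c unfolding assms(3)
    by (simp flip: units_of_mult[of K] units_of_one[of K])
  then show ?thesis unfolding \<gamma>_def assms(3) using \<beta>_closed[OF assms(1,2)] by simp
qed

end

section \<open>The invariant tw\<close>

context CGL_lattice
begin

theorem tw_eq_generate:
  assumes independent: "int_independent \<Gamma> VA (\<lambda>j. \<pi> (e j))"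
    and b: "\<And>k. k \<in> NA \<Longrightarrow> kernel_vector k (b k)"
  shows "tw \<Gamma> K A D =
    generate U ({chr k (h k) | k. k \<in> NA} \<union> {\<beta> (b k) (e i) | k i. k \<in> NA \<and> i \<in> VA \<and> i < k})"
    (is "_ = generate U ?Y")
proof
  have lam: "chr k (h k) \<in> carrier U" if "k \<in> NA" for k
    using chr_act(1)[OF VA_NA(2)[OF that] h_torus[OF VA_NA(2)[OF that]]] by (simp add: units_of_carrier)
  note bD = kernel_vectorD[OF b]
  have Y: "?Y \<subseteq> carrier U" using lam \<beta>_closed[OF bD(1) e_carrier] by auto
  show "generate U ?Y \<subseteq> tw \<Gamma> K A D" unfolding tw_def
  proof (rule INT_greatest)
    fix c assume c: "c \<in> cocycles \<Gamma> K"
    interpret T: twisted_lattice K A N x \<sigma> \<delta> r act h \<pi> \<beta> c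
      by (intro twisted_lattice.intro CGL_lattice_axioms twisted_lattice_axioms.intro c)
    show "generate U ?Y \<subseteq> AD K (twist \<Gamma> K A D c)"
    proof (rule T.twist_lower)
      fix y assume "y \<in> ?Y"
      \<comment> \<open>Both kinds of generators are values of \<open>\<beta> (b k)\<close> at basis
        vectors, since \<lambda>_k is the value at \<open>e k\<close>.\<close>
      then obtain k i where k: "k \<in> NA" "y = \<beta> (b k) (e i)"
        using kernel_vector_self[OF VA_NA(2) b, symmetric] by (elim UnE CollectE exE conjE) (rule that, auto)
      then have "y = T.\<gamma> (b k) (e i)" using T.\<gamma>_kernel[OF bD(1)[OF k(1)] e_carrier bD(2)[OF k(1)]] by simp
      then show "\<exists>s\<in>carrier L. \<exists>t\<in>carrier L. y = T.\<gamma> s t" using bD(1)[OF k(1)] e_carrier by blast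
    qed
  qed
  show "tw \<Gamma> K A D \<subseteq> generate U ?Y"
  proof
    fix \<alpha> assume \<alpha>: "\<alpha> \<in> tw \<Gamma> K A D"
    define S where "S = (\<lambda>(i, j). \<beta> (e i) (e j)) ` ({1..N} \<times> {1..N})"
    have S: "finite S" "S \<subseteq> carrier U" unfolding S_def using \<beta>_closed[OF e_carrier e_carrier] by auto
    let ?F = "generate U S"
    note F = U.generate_is_subgroup[OF S(2)]
    have SF: "\<beta> (e i) (e j) \<in> ?F" if "i \<in> {1..N}" "j \<in> {1..N}" for i j
      using that unfolding S_def by (intro generate.incl) auto
    have E: "e ` {1..N} \<subseteq> carrier L" using e_carrier by blast
    \<comment> \<open>The trivial cocycle places \<alpha> in the finitely generated group
      \<open>?F\<close>, the group modulo which the generic cocycle will be chosen.\<close>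
    have one_cocycle: "(\<lambda>s t. \<one>\<^bsub>K\<^esub>) \<in> cocycles \<Gamma> K" unfolding cocycles_def by simp
    interpret T1: twisted_lattice K A N x \<sigma> \<delta> r act h \<pi> \<beta> "\<lambda>s t. \<one>\<^bsub>K\<^esub>"
      by (intro twisted_lattice.intro CGL_lattice_axioms twisted_lattice_axioms.intro one_cocycle)
    have T1: "T1.\<gamma> s t = \<beta> s t" if "s \<in> carrier L" "t \<in> carrier L" for s t
    proof -
      have "T1.commutation (\<pi> s) (\<pi> t) = \<one>\<^bsub>U\<^esub>" unfolding T1.commutation_def by (simp add: units_of_one)
      then show ?thesis unfolding T1.\<gamma>_def using \<beta>_closed[OF that] by simp
    qed
    have gen: "T1.\<gamma> s t \<in> ?F" if st: "s \<in> e ` {1..N}" "t \<in> e ` {1..N}" for s t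
    proof -
      obtain i j where "s = e i" "t = e j" "i \<in> {1..N}" "j \<in> {1..N}" using st by blast
      then show ?thesis using SF T1[OF e_carrier e_carrier] by simp
    qed
    have \<alpha>F: "\<alpha> \<in> ?F" using T1.twist_upper[OF F span_all[unfolded span_def] E gen] \<alpha> one_cocycle unfolding tw_def by blast
    have \<beta>F: "\<beta> s t \<in> ?F" if "s \<in> carrier L" "t \<in> carrier L" for s t
      using T1.\<gamma>_mem[OF F span_all[unfolded span_def] E gen that] T1[OF that] by simp
    have N1: "1 \<in> {1..N}" using N_pos by simp
    \<comment> \<open>There is at least one variable, so \<lambda>_1 supplies the element that is
      not a root of unity.\<close>
    have q: "chr 1 (h 1) \<in> Units K" "\<not> root_of_unity K (chr 1 (h 1))"
      using chr_act(1)[OF N1 h_torus[OF N1]] lambda_power[OF N1] unfolding root_of_unity_def by blast+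
    have V: "finite VA" unfolding CGL_V_def by simp
    \<comment> \<open>Genericity relative to \<open>S\<close>: a product of powers of the new
      scalars over pairs in \<open>VA\<close> lies in \<open>?F\<close> only if all exponents are
      zero.\<close>
    obtain c where c: "c \<in> cocycles \<Gamma> K" and generic: "\<And>n :: nat \<times> nat \<Rightarrow> int.
      finprod U (\<lambda>(i, j). (c (\<pi> (e i)) (\<pi> (e j)) \<otimes>\<^bsub>K\<^esub> inv\<^bsub>K\<^esub> c (\<pi> (e j)) (\<pi> (e i))) [^]\<^bsub>U\<^esub> n (i, j))
        {(i, j) \<in> VA \<times> VA. i < j} \<in> ?F \<Longrightarrow> \<forall>i\<in>VA. \<forall>j\<in>VA. i < j \<longrightarrow> n (i, j) = 0"
      using generic_cocycle[OF q S V \<pi>_closed[OF e_carrier] independent] by blast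
    interpret T: twisted_lattice K A N x \<sigma> \<delta> r act h \<pi> \<beta> c
      by (intro twisted_lattice.intro CGL_lattice_axioms twisted_lattice_axioms.intro c)
    define J where "J = {(i, j) \<in> VA \<times> VA. i < j}"
    have J: "finite J" unfolding J_def by (rule finite_subset[of _ "VA \<times> VA"]) (use V in auto)
    define f where "f p = T.\<gamma> (e (fst p)) (e (snd p))" for p
    have f: "f \<in> J \<rightarrow> carrier U" unfolding f_def using T.\<gamma>_closed[OF e_carrier e_carrier] by auto
    define Y' where "Y' = {\<beta> (b k) (e i) | k i. k \<in> NA \<and> i \<in> {1..N}}"
    have Y': "Y' \<subseteq> carrier U" unfolding Y'_def using \<beta>_closed[OF bD(1) e_carrier] by auto
    let ?H = "generate U (Y' \<union> f ` J)"
    have YJ: "Y' \<union> f ` J \<subseteq> carrier U" using Y' f by auto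
    note H = U.generate_is_subgroup[OF YJ]
    have bH: "\<beta> (b k) t \<in> ?H" if k: "k \<in> NA" and t: "t \<in> carrier L" for k t
    proof (rule \<beta>_span_mem[OF H bD(1)[OF k] _ t[folded span_all]])
      show "\<beta> (b k) (e l) \<in> ?H" if "l \<in> {1..N}" for l
        by (rule generate.incl) (use that k in \<open>unfold Y'_def, blast\<close>)
    qed
    \<comment> \<open>The kernel vectors replace the basis vectors with index in \<open>NA\<close>.
      Pairs involving a kernel vector are unaffected by the twist, so only pairs inside
      \<open>VA\<close> carry generic scalars.\<close>
    let ?S = "e ` VA \<union> b ` NA"
    have SL: "?S \<subseteq> carrier L" using e_carrier bD(1) by blast
    have bg: "T.\<gamma> (b k) t \<in> ?H" if k: "k \<in> NA" and t: "t \<in> carrier L" for k t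
      using bH[OF that] T.\<gamma>_kernel[OF bD(1)[OF k] t bD(2)[OF k]] by simp
    have lt: "T.\<gamma> (e i) (e j) \<in> ?H" if "i \<in> VA" "j \<in> VA" "i < j" for i j
    proof (rule generate.incl)
      have "f (i, j) \<in> f ` J" unfolding J_def using that by (intro imageI) simp
      then show "T.\<gamma> (e i) (e j) \<in> Y' \<union> f ` J" unfolding f_def by simp
    qed
    have ee: "T.\<gamma> (e i) (e j) \<in> ?H" if ij: "i \<in> VA" "j \<in> VA" for i j
    proof (cases i j rule: linorder_cases)
      case greater
      show ?thesis using subgroup.m_inv_closed[OF H lt[OF ij(2,1) greater]]
        unfolding T.\<gamma>_swap[of "e j" "e i", OF e_carrier e_carrier] .
    next
      case equal
      then show ?thesis using T.\<gamma>_self[OF e_carrier] subgroup.one_closed[OF H] by simp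
    qed (use lt ij in simp)
    have genH: "T.\<gamma> s t \<in> ?H" if st: "s \<in> ?S" "t \<in> ?S" for s t
    proof (cases "s \<in> b ` NA")
      case True
      then show ?thesis using bg SL st(2) by blast
    next
      case sf: False
      show ?thesis
      proof (cases "t \<in> b ` NA")
        case True
        then have "T.\<gamma> t s \<in> ?H" using bg SL st(1) by blast
        moreover have "T.\<gamma> s t = inv\<^bsub>U\<^esub> T.\<gamma> t s" using T.\<gamma>_swap SL st by blast
        ultimately show ?thesis using subgroup.m_inv_closed[OF H] by simp
      next
        case False
        then show ?thesis using sf st ee by blast
      qed
    qed
    have "\<alpha> \<in> ?H" using T.twist_upper[OF H kernel_vectors_generate[OF b] SL genH] \<alpha> c unfolding tw_def by blast
    then obtain z and n :: "nat \<times> nat \<Rightarrow> int" where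
      z: "z \<in> generate U Y'" and \<alpha>z: "\<alpha> = z \<otimes>\<^bsub>U\<^esub> finprod U (\<lambda>p. f p [^]\<^bsub>U\<^esub> n p) J"
      using U.generate_union_decomposition[OF J f Y'] by blast
    have zF: "z \<in> ?F"
    proof -
      have "generate U Y' \<subseteq> ?F"
        by (rule U.generate_subgroup_incl[OF _ F]) (use \<beta>F bD(1) e_carrier in \<open>auto simp: Y'_def\<close>)
      then show ?thesis using z by blast
    qed
    \<comment> \<open>Each \<open>f p\<close> is split into its untwisted part \<open>g p\<close>,
      which lies in \<open>?F\<close>, and its generic part \<open>k p\<close>. As \<alpha> and
      \<open>z\<close> lie in \<open>?F\<close> too, so does the product of the generic
      parts.\<close>
    define g where "g p = \<beta> (e (fst p)) (e (snd p))" for p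
    define k where "k p = T.commutation (\<pi> (e (fst p))) (\<pi> (e (snd p)))" for p
    have gc: "g p \<in> carrier U" "k p \<in> carrier U" for p
      unfolding g_def k_def using \<beta>_closed[OF e_carrier e_carrier] T.commutation_closed[OF e_carrier e_carrier] by auto
    have "finprod U (\<lambda>p. f p [^]\<^bsub>U\<^esub> n p) J =
      finprod U (\<lambda>p. g p [^]\<^bsub>U\<^esub> n p \<otimes>\<^bsub>U\<^esub> k p [^]\<^bsub>U\<^esub> n p) J"
      by (rule U.finprod_cong')
        (use gc in \<open>auto simp: f_def T.\<gamma>_def g_def[symmetric] k_def[symmetric] U.int_pow_distrib\<close>)
    also have "\<dots> = finprod U (\<lambda>p. g p [^]\<^bsub>U\<^esub> n p) J \<otimes>\<^bsub>U\<^esub> finprod U (\<lambda>p. k p [^]\<^bsub>U\<^esub> n p) J"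
      by (rule U.finprod_multf) (use gc in auto)
    finally have fgk: "finprod U (\<lambda>p. f p [^]\<^bsub>U\<^esub> n p) J =
      finprod U (\<lambda>p. g p [^]\<^bsub>U\<^esub> n p) J \<otimes>\<^bsub>U\<^esub> finprod U (\<lambda>p. k p [^]\<^bsub>U\<^esub> n p) J" (is "_ = ?g \<otimes>\<^bsub>U\<^esub> ?k") .
    have gF: "?g \<in> ?F"
      by (rule U.subgroup_finprod_closed[OF F J], rule U.subgroup_int_pow_closed[OF F])
        (use \<beta>F[OF e_carrier e_carrier] in \<open>simp add: g_def\<close>)
    have kc: "?k \<in> carrier U" using gc(2) by (intro U.finprod_closed) auto
    note uc = subgroup.mem_carrier[OF F zF] subgroup.mem_carrier[OF F gF] subgroup.mem_carrier[OF F \<alpha>F]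
    have "\<alpha> = (z \<otimes>\<^bsub>U\<^esub> ?g) \<otimes>\<^bsub>U\<^esub> ?k"
      unfolding U.m_assoc[OF uc(1,2) kc] using \<alpha>z unfolding fgk .
    then have "?k = inv\<^bsub>U\<^esub> (z \<otimes>\<^bsub>U\<^esub> ?g) \<otimes>\<^bsub>U\<^esub> \<alpha>"
      using U.inv_solve_left[OF kc U.m_closed[OF uc(1,2)] uc(3)] by blast
    then have "?k \<in> ?F" using subgroup.m_closed[OF F] subgroup.m_inv_closed[OF F] zF gF \<alpha>F by simp
    then have "finprod U (\<lambda>(i, j). (c (\<pi> (e i)) (\<pi> (e j)) \<otimes>\<^bsub>K\<^esub> inv\<^bsub>K\<^esub> c (\<pi> (e j)) (\<pi> (e i))) [^]\<^bsub>U\<^esub> n (i, j)) J \<in> ?F"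
      unfolding k_def T.commutation_def by (simp add: case_prod_unfold)
    from generic[folded J_def, OF this] have n0: "n p = 0" if "p \<in> J" for p using that unfolding J_def by auto
    have "finprod U (\<lambda>p. f p [^]\<^bsub>U\<^esub> n p) J = \<one>\<^bsub>U\<^esub>"
      by (rule U.finprod_one_eqI) (simp add: n0)
    then have "\<alpha> = z" using \<alpha>z subgroup.mem_carrier[OF F zF] by simp
    moreover have "generate U Y' \<subseteq> generate U ?Y"
    proof (rule U.generate_subgroup_incl[OF _ U.generate_is_subgroup[OF Y]])
      have "\<beta> (b k) (e i) \<in> generate U ?Y" if "k \<in> NA" "i \<in> {1..N}" for k i
        by (rule kernel_vector_\<beta>_mem[OF b U.generate_is_subgroup[OF Y] _ _ that])
          (blast intro: generate.incl)+
      then show "Y' \<subseteq> generate U ?Y" unfolding Y'_def by blast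
    qed
    ultimately show "\<alpha> \<in> generate U ?Y" using z by blast
  qed
qed

text \<open>By the skew Leibniz rule the elements of A_[j,l-1] that \<open>\<delta> l\<close> maps
  back into A_[j,l-1] form a subalgebra; the symmetry condition puts the variables into it.\<close>

lemma symmetric_delta_stable:
  assumes sym: "symmetric_CGL_extension K A N x \<sigma> \<delta> r act h"
    and j: "1 \<le> j" and l: "l \<in> {1..N}" "j \<le> l" and a: "a \<in> IA j (l - 1)"
  shows "\<delta> l a \<in> IA j (l - 1)"
proof -
  interpret symmetric_CGL_extension K A N x \<sigma> \<delta> r act h by (rule sym)
  let ?T = "IA j (l - 1)"
  have lN: "l - 1 \<le> N" using l by auto
  have T1: "?T \<subseteq> IA 1 (l - 1)" using IA_mono[of 1 j] j by simp
  note sd = \<delta>_derivation[OF l(1), unfolded skew_derivation_def]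
  note lin = linear_onD[OF conjunct1[OF sd]]
  note T = IA_subalgebra[OF j lN]
  note Ts = subringD[OF subalgebraD(1)[OF T]] and gr = IA_graded[OF j lN] and g = h_torus[OF l(1)]
  let ?S = "{a \<in> ?T. \<delta> l a \<in> ?T}"
  have "subalgebra_of K A ?S"
  proof (rule subalgebraI)
    show "?S \<subseteq> carrier A" using Ts(1) by blast
    have "\<one> \<in> IA 1 (l - 1)" using Ts(3) T1 by blast
    then have "x l \<oplus> \<delta> l \<one> = x l" "\<delta> l \<one> \<in> carrier A"
      using delta_eq[OF l(1), of "\<one>"] act_one[OF g] x_carrier[OF l(1)]
        graded_subsetD(1)[OF IA_graded[of 1 "l - 1"]] lN by auto
    then have "\<delta> l \<one> = \<zero>" using x_carrier[OF l(1)] by simp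
    then show "\<one> \<in> ?S" using Ts(2,3) by simp
  next
    fix a b assume "a \<in> ?S" "b \<in> ?S"
    then have ab: "a \<in> ?T" "b \<in> ?T" "\<delta> l a \<in> ?T" "\<delta> l b \<in> ?T" by auto
    note ab1 = ab(1)[THEN subsetD[OF T1]] ab(2)[THEN subsetD[OF T1]]
    show "a \<oplus> b \<in> ?S" using lin(2)[OF ab1] Ts(4) ab by simp
    have "\<delta> l (a \<otimes> b) = act (h l) a \<otimes> \<delta> l b \<oplus> \<delta> l a \<otimes> b"
      using sd ab1 \<sigma>_eq_h[OF l(1) ab1(1)] by simp
    then show "a \<otimes> b \<in> ?S" using Ts(4,5) ab act_graded(1)[OF g gr ab(1)] by simp
  next
    fix \<mu> a assume "\<mu> \<in> carrier K" "a \<in> ?S"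
    then show "\<mu> \<odot> a \<in> ?S" using lin(3)[of \<mu> a] subalgebraD(2)[OF T] T1 by auto
  qed
  moreover have "x ` {j..l - 1} \<subseteq> ?S"
  proof
    fix y assume "y \<in> x ` {j..l - 1}"
    then obtain i where i: "y = x i" "i \<in> {j..l - 1}" by blast
    have "\<delta> l (x i) \<in> IA (i + 1) (l - 1)" using symmetric_\<delta>[of i l] i(2) j l(1) by auto
    then have "\<delta> l (x i) \<in> ?T" using IA_mono[of j "i + 1" "l - 1" "l - 1"] i(2) by auto
    then show "y \<in> ?S" using x_IA[OF i(2)] i(1) by simp
  qed
  ultimately have "IA j (l - 1) \<subseteq> ?S" unfolding interval_subalgebra_def[of K A x j "l - 1"] by (rule algebra_generated_least)
  then show ?thesis using a by blast
qed

text \<open>The mirror image of \<open>\<beta>_kernel_above\<close>: the torus element from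
  \<open>symmetric_h\<close> evaluates on the basis vectors above \<open>i\<close> as
  \<open>\<beta> (e i)\<close> does.\<close>

lemma symmetric_\<beta>_below:
  assumes sym: "symmetric_CGL_extension K A N x \<sigma> \<delta> r act h"
    and i: "i \<in> {1..N}" and t: "t \<in> span (i + 1) N" "\<pi> t = \<one>\<^bsub>\<Gamma>\<^esub>"
  shows "\<beta> (e i) t = \<one>\<^bsub>U\<^esub>"
proof -
  obtain g where g: "g \<in> carrier Tor"
    "\<And>k. k \<in> {i + 1..N} \<Longrightarrow> act g (x k) = inv\<^bsub>K\<^esub> (CGL_lambda2 K A x \<sigma> k i) \<odot> x k"
    using symmetric_CGL_extension.symmetric_h[OF sym i] by blast
  have chr: "chr k g = \<beta> (e i) (e k)" if k: "k \<in> {i + 1..N}" for k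
  proof -
    have kN: "k \<in> {1..N}" using k by auto
    have u: "\<beta> (e k) (e i) \<in> Units K" using \<beta>_closed[OF e_carrier e_carrier] by (simp add: units_of_carrier)
    have "chr k g \<odot> x k = inv\<^bsub>K\<^esub> \<beta> (e k) (e i) \<odot> x k"
      using g(2)[OF k] chr_act(2)[OF kN g(1)] \<beta>_lambda2[OF kN i] by simp
    then have "chr k g = inv\<^bsub>K\<^esub> \<beta> (e k) (e i)"
      by (rule smult_cancel[OF R.Units_closed[OF chr_act(1)[OF kN g(1)]] R.Units_inv_closed[OF u]
            x_carrier[OF kN] x_nonzero[OF kN]])
    then show ?thesis using \<beta>_swap[of "e k" "e i", OF e_carrier e_carrier] R.units_of_inv[OF u] by simp
  qed
  have "\<pi> t g = \<beta> (e i) t"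
  proof (rule L.generate_hom_eq[OF evaluation_hom[OF g(1)] \<beta>_hom_right[OF e_carrier] U.is_group])
    show "t \<in> generate L (e ` {i + 1..N})" using t(1) unfolding span_def .
    fix s assume "s \<in> e ` {i + 1..N}"
    then obtain k where k: "s = e k" "k \<in> {i + 1..N}" by blast
    then show "\<pi> s g = \<beta> (e i) s" using chr[OF k(2)] \<pi>_e[of k] by simp
  qed (use e_carrier in blast)
  then show ?thesis unfolding t(2) character_one using g(1) by (simp add: units_of_one)
qed

text \<open>Apply \<open>\<delta> k\<close> to the relation that expresses x_i x_j through x_j x_i
  and \<open>\<delta> i (x j)\<close>. By the two vanishing hypotheses the Leibniz rule leaves only
  multiples of x_i w and w x_i, with w = \<open>\<delta> k (x j)\<close>.\<close>

lemma delta_commute: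
  assumes k: "k \<in> {1..N}" and j: "1 \<le> j" "j < i" and i: "i \<le> k - 1"
    and zero: "\<delta> k (x i) = \<zero>" "\<delta> k (\<delta> i (x j)) = \<zero>"
  shows "x i \<otimes> \<delta> k (x j) =
    (\<beta> (e i) (e k) \<otimes>\<^bsub>K\<^esub> \<beta> (e i) (e j)) \<odot> (\<delta> k (x j) \<otimes> x i)"
proof -
  let ?T = "IA 1 (k - 1)"
  have ij: "i \<in> {1..N}" "j \<in> {1..N}" "i \<in> {1..k - 1}" "j \<in> {1..k - 1}" "j \<in> {1..i - 1}" using k j i by auto
  have xT: "x i \<in> ?T" "x j \<in> ?T" using x_IA ij by blast+
  note sd = \<delta>_derivation[OF k, unfolded skew_derivation_def]
  note lin = linear_onD[OF conjunct1[OF sd]]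
  have T: "subring ?T A" "graded_subset ?T" using IA_subring[of 1 "k - 1"] IA_graded[of 1 "k - 1"] k by auto
  note Ts = subringD[OF T(1)]
  note g = h_torus[OF k] h_torus[OF ij(1)]
  define w where "w = \<delta> k (x j)"
  have c: "x i \<in> carrier A" "x j \<in> carrier A" "w \<in> carrier A"
    using x_carrier ij Ts(7)[OF lin(1)[OF xT(2)]] unfolding w_def by auto
  let ?a = "chr i (h k)" and ?b = "chr j (h i)"
  have a: "?a \<in> Units K" "?a \<in> carrier K" using chr_act(1)[OF ij(1) g(1)] by auto
  have b: "?b \<in> carrier K" using chr_act(1)[OF ij(2) g(2)] by auto
  have dT: "\<delta> i (x j) \<in> ?T" using delta_eq(2)[OF ij(1) x_IA[OF ij(5)]] IA_mono[OF order_refl, of "i - 1" "k - 1" 1] i diff_le_self[of i 1] order_trans by blast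
  have eq: "x i \<otimes> x j = ?b \<odot> (x j \<otimes> x i) \<oplus> \<delta> i (x j)"
    using delta_eq(1)[OF ij(1) x_IA[OF ij(5)]] chr_act(2)[OF ij(2) g(2)] b c by (simp add: smult_mult_left)
  have prod: "\<delta> k (p \<otimes> q) = act (h k) p \<otimes> \<delta> k q \<oplus> \<delta> k p \<otimes> q" if "p \<in> ?T" "q \<in> ?T" for p q
    using sd that \<sigma>_eq_h[OF k that(1)] by simp
  have "?a \<odot> (x i \<otimes> w) = \<delta> k (x i \<otimes> x j)"
    unfolding prod[OF xT] zero(1) w_def[symmetric] chr_act(2)[OF ij(1) g(1)] using a c by (simp add: smult_mult_left)
  also have "\<dots> = ?b \<odot> \<delta> k (x j \<otimes> x i) \<oplus> \<delta> k (\<delta> i (x j))"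
    unfolding eq using lin(2,3) b Ts(5)[OF xT(2,1)] dT subalgebraD(2)[OF IA_subalgebra[of 1 "k - 1"] b Ts(5)[OF xT(2,1)]] k
    by auto
  also have "\<dots> = ?b \<odot> (w \<otimes> x i)"
    unfolding prod[OF xT(2,1)] zero w_def[symmetric] using b c act_closed[OF g(1) c(2)] by simp
  finally have ab: "?a \<odot> (x i \<otimes> w) = ?b \<odot> (w \<otimes> x i)" .
  have "x i \<otimes> w = inv\<^bsub>K\<^esub> ?a \<odot> (?a \<odot> (x i \<otimes> w))"
    using a c by (simp add: smult_assoc1[symmetric])
  also have "\<dots> = (inv\<^bsub>K\<^esub> ?a \<otimes>\<^bsub>K\<^esub> ?b) \<odot> (w \<otimes> x i)"
    unfolding ab using a b c by (simp add: smult_assoc1)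
  also have "inv\<^bsub>K\<^esub> ?a = \<beta> (e i) (e k)"
    using \<beta>_swap[of "e k" "e i", OF e_carrier e_carrier] \<beta>_e[OF k ij(3)] R.units_of_inv[OF a(1)] by simp
  finally show ?thesis unfolding w_def \<beta>_e[OF ij(1,5)] .
qed

text \<open>Maximality of \<open>j\<close> makes \<open>\<delta> k\<close> vanish on A_[j+1,k-1], so
  \<open>delta_commute\<close> together with the leading exponent gives the value 1 for j < i < k,
  and \<open>symmetric_\<beta>_below\<close> gives it for i < j. The remaining index j is then
  forced by \<open>\<beta> b b\<close> being 1.\<close>

lemma symmetric_kernel_vector:
  assumes sym: "symmetric_CGL_extension K A N x \<sigma> \<delta> r act h" and k: "k \<in> NA"
  shows "\<exists>b. kernel_vector k b \<and> (\<forall>i\<in>{1..k - 1}. \<beta> b (e i) \<in> {\<one>\<^bsub>U\<^esub>, inv\<^bsub>U\<^esub> chr k (h k)})"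
proof -
  interpret symmetric_CGL_extension K A N x \<sigma> \<delta> r act h by (rule sym)
  have kN: "k \<in> {1..N}" using VA_NA(2)[OF k] .
  let ?J = "{j \<in> {1..k - 1}. \<delta> k (x j) \<noteq> \<zero>}"
  define j where "j = Max ?J"
  have "j \<in> ?J" unfolding j_def using delta_nonzero[OF k] by (intro Max_in) auto
  then have j: "j \<in> {1..k - 1}" "\<delta> k (x j) \<noteq> \<zero>" by auto
  have zero: "\<delta> k (x i) = \<zero>" if "i \<in> {j + 1..k - 1}" for i
  proof (rule ccontr)
    assume "\<delta> k (x i) \<noteq> \<zero>"
    then have "i \<le> j" unfolding j_def using that j(1) by (intro Max_ge) auto
    then show False using that by simp
  qed
  have jk: "1 \<le> j" "j < k" "k \<le> N" "j + 1 - 1 \<le> k - 1" "1 \<le> j + 1" using j(1) kN by auto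
  have w: "\<delta> k (x j) \<in> IA (j + 1) (k - 1)" using symmetric_\<delta>[OF jk(1-3)] .
  have stable: "\<delta> l a \<in> IA (j + 1) (l - 1)" if "l \<in> {j + 1..k - 1}" "a \<in> IA (j + 1) (l - 1)" for l a
    using symmetric_delta_stable[OF sym jk(5) _ _ that(2)] that(1) kN by auto
  obtain m where m: "m \<in> span (j + 1) (k - 1)" "\<pi> (e k \<otimes>\<^bsub>L\<^esub> (e j \<otimes>\<^bsub>L\<^esub> inv\<^bsub>L\<^esub> m)) = \<one>\<^bsub>\<Gamma>\<^esub>"
    and comm: "\<And>l \<mu>. \<lbrakk>l \<in> {j + 1..k - 1}; \<mu> \<in> carrier K;
      x l \<otimes> \<delta> k (x j) = \<mu> \<odot> (\<delta> k (x j) \<otimes> x l)\<rbrakk> \<Longrightarrow> \<mu> = \<beta> (e l) m"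
    using delta_exponent[OF kN j(1) jk(5,4) stable w j(2)] by blast
  have mc: "m \<in> carrier L" using span_carrier[OF m(1)] .
  define b where "b = e k \<otimes>\<^bsub>L\<^esub> (e j \<otimes>\<^bsub>L\<^esub> inv\<^bsub>L\<^esub> m)"
  have span: "e j \<otimes>\<^bsub>L\<^esub> inv\<^bsub>L\<^esub> m \<in> span j (k - 1)"
    using m(1) span_mono[of j "j + 1" "k - 1" "k - 1"] e_span[of j j "k - 1"] j(1)
      subgroup.m_closed[OF span_subgroup] subgroup.m_inv_closed[OF span_subgroup] by auto
  then have "e j \<otimes>\<^bsub>L\<^esub> inv\<^bsub>L\<^esub> m \<in> span 1 (k - 1)" using span_mono[of 1 j] jk(1) by blast
  from kernel_vectorI[OF this m(2)] have kb: "kernel_vector k b" unfolding b_def .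
  note bD = kernel_vectorD(1,2)[OF kb]
  have swap: "\<beta> b (e i) = inv\<^bsub>U\<^esub> \<beta> (e i) b" for i using \<beta>_swap[OF e_carrier bD(1)] .
  have expand: "\<beta> s b = \<beta> s (e k) \<otimes>\<^bsub>U\<^esub> (\<beta> s (e j) \<otimes>\<^bsub>U\<^esub> inv\<^bsub>U\<^esub> \<beta> s m)" if "s \<in> carrier L" for s
    unfolding b_def using that mc e_carrier by (simp add: \<beta>_right \<beta>_right_inv)
  have mid: "\<beta> b (e i) = \<one>\<^bsub>U\<^esub>" if i: "i \<in> {j + 1..k - 1}" for i
  proof -
    have iN: "i \<in> {1..N}" "j < i" "i \<le> k - 1" using i kN by auto
    have "\<delta> i (x j) \<in> IA (j + 1) (i - 1)" using symmetric_\<delta>[of j i] jk(1) iN by auto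
    then have "\<delta> i (x j) \<in> IA (j + 1) (k - 1)" using IA_mono[OF order_refl, of "i - 1" "k - 1" "j + 1"] iN(3) diff_le_self[of i 1] order_trans by blast
    then have "\<delta> k (\<delta> i (x j)) = \<zero>" using delta_vanishes[OF kN jk(5) zero] by blast
    note dc = delta_commute[OF kN jk(1) iN(2,3) zero[OF i] this]
    note c = \<beta>_closed[of "e i" "e k", OF e_carrier e_carrier] \<beta>_closed[of "e i" "e j", OF e_carrier e_carrier] \<beta>_closed[of "e i" m, OF e_carrier mc]
    have "\<beta> (e i) (e k) \<otimes>\<^bsub>K\<^esub> \<beta> (e i) (e j) = \<beta> (e i) m"
      by (rule comm[OF i _ dc]) (use c in \<open>simp add: units_of_carrier R.Units_closed\<close>)
    then have "\<beta> (e i) (e k) \<otimes>\<^bsub>U\<^esub> \<beta> (e i) (e j) = \<beta> (e i) m" by (simp add: units_of_mult)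
    then have "\<beta> (e i) b = \<one>\<^bsub>U\<^esub>" unfolding expand[OF e_carrier] using c by (simp add: U.m_assoc[symmetric])
    then show ?thesis unfolding swap by simp
  qed
  have low: "\<beta> b (e i) = \<one>\<^bsub>U\<^esub>" if i: "1 \<le> i" "i < j" for i
  proof -
    have "b \<in> span j N"
      unfolding b_def
    proof (rule subgroup.m_closed[OF span_subgroup])
      show "e k \<in> span j N" using e_span[of k j N] jk by auto
      show "e j \<otimes>\<^bsub>L\<^esub> inv\<^bsub>L\<^esub> m \<in> span j N" using span span_mono[OF order_refl, of "k - 1" N j] jk(3) diff_le_self[of k 1] order_trans by blast
    qed
    then have "b \<in> span (i + 1) N" using span_mono[of "i + 1" j N N] i by auto
    then have "\<beta> (e i) b = \<one>\<^bsub>U\<^esub>" using symmetric_\<beta>_below[OF sym _ _ bD(2)] i jk by auto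
    then show ?thesis unfolding swap by simp
  qed
  \<comment> \<open>The values at indices strictly between j and k are 1, so
    \<open>\<beta> b m\<close> is 1. Expanding \<open>\<beta> b b\<close> then leaves the product of
    the values at \<open>e k\<close> and \<open>e j\<close>.\<close>
  have self: "\<beta> b (e j) = inv\<^bsub>U\<^esub> chr k (h k)"
  proof -
    note c = \<beta>_closed[OF bD(1) e_carrier]
    have "\<beta> b m \<in> {\<one>\<^bsub>U\<^esub>}"
      by (rule \<beta>_span_mem[OF U.triv_subgroup bD(1) _ m(1)]) (simp add: mid)
    then have "\<beta> b (e k) \<otimes>\<^bsub>U\<^esub> \<beta> b (e j) = \<beta> b b" using expand[OF bD(1)] c by simp
    also have "\<dots> = \<one>\<^bsub>U\<^esub>" using \<beta>_self[OF bD(1)] by (simp add: units_of_one)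
    finally have "\<beta> b (e j) \<otimes>\<^bsub>U\<^esub> \<beta> b (e k) = \<one>\<^bsub>U\<^esub>" using c by (simp add: U.m_comm)
    then show ?thesis unfolding kernel_vector_self[OF kN kb, symmetric] using U.inv_equality c by metis
  qed
  have "\<beta> b (e i) \<in> {\<one>\<^bsub>U\<^esub>, inv\<^bsub>U\<^esub> chr k (h k)}" if "i \<in> {1..k - 1}" for i
    using that low[of i] mid[of i] self by (cases i j rule: linorder_cases) auto
  then show ?thesis using kb by blast
qed

text \<open>Part (a) holds for every choice of kernel vectors. For those of
  \<open>symmetric_kernel_vector\<close> the additional generators are 1 or inverses of some
  \<lambda>_k and contribute nothing new.\<close>

theorem symmetric_tw_eq_generate:
  assumes sym: "symmetric_CGL_extension K A N x \<sigma> \<delta> r act h"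
    and independent: "int_independent \<Gamma> VA (\<lambda>j. \<pi> (e j))"
  shows "tw \<Gamma> K A D = generate U {chr k (h k) | k. k \<in> NA}" (is "_ = generate U ?Y")
proof -
  have "\<forall>k\<in>NA. \<exists>b. kernel_vector k b \<and> (\<forall>i\<in>{1..k - 1}. \<beta> b (e i) \<in> {\<one>\<^bsub>U\<^esub>, inv\<^bsub>U\<^esub> chr k (h k)})"
    using symmetric_kernel_vector[OF sym] by (rule ballI)
  from bchoice[OF this] obtain b where b: "\<forall>k\<in>NA. kernel_vector k (b k) \<and>
    (\<forall>i\<in>{1..k - 1}. \<beta> (b k) (e i) \<in> {\<one>\<^bsub>U\<^esub>, inv\<^bsub>U\<^esub> chr k (h k)})" ..
  let ?Z = "{\<beta> (b k) (e i) | k i. k \<in> NA \<and> i \<in> VA \<and> i < k}"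
  have Y: "?Y \<subseteq> carrier U"
    using chr_act(1) h_torus VA_NA(2) by (auto simp: units_of_carrier)
  note H = U.generate_is_subgroup[OF Y]
  have "?Z \<subseteq> generate U ?Y"
  proof
    fix z assume "z \<in> ?Z"
    then obtain k i where ki: "k \<in> NA" "i \<in> VA" "i < k" "z = \<beta> (b k) (e i)" by blast
    then have "i \<in> {1..k - 1}" using VA_NA(3)[of i] by auto
    then have z: "z \<in> {\<one>\<^bsub>U\<^esub>, inv\<^bsub>U\<^esub> chr k (h k)}" using b ki by blast
    have "chr k (h k) \<in> generate U ?Y" using ki(1) by (intro generate.incl) blast
    then show "z \<in> generate U ?Y" using z subgroup.one_closed[OF H] subgroup.m_inv_closed[OF H] by auto
  qed
  then have "?Y \<union> ?Z \<subseteq> generate U ?Y" using generate.incl[of _ ?Y U] by blast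
  then have "generate U (?Y \<union> ?Z) \<subseteq> generate U ?Y" by (rule U.generate_subgroup_incl[OF _ H])
  moreover have "generate U ?Y \<subseteq> generate U (?Y \<union> ?Z)" by (rule U.mono_generate) blast
  moreover have "tw \<Gamma> K A D = generate U (?Y \<union> ?Z)" using tw_eq_generate[OF independent, of b] b by blast
  ultimately show ?thesis by simp
qed

end

theorem theorem5p6:
  fixes K :: "('k, 'm) ring_scheme" and A :: "('k, 'a, 'n) module_scheme"
    and N r :: nat and x :: "nat \<Rightarrow> 'a" and \<sigma> \<delta> :: "nat \<Rightarrow> 'a \<Rightarrow> 'a"
    and act :: "(nat \<Rightarrow> 'k) \<Rightarrow> 'a \<Rightarrow> 'a" and h :: "nat \<Rightarrow> nat \<Rightarrow> 'k"
    and \<pi> :: "(nat \<Rightarrow> int) \<Rightarrow> (nat \<Rightarrow> 'k) \<Rightarrow> 'k"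
    and \<chi>' :: "(nat \<Rightarrow> int) \<Rightarrow> (nat \<Rightarrow> int) \<Rightarrow> 'k"
  defines "e \<equiv> basis_vector N"
    and "\<Gamma> \<equiv> character_group K r"
    and "D \<equiv> eigenspace K A r act"
    and "VA \<equiv> CGL_V K A N x \<delta>"
    and "NA \<equiv> CGL_N K A N x \<delta>"
    and "lam \<equiv> CGL_lambda K A x act h"
  assumes CGL: "CGL_extension K A N x \<sigma> \<delta> r act h"
    and \<pi>_hom: "\<pi> \<in> hom (int_lattice N) \<Gamma>"
    and \<pi>_basis: "\<And>i. i \<in> {1..N} \<Longrightarrow> \<pi> (e i) = hom_degree \<Gamma> D (x i)"
    and independent: "int_independent \<Gamma> VA (\<lambda>j. \<pi> (e j))"
    and \<chi>'_bicharacter: "alternating_bicharacter (int_lattice N) K \<chi>'"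
    and \<chi>'_basis: "\<And>i j. i \<in> {1..N} \<Longrightarrow> j \<in> {1..N} \<Longrightarrow> \<chi>' (e i) (e j) = CGL_lambda2 K A x \<sigma> i j"
  shows "(\<forall>k\<in>NA. \<exists>b\<in>kernel (int_lattice N) \<Gamma> \<pi>.
            b \<otimes>\<^bsub>int_lattice N\<^esub> inv\<^bsub>int_lattice N\<^esub> (e k) \<in> generate (int_lattice N) (e ` {1..k - 1})) \<and>
         (\<forall>b. (\<forall>k\<in>NA. b k \<in> kernel (int_lattice N) \<Gamma> \<pi> \<and>
            b k \<otimes>\<^bsub>int_lattice N\<^esub> inv\<^bsub>int_lattice N\<^esub> (e k) \<in> generate (int_lattice N) (e ` {1..k - 1})) \<longrightarrow>
           tw \<Gamma> K A D = generate (units_of K)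
             ({lam k | k. k \<in> NA} \<union> {\<chi>' (b k) (e i) | k i. k \<in> NA \<and> i \<in> VA \<and> i < k})) \<and>
         (symmetric_CGL_extension K A N x \<sigma> \<delta> r act h \<longrightarrow>
           tw \<Gamma> K A D = generate (units_of K) {lam k | k. k \<in> NA})"
proof -
  interpret C: CGL_lattice K A N x \<sigma> \<delta> r act h \<pi> \<chi>'
    by (intro CGL_lattice.intro CGL_lattice_axioms.intro CGL)
      (use \<pi>_hom \<pi>_basis \<chi>'_bicharacter \<chi>'_basis in \<open>simp_all only: e_def \<Gamma>_def D_def\<close>)
  note defs = e_def \<Gamma>_def D_def VA_def NA_def
  have lam: "{lam k | k. k \<in> NA} = {C.chr k (h k) | k. k \<in> C.NA}"
    unfolding lam_def NA_def using C.lambda_eq[OF C.VA_NA(2)] by (intro Collect_cong) metis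
  have kernel_vector: "C.kernel_vector k b \<longleftrightarrow> b \<in> kernel (int_lattice N) \<Gamma> \<pi> \<and>
      b \<otimes>\<^bsub>int_lattice N\<^esub> inv\<^bsub>int_lattice N\<^esub> (e k) \<in> generate (int_lattice N) (e ` {1..k - 1})" for k b
    unfolding C.kernel_vector_def C.span_def defs by (rule refl)
  note ind = independent[unfolded defs]
  show ?thesis
  proof (intro conjI allI impI)
    show "\<forall>k\<in>NA. \<exists>b\<in>kernel (int_lattice N) \<Gamma> \<pi>.
        b \<otimes>\<^bsub>int_lattice N\<^esub> inv\<^bsub>int_lattice N\<^esub> (e k) \<in> generate (int_lattice N) (e ` {1..k - 1})"
      using C.kernel_vector_exists unfolding kernel_vector NA_def by blast
  next
    fix b assume "\<forall>k\<in>NA. b k \<in> kernel (int_lattice N) \<Gamma> \<pi> \<and>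
        b k \<otimes>\<^bsub>int_lattice N\<^esub> inv\<^bsub>int_lattice N\<^esub> (e k) \<in> generate (int_lattice N) (e ` {1..k - 1})"
    then have "\<And>k. k \<in> C.NA \<Longrightarrow> C.kernel_vector k (b k)" unfolding kernel_vector NA_def by blast
    from C.tw_eq_generate[OF ind this]
    show "tw \<Gamma> K A D = generate (units_of K)
        ({lam k | k. k \<in> NA} \<union> {\<chi>' (b k) (e i) | k i. k \<in> NA \<and> i \<in> VA \<and> i < k})"
      unfolding lam unfolding defs .
  next
    assume "symmetric_CGL_extension K A N x \<sigma> \<delta> r act h"
    from C.symmetric_tw_eq_generate[OF this ind]
    show "tw \<Gamma> K A D = generate (units_of K) {lam k | k. k \<in> NA}" unfolding lam unfolding defs .
  qed
qed

end
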